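(* The simple objects of the category $\mathcal O$ of $\mathcal U_q(\mathfrak b^\sigma)$-modules are exactly the irreducible $l$-highest weight modules $L(\gamma)$, $\gamma=(\gamma_i(u))_{i\in I}$, such that all $\gamma_i(u)$ are (expansions at $u=0$ of) rational functions, where $\gamma$ runs over tuples in $\mathbb C[[u]]^I$ with $\gamma_i(0)\ne0$ and $\gamma_{\sigma(i)}(u)=\gamma_i(\omega u)$ for all $i\in I$.
   Context: Twisted data. $\mathfrak g$ is a simple complex Lie algebra of type $A_m$ ($m\ge2$), $D_m$ ($m\ge4$) or $E_6$ with Dynkin nodes $I$ and Cartan matrix $C$; $\sigma:I\to I$ is a non-trivial diagram automorphism of order $M\in\{2,3\}$; $\omega=e^{2\pi\sqrt{-1}/M}$. $I_\sigma$ is the set of $\sigma$-orbits, $\bar i$ the orbit of $i$; in each orbit a representative is fixed, the smallest node in the standard labelling ($1,\dots,n$ for $A_{2n}^{(2)},A_{2n-1}^{(2)},D_{n+1}^{(2)}$; $1$ and the trivalent node $2$ for $D_4^{(3)}$; in all cases a connected subdiagram). $d_{\bar i}=\frac12\sum_{r=1}^MC_{i,\sigma^r(i)}$. $\hat I_\sigma=I_\sigma\sqcup\{\epsilon\}$; $C^\sigma$ is the generalized Cartan matrix of the twisted affine type, $\epsilon$ the affine node (for $A_{2n}^{(2)}$ the end node with longest root), so $d_{\bar i}C^\sigma_{\bar i,\bar j}=\sum_{r=1}^MC_{i,\sigma^r(j)}$ on $I_\sigma$; $d_\epsilon$ makes $(d_iC^\sigma_{i,j})$ symmetric; $(a_i)_{i\in\hat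 I_\sigma}$ are the positive integers with $\sum_ia_id_iC^\sigma_{i,j}=0$ for all $j$, $a_\epsilon=1$. $q\in\mathbb C^*$ is not a root of unity (with a fixed square root), $q_i=q^{d_i}$, $[m]_p=\frac{p^m-p^{-m}}{p-p^{-1}}$. Algebra. $\mathcal U_q(\mathcal L\mathfrak g^\sigma)$ has generators $e_i^\pm,k_i^{\pm1}$ ($i\in\hat I_\sigma$) and relations: the $k_i$ are invertible and commute, $k_ie_j^\pm=q_i^{\pm C^\sigma_{i,j}}e_j^\pm k_i$, $[e_i^+,e_j^-]=\delta_{i,j}\frac{k_i-k_i^{-1}}{q_i-q_i^{-1}}$, the quantum Serre relations of $C^\sigma$, and $\prod_ik_i^{a_i}=1$. It is also generated by the Drinfeld generators $x_{i,m}^\pm$ ($m\in\mathbb Z$), $h_{i,r}$ ($r\neq0$), $k_i^{\pm1}$, $i\in I$, of its Drinfeld presentation (Chari–Pressley, Damiani), where $x_{i,0}^\pm=e_{\bar i}^\pm$, $k_i=k_{\bar i}$ for representatives $i$, $e_\epsilon^\pm$ has degree $\pm1$ for the grading $\deg x_{i,m}^\pm=m,\deg h_{i,r}=r,\deg k_i=0$, and $x_{\sigma(i),m}^\pm=\omega^mx_{i,m}^\pm$, $h_{\sigma(i),r}=\omega^rh_{i,r}$, $k_{\sigma(i)}=k_i$, the $h$'s and $k$'s commute, $k_ix_{j,m}^\pm=q^{\pm\sum_{r=1}^MC_{i,\sigma^r(j)}}x_{j,m}^\pm k_i$, $[h_{i,s},x_{j,l}^\pm]=\pm\frac1s\left(\sum_{r=1}^M[sC_{i,\sigma^r(j)}/d_{\bar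 i}]_{q_{\bar i}}\omega^{sr}\right)x_{j,s+l}^\pm$, $[x_{i,s}^+,x_{j,l}^-]=\frac{\sum_{r=1}^M\delta_{\sigma^r(i),j}\omega^{rl}}{N_i}\frac{\phi_{i,s+l}^+-\phi_{i,s+l}^-}{q_{\bar i}-q_{\bar i}^{-1}}$ with $N_i=M$ if $\sigma(i)=i$, $N_i=1$ otherwise, and $\phi_i^\pm(u)=\sum_{m\ge0}\phi^\pm_{i,\pm m}u^{\pm m}=k_i^{\pm1}\exp(\pm(q_{\bar i}-q_{\bar i}^{-1})\sum_{l\ge1}h_{i,\pm l}u^{\pm l})$ (other $\phi^\pm_{i,m}$ are $0$). Borel subalgebra and category $\mathcal O$. $\mathcal U_q(\mathfrak b^\sigma)$ is the subalgebra generated by $e_i^+,k_i^{\pm1}$ ($i\in\hat I_\sigma$); it contains $x^+_{i,r}$ ($r\ge0$), $x^-_{i,r}$ ($r>0$), $\phi^+_{i,r}$ ($r\ge0$). A $\mathcal U_q(\mathfrak b^\sigma)$-module is of highest $l$-weight $\gamma=(\gamma_i(u))_{i\in I}$ if it is generated by a vector $v$ with $x^+_{i,r}v=0$ ($i\in I$, $r\ge0$) and $\phi_i^+(u)v=\gamma_i(u)v$; $L(\gamma)$ is the unique simple such module. $\mathfrak t$ is the subalgebra generated by the $k_{\bar i}^{\pm1}$, $\bar i\in I_\sigma$; $\mathfrak t^*$ is the group of its algebra characters, written additively; $\alpha_{\bar i}\in\mathfrak t^*$ is given by $\alpha_{\bar i}(k_{\bar j})=q_{\bar i}^{C^\sigma_{\bar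 i,\bar j}}$; $\lambda\le\mu$ iff $\mu-\lambda\in\sum\mathbb N\alpha_{\bar i}$; $D(\lambda)=\{\mu\le\lambda\}$. $\mathcal O$ is the category of $\mathcal U_q(\mathfrak b^\sigma)$-modules that are $\mathfrak t$-diagonalizable with finite-dimensional weight spaces and weights contained in a finite union $\bigcup_sD(\lambda_s)$; morphisms are module homomorphisms. *)

theory Defs
  imports
    Complex_Main
    "HOL-Library.Poly_Mapping"
    "HOL-Computational_Algebra.Polynomial_FPS"
begin

section \<open>Twisted data\<close>

text \<open>\<open>TA m\<close>, \<open>TD m\<close>, \<open>TE6\<close> are the types \<open>A\<^sub>m\<close>, \<open>D\<^sub>m\<close>, \<open>E\<^sub>6\<close>; nodes are numbered as in Bourbaki.\<close>

datatype dynkin = TA nat | TD nat | TE6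

fun valid_type :: "dynkin \<Rightarrow> bool" where
  "valid_type (TA m) \<longleftrightarrow> m \<ge> 2"
| "valid_type (TD m) \<longleftrightarrow> m \<ge> 4"
| "valid_type TE6 \<longleftrightarrow> True"

fun rank :: "dynkin \<Rightarrow> nat" where
  "rank (TA m) = m"
| "rank (TD m) = m"
| "rank TE6 = 6"

fun edges :: "dynkin \<Rightarrow> nat set set" where
  "edges (TA m) = {{i, i + 1} |i. 1 \<le> i \<and> i + 1 \<le> m}"
| "edges (TD m) = {{i, i + 1} |i. 1 \<le> i \<and> i + 1 \<le> m - 1} \<union> {{m - 2, m}}"
| "edges TE6 = {{1, 3}, {3, 4}, {4, 5}, {5, 6}, {2, 4}}"

definition cartan :: "dynkin \<Rightarrow> nat \<Rightarrow> nat \<Rightarrow> int" where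
  "cartan X i j = (if i = j then 2 else if {i, j} \<in> edges X then -1 else 0)"

text \<open>A datum consists of the type of the Lie algebra, the diagram automorphism \<open>\<sigma>\<close>
  and the chosen square root of \<open>q\<close>.\<close>

record datum =
  dtype :: dynkin
  aut :: "nat \<Rightarrow> nat"
  sqrt_q :: complex

definition nodes :: "datum \<Rightarrow> nat set" where
  "nodes T = {1..rank (dtype T)}"

abbreviation cart :: "datum \<Rightarrow> nat \<Rightarrow> nat \<Rightarrow> int" where
  "cart T \<equiv> cartan (dtype T)"

definition qq :: "datum \<Rightarrow> complex" where
  "qq T = (sqrt_q T)\<^sup>2"

definition twisted_datum :: "datum \<Rightarrow> bool" where
  "twisted_datum T \<longleftrightarrow>
     valid_type (dtype T) \<and>
     bij_betw (aut T) (nodes T) (nodes T) \<and>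
     (\<forall>i\<in>nodes T. \<forall>j\<in>nodes T. cart T (aut T i) (aut T j) = cart T i j) \<and>
     (\<exists>i\<in>nodes T. aut T i \<noteq> i) \<and>
     qq T \<noteq> 0 \<and> (\<forall>n>0. qq T ^ n \<noteq> 1)"

definition ord_aut :: "datum \<Rightarrow> nat" where
  "ord_aut T = (LEAST M. M > 0 \<and> (\<forall>i\<in>nodes T. (aut T ^^ M) i = i))"

definition omega :: "datum \<Rightarrow> complex" where
  "omega T = cis (2 * pi / real (ord_aut T))"

text \<open>The set \<open>I\<^sub>\<sigma>\<close> of orbits is encoded by the set \<open>reps\<close> of smallest elements of orbits;
  \<open>rep T i\<close> stands for the orbit of \<open>i\<close>.\<close>

definition rep :: "datum \<Rightarrow> nat \<Rightarrow> nat" where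
  "rep T i = (LEAST j. \<exists>r. j = (aut T ^^ r) i)"

definition reps :: "datum \<Rightarrow> nat set" where
  "reps T = rep T ` nodes T"

datatype anode = Eps | Orb nat

definition anodes :: "datum \<Rightarrow> anode set" where
  "anodes T = insert Eps (Orb ` reps T)"

text \<open>\<open>csum T i j\<close> is the sum of \<open>C(i, \<sigma>\<^sup>r(j))\<close> over \<open>r = 1, \<dots>, M\<close>.\<close>

definition csum :: "datum \<Rightarrow> nat \<Rightarrow> nat \<Rightarrow> int" where
  "csum T i j = (\<Sum>r=1..ord_aut T. cart T i ((aut T ^^ r) j))"

text \<open>The orbit joined to the affine node \<open>\<epsilon>\<close> in the twisted affine diagram: the orbit of \<open>1\<close> for
  \<open>A\<^sub>2\<^sub>n\<^sup>(\<^sup>2\<^sup>)\<close>, \<open>E\<^sub>6\<^sup>(\<^sup>2\<^sup>)\<close>, \<open>D\<^sub>4\<^sup>(\<^sup>3\<^sup>)\<close>, that of \<open>2\<close> for \<open>A\<^sub>2\<^sub>n\<^sub>-\<^sub>1\<^sup>(\<^sup>2\<^sup>)\<close>, and the end of the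
  diagram fixed by \<open>\<sigma>\<close> for \<open>D\<^sub>n\<^sub>+\<^sub>1\<^sup>(\<^sup>2\<^sup>)\<close> (this is node \<open>1\<close> if \<open>\<sigma>\<close> exchanges the last two nodes;
  the formulation covers the other two involutions of \<open>D\<^sub>4\<close> as well).\<close>

definition aff_nbr :: "datum \<Rightarrow> nat" where
  "aff_nbr T = (case dtype T of
       TA m \<Rightarrow> if even m then 1 else 2
     | TD m \<Rightarrow> if ord_aut T = 3 then 1
               else (THE i. i \<in> nodes T \<and> aut T i = i \<and> card {j \<in> nodes T. cart T i j = -1} = 1)
     | TE6 \<Rightarrow> 1)"

text \<open>\<open>d2 T a\<close> is twice the symmetrizing number \<open>d\<^sub>a\<close>, which is an integer. It is \<open>2 d\<^sub>\<epsilon> = 4\<close> for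
  \<open>A\<^sub>2\<^sub>n\<^sup>(\<^sup>2\<^sup>)\<close>, where \<open>\<epsilon>\<close> carries the longest root, and \<open>2 d\<^sub>\<epsilon> = 2\<close> otherwise.\<close>

fun d2 :: "datum \<Rightarrow> anode \<Rightarrow> int" where
  "d2 T (Orb i) = csum T i i"
| "d2 T Eps = (case dtype T of TA m \<Rightarrow> if even m then 4 else 2 | _ \<Rightarrow> 2)"

text \<open>\<open>sym2 T a b\<close> is \<open>2 d\<^sub>a C\<^sup>\<sigma>(a, b)\<close>. In all twisted affine diagrams the edge between
  \<open>\<epsilon>\<close> and its neighbour \<open>j\<close> satisfies \<open>d\<^sub>\<epsilon> C\<^sup>\<sigma>(\<epsilon>, j) = d\<^sub>j C\<^sup>\<sigma>(j, \<epsilon>) = - max d\<^sub>\<epsilon> d\<^sub>j\<close>. This gives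
  \<open>(C\<^sup>\<sigma>(\<epsilon>, j), C\<^sup>\<sigma>(j, \<epsilon>)) = (-1, -4)\<close> for \<open>A\<^sub>2\<^sup>(\<^sup>2\<^sup>)\<close>, \<open>(-1, -2)\<close> for \<open>A\<^sub>2\<^sub>n\<^sup>(\<^sup>2\<^sup>)\<close> with \<open>n \<ge> 2\<close>,
  \<open>(-2, -1)\<close> for \<open>A\<^sub>3\<^sup>(\<^sup>2\<^sup>)\<close> and \<open>D\<^sub>n\<^sub>+\<^sub>1\<^sup>(\<^sup>2\<^sup>)\<close>, and \<open>(-1, -1)\<close> otherwise.\<close>

fun sym2 :: "datum \<Rightarrow> anode \<Rightarrow> anode \<Rightarrow> int" where
  "sym2 T (Orb i) (Orb j) = 2 * csum T i j"
| "sym2 T Eps Eps = 2 * d2 T Eps"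
| "sym2 T Eps (Orb j) = (if j = aff_nbr T then - max (d2 T Eps) (d2 T (Orb j)) else 0)"
| "sym2 T (Orb j) Eps = (if j = aff_nbr T then - max (d2 T Eps) (d2 T (Orb j)) else 0)"

definition aff_cartan :: "datum \<Rightarrow> anode \<Rightarrow> anode \<Rightarrow> int" where
  "aff_cartan T a b = sym2 T a b div d2 T a"

definition kac_label :: "datum \<Rightarrow> anode \<Rightarrow> nat" where
  "kac_label T = (THE m. (\<forall>a. a \<in> anodes T \<longleftrightarrow> m a > 0) \<and> m Eps = 1 \<and>
     (\<forall>b\<in>anodes T. (\<Sum>a\<in>anodes T. int (m a) * d2 T a * aff_cartan T a b) = 0))"

definition qn :: "datum \<Rightarrow> anode \<Rightarrow> complex" where
  "qn T a = sqrt_q T powi d2 T a"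

definition qint :: "complex \<Rightarrow> nat \<Rightarrow> complex" where
  "qint p m = (p ^ m - inverse p ^ m) / (p - inverse p)"

definition qfact :: "complex \<Rightarrow> nat \<Rightarrow> complex" where
  "qfact p m = (\<Prod>k=1..m. qint p k)"

definition qbinom :: "complex \<Rightarrow> nat \<Rightarrow> nat \<Rightarrow> complex" where
  "qbinom p m r = qfact p m / (qfact p r * qfact p (m - r))"


section \<open>Free algebras over the complex numbers\<close>

text \<open>Words under concatenation, written additively so that the convolution product of
  \<open>Poly_Mapping\<close> makes \<open>'g word \<Rightarrow>\<^sub>0 complex\<close> the free associative algebra on \<open>'g\<close>.\<close>

datatype 'g word = Word (letters: "'g list")

instantiation word :: (type) monoid_add
begin

definition zero_word :: "'a word" where
  "0 = Word []"

definition plus_word :: "'a word \<Rightarrow> 'a word \<Rightarrow> 'a word" where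
  "v + w = Word (letters v @ letters w)"

instance
  by standard (simp_all add: zero_word_def plus_word_def)

end

type_synonym 'g free_alg = "'g word \<Rightarrow>\<^sub>0 complex"

definition var :: "'g \<Rightarrow> 'g free_alg" where
  "var g = Poly_Mapping.single (Word [g]) 1"

definition sc :: "complex \<Rightarrow> 'g free_alg" where
  "sc c = Poly_Mapping.single 0 c"

definition comm :: "'a::ring \<Rightarrow> 'a \<Rightarrow> 'a" where
  "comm a b = a * b - b * a"

inductive_set subalg :: "'g free_alg set \<Rightarrow> 'g free_alg set" for S where
  scalar: "sc c \<in> subalg S"
| gen: "a \<in> S \<Longrightarrow> a \<in> subalg S"
| add: "a \<in> subalg S \<Longrightarrow> b \<in> subalg S \<Longrightarrow> a + b \<in> subalg S"
| mult: "a \<in> subalg S \<Longrightarrow> b \<in> subalg S \<Longrightarrow> a * b \<in> subalg S"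

text \<open>The two-sided ideal of the algebra \<open>A\<close> generated by \<open>R\<close>.\<close>

inductive_set ideal_gen :: "'g free_alg set \<Rightarrow> 'g free_alg set \<Rightarrow> 'g free_alg set" for A R where
  zero: "0 \<in> ideal_gen A R"
| step: "z \<in> ideal_gen A R \<Longrightarrow> a \<in> A \<Longrightarrow> r \<in> R \<Longrightarrow> b \<in> A \<Longrightarrow> z + a * r * b \<in> ideal_gen A R"


section \<open>The twisted quantum loop algebra\<close>

datatype sign = Pl | Mi

fun sgn_int :: "sign \<Rightarrow> int" where
  "sgn_int Pl = 1"
| "sgn_int Mi = -1"

text \<open>\<open>Ch p a\<close> is the Chevalley generator \<open>e\<^sub>a\<^sup>p\<close>.\<close>

datatype gen = Ch sign anode | Kg anode | Kinvg anode

type_synonym falg = "gen free_alg"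

abbreviation ee :: "sign \<Rightarrow> anode \<Rightarrow> falg" where "ee p a \<equiv> var (Ch p a)"
abbreviation kk :: "anode \<Rightarrow> falg" where "kk a \<equiv> var (Kg a)"
abbreviation kinv :: "anode \<Rightarrow> falg" where "kinv a \<equiv> var (Kinvg a)"

definition chev_alg :: "datum \<Rightarrow> falg set" where
  "chev_alg T = subalg ((\<Union>a\<in>anodes T. {ee Pl a, ee Mi a, kk a, kinv a}))"

definition serre :: "datum \<Rightarrow> sign \<Rightarrow> anode \<Rightarrow> anode \<Rightarrow> falg" where
  "serre T p a b = (let n = nat (1 - aff_cartan T a b) in
     \<Sum>r\<le>n. sc ((-1) ^ r * qbinom (qn T a) n r) * ee p a ^ (n - r) * ee p b * ee p a ^ r)"

text \<open>The order of the factors is irrelevant modulo the other relations.\<close>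

definition k_delta :: "datum \<Rightarrow> falg" where
  "k_delta T = prod_list (map (\<lambda>a. kk a ^ kac_label T a)
     (Eps # map Orb (sorted_list_of_set (reps T))))"

definition relations :: "datum \<Rightarrow> falg set" where
  "relations T =
     {kk a * kinv a - 1 |a. a \<in> anodes T} \<union>
     {kinv a * kk a - 1 |a. a \<in> anodes T} \<union>
     {comm (kk a) (kk b) |a b. a \<in> anodes T \<and> b \<in> anodes T} \<union>
     {kk a * ee p b - sc (qn T a powi (sgn_int p * aff_cartan T a b)) * ee p b * kk a |a b p.
        a \<in> anodes T \<and> b \<in> anodes T} \<union>
     {comm (ee Pl a) (ee Mi b)
        - (if a = b then sc (1 / (qn T a - inverse (qn T a))) * (kk a - kinv a) else 0) |a b.
        a \<in> anodes T \<and> b \<in> anodes T} \<union>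
     {serre T p a b |a b p. a \<in> anodes T \<and> b \<in> anodes T \<and> a \<noteq> b} \<union>
     {k_delta T - 1}"

text \<open>The algebra \<open>U\<^sub>q(L\<gg>\<^sup>\<sigma>)\<close> is the quotient \<open>chev_alg T / rel_ideal T\<close>. Its elements are
  handled through representatives in \<open>chev_alg T\<close>, equality in it being the congruence \<open>ueq T\<close>; its
  subalgebras are given by their full preimages in \<open>chev_alg T\<close>.\<close>

definition rel_ideal :: "datum \<Rightarrow> falg set" where
  "rel_ideal T = ideal_gen (chev_alg T) (relations T)"

definition ueq :: "datum \<Rightarrow> falg \<Rightarrow> falg \<Rightarrow> bool" where
  "ueq T a b \<longleftrightarrow> a - b \<in> rel_ideal T"

definition usub :: "datum \<Rightarrow> falg set \<Rightarrow> falg set" where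
  "usub T S = {a \<in> chev_alg T. \<exists>b\<in>subalg S. ueq T a b}"

definition borel :: "datum \<Rightarrow> falg set" where
  "borel T = usub T (\<Union>a\<in>anodes T. {ee Pl a, kk a, kinv a})"

definition torus :: "datum \<Rightarrow> falg set" where
  "torus T = usub T (\<Union>i\<in>reps T. {kk (Orb i), kinv (Orb i)})"


section \<open>Drinfeld generators\<close>

abbreviation ki :: "datum \<Rightarrow> nat \<Rightarrow> falg" where "ki T i \<equiv> kk (Orb (rep T i))"
abbreviation ki_inv :: "datum \<Rightarrow> nat \<Rightarrow> falg" where "ki_inv T i \<equiv> kinv (Orb (rep T i))"

definition qi :: "datum \<Rightarrow> nat \<Rightarrow> complex" where
  "qi T i = qn T (Orb (rep T i))"

text \<open>\<open>\<phi>\<^sub>i\<^sup>\<plusminus>(u)\<close> as a power series in \<open>u\<^sup>\<plusminus>\<^sup>1\<close>; composing with \<open>exp_series\<close> is the formal exponential.\<close>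

definition exp_series :: "falg fps" where
  "exp_series = Abs_fps (\<lambda>n. sc (1 / fact n))"

definition h_series :: "(nat \<Rightarrow> int \<Rightarrow> falg) \<Rightarrow> sign \<Rightarrow> nat \<Rightarrow> falg fps" where
  "h_series h p i = Abs_fps (\<lambda>l. if l = 0 then 0 else h i (sgn_int p * int l))"

definition phi_series :: "datum \<Rightarrow> (nat \<Rightarrow> int \<Rightarrow> falg) \<Rightarrow> sign \<Rightarrow> nat \<Rightarrow> falg fps" where
  "phi_series T h p i =
     fps_const (case p of Pl \<Rightarrow> ki T i | Mi \<Rightarrow> ki_inv T i) *
     (exp_series oo (fps_const (sc (of_int (sgn_int p) * (qi T i - inverse (qi T i)))) * h_series h p i))"

definition phi :: "datum \<Rightarrow> (nat \<Rightarrow> int \<Rightarrow> falg) \<Rightarrow> sign \<Rightarrow> nat \<Rightarrow> int \<Rightarrow> falg" where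
  "phi T h p i m = (if sgn_int p * m \<ge> 0 then fps_nth (phi_series T h p i) (nat \<bar>m\<bar>) else 0)"

text \<open>The scalar in \<open>[h\<^sub>i\<^sub>,\<^sub>s, x\<^sub>j\<^sub>,\<^sub>l]\<close>. As \<open>q\<^sub>i = q powr d\<^sub>i\<close>, the quantum number \<open>[s c / d\<^sub>i]\<close> in \<open>q\<^sub>i\<close> is
  \<open>(q\<^sup>s\<^sup>c - q\<^sup>-\<^sup>s\<^sup>c) / (q\<^sub>i - q\<^sub>i\<^sup>-\<^sup>1)\<close>, which makes sense even if \<open>s c / d\<^sub>i\<close> is not an integer.\<close>

definition hx_coeff :: "datum \<Rightarrow> nat \<Rightarrow> nat \<Rightarrow> int \<Rightarrow> complex" where
  "hx_coeff T i j s = (1 / of_int s) *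
     (\<Sum>r=1..ord_aut T.
        (qq T powi (s * cart T i ((aut T ^^ r) j)) - qq T powi (- (s * cart T i ((aut T ^^ r) j))))
          / (qi T i - inverse (qi T i)) * omega T powi (s * int r))"

definition stab_num :: "datum \<Rightarrow> nat \<Rightarrow> nat" where
  "stab_num T i = (if aut T i = i then ord_aut T else 1)"

definition xx_coeff :: "datum \<Rightarrow> nat \<Rightarrow> nat \<Rightarrow> int \<Rightarrow> complex" where
  "xx_coeff T i j l =
     (\<Sum>r=1..ord_aut T. if (aut T ^^ r) i = j then omega T powi (int r * l) else 0)
       / of_nat (stab_num T i)"

text \<open>A grading of the algebra \<open>chev_alg T / rel_ideal T\<close> by the integers.\<close>

definition Z_grading :: "datum \<Rightarrow> (int \<Rightarrow> falg set) \<Rightarrow> bool" where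
  "Z_grading T G \<longleftrightarrow>
     (\<forall>d. rel_ideal T \<subseteq> G d \<and> G d \<subseteq> chev_alg T) \<and>
     (\<forall>d. \<forall>a\<in>G d. \<forall>b\<in>G d. a + b \<in> G d) \<and>
     (\<forall>d c. \<forall>a\<in>G d. sc c * a \<in> G d) \<and>
     (\<forall>d d'. \<forall>a\<in>G d. \<forall>b\<in>G d'. a * b \<in> G (d + d')) \<and>
     (\<forall>a\<in>chev_alg T. \<exists>D g. finite D \<and> (\<forall>d\<in>D. g d \<in> G d) \<and> a = (\<Sum>d\<in>D. g d)) \<and>
     (\<forall>D g. finite D \<and> (\<forall>d\<in>D. g d \<in> G d) \<and> (\<Sum>d\<in>D. g d) \<in> rel_ideal T
        \<longrightarrow> (\<forall>d\<in>D. g d \<in> rel_ideal T))"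

text \<open>\<open>x p i m\<close> and \<open>h i r\<close> are representatives of the elements \<open>x\<^sub>i\<^sub>,\<^sub>m\<^sup>p\<close> and \<open>h\<^sub>i\<^sub>,\<^sub>r\<close>
  (the value \<open>h i 0\<close> is not used).\<close>

definition drinfeld_set ::
    "datum \<Rightarrow> (sign \<Rightarrow> nat \<Rightarrow> int \<Rightarrow> falg) \<Rightarrow> (nat \<Rightarrow> int \<Rightarrow> falg) \<Rightarrow> falg set" where
  "drinfeld_set T x h =
     {x p i m |p i m. i \<in> nodes T} \<union> {h i r |i r. i \<in> nodes T \<and> r \<noteq> 0} \<union>
     {ki T i |i. i \<in> nodes T} \<union> {ki_inv T i |i. i \<in> nodes T}"

definition drinfeld_relations ::
    "datum \<Rightarrow> (sign \<Rightarrow> nat \<Rightarrow> int \<Rightarrow> falg) \<Rightarrow> (nat \<Rightarrow> int \<Rightarrow> falg) \<Rightarrow> bool" where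
  "drinfeld_relations T x h \<longleftrightarrow>
     (\<forall>i\<in>nodes T. \<forall>p m. ueq T (x p (aut T i) m) (sc (omega T powi m) * x p i m)) \<and>
     (\<forall>i\<in>nodes T. \<forall>r. r \<noteq> 0 \<longrightarrow> ueq T (h (aut T i) r) (sc (omega T powi r) * h i r)) \<and>
     (\<forall>i\<in>nodes T. \<forall>j\<in>nodes T. \<forall>r s. r \<noteq> 0 \<longrightarrow> s \<noteq> 0 \<longrightarrow> ueq T (comm (h i r) (h j s)) 0) \<and>
     (\<forall>i\<in>nodes T. \<forall>j\<in>nodes T. \<forall>r. r \<noteq> 0 \<longrightarrow> ueq T (comm (ki T i) (h j r)) 0) \<and>
     (\<forall>i\<in>nodes T. \<forall>j\<in>nodes T. \<forall>p m.
        ueq T (ki T i * x p j m) (sc (qq T powi (sgn_int p * csum T i j)) * x p j m * ki T i)) \<and>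
     (\<forall>i\<in>nodes T. \<forall>j\<in>nodes T. \<forall>p s l. s \<noteq> 0 \<longrightarrow>
        ueq T (comm (h i s) (x p j l)) (sc (of_int (sgn_int p) * hx_coeff T i j s) * x p j (s + l))) \<and>
     (\<forall>i\<in>nodes T. \<forall>j\<in>nodes T. \<forall>s l.
        ueq T (comm (x Pl i s) (x Mi j l))
          (sc (xx_coeff T i j l / (qi T i - inverse (qi T i))) *
             (phi T h Pl i (s + l) - phi T h Mi i (s + l))))"

text \<open>The Drinfeld generators enter through the properties by which they are identified inside the
  Chevalley presentation: they generate, their modes \<open>0\<close> are the Chevalley generators,
  \<open>e\<^sub>\<epsilon>\<^sup>\<plusminus>\<close> has degree \<open>\<plusminus>1\<close> for their grading, they satisfy the relations of the
  Drinfeld presentation used here, and their nonnegative half lies in the Borel subalgebra.\<close>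

definition drinfeld_generators ::
    "datum \<Rightarrow> (sign \<Rightarrow> nat \<Rightarrow> int \<Rightarrow> falg) \<Rightarrow> (nat \<Rightarrow> int \<Rightarrow> falg) \<Rightarrow> bool" where
  "drinfeld_generators T x h \<longleftrightarrow>
     drinfeld_set T x h \<subseteq> chev_alg T \<and>
     usub T (drinfeld_set T x h) = chev_alg T \<and>
     (\<forall>i\<in>reps T. \<forall>p. ueq T (x p i 0) (ee p (Orb i))) \<and>
     (\<exists>G. Z_grading T G \<and>
        (\<forall>i\<in>nodes T. \<forall>p m. x p i m \<in> G m) \<and>
        (\<forall>i\<in>nodes T. \<forall>r. r \<noteq> 0 \<longrightarrow> h i r \<in> G r) \<and>
        (\<forall>i\<in>nodes T. ki T i \<in> G 0 \<and> ki_inv T i \<in> G 0) \<and>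
        ee Pl Eps \<in> G 1 \<and> ee Mi Eps \<in> G (-1)) \<and>
     drinfeld_relations T x h \<and>
     (\<forall>i\<in>nodes T. \<forall>r\<ge>0. x Pl i r \<in> borel T) \<and>
     (\<forall>i\<in>nodes T. \<forall>r>0. x Mi i r \<in> borel T) \<and>
     (\<forall>i\<in>nodes T. \<forall>r\<ge>0. phi T h Pl i r \<in> borel T)"


section \<open>Modules over the Borel subalgebra\<close>

text \<open>A module is a complex vector space \<open>'v\<close> (with scalar multiplication \<open>scl\<close>) together with
  operators \<open>act a\<close>, which are relevant for \<open>a \<in> borel T\<close> only.\<close>

definition borel_module ::
    "datum \<Rightarrow> (complex \<Rightarrow> 'v \<Rightarrow> 'v) \<Rightarrow> (falg \<Rightarrow> 'v \<Rightarrow> 'v::ab_group_add) \<Rightarrow> bool" where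
  "borel_module T scl act \<longleftrightarrow>
     vector_space scl \<and>
     (\<forall>a\<in>borel T. Vector_Spaces.linear scl scl (act a)) \<and>
     (\<forall>c v. act (sc c) v = scl c v) \<and>
     (\<forall>a\<in>borel T. \<forall>b\<in>borel T. \<forall>v. act (a + b) v = act a v + act b v \<and> act (a * b) v = act a (act b v)) \<and>
     (\<forall>a\<in>rel_ideal T. \<forall>v. act a v = 0)"

definition borel_submodule ::
    "datum \<Rightarrow> (complex \<Rightarrow> 'v \<Rightarrow> 'v) \<Rightarrow> (falg \<Rightarrow> 'v \<Rightarrow> 'v::ab_group_add) \<Rightarrow> 'v set \<Rightarrow> bool" where
  "borel_submodule T scl act W \<longleftrightarrow>
     module.subspace scl W \<and> (\<forall>a\<in>borel T. \<forall>w\<in>W. act a w \<in> W)"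

definition simple_module ::
    "datum \<Rightarrow> (complex \<Rightarrow> 'v \<Rightarrow> 'v) \<Rightarrow> (falg \<Rightarrow> 'v \<Rightarrow> 'v::ab_group_add) \<Rightarrow> bool" where
  "simple_module T scl act \<longleftrightarrow>
     borel_module T scl act \<and> (UNIV :: 'v set) \<noteq> {0} \<and>
     (\<forall>W. borel_submodule T scl act W \<longrightarrow> W = {0} \<or> W = UNIV)"

text \<open>Elements of \<open>\<tt>\<^sup>*\<close>: functions whose restriction to \<open>torus T\<close> is (induced by) an algebra
  character; values outside \<open>torus T\<close> never matter.\<close>

definition tchar :: "datum \<Rightarrow> (falg \<Rightarrow> complex) \<Rightarrow> bool" where
  "tchar T \<chi> \<longleftrightarrow>
     (\<forall>c. \<chi> (sc c) = c) \<and>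
     (\<forall>a\<in>torus T. \<forall>b\<in>torus T. \<chi> (a + b) = \<chi> a + \<chi> b \<and> \<chi> (a * b) = \<chi> a * \<chi> b) \<and>
     (\<forall>a\<in>rel_ideal T. \<chi> a = 0)"

text \<open>\<open>\<lambda> \<le> \<mu>\<close>: the additive identity \<open>\<mu> = \<lambda> + \<Sum>\<^sub>i n\<^sub>i \<alpha>\<^sub>i\<close> of characters, evaluated on the
  generators \<open>k\<^sub>j\<close> of \<open>\<tt>\<close>.\<close>

definition wt_le :: "datum \<Rightarrow> (falg \<Rightarrow> complex) \<Rightarrow> (falg \<Rightarrow> complex) \<Rightarrow> bool" where
  "wt_le T \<chi> \<mu> \<longleftrightarrow>
     (\<exists>n :: nat \<Rightarrow> nat. \<forall>j\<in>reps T.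
        \<mu> (kk (Orb j)) =
          \<chi> (kk (Orb j)) * (\<Prod>i\<in>reps T. (qn T (Orb i) powi aff_cartan T (Orb i) (Orb j)) ^ n i))"

definition weight_space ::
    "datum \<Rightarrow> (complex \<Rightarrow> 'v \<Rightarrow> 'v) \<Rightarrow> (falg \<Rightarrow> 'v \<Rightarrow> 'v::ab_group_add) \<Rightarrow>
      (falg \<Rightarrow> complex) \<Rightarrow> 'v set" where
  "weight_space T scl act \<chi> = {v. \<forall>a\<in>torus T. act a v = scl (\<chi> a) v}"

definition in_cat_O ::
    "datum \<Rightarrow> (complex \<Rightarrow> 'v \<Rightarrow> 'v) \<Rightarrow> (falg \<Rightarrow> 'v \<Rightarrow> 'v::ab_group_add) \<Rightarrow> bool" where
  "in_cat_O T scl act \<longleftrightarrow>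
     borel_module T scl act \<and>
     module.span scl (\<Union>\<chi>\<in>{\<chi>. tchar T \<chi>}. weight_space T scl act \<chi>) = UNIV \<and>
     (\<forall>\<chi>. tchar T \<chi> \<longrightarrow> (\<exists>B. finite B \<and> weight_space T scl act \<chi> \<subseteq> module.span scl B)) \<and>
     (\<exists>\<Lambda>. finite \<Lambda> \<and> (\<forall>\<mu>\<in>\<Lambda>. tchar T \<mu>) \<and>
        (\<forall>\<chi>. tchar T \<chi> \<and> weight_space T scl act \<chi> \<noteq> {0} \<longrightarrow> (\<exists>\<mu>\<in>\<Lambda>. wt_le T \<chi> \<mu>)))"

text \<open>The tuples \<open>\<gamma>\<close> over which the highest \<open>l\<close>-weights run.\<close>

definition l_weight :: "datum \<Rightarrow> (nat \<Rightarrow> complex fps) \<Rightarrow> bool" where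
  "l_weight T \<gamma> \<longleftrightarrow>
     (\<forall>i\<in>nodes T. fps_nth (\<gamma> i) 0 \<noteq> 0 \<and> \<gamma> (aut T i) = \<gamma> i oo (fps_const (omega T) * fps_X))"

definition rational_fps :: "complex fps \<Rightarrow> bool" where
  "rational_fps f \<longleftrightarrow> (\<exists>P Q. poly Q 0 \<noteq> 0 \<and> f = fps_of_poly P / fps_of_poly Q)"

definition highest_l_weight ::
    "datum \<Rightarrow> (sign \<Rightarrow> nat \<Rightarrow> int \<Rightarrow> falg) \<Rightarrow> (nat \<Rightarrow> int \<Rightarrow> falg) \<Rightarrow>
      (complex \<Rightarrow> 'v \<Rightarrow> 'v) \<Rightarrow> (falg \<Rightarrow> 'v \<Rightarrow> 'v::ab_group_add) \<Rightarrow>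
      (nat \<Rightarrow> complex fps) \<Rightarrow> bool" where
  "highest_l_weight T x h scl act \<gamma> \<longleftrightarrow>
     borel_module T scl act \<and>
     (\<exists>v. (\<forall>W. borel_submodule T scl act W \<and> v \<in> W \<longrightarrow> W = UNIV) \<and>
        (\<forall>i\<in>nodes T. \<forall>r\<ge>0. act (x Pl i r) v = 0) \<and>
        (\<forall>i\<in>nodes T. \<forall>m. act (phi T h Pl i (int m)) v = scl (fps_nth (\<gamma> i) m) v))"

text \<open>\<open>is_L T x h scl act \<gamma>\<close>: the module is (isomorphic to) \<open>L(\<gamma>)\<close>, the simple module of highest
  \<open>l\<close>-weight \<open>\<gamma>\<close>.\<close>

definition is_L ::
    "datum \<Rightarrow> (sign \<Rightarrow> nat \<Rightarrow> int \<Rightarrow> falg) \<Rightarrow> (nat \<Rightarrow> int \<Rightarrow> falg) \<Rightarrow>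
      (complex \<Rightarrow> 'v \<Rightarrow> 'v) \<Rightarrow> (falg \<Rightarrow> 'v \<Rightarrow> 'v::ab_group_add) \<Rightarrow>
      (nat \<Rightarrow> complex fps) \<Rightarrow> bool" where
  "is_L T x h scl act \<gamma> \<longleftrightarrow> simple_module T scl act \<and> highest_l_weight T x h scl act \<gamma>"

end

theory Submission
 imports Defs "HOL-Library.Function_Algebras" "HOL-Computational_Algebra.Fundamental_Theorem_Algebra"
begin

text \<open>The Drinfeld generators are known only through relations, a grading and membership in
  the Borel subalgebra, so facts usually read off a triangular decomposition are derived from the
  Chevalley presentation. Two constructions supply them: modules induced from the Borel subalgebra
  show that the lowering generators impose no new relations on the Borel part, and regular modules
  twisted by characters separate the powers of the \<open>k\<close>s. The induced module is also
  forced by \<open>e\<^sub>\<epsilon>\<close>: its expression involves \<open>x\<^sup>-\<close> of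
  mode 0, which does not act on a Borel module. That expression comes from \<open>x\<^sup>+\<close>
  of mode 1 at a node moved by \<sigma>; at a fixed node this element vanishes. It contains
  \<open>e\<^sub>\<epsilon>\<close> exactly once, and commutators with the \<open>x\<^sup>-\<close>
  of mode 0 strip off the other factors. That something nonzero is left is tested on a vacuum
  vector, where the commutator with \<open>x\<^sup>-\<close> of mode -1 is a multiple of the
  difference of \<open>k\<^sub>i\<close> and its inverse.\<close>

abbreviation "cf == fps_nth"

text \<open>Highest weight vectors: in a simple object of \<open>O\<close> a weight space of maximal height is killed by the
  \<open>x\<^sup>+\<close> and contains a common eigenvector \<open>v\<close> of the \<open>\<phi>\<close>. The \<open>x\<^sup>- v\<close> with modes divisible by \<open>M\<close> lie in one
  finite-dimensional weight space, and applying \<open>x\<^sup>+\<close> to a linear relation between them gives a recurrence for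
  the coefficients of \<open>\<gamma>\<close>.

  Conversely, a simple module \<open>V\<close> embeds into the induced module of the whole algebra. The span \<open>S\<close> of the
  monomials in the \<open>x\<^sup>-\<close> applied to \<open>v\<close>, and the span \<open>Z\<close> of the vectors of height \<open>k\<close> in \<open>S\<close> killed by all
  products of \<open>k\<close> of the \<open>x\<^sup>+\<close> with nonnegative modes, are stable under the Borel subalgebra; the difficult point is
  \<open>e\<^sub>\<epsilon>\<close>, which is shown to be a polynomial in such modes by means of skew derivations. Hence \<open>V \<subseteq> S\<close> and
  \<open>V \<inter> Z = 0\<close>. If \<open>\<gamma>\<close> is rational, the \<open>x\<^sup>-\<close> and the \<open>\<phi>\<close> satisfy polynomial recurrences modulo \<open>Z\<close> at
  every height, so the weight spaces of \<open>S / Z\<close> are finite-dimensional.\<close>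

section \<open>The free algebra and its actions\<close>

lemma sc_0 [simp]: "sc 0 = 0" by (simp add: sc_def)

lemma sc_1 [simp]: "sc 1 = 1" by (simp add: sc_def)

lemma sc_add: "sc (a + b) = sc a + sc b" by (simp add: sc_def single_add)

lemma sc_uminus: "sc (- a) = - sc a" by (simp add: sc_def single_uminus)

lemma sc_diff: "sc (a - b) = sc a - sc b" by (simp add: sc_def single_diff)

lemma sc_mult: "sc (a * b) = sc a * sc b" by (simp add: sc_def mult_single)

lemma word_add_0 [simp]: "(w :: 'g word) + 0 = w" "0 + (w :: 'g word) = w" by simp_all

lemma pm_add_induct [case_names zero single add]:
 fixes a :: "'a \<Rightarrow>\<^sub>0 'b::comm_monoid_add"
 assumes "P 0" "!!w c. P (Poly_Mapping.single w c)" "!!a b. P a ==> P b ==> P (a + b)"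
 shows "P a"
proof (induction a rule: update_induct)
 case const
 show ?case by (rule assms(1))
next
 case (update f w c)
 have "Poly_Mapping.update w c f = Poly_Mapping.single w c + f" using update(1)
  by (intro poly_mapping_eqI) (auto simp: lookup_update lookup_add lookup_single when_def in_keys_iff)
 thus ?case using update assms by simp
qed

lemma sc_commute: "sc c * a = a * (sc c :: 'g free_alg)"
proof (induction a rule: pm_add_induct)
 case (single w d)
 thus ?case by (simp add: sc_def mult_single mult.commute)
qed (simp_all add: distrib_left distrib_right)

lemma sc_inject [simp]: "sc a = (sc b :: 'g free_alg) \<longleftrightarrow> a = b" by (metis lookup_single_eq sc_def)

interpretation free_alg: vector_space "%c (a :: 'g free_alg). sc c * a"
 by standard (simp_all add: sc_add sc_mult distrib_left distrib_right mult.assoc)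

text \<open>The universal property of the free algebra: linear operators for the letters extend to
  an action. With \<open>foldr\<close> the last letter of a word acts first, as a left action
  requires.\<close>

definition alg_act :: "(complex => 'v => 'v) => ('g => 'v => 'v) => 'g free_alg => 'v => 'v::ab_group_add" where
 "alg_act scl ops a v =
  (SUM w:Poly_Mapping.keys a. scl (Poly_Mapping.lookup a w) (foldr ops (letters w) v))"

locale free_action = vector_space scl
 for scl :: "complex => 'v::ab_group_add => 'v" +
 fixes ops :: "'g => 'v => 'v"
 assumes ops_add: "ops g (v + w) = ops g v + ops g w"
  and ops_scl: "ops g (scl c v) = scl c (ops g v)"
begin

abbreviation "ac == alg_act scl ops"

lemma foldr_add: "foldr ops u (v + w) = foldr ops u v + foldr ops u w" by (induction u) (simp_all add: ops_add)

lemma foldr_scl: "foldr ops u (scl c v) = scl c (foldr ops u v)" by (induction u) (simp_all add: ops_scl)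

lemma act_sum_superset:
 assumes "finite S" "Poly_Mapping.keys a <= S"
 shows "ac a v = (SUM w:S. scl (Poly_Mapping.lookup a w) (foldr ops (letters w) v))" unfolding alg_act_def using assms
 by (intro sum.mono_neutral_left) (auto simp: in_keys_iff)

lemma act_zero [simp]: "ac 0 v = 0" by (simp add: alg_act_def)

lemma act_single: "ac (Poly_Mapping.single w c) v = scl c (foldr ops (letters w) v)" by (subst act_sum_superset[of "{w}"]) auto

lemma act_add: "ac (a + b) v = ac a v + ac b v"
proof -
 let ?S = "Poly_Mapping.keys a Un Poly_Mapping.keys b"
 have "ac (a + b) v = (SUM w:?S. scl (Poly_Mapping.lookup (a + b) w) (foldr ops (letters w) v))"
  by (rule act_sum_superset) (auto simp: Poly_Mapping.keys_add)
 moreover have "ac a v = (SUM w:?S. scl (Poly_Mapping.lookup a w) (foldr ops (letters w) v))"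
  "ac b v = (SUM w:?S. scl (Poly_Mapping.lookup b w) (foldr ops (letters w) v))" by (rule act_sum_superset; simp)+
 ultimately show ?thesis by (simp add: lookup_add scale_left_distrib sum.distrib)
qed

lemma act_add_right: "ac a (v + w) = ac a v + ac a w" by (simp add: alg_act_def foldr_add scale_right_distrib sum.distrib)

lemma act_sclr: "ac a (scl c v) = scl c (ac a v)" by (simp add: alg_act_def foldr_scl scale_sum_right mult.commute)

lemma act_mult: "ac (a * b) v = ac a (ac b v)"
proof (induction a rule: pm_add_induct)
 case (single w c)
 show ?case
 proof (induction b rule: pm_add_induct)
  case (single w' c')
  thus ?case by (simp add: mult_single act_single plus_word_def foldr_scl)
 qed (simp_all add: act_add_right distrib_left act_add act_single foldr_add scale_right_distrib
  foldr_scl [of _ 0, simplified] act_sclr [of _ 0, simplified])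
qed (simp_all add: distrib_right act_add)

lemma act_var [simp]: "ac (var g) v = ops g v" by (simp add: var_def act_single)

lemma act_sc [simp]: "ac (sc c) v = scl c v" by (simp add: sc_def act_single zero_word_def)

lemma act_one [simp]: "ac 1 v = v" using act_sc[of 1 v] by simp

lemma act_uminus: "ac (- a) v = - ac a v" by (metis act_add act_zero add_eq_0_iff)

lemma act_diff: "ac (a - b) v = ac a v - ac b v" using act_add[of a "- b" v] by (simp add: act_uminus)

end

section \<open>Diagram automorphisms\<close>

lemma cartan_sym: "cartan X i j = cartan X j i" by (simp add: cartan_def insert_commute)

lemma cartan_diag [simp]: "cartan X i i = 2" by (simp add: cartan_def)

lemma cartan_cases: "i ~= j ==> cartan X i j = 0 | cartan X i j = -1" by (simp add: cartan_def)

lemma cartan_TA: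
 "cartan (TA m) i j = (if i = j then 2 else if 1 <= i & i + 1 <= m & j = i + 1 | 1 <= j & j + 1 <= m & i = j + 1
  then -1 else 0)" by (auto simp: cartan_def doubleton_eq_iff)

lemma adj_TD:
 "{i, j} : edges (TD (k + 4)) \<longleftrightarrow> 1 <= i & i <= k + 2 & j = i + 1 | 1 <= j & j <= k + 2 & i = j + 1
  | i = k + 2 & j = k + 4 | j = k + 2 & i = k + 4"
proof -
 have "{i, j} : edges (TD (k + 4)) \<longleftrightarrow>
  (EX l. (i = l & j = l + 1 | i = l + 1 & j = l) & 1 <= l & l <= k + 2) |
  (i = k + 2 & j = k + 4 | i = k + 4 & j = k + 2)" by (simp add: doubleton_eq_iff) blast
 thus ?thesis by blast
qed

lemma TD_nbr:
 "cartan (TD (k + 4)) i j = -1 \<longleftrightarrow> 1 <= i & i <= k + 2 & j = i + 1 | 1 <= j & j <= k + 2 & i = j + 1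
  | i = k + 2 & j = k + 4 | j = k + 2 & i = k + 4"
proof -
 have "cartan (TD (k + 4)) i j = -1 \<longleftrightarrow> i ~= j & {i, j} : edges (TD (k + 4))"
  by (simp add: cartan_def del: edges.simps)
 thus ?thesis unfolding adj_TD by auto
qed

lemma cartan_TE6:
 "cartan TE6 i j = (if i = j then 2 else
  if {i, j} : {{1, 3}, {3, 4}, {4, 5}, {5, 6}, {2, 4}} then -1 else 0)" by (simp add: cartan_def)

text \<open>Off the diagonal a Cartan row is -1 on the neighbours and 0 elsewhere, so evaluating the
  matrix on a vector becomes a sum over the neighbour set \<open>N\<close>; the types below differ
  only in \<open>N\<close>.\<close>

lemma sum_nbrs:
 fixes f :: "nat => int"
 assumes "finite S" "b : S" "N <= S" "b ~: N" "!!l. l : S ==> cartan X b l = -1 \<longleftrightarrow> l : N"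
 shows "(SUM l:S. cartan X b l * f l) = 2 * f b - (SUM l:N. f l)"
proof -
 have "(SUM l:S. cartan X b l * f l) = (SUM l:S. (if l = b then 2 * f b else 0) - (if l : N then f l else 0))"
 proof (intro sum.cong refl)
  fix l assume "l : S"
  thus "cartan X b l * f l = (if l = b then 2 * f b else 0) - (if l : N then f l else 0)"
  using assms(4) assms(5)[of l] cartan_cases[of b l X] by auto
 qed
 also have "... = 2 * f b - (SUM l:S Int N. f l)" using assms(1,2) by (simp add: sum_subtractf sum.inter_restrict)
 also have "S Int N = N" using assms(3) by blast
 finally show ?thesis .
qed

lemma sum_TA:
 fixes f :: "nat => int"
 assumes "b : {1..m}"
 shows "(SUM l:{1..m}. cartan (TA m) b l * f l) = 2 * f b - (if b = 1 then 0 else f (b - 1)) - (if b = m then 0 else f (b + 1))"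
 using assms by (subst sum_nbrs[where N = "(if b = 1 then {} else {b - 1}) Un (if b = m then {} else {b + 1})"])
  (auto simp: cartan_TA split: if_splits)

text \<open>The vector (1, 2, ..., 2, 1) arises from the Kac labels for type \<open>A\<close> of odd
  rank. For \<open>m = 3\<close> the nodes 2 and \<open>m - 1\<close> coincide, and their two
  contributions add up to 2.\<close>

lemma sum_cartan_TA_12:
 assumes "m >= 3" "m ~= 4" and b: "b : {1..m}"
 shows "(SUM l:{1..m}. cartan (TA m) b l * (if l = 1 | l = m then 1 else 2)) =
  (if b = 2 | b = m - 1 then if m = 3 then 2 else 1 else 0)"
proof -
 consider "b = 1" | "b = m" | "m = 3" "b = 2" | "m >= 5" "b = 2" | "m >= 5" "b = m - 1" | "2 < b" "b + 1 < m" using assms by force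
 thus ?thesis unfolding sum_TA[OF b] using assms by cases auto
qed

lemma sum_TD:
 fixes f :: "nat => int"
 assumes "b : {1..k + 4}"
 shows "(SUM l:{1..k + 4}. cartan (TD (k + 4)) b l * f l) =
  2 * f b - (if b = 1 | b = k + 4 then 0 else f (b - 1)) - (if b <= k + 2 then f (b + 1) else 0) -
  (if b = k + 2 then f (k + 4) else if b = k + 4 then f (k + 2) else 0)" using assms
 by (subst sum_nbrs[where N = "(if b = 1 | b = k + 4 then {} else {b - 1}) Un (if b <= k + 2 then {b + 1} else {}) Un
  (if b = k + 2 then {k + 4} else if b = k + 4 then {k + 2} else {})"])
  (auto simp: TD_nbr split: if_splits)

lemma atLeastAtMost_1_6: "{1..6::nat} = {1, 2, 3, 4, 5, 6}" by auto

lemma sum_cartan_TE6: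
 fixes f :: "nat => int"
 shows "(SUM l:{1..6}. cartan TE6 1 l * f l) = 2 * f 1 - f 3"
  "(SUM l:{1..6}. cartan TE6 (Suc 0) l * f l) = 2 * f 1 - f 3"
  "(SUM l:{1..6}. cartan TE6 2 l * f l) = 2 * f 2 - f 4"
  "(SUM l:{1..6}. cartan TE6 3 l * f l) = 2 * f 3 - f 1 - f 4"
  "(SUM l:{1..6}. cartan TE6 4 l * f l) = 2 * f 4 - f 2 - f 3 - f 5"
  "(SUM l:{1..6}. cartan TE6 5 l * f l) = 2 * f 5 - f 4 - f 6"
  "(SUM l:{1..6}. cartan TE6 6 l * f l) = 2 * f 6 - f 5" unfolding atLeastAtMost_1_6 by (simp_all add: cartan_TE6 doubleton_eq_iff)

text \<open>The sum of the positive coroots, in the basis of simple coroots.\<close>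

lemma ex_two_rho:
 assumes "valid_type X"
 shows "EX f :: nat => int. (ALL i:{1..rank X}. f i > 0 & (SUM l:{1..rank X}. cartan X i l * f l) = 2)"
proof (cases X)
 case (TA m)
 hence m: "m >= 2" using assms by simp
 \<comment> \<open>Positive coroots of type \<open>A\<close> correspond to intervals of nodes, and
   \<open>i (m + 1 - i)\<close> of them contain \<open>i\<close>.\<close>
 let ?f = "%i. int i * (int m + 1 - int i)"
 have "?f i > 0 & (SUM l:{1..m}. cartan (TA m) i l * ?f l) = 2" if i: "i : {1..m}" for i
 proof
  show "?f i > 0" using i by simp
  show "(SUM l:{1..m}. cartan (TA m) i l * ?f l) = 2"
  using i m unfolding sum_TA[OF i] by (auto simp: algebra_simps of_nat_diff)
 qed
 thus ?thesis using TA by (intro exI[of _ ?f]) simp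
next
 case (TD m)
 then obtain k where m: "m = k + 4" using assms by (metis valid_type.simps(2) add.commute le_Suc_ex)
 \<comment> \<open>With \<open>m = k + 4\<close> these are \<open>i (2 m - 1 - i)\<close> along the
   leg and \<open>m (m - 1) / 2\<close> at the two ends of the fork; the parity split performs the
   halving inside the integers.\<close>
 define f where "f i = (if i <= k + 2 then int i * (2 * int k + 7 - int i)
  else if even k then int (k div 2 + 2) * (int k + 3) else (int k + 4) * int ((k + 3) div 2))" for i
 have half: "2 * (if even k then int (k div 2 + 2) * (int k + 3) else (int k + 4) * int ((k + 3) div 2))
  = (int k + 4) * (int k + 3)" by (auto elim!: evenE oddE simp: algebra_simps)
 have f1: "f i = int i * (2 * int k + 7 - int i)" if "i <= k + 2" for i using that by (simp add: f_def)
 have f2: "2 * f i = (int k + 4) * (int k + 3)" if "i > k + 2" for i using that half by (simp add: f_def)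
 have pos: "f i > 0" if "i : {1..m}" for i
 proof (cases "i <= k + 2")
  case True thus ?thesis using that by (simp add: f1)
 next
  case False
  hence "2 * f i > 0" using f2[of i] by simp
  thus ?thesis by simp
 qed
 have "(SUM l:{1..k + 4}. cartan (TD (k + 4)) i l * f l) = 2" if i: "i : {1..k + 4}" for i
  using i f2[of "Suc (Suc (Suc k))"] f2[of "k + 3"] f2[of "k + 4"] unfolding sum_TD[OF i]
  by (cases "i = k + 3 | i = k + 4") (auto simp: f1 algebra_simps of_nat_diff)
 thus ?thesis using TD m pos by (intro exI[of _ f]) simp
next
 case TE6
 let ?f = "%i::nat. if i = 1 | i = 6 then 16 else if i = 2 then 22 else if i = 4 then 42 else (30 :: int)"
 have "?f i > 0 & (SUM l:{1..6}. cartan TE6 i l * ?f l) = 2" if "i : {1..6}" for i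
 proof -
  from that have "i = 1 | i = 2 | i = 3 | i = 4 | i = 5 | i = 6" by auto
  thus ?thesis by (elim disjE) (simp_all only: sum_cartan_TE6, simp_all)
 qed
 thus ?thesis using TE6 by (intro exI[of _ ?f]) simp
qed

section \<open>Automorphisms of the finite diagrams\<close>

locale twisted =
 fixes T :: datum
 assumes twisted: "twisted_datum T"
begin

abbreviation "An == anodes T"
abbreviation "Rp == reps T"
abbreviation "Nd == nodes T"
abbreviation "kO j == kk (Orb j)"
abbreviation "kI j == kinv (Orb j)"
abbreviation "sg == aut T"
abbreviation "M == ord_aut T"

lemma valid: "valid_type (dtype T)"
 and bij_aut: "bij_betw sg (Nd) (Nd)"
 and aut_cart: "i : Nd ==> j : Nd ==> cart T (sg i) (sg j) = cart T i j"
 and aut_nontriv: "EX i:Nd. sg i ~= i"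
 and qq_nz: "qq T ~= 0"
 and qq_root: "n > 0 ==> qq T ^ n ~= 1" using twisted unfolding twisted_datum_def by auto

lemma aut_nodes: "i : Nd ==> sg i : Nd" using bij_aut by (auto simp: bij_betw_def)

lemma aut_inj: "i : Nd ==> j : Nd ==> sg i = sg j \<longleftrightarrow> i = j"
 using bij_aut by (auto simp: bij_betw_def inj_on_def)

lemma finite_nodes [simp]: "finite (Nd)" by (simp add: nodes_def)

text \<open>An automorphism of a path moves one step at a time, and injectivity
  (\<open>step2\<close>) forbids turning back; so it is affine of slope \<open>e = 1\<close> or
  \<open>e = -1\<close>. Slope 1 leaves room only for the identity.\<close>

lemma aut_TA:
 assumes X: "dtype T = TA m" and i: "i : {1..m}"
 shows "sg i = m + 1 - i"
proof -
 have N: "Nd = {1..m}" and m: "m >= 2" using X valid by (simp_all add: nodes_def)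
 define f where "f i = int (sg i)" for i
 have rng: "1 <= f i & f i <= int m" if "i : {1..m}" for i using aut_nodes[of i] that by (simp add: N f_def)
 have step: "f (i + 1) - f i = 1 | f (i + 1) - f i = -1" if "1 <= i" "i < m" for i
  using aut_cart[of i "i + 1"] that unfolding X N f_def by (auto simp: cartan_TA split: if_splits)
 have step2: "f (i + 2) ~= f i" if "1 <= i" "i + 1 < m" for i using aut_inj[of i "i + 2"] that by (simp add: N f_def)
 define e where "e = f 2 - f 1"
 have e: "e = 1 | e = -1" using step[of 1] m by (simp add: e_def numeral_2_eq_2)
 have inc: "i + 1 <= m --> f (i + 1) = f i + e" if "1 <= i" for i using that
 proof (induction i rule: dec_induct)
  case base thus ?case by (simp add: e_def numeral_2_eq_2)
 next
  case (step n)
  show ?case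
  proof
  assume le: "Suc n + 1 <= m"
  have "f (Suc n) = f n + e" using step le by simp
  moreover have "f (n + 2) ~= f n" using step2[of n] step le by simp
  moreover have "f (n + 2) - f (Suc n) = 1 | f (n + 2) - f (Suc n) = -1"
  using `!!i. 1 <= i ==> i < m ==> _`[of "Suc n"] le by simp
  ultimately show "f (Suc n + 1) = f (Suc n) + e" using e by auto
  qed
 qed
 have lin: "i <= m --> f i = f 1 + e * (int i - 1)" if "1 <= i" for i using that
 proof (induction i rule: dec_induct)
  case base thus ?case by simp
 next
  case (step n) thus ?case using inc[of n] by (auto simp: algebra_simps)
 qed
 have "e ~= 1"
 proof
  assume e1: "e = 1"
  have "f 1 = 1" using lin[of m] rng[of m] rng[of 1] m e1 by simp
  hence "sg i = i" if "i : {1..m}" for i using lin[of i] that e1 by (simp add: f_def)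
  thus False using aut_nontriv by (auto simp: N)
 qed
 hence e': "e = -1" using e by simp
 have "f 1 = int m" using lin[of m] rng[of m] rng[of 1] m e' by simp
 hence "f i = int m + 1 - int i" using lin[of i] i e' by simp
 thus ?thesis using i by (simp add: f_def)
qed

lemma TD_adj:
 assumes X: "dtype T = TD (k + 4)" and "i : {1..k + 4}" "j : {1..k + 4}"
  "cartan (TD (k + 4)) i j = -1"
 shows "cartan (TD (k + 4)) (sg i) (sg j) = -1" using aut_cart[of i j] assms by (simp add: nodes_def)

text \<open>Only \<open>k + 2\<close> has three neighbours, and an automorphism carries these to
  three different neighbours of its image.\<close>

lemma aut_TD_branch:
 assumes X: "dtype T = TD (k + 4)"
 shows "sg (k + 2) = k + 2"
proof (rule ccontr)
 have N: "Nd = {1..k + 4}" using X by (simp add: nodes_def)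
 let ?b = "sg (k + 2)"
 assume ne: "?b ~= k + 2"
 have b: "?b : {1..k + 4}" using aut_nodes[of "k + 2"] by (simp add: N)
 have adj: "cartan (TD (k + 4)) ?b (sg (k + 1)) = -1" "cartan (TD (k + 4)) ?b (sg (k + 3)) = -1"
  "cartan (TD (k + 4)) ?b (sg (k + 4)) = -1" by (rule TD_adj[OF X]; simp add: TD_nbr)+
 have dist: "sg (k + 1) ~= sg (k + 3)" "sg (k + 1) ~= sg (k + 4)" "sg (k + 3) ~= sg (k + 4)"
  by (simp_all add: aut_inj N)
 have lt: "?b <= k + 1 | ?b = k + 3 | ?b = k + 4" using b ne by auto
 have few: "j = ?b + 1 | j + 1 = ?b" if "cartan (TD (k + 4)) ?b j = -1" "?b <= k + 1" for j
  using that unfolding TD_nbr by auto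
 have one: "j = k + 2" if "cartan (TD (k + 4)) ?b j = -1" "?b = k + 3 | ?b = k + 4" for j using that unfolding TD_nbr by auto
 show False
 proof (cases "?b <= k + 1")
  case True
  thus False using few[OF adj(1)] few[OF adj(2)] few[OF adj(3)] dist by linarith
 next
  case False
  thus False using one[OF adj(1)] one[OF adj(2)] dist(1) lt by simp
 qed
qed

text \<open>From rank 5 on, one neighbour of the branch node, \<open>k + 1\<close>, has a further
  neighbour and is therefore fixed; from there the leg is fixed node by node, and nontriviality
  leaves only the exchange of the last two nodes. In rank 4 all three neighbours are leaves, which
  is why \<open>D\<^sub>4\<close> is treated apart.\<close>

lemma aut_TD:
 assumes X: "dtype T = TD (k + 4)" and k: "k >= 1"
 shows "sg (k + 4) = k + 3" "sg (k + 3) = k + 4" "!!i. 1 <= i ==> i <= k + 2 ==> sg i = i"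
proof -
 have N: "Nd = {1..k + 4}" using X by (simp_all add: nodes_def)
 note br = aut_TD_branch[OF X]
 have adj: "cartan (TD (k + 4)) (k + 2) (sg (k + 1)) = -1" "cartan (TD (k + 4)) (k + 2) (sg (k + 3)) = -1"
  "cartan (TD (k + 4)) (k + 2) (sg (k + 4)) = -1"
  using TD_adj[OF X, of "k + 2" "k + 1"] TD_adj[OF X, of "k + 2" "k + 3"] TD_adj[OF X, of "k + 2" "k + 4"]
  unfolding br by (simp_all add: TD_nbr)
 have in3: "sg (k + 1) : {k + 1, k + 3, k + 4}" "sg (k + 3) : {k + 1, k + 3, k + 4}" "sg (k + 4) : {k + 1, k + 3, k + 4}"
  using adj unfolding TD_nbr by auto
 have dist: "sg (k + 1) ~= sg (k + 3)" "sg (k + 1) ~= sg (k + 4)" "sg (k + 3) ~= sg (k + 4)"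
  by (simp_all add: aut_inj N)
 have k1: "sg (k + 1) = k + 1"
 proof -
  have "cartan (TD (k + 4)) (sg (k + 1)) (sg k) = -1"
  by (rule TD_adj[OF X]) (use k in \<open>simp_all add: TD_nbr\<close>)
  moreover have "sg k ~= sg (k + 2)" using k by (simp add: aut_inj N)
  ultimately show ?thesis using in3(1) br unfolding TD_nbr by auto
 qed
 have "1 <= k + 2 - l ==> sg (k + 2 - l) = k + 2 - l" for l
 proof (induction l rule: less_induct)
  case (less l)
  consider "l = 0" | "l = 1" | l' where "l = l' + 2" by (metis add_2_eq_Suc' not0_implies_Suc One_nat_def)
  thus ?case
  proof cases
  case 1 thus ?thesis using br by simp
  next
  case 2 thus ?thesis using k1 by simp
  next
  case 3
  define j where "j = k + 2 - l"
  have j: "k + 2 - (l' + 1) = j + 1" "k + 2 - l' = j + 2" "1 <= j" "j <= k" using 3 less(2) by (simp_all add: j_def)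
  have 1: "sg (j + 1) = j + 1" "sg (j + 2) = j + 2" using less(1)[of "l' + 1"] less(1)[of l'] 3 j by simp_all
  have "cartan (TD (k + 4)) (sg (j + 1)) (sg j) = -1"
  by (rule TD_adj[OF X]) (use j in \<open>simp_all add: TD_nbr\<close>)
  hence "sg j = j | sg j = j + 2" using j 1 unfolding TD_nbr by auto
  moreover have "sg j ~= sg (j + 2)" using j by (simp add: aut_inj N)
  ultimately show ?thesis using 1 by (simp add: j_def)
  qed
 qed
 hence fixed: "sg i = i" if "1 <= i" "i <= k + 2" for i by (metis that diff_diff_cancel)
 thus "!!i. 1 <= i ==> i <= k + 2 ==> sg i = i" .
 have "~ (sg (k + 3) = k + 3 & sg (k + 4) = k + 4)"
 proof
  assume h: "sg (k + 3) = k + 3 & sg (k + 4) = k + 4"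
  have "sg i = i" if "i : Nd" for i
  proof -
  have "1 <= i & i <= k + 2 | i = k + 3 | i = k + 4" using that N by auto
  thus ?thesis using h fixed by blast
  qed
  thus False using aut_nontriv by blast
 qed
 thus "sg (k + 4) = k + 3" "sg (k + 3) = k + 4" using k1 in3 dist by auto
qed

text \<open>The trivalent node 4 is found by elimination, then 2 as its only neighbour that is a
  leaf. The two long arms are either both fixed, which gives the identity, or exchanged.\<close>

lemma aut_TE6:
 assumes X: "dtype T = TE6"
 shows "sg 1 = 6" "sg 6 = 1" "sg 3 = 5" "sg 5 = 3" "sg 2 = 2" "sg 4 = 4"
proof -
 have N: "Nd = {1, 2, 3, 4, 5, 6}" using X by (auto simp: nodes_def)
 note [simp del] = One_nat_def
 have in6: "sg i : {1, 2, 3, 4, 5, 6}" if "i : {1, 2, 3, 4, 5, 6}" for i using aut_nodes[of i] that unfolding N by blast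
 have c: "cartan TE6 (sg i) (sg j) = cartan TE6 i j" if "i : {1, 2, 3, 4, 5, 6}" "j : {1, 2, 3, 4, 5, 6}" for i j
  using aut_cart[of i j] that unfolding X N by blast
 have inj: "sg i = sg j \<longleftrightarrow> i = j" if "i : {1, 2, 3, 4, 5, 6}" "j : {1, 2, 3, 4, 5, 6}" for i j
  using aut_inj[of i j] that unfolding N by blast
 have adj: "{sg i, sg j} : {{1, 3}, {3, 4}, {4, 5}, {5, 6}, {2, 4}}"
  if "{i, j} : {{1, 3}, {3, 4}, {4, 5}, {5, 6}, {2, 4::nat}}" for i j
 proof -
  have ij: "i : {1, 2, 3, 4, 5, 6}" "j : {1, 2, 3, 4, 5, 6}" "i ~= j" using that by (auto simp: doubleton_eq_iff)
  hence "cartan TE6 (sg i) (sg j) = -1" using c[of i j] that by (simp add: cartan_TE6)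
  thus ?thesis by (auto simp: cartan_TE6 split: if_splits)
 qed
 have a: "{sg 1, sg 3} : {{1, 3}, {3, 4}, {4, 5}, {5, 6}, {2, 4}}"
  "{sg 3, sg 4} : {{1, 3}, {3, 4}, {4, 5}, {5, 6}, {2, 4}}"
  "{sg 4, sg 5} : {{1, 3}, {3, 4}, {4, 5}, {5, 6}, {2, 4}}"
  "{sg 5, sg 6} : {{1, 3}, {3, 4}, {4, 5}, {5, 6}, {2, 4}}"
  "{sg 2, sg 4} : {{1, 3}, {3, 4}, {4, 5}, {5, 6}, {2, 4}}" by (rule adj; simp)+
 have d: "sg 3 ~= sg 5" "sg 2 ~= sg 3" "sg 2 ~= sg 5" "sg 1 ~= sg 4" "sg 6 ~= sg 4" "sg 1 ~= sg 2" "sg 6 ~= sg 2"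
  "sg 1 ~= sg 5" by (simp_all add: inj)
 show 4: "sg 4 = 4"
 proof -
  consider "sg 4 = 1" | "sg 4 = 2" | "sg 4 = 3" | "sg 4 = 4" | "sg 4 = 5" | "sg 4 = 6"
  using in6[of 4] by auto
  thus ?thesis by cases (use a(2,3,5) d(1-3) in \<open>auto simp: doubleton_eq_iff\<close>)
 qed
 have 3: "sg 3 : {2, 3, 5}" "sg 5 : {2, 3, 5}" "sg 2 : {2, 3, 5}"
  using a(2,3,5) 4 by (auto simp: doubleton_eq_iff)
 have "sg 3 ~= 2" "sg 5 ~= 2" using a(1,4) d(4,5) 4 by (auto simp: doubleton_eq_iff)
 hence 35: "sg 3 = 3 & sg 5 = 5 | sg 3 = 5 & sg 5 = 3" and 2: "sg 2 = 2" using 3 d(1-3) by auto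
 show "sg 2 = 2" by fact
 have "~ (sg 3 = 3 & sg 5 = 5)"
 proof
  assume h: "sg 3 = 3 & sg 5 = 5"
  hence "sg 1 = 1" "sg 6 = 6" using a(1,4) d(4,5) 4 by (auto simp: doubleton_eq_iff)
  thus False using aut_nontriv h 2 4 by (auto simp: N)
 qed
 thus 1: "sg 3 = 5" "sg 5 = 3" using 35 by auto
 thus "sg 1 = 6" "sg 6 = 1" using a(1,4) d(4,5) 4 by (auto simp: doubleton_eq_iff)
qed

lemma aut_TD4:
 assumes X: "dtype T = TD 4"
 shows "sg 2 = 2" "sg 1 : {1, 3, 4}" "sg 3 : {1, 3, 4}" "sg 4 : {1, 3, 4}"
  "sg 1 ~= sg 3" "sg 1 ~= sg 4" "sg 3 ~= sg 4" "~ (sg 1 = 1 & sg 3 = 3 & sg 4 = 4)"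
proof -
 have N: "Nd = {1, 2, 3, 4}" using X by (auto simp: nodes_def)
 show 2: "sg 2 = 2" using aut_TD_branch[of 0] X by (simp add: numeral_2_eq_2)
 have "sg i : {1, 3, 4}" if "i : {1, 3, 4}" for i
 proof -
  have "sg i : {1, 2, 3, 4}" "sg i ~= sg 2" using aut_nodes[of i] aut_inj[of i 2] that by (auto simp: N)
  thus ?thesis using 2 by auto
 qed
 thus "sg 1 : {1, 3, 4}" "sg 3 : {1, 3, 4}" "sg 4 : {1, 3, 4}" by blast+
 show "sg 1 ~= sg 3" "sg 1 ~= sg 4" "sg 3 ~= sg 4" by (simp_all add: aut_inj N)
 show "~ (sg 1 = 1 & sg 3 = 3 & sg 4 = 4)" using aut_nontriv 2 by (auto simp: N)
qed

lemma ord_2I: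
 assumes "!!i. i : Nd ==> sg (sg i) = i"
 shows "M = 2" unfolding ord_aut_def
proof (rule Least_equality)
 show "0 < (2::nat) & (ALL i:Nd. (sg ^^ 2) i = i)" using assms by (simp add: numeral_2_eq_2)
next
 fix m assume m: "0 < m & (ALL i:Nd. (sg ^^ m) i = i)"
 have "m ~= 1" using m aut_nontriv by auto
 thus "2 <= m" using m by simp
qed

lemma ord_3I:
 assumes "!!i. i : Nd ==> sg (sg (sg i)) = i"
 shows "M = 3" unfolding ord_aut_def
proof (rule Least_equality)
 show "0 < (3::nat) & (ALL i:Nd. (sg ^^ 3) i = i)" using assms by (simp add: numeral_3_eq_3)
next
 fix m assume m: "0 < m & (ALL i:Nd. (sg ^^ m) i = i)"
 have "m ~= 1" using m aut_nontriv by auto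
 moreover have "m ~= 2"
 proof
  assume "m = 2"
  hence "sg (sg i) = i" if "i : Nd" for i using m that by (simp add: numeral_2_eq_2)
  hence "sg i = i" if "i : Nd" for i using assms[OF that] that by simp
  thus False using aut_nontriv by blast
 qed
 ultimately show "3 <= m" using m by simp
qed

lemma nodes_TD4: "dtype T = TD 4 ==> Nd = insert 2 {1, 3, 4}" by (auto simp: nodes_def)

lemma nodes_TE6: "dtype T = TE6 ==> Nd = {1, 2, 3, 4, 5, 6}" by (auto simp: nodes_def)

text \<open>In \<open>D4\<close> the leaf \<open>l\<close> is fixed and the leaves \<open>a\<close>,
  \<open>b\<close> are exchanged; in \<open>D43\<close> the automorphism is a triality, and
  \<open>a\<close>, \<open>b\<close> name the orbit of the leaf 1 in either direction of
  rotation.\<close>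

lemma aut_cases:
 obtains (A) m where "dtype T = TA m" "m >= 2" "!!i. i : {1..m} ==> sg i = m + 1 - i"
  "ALL i:Nd. sg (sg i) = i" "M = 2"
 | (D) k where "dtype T = TD (k + 4)" "k >= 1" "sg (k + 4) = k + 3" "sg (k + 3) = k + 4"
  "!!i. 1 <= i ==> i <= k + 2 ==> sg i = i" "ALL i:Nd. sg (sg i) = i" "M = 2"
 | (D4) l a b where "dtype T = TD 4" "{l, a, b} = {1, 3, 4}" "l ~= a" "l ~= b" "a ~= b"
  "sg 2 = 2" "sg l = l" "sg a = b" "sg b = a" "ALL i:Nd. sg (sg i) = i" "M = 2"
 | (D43) a b where "dtype T = TD 4" "{1, a, b} = {1, 3, 4}" "1 ~= a" "1 ~= b" "a ~= b"
  "sg 2 = 2" "sg 1 = a" "sg a = b" "sg b = 1" "ALL i:Nd. sg (sg (sg i)) = i" "M = 3"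
 | (E) "dtype T = TE6" "sg 1 = 6" "sg 6 = 1" "sg 3 = 5" "sg 5 = 3" "sg 2 = 2" "sg 4 = 4"
  "ALL i:Nd. sg (sg i) = i" "M = 2"
proof (cases "dtype T")
 case (TA m)
 have "sg (sg i) = i" if "i : Nd" for i
 proof -
  have i: "i : {1..m}" "m + 1 - i : {1..m}" using that TA by (auto simp: nodes_def)
  show ?thesis using i(1) unfolding aut_TA[OF TA i(1)] aut_TA[OF TA i(2)] by simp
 qed
 thus thesis using A[of m] aut_TA[OF TA] TA valid ord_2I by simp
next
 case (TD m)
 then obtain k where m: "m = k + 4" using valid by (metis valid_type.simps(2) add.commute le_Suc_ex)
 show thesis
 proof (cases "k = 0")
  case False
  hence a: "sg (k + 4) = k + 3" "sg (k + 3) = k + 4" "!!i. 1 <= i ==> i <= k + 2 ==> sg i = i"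
  using aut_TD[of k] TD m by simp_all
  have "sg (sg i) = i" if "i : Nd" for i
  proof -
  have "1 <= i & i <= k + 2 | i = k + 3 | i = k + 4" using that TD m by (auto simp: nodes_def)
  thus ?thesis using a by auto
  qed
  thus thesis using D[of k] a TD m False ord_2I by simp
 next
  case True
  hence X: "dtype T = TD 4" using TD m by simp
  note a = aut_TD4[OF X] and N = nodes_TD4[OF X]
  note [simp del] = One_nat_def
  consider "sg 1 = 1" "sg 3 = 4" "sg 4 = 3" | "sg 3 = 3" "sg 1 = 4" "sg 4 = 1"
  | "sg 4 = 4" "sg 1 = 3" "sg 3 = 1" | "sg 1 = 3" "sg 3 = 4" "sg 4 = 1" | "sg 1 = 4" "sg 4 = 3" "sg 3 = 1"
  using a(2-) by auto
  thus thesis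
  proof cases
  case 1
  hence "ALL i:Nd. sg (sg i) = i" unfolding N using a(1) by simp
  thus thesis using D4[OF X, of 1 3 4] 1 a(1) ord_2I by auto
  next
  case 2
  hence "ALL i:Nd. sg (sg i) = i" unfolding N using a(1) by simp
  thus thesis using D4[OF X, of 3 1 4] 2 a(1) ord_2I by auto
  next
  case 3
  hence "ALL i:Nd. sg (sg i) = i" unfolding N using a(1) by simp
  thus thesis using D4[OF X, of 4 1 3] 3 a(1) ord_2I by auto
  next
  case 4
  hence "ALL i:Nd. sg (sg (sg i)) = i" unfolding N using a(1) by simp
  thus thesis using D43[OF X, of 3 4] 4 a(1) ord_3I by auto
  next
  case 5
  hence "ALL i:Nd. sg (sg (sg i)) = i" unfolding N using a(1) by simp
  thus thesis using D43[OF X, of 4 3] 5 a(1) ord_3I by auto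
  qed
 qed
next
 case TE6
 note a = aut_TE6[OF TE6]
 have "ALL i:Nd. sg (sg i) = i" unfolding nodes_TE6[OF TE6] using a by (simp del: One_nat_def)
 thus thesis using E[OF TE6 a] ord_2I by blast
qed

lemma M_cases: "(M = 2 & (ALL i:Nd. sg (sg i) = i)) | (M = 3 & (ALL i:Nd. sg (sg (sg i)) = i))"
 by (cases rule: aut_cases) auto

lemma M_pos: "M > 0" and M_ge_2: "M >= 2" using M_cases by auto

lemma pow_nodes: "i : Nd ==> (sg ^^ r) i : Nd" by (induction r) (auto intro: aut_nodes)

lemma pow_M: "i : Nd ==> (sg ^^ M) i = i" using M_cases by (auto simp: numeral_2_eq_2 numeral_3_eq_3)

lemma sum_orbit:
 fixes f :: "nat => 'z::comm_monoid_add"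
 assumes "j : Nd"
 shows "(SUM r=1..M. f ((sg ^^ r) j)) = (if M = 2 then f j + f (sg j) else f j + f (sg j) + f (sg (sg j)))"
proof -
 from M_cases consider "M = 2" "sg (sg j) = j" | "M = 3" "sg (sg (sg j)) = j" using assms by blast
 thus ?thesis
 proof cases
  case 1
  have "{1..M} = {1, 2}" using 1 by auto
  thus ?thesis using 1 by (simp add: numeral_2_eq_2 add.commute)
 next
  case 2
  have "{1..M} = {1, 2, 3}" using 2 by auto
  thus ?thesis using 2 by (simp add: numeral_2_eq_2 numeral_3_eq_3 ac_simps)
 qed
qed

lemma pow_fixed: "sg i = i ==> (sg ^^ r) i = i" by (induction r) auto

lemma pow_eq_self:
 assumes "i : Nd" "sg i ~= i" "r : {1..M}"
 shows "(sg ^^ r) i = i \<longleftrightarrow> r = M"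
proof -
 from M_cases consider "M = 2" "sg (sg i) = i" | "M = 3" "sg (sg (sg i)) = i" using assms by blast
 thus ?thesis
 proof cases
  case 1
  hence "r = 1 | r = 2" using assms by auto
  thus ?thesis using 1 assms by (auto simp: numeral_2_eq_2)
 next
  case 2
  hence "r = 1 | r = 2 | r = 3" using assms by auto
  moreover have "sg (sg i) ~= i" using 2 assms(2) by metis
  ultimately show ?thesis using 2 assms by (auto simp: numeral_2_eq_2 numeral_3_eq_3)
 qed
qed

subsection \<open>Orbits\<close>

lemma rep_pow: "EX r. rep T i = (sg ^^ r) i" unfolding rep_def by (rule LeastI_ex) blast

lemma rep_le: "rep T i <= (sg ^^ r) i" unfolding rep_def by (rule Least_le) blast

lemma rep_le_self: "rep T i <= i" using rep_le[of i 0] by simp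

lemma rep_nodes: "i : Nd ==> rep T i : Nd" using rep_pow[of i] pow_nodes by metis

lemma rep_aut:
 assumes "i : Nd"
 shows "rep T (sg i) = rep T i"
proof (rule antisym)
 obtain r where r: "rep T i = (sg ^^ r) i" using rep_pow by blast
 have "(sg ^^ (r + (M - 1))) (sg i) = (sg ^^ r) ((sg ^^ Suc (M - 1)) i)"
  by (simp only: funpow_add funpow_Suc_right o_apply)
 also have "... = (sg ^^ r) i" using pow_M[OF assms] M_pos by simp
 finally show "rep T (sg i) <= rep T i" using rep_le[of "sg i" "r + (M - 1)"] r by simp
next
 obtain r where "rep T (sg i) = (sg ^^ r) (sg i)" using rep_pow by blast
 thus "rep T i <= rep T (sg i)" using rep_le[of i "Suc r"] unfolding funpow_Suc_right o_apply by simp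
qed

lemma rep_pow_eq: "i : Nd ==> rep T ((sg ^^ r) i) = rep T i" by (induction r) (auto simp: rep_aut pow_nodes)

lemma rep_rep: "i : Nd ==> rep T (rep T i) = rep T i" using rep_pow[of i] rep_pow_eq by metis

lemma reps_iff: "i : Rp \<longleftrightarrow> i : Nd & rep T i = i"
proof
 assume "i : Rp"
 then obtain j where "i = rep T j" "j : Nd" by (auto simp: reps_def)
 thus "i : Nd & rep T i = i" by (simp add: rep_nodes rep_rep)
next
 assume "i : Nd & rep T i = i"
 thus "i : Rp" unfolding reps_def by (metis imageI)
qed

lemma reps_no: "i : Rp ==> i : Nd"
 and rep_reps: "i : Rp ==> rep T i = i" by (simp_all add: reps_iff)

lemma rep_reps': "i : Nd ==> rep T i : Rp" by (simp add: reps_iff rep_nodes rep_rep)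

lemma finite_reps [simp]: "finite (Rp)" by (simp add: reps_def)

lemma pow_mod: "i : Nd ==> EX s:{1..M}. (sg ^^ r) i = (sg ^^ s) i"
proof (induction r)
 case 0
 thus ?case using pow_M[of i] M_pos by (intro bexI[of _ M]) auto
next
 case (Suc r)
 then obtain s where s: "s : {1..M}" "(sg ^^ r) i = (sg ^^ s) i" by blast
 show ?case
 proof (cases "s = M")
  case True
  hence "(sg ^^ Suc r) i = (sg ^^ 1) i" using s pow_M Suc by simp
  thus ?thesis using M_pos by (intro bexI[of _ 1]) auto
 next
  case False
  thus ?thesis using s by (intro bexI[of _ "Suc s"]) auto
 qed
qed

lemma rep_eq_iff:
 assumes "i : Nd" "j : Nd"
 shows "rep T i = rep T j \<longleftrightarrow> (EX s:{1..M}. i = (sg ^^ s) j)"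
proof
 assume eq: "rep T i = rep T j"
 obtain r where r: "rep T j = (sg ^^ r) j" using rep_pow by blast
 obtain r' where r': "rep T i = (sg ^^ r') i" using rep_pow by blast
 obtain t where t: "t : {1..M}" "(sg ^^ r') i = (sg ^^ t) i" using pow_mod assms by blast
 have "i = (sg ^^ (M - t)) ((sg ^^ t) i)"
  using pow_M[OF assms(1)] t(1) by (metis atLeastAtMost_iff funpow_add le_add_diff_inverse2 o_apply)
 also have "(sg ^^ t) i = (sg ^^ r) j" using t r r' eq by simp
 also have "(sg ^^ (M - t)) ((sg ^^ r) j) = (sg ^^ (M - t + r)) j" by (simp only: funpow_add o_apply)
 finally show "EX s:{1..M}. i = (sg ^^ s) j" using pow_mod[OF assms(2)] by metis
next
 assume "EX s:{1..M}. i = (sg ^^ s) j"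
 thus "rep T i = rep T j" using rep_pow_eq[OF assms(2)] by auto
qed

lemma rep_eq_iff3:
 assumes "i : Nd" "j : Nd"
 shows "rep T i = rep T j \<longleftrightarrow> i = j | i = sg j | i = sg (sg j)"
proof
 assume "rep T i = rep T j"
 then obtain s where s: "s : {1..M}" "i = (sg ^^ s) j" using rep_eq_iff[OF assms] by blast
 have "s = 1 | s = 2 | s = 3 & M = 3" using s M_cases by auto
 thus "i = j | i = sg j | i = sg (sg j)" using s pow_M[OF assms(2)] by (auto simp: numeral_2_eq_2)
next
 assume "i = j | i = sg j | i = sg (sg j)"
 thus "rep T i = rep T j" using rep_aut assms aut_nodes by auto
qed

lemma pow_reps: "i : Rp ==> j : Rp ==> (sg ^^ r) i = j ==> i = j"
 using rep_pow_eq reps_iff by metis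

abbreviation "stab == %i. int (stab_num T i)"

text \<open>Orbit-stabilizer: as \<open>r\<close> runs through \<open>1..M\<close>, the orbit of
  \<open>j\<close> is run through \<open>stab j\<close> times, because \<open>M\<close> is 2 or 3
  and an orbit has one or \<open>M\<close> elements.\<close>

lemma orbit_sum:
 fixes G :: "nat => int"
 assumes j: "j : Nd"
 shows "stab j * (\<Sum>l | l : Nd & rep T l = rep T j. G l) = (SUM r=1..M. G ((sg ^^ r) j))"
proof -
 have S: "{l. l : Nd & rep T l = rep T j} = (%r. (sg ^^ r) j) ` {1..M}"
  using rep_eq_iff[OF _ j] pow_nodes[OF j] by blast
 show ?thesis
 proof (cases "sg j = j")
  case True
  hence "{l. l : Nd & rep T l = rep T j} = {j}" unfolding S using M_pos by (simp add: pow_fixed image_constant_conv)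
  thus ?thesis using True by (simp add: stab_num_def pow_fixed)
 next
  case False
  have "inj_on (%r. (sg ^^ r) j) {1..M}"
  proof (rule linorder_inj_onI)
  fix r s assume rs: "r < s" "r : {1..M}" "s : {1..M}"
  show "(sg ^^ r) j ~= (sg ^^ s) j"
  proof
  assume eq: "(sg ^^ r) j = (sg ^^ s) j"
  have "(sg ^^ (M - r + s)) j = (sg ^^ (M - r)) ((sg ^^ r) j)" by (simp add: funpow_add eq)
  also have "... = j" using pow_M[OF j] rs(2) by (metis atLeastAtMost_iff funpow_add le_add_diff_inverse2 o_apply)
  finally have "(sg ^^ (M - r + s)) j = j" .
  moreover have "M - r + s = (s - r) + M" using rs by auto
  ultimately have "(sg ^^ (s - r)) ((sg ^^ M) j) = j" by (simp add: funpow_add)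
  hence "(sg ^^ (s - r)) j = j" using pow_M[OF j] by simp
  moreover have "s - r : {1..M}" "s - r ~= M" using rs by auto
  ultimately show False using pow_eq_self[OF j False] by blast
  qed
  qed auto
  thus ?thesis unfolding S using False by (simp add: sum.reindex stab_num_def)
 qed
qed

text \<open>Folding backwards: on a vector constant on orbits, \<open>csum\<close> becomes the
  ordinary Cartan matrix after weighting with the stabilizers. Equations for \<open>csum\<close> can
  thus be solved on the finite diagram.\<close>

lemma sum_nodes_reps:
 fixes m :: "nat => int"
 assumes "!!i. i : Nd ==> m (sg i) = m i"
 shows "(SUM l:Nd. cart T i l * (stab l * m l)) = (SUM j:Rp. csum T i j * m j)"
proof -
 have inv: "m ((sg ^^ r) j) = m j & stab ((sg ^^ r) j) = stab j" if "j : Nd" for j r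
 proof (induction r)
  case (Suc r)
  have "sg (sg ((sg ^^ r) j)) = sg ((sg ^^ r) j) \<longleftrightarrow> sg ((sg ^^ r) j) = (sg ^^ r) j"
  using aut_inj pow_nodes[OF that] aut_nodes by simp
  thus ?case using Suc assms pow_nodes[OF that] by (simp add: stab_num_def)
 qed simp
 have inv': "m l = m j & stab l = stab j" if "l : Nd" "j : Nd" "rep T l = rep T j" for l j
  using rep_eq_iff[OF that(1,2)] that inv[OF that(2)] by auto
 have "(SUM l:Nd. cart T i l * (stab l * m l)) =
  (SUM j:Rp. \<Sum>l | l : Nd & rep T l = j. cart T i l * (stab l * m l))"
  unfolding reps_def by (rule sum.image_gen) simp
 also have "... = (SUM j:Rp. csum T i j * m j)"
 proof (intro sum.cong refl)
  fix j assume j: "j : Rp"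
  have "(\<Sum>l | l : Nd & rep T l = j. cart T i l * (stab l * m l)) =
  (\<Sum>l | l : Nd & rep T l = j. cart T i l * (stab j * m j))"
  proof (intro sum.cong refl)
  fix l assume "l : {l. l : Nd & rep T l = j}"
  thus "cart T i l * (stab l * m l) = cart T i l * (stab j * m j)" using inv'[of l j] reps_no[OF j] rep_reps[OF j] by simp
  qed
  also have "... = (stab j * (\<Sum>l | l : Nd & rep T l = rep T j. cart T i l)) * m j"
  using rep_reps[OF j] by (simp add: sum_distrib_left sum_distrib_right mult_ac)
  also have "... = csum T i j * m j" by (subst orbit_sum[OF reps_no[OF j]]) (simp add: csum_def)
  finally show "(\<Sum>l | l : Nd & rep T l = j. cart T i l * (stab l * m l)) = csum T i j * m j" .
 qed
 finally show ?thesis .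
qed

lemma csum_expand:
 assumes "j : Nd"
 shows "csum T i j = (if M = 2 then cart T i j + cart T i (sg j) else cart T i j + cart T i (sg j) + cart T i (sg (sg j)))"
 unfolding csum_def by (rule sum_orbit[OF assms])

lemma csum_sym:
 assumes i: "i : Nd" and j: "j : Nd"
 shows "csum T i j = csum T j i"
proof -
 from M_cases consider "M = 2" "!!i. i : Nd ==> sg (sg i) = i"
  | "M = 3" "!!i. i : Nd ==> sg (sg (sg i)) = i" by blast
 thus ?thesis
 proof cases
  case 1
  have "cart T i (sg j) = cart T (sg i) j" using aut_cart[of i "sg j"] aut_nodes 1(2) i j by simp
  thus ?thesis using 1(1) by (simp add: csum_expand i j cartan_sym[of _ i] cartan_sym[of _ "sg i"])
 next
  case 2
  have "cart T i (sg j) = cart T (sg (sg i)) j" "cart T i (sg (sg j)) = cart T (sg i) j"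
  using aut_cart[of i "sg j"] aut_cart[of "sg i" "sg (sg j)"] aut_cart[of i "sg (sg j)"] aut_nodes 2(2) i j
  by simp_all
  thus ?thesis using 2(1) by (simp add: csum_expand i j cartan_sym[of _ j])
 qed
qed

lemma csum_nonpos:
 assumes "i : Rp" "j : Rp" "i ~= j"
 shows "csum T i j <= 0" unfolding csum_def
proof (intro sum_nonpos)
 fix r
 have "i ~= (sg ^^ r) j" using pow_reps[OF assms(2,1)] assms(3) by auto
 thus "cart T i ((sg ^^ r) j) <= 0" using cartan_cases[of i "(sg ^^ r) j" "dtype T"] by auto
qed

text \<open>The coroot sum, summed over \<sigma>, is carried to the folded matrix by dividing by the
  stabilizer; an extra factor \<open>M\<close> keeps the entries integral. The vector yields
  nondegeneracy of \<open>csum\<close> and, later, a height function on weights.\<close>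

lemma ex_height_vector:
 "EX y :: nat => int. EX c > 0. ALL i:Rp. y i > 0 & (SUM j:Rp. csum T i j * y j) = c"
proof -
 obtain f :: "nat => int" where f: "!!i. i : Nd ==> f i > 0"
  "!!i. i : Nd ==> (SUM l:Nd. cart T i l * f l) = 2"
  using ex_two_rho[OF valid] unfolding nodes_def by metis
 define g where "g l = (SUM r=1..M. f ((sg ^^ r) l))" for l
 define m where "m l = (if sg l = l then g l else int M * g l)" for l
 have ginv: "g (sg l) = g l" if "l : Nd" for l unfolding g_def sum_orbit[OF that] sum_orbit[OF aut_nodes[OF that]]
  using M_cases that by (auto simp: ac_simps)
 have minv: "m (sg i) = m i" if "i : Nd" for i
  using ginv[OF that] aut_inj[of "sg i" i] aut_nodes that by (simp add: m_def)
 have sm: "stab l * m l = int M * g l" for l by (simp add: m_def stab_num_def)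
 have gpos: "g l > 0" if "l : Nd" for l unfolding g_def using f(1) pow_nodes[OF that] M_pos by (intro sum_pos) auto
 have powbij: "bij_betw (sg ^^ r) (Nd) (Nd)" for r
  by (induction r) (simp_all add: bij_betw_trans[OF _ bij_aut, unfolded o_def] o_def flip: id_def)
 have powcart: "cart T ((sg ^^ r) i) ((sg ^^ r) l) = cart T i l" if "i : Nd" "l : Nd" for i l r
  by (induction r) (simp_all add: aut_cart pow_nodes that)
 have "(SUM j:Rp. csum T i j * m j) = 2 * int M * int M" if i: "i : Nd" for i
 proof -
  have "(SUM j:Rp. csum T i j * m j) = (SUM l:Nd. cart T i l * (stab l * m l))"
  by (rule sum_nodes_reps[symmetric]) (rule minv)
  also have "... = int M * (SUM l:Nd. cart T i l * g l)" unfolding sm by (simp add: sum_distrib_left mult.left_commute)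
  also have "(SUM l:Nd. cart T i l * g l) = (SUM r=1..M. SUM l:Nd. cart T i l * f ((sg ^^ r) l))"
  unfolding g_def sum_distrib_left by (rule sum.swap)
  also have "... = (SUM r=1..M. 2)"
  proof (intro sum.cong refl)
  fix r
  have "(SUM l:Nd. cart T i l * f ((sg ^^ r) l)) =
  (SUM l:Nd. cart T ((sg ^^ r) i) ((sg ^^ r) l) * f ((sg ^^ r) l))"
  using powcart[OF i] by (intro sum.cong) auto
  also have "... = (SUM l:Nd. cart T ((sg ^^ r) i) l * f l)" by (rule sum.reindex_bij_betw[OF powbij])
  finally show "(SUM l:Nd. cart T i l * f ((sg ^^ r) l)) = 2" using f(2) pow_nodes[OF i] by simp
  qed
  finally show ?thesis by simp
 qed
 moreover have "m l > 0" if "l : Nd" for l using gpos[OF that] M_pos by (simp add: m_def)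
 ultimately show ?thesis using M_pos reps_no by (intro exI[of _ m] exI[of _ "2 * int M * int M"]) auto
qed

text \<open>On the height vector the row of \<open>i\<close> has a positive total, to which only the
  diagonal term can contribute positively.\<close>

lemma csum_pos: "i : Rp ==> csum T i i > 0"
proof -
 assume i: "i : Rp"
 obtain y c where y: "c > 0" "!!i. i : Rp ==> y i > 0" "(SUM j:Rp. csum T i j * y j) = c"
  using ex_height_vector i by blast
 have "(SUM j:Rp. csum T i j * y j) = csum T i i * y i + (SUM j:Rp - {i}. csum T i j * y j)"
  using i by (simp add: sum.remove)
 moreover have "(SUM j:Rp - {i}. csum T i j * y j) <= 0"
  using y(2) csum_nonpos[OF i] by (intro sum_nonpos mult_nonpos_nonneg) (auto intro: less_imp_le)
 ultimately have "csum T i i * y i > 0" using y by simp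
 thus ?thesis using y(2)[OF i] by (simp add: zero_less_mult_iff)
qed

text \<open>A matrix with nonpositive off-diagonal entries is nonsingular if it maps some positive vector
  to a positive vector: look at an index where the ratio of the two vectors is maximal.\<close>

lemma csum_nondeg:
 fixes be :: "nat => int"
 assumes z: "!!j. j : Rp ==> (SUM i:Rp. be i * csum T i j) = 0" and i: "i : Rp"
 shows "be i = 0"
proof -
 obtain y c where y: "c > 0" "!!i. i : Rp ==> y i > (0::int)"
  "!!i. i : Rp ==> (SUM j:Rp. csum T i j * y j) = c" using ex_height_vector by blast
 have le0: "be i <= 0" if i: "i : Rp" and z: "!!j. j : Rp ==> (SUM i:Rp. be i * csum T i j) = 0"
  for i and be :: "nat => int"
 proof (rule ccontr)
  assume pos: "~ be i <= 0"
  let ?t = "%i. of_int (be i) / of_int (y i) :: real"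
  obtain j where j: "j : Rp" "!!l. l : Rp ==> ?t l <= ?t j"
  proof -
  have "Max (?t ` Rp) : ?t ` Rp" using i by (intro Max_in) auto
  then obtain j where "j : Rp" "?t j = Max (?t ` Rp)" by auto
  moreover have "?t l <= Max (?t ` Rp)" if "l : Rp" for l using that by (intro Max_ge) auto
  ultimately show thesis using that[of j] by simp
  qed
  have "?t i > 0" using pos y(2)[OF i] by simp
  hence tj: "?t j > 0" using j(2)[OF i] by linarith
  have le: "be l * y j <= be j * y l" if "l : Rp" for l
  proof -
  have "of_int (be l * y j) <= (of_int (be j * y l) :: real)"
  using j(2)[OF that] y(2)[OF that] y(2)[OF j(1)] by (simp add: field_simps)
  thus ?thesis by (simp only: of_int_le_iff)
  qed
  have "0 = y j * (SUM i:Rp. be i * csum T i j)" using z[OF j(1)] by simp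
  also have "... = (SUM l:Rp. (be l * y j) * csum T j l)"
  using csum_sym reps_no j(1) by (auto simp: sum_distrib_left mult_ac intro!: sum.cong)
  also have "... >= (SUM l:Rp. (be j * y l) * csum T j l)"
  proof (intro sum_mono)
  fix l assume l: "l : Rp"
  show "be j * y l * csum T j l <= be l * y j * csum T j l"
  using le[OF l] csum_nonpos[OF j(1) l] by (cases "j = l") (auto intro: mult_right_mono_neg)
  qed
  also have "(SUM l:Rp. (be j * y l) * csum T j l) = be j * c"
  unfolding y(3)[OF j(1), symmetric] by (simp add: sum_distrib_left mult_ac)
  finally have "be j * c <= 0" .
  moreover have "be j > 0" using tj y(2)[OF j(1)] by (simp add: zero_less_divide_iff)
  ultimately show False using y(1) by (simp add: mult_le_0_iff)
 qed
 have "- be i <= 0" using le0[OF i, of "%i. - be i"] z by (simp add: sum_negf)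
 thus ?thesis using le0[OF i z] by simp
qed

lemma csum_fixed:
 assumes i: "i : Nd" "sg i = i" and that: "j : Nd"
 shows "csum T i j = int M * cart T i j"
proof -
 have "cart T i (sg j) = cart T i j" if "j : Nd" for j using aut_cart[of i j] i that by simp
 thus ?thesis using M_cases that aut_nodes by (auto simp: csum_expand)
qed

lemma csum_diag_fixed: "i : Nd ==> sg i = i ==> csum T i i = 2 * int M" by (simp add: csum_fixed)

lemma csum_diag_moved:
 assumes i: "i : Rp" "sg i ~= i"
 shows "csum T i i = 1 | csum T i i = 2"
proof -
 note n = reps_no[OF i(1)]
 from M_cases consider "M = 2" | "M = 3" "sg (sg (sg i)) = i" using n by blast
 thus ?thesis
 proof cases
  case 1
  thus ?thesis using cartan_cases[of i "sg i" "dtype T"] i(2) by (auto simp: csum_expand n)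
 next
  case 2
  have "cart T i (sg (sg i)) = cart T (sg i) i" using aut_cart[of i "sg (sg i)"] aut_nodes n 2(2) by simp
  \<comment> \<open>Both off-diagonal terms are equal; the value -1 would give 2 - 2 = 0, against
    \<open>csum_pos\<close>.\<close>
  thus ?thesis using cartan_cases[of i "sg i" "dtype T"] i(2) csum_pos[OF i(1)] 2(1)
  by (auto simp: csum_expand n cartan_sym[of "dtype T" "sg i"])
 qed
qed

lemma csum_dvd:
 assumes "i : Rp" "j : Nd"
 shows "csum T i i dvd 2 * csum T i j"
proof (cases "sg i = i")
 case True
 thus ?thesis using assms reps_no by (simp add: csum_fixed)
next
 case False
 thus ?thesis using csum_diag_moved[OF assms(1)] by auto
qed

end

lemma cartan_TD4_adj:
 "cartan (TD 4) i j = -1 \<longleftrightarrow> i = 2 & j : {1, 3, 4} | j = 2 & i : {1, 3, 4}"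
 using TD_nbr[of 0 i j] by (auto simp: numeral_2_eq_2 numeral_3_eq_3 le_Suc_eq)

lemma sum_cartan_TD4:
 fixes f :: "nat => int"
 shows "b : {1, 3, 4} ==> (SUM l:insert 2 {1, 3, 4}. cartan (TD 4) b l * f l) = 2 * f b - f 2"
  and "(SUM l:insert 2 {1, 3, 4}. cartan (TD 4) 2 l * f l) = 2 * f 2 - (SUM l:{1, 3, 4}. f l)"
proof -
 show "(SUM l:insert 2 {1, 3, 4}. cartan (TD 4) b l * f l) = 2 * f b - f 2" if "b : {1, 3, 4}"
  using that by (subst sum_nbrs[where N = "{2}"]) (auto simp: cartan_TD4_adj)
 show "(SUM l:insert 2 {1, 3, 4}. cartan (TD 4) 2 l * f l) = 2 * f 2 - (SUM l:{1, 3, 4}. f l)"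
  by (subst sum_nbrs[where N = "{1, 3, 4}"]) (auto simp: cartan_TD4_adj)
qed

context twisted
begin

section \<open>Kac labels of the twisted affine diagrams\<close>

definition "aff_t = max (d2 T Eps) (d2 T (Orb (aff_nbr T)))"

text \<open>The Kac labels pulled back to the nodes of the finite diagram. Weighted by the
  stabilizers they are sent by the Cartan matrix to a vector supported on the orbit joined to
  \<epsilon>; the identity for \<open>m (aff_nbr T) * aff_t\<close> is the equation at \<epsilon>
  itself. The divisibilities make \<open>aff_cartan\<close> exact at that edge.\<close>

definition aff_labels :: "(nat => int) => bool" where
 "aff_labels m \<longleftrightarrow> (ALL i:Nd. m i > 0 & m (sg i) = m i) & aff_nbr T : Rp &
  (ALL b:Nd. 2 * (SUM l:Nd. cart T b l * (stab l * m l)) = (if rep T b = aff_nbr T then aff_t else 0)) &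
  m (aff_nbr T) * aff_t = 2 * d2 T Eps & d2 T Eps dvd aff_t & d2 T (Orb (aff_nbr T)) dvd aff_t"

lemma node1_rep: "1 : Nd ==> rep T 1 = 1" using rep_nodes[of 1] rep_le_self[of 1] by (auto simp: nodes_def)

lemma rep_fixed: "sg i = i ==> rep T i = i" using rep_pow[of i] by (auto simp: pow_fixed)

lemma stab_moved: "sg i ~= i ==> stab i = 1" by (simp add: stab_num_def)

text \<open>The witness is the constant 2 for \<open>A\<close> of even rank and the constant 1 for
  \<open>D\<close> with an involution; the remaining types need the varying vectors
  \<open>mu\<close>.\<close>

lemma affine_labels_exist: "EX m. aff_labels m"
proof (cases rule: aut_cases)
 case (A m)
 have N: "Nd = {1..m}" using A(1) by (simp add: nodes_def)
 have sq: "sg (sg i) = i" if "i : {1..m}" for i using A(4) that N by blast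
 note M2 = A(5)
 have n1: "1 : Nd" using A(2) by (simp add: N)
 show ?thesis
 proof (cases "even m")
  case True
  have mv: "sg l ~= l" if "l : {1..m}" for l
  proof
  assume "sg l = l"
  hence "m + 1 = 2 * l" using A(3)[OF that] that by auto
  thus False using True by presburger
  qed
  have nbr: "aff_nbr T = 1" using A(1) True by (simp add: aff_nbr_def)
  have r1: "1 : Rp" using n1 node1_rep by (simp add: reps_iff)
  have e: "d2 T Eps = 4" using A(1) True by simp
  have d: "d2 T (Orb 1) = 1 | d2 T (Orb 1) = 2" using csum_diag_moved[OF r1] mv n1 N by auto
  have t: "aff_t = 4" using e d by (auto simp: aff_t_def nbr)
  have st: "stab l = 1" if "l : {1..m}" for l using mv[OF that] by (rule stab_moved)
  have "2 * (SUM l:Nd. cart T b l * (stab l * 2)) = (if rep T b = 1 then 4 else 0)" if b: "b : {1..m}" for b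
  proof -
  have "(SUM l:Nd. cart T b l * (stab l * 2)) = (SUM l:{1..m}. cartan (TA m) b l * 2)"
  unfolding N A(1) using st by (intro sum.cong) auto
  moreover have "rep T b = 1 \<longleftrightarrow> b = 1 | b = m"
  using rep_eq_iff3[of b 1] node1_rep[OF n1] n1 b sq[of 1] A(3)[of 1] by (auto simp: N)
  moreover have "(SUM l:{1..m}. cartan (TA m) b l * 2) = (if b = 1 | b = m then 2 else 0)"
  using sum_TA[OF b, of "%_. 2"] A(2) by auto
  ultimately show ?thesis by simp
  qed
  hence "aff_labels (%_. 2)" unfolding aff_labels_def nbr t e using r1 d by (auto simp: N)
  thus ?thesis by blast
 next
  case False
  hence m3: "m >= 3" using A(2) by (cases "m = 2") auto
  have fx: "sg l = l \<longleftrightarrow> 2 * l = m + 1" if "l : {1..m}" for l using A(3)[OF that] that by auto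
  have nbr: "aff_nbr T = 2" using A(1) False by (simp add: aff_nbr_def)
  have n2: "2 : Nd" using m3 by (simp add: N)
  have s2: "sg 2 = m - 1" using A(3)[of 2] m3 by simp
  have r2: "rep T 2 = 2"
  proof -
  have "rep T (rep T 2) = rep T 2" by (rule rep_rep[OF n2])
  hence "rep T 2 = 2 | rep T 2 = m - 1" using rep_eq_iff3[OF rep_nodes[OF n2] n2] s2 sq[of 2] m3 by auto
  thus ?thesis using rep_le_self[of 2] m3 by auto
  qed
  have rr: "2 : Rp" using n2 r2 by (simp add: reps_iff)
  have e: "d2 T Eps = 2" using A(1) False by simp
  define f where "f l = (if l = 1 | l = m then 1 else 2 :: int)" for l
  \<comment> \<open>The middle node is the only fixed one, and its stabilizer 2 turns the label 1
    into the entry 2 of \<open>f\<close>.\<close>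
  define mu where "mu l = (if l = 1 | l = m | 2 * l = m + 1 then 1 else 2 :: int)" for l
  have st: "stab l * mu l = f l" if "l : {1..m}" for l using fx[OF that] that m3 M2 by (auto simp: stab_num_def mu_def f_def)
  have d: "d2 T (Orb 2) = (if m = 3 then 4 else 1) | d2 T (Orb 2) = (if m = 3 then 4 else 2)"
  using csum_diag_moved[OF rr] csum_diag_fixed[OF n2] fx[of 2] m3 M2 False by (auto split: if_splits)
  have t: "aff_t = (if m = 3 then 4 else 2)" using e d by (auto simp: aff_t_def nbr)
  have "2 * (SUM l:Nd. cart T b l * (stab l * mu l)) = (if rep T b = 2 then aff_t else 0)" if b: "b : {1..m}" for b
  proof -
  have "(SUM l:Nd. cart T b l * (stab l * mu l)) = (SUM l:{1..m}. cartan (TA m) b l * f l)"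
  unfolding N A(1) using st by (intro sum.cong) auto
  moreover have "rep T b = 2 \<longleftrightarrow> b = 2 | b = m - 1"
  using rep_eq_iff3[of b 2] r2 n2 b sq[of 2] s2 m3 by (auto simp: N)
  moreover have "m ~= 4" using False by auto
  hence "(SUM l:{1..m}. cartan (TA m) b l * f l) = (if b = 2 | b = m - 1 then if m = 3 then 2 else 1 else 0)"
  unfolding f_def by (rule sum_cartan_TA_12[OF m3 _ b])
  ultimately show ?thesis by (simp add: t)
  qed
  moreover have "mu l > 0 & mu (sg l) = mu l" if "l : {1..m}" for l
  using A(3)[OF that] that by (auto simp: mu_def)
  moreover have "mu 2 * aff_t = 4" using m3 by (auto simp: mu_def t)
  moreover have "d2 T (Orb 2) dvd aff_t" "(2::int) dvd aff_t" using d by (auto simp: t)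
  ultimately have "aff_labels mu" unfolding aff_labels_def nbr e using rr by (simp add: N)
  thus ?thesis by blast
 qed
next
 case (D k)
 have N: "Nd = {1..k + 4}" using D(1) by (simp add: nodes_def)
 note M2 = D(7)
 have C: "cart T = cartan (TD (k + 4))" using D(1) by simp
 have two: "card S ~= 1" if "x : S" "y : S" "x ~= y" for S and x y :: nat
  using that by (metis card_1_singletonE singletonD)
 have nbr: "aff_nbr T = 1"
 proof -
  have "(THE i. i : Nd & sg i = i & card {j : Nd. cart T i j = -1} = 1) = 1"
  proof (rule the_equality)
  have "{j : Nd. cart T 1 j = -1} = {2}" using D(2) unfolding C N TD_nbr by auto
  thus "1 : Nd & sg 1 = 1 & card {j : Nd. cart T 1 j = -1} = 1" using D(5)[of 1] by (simp add: N)
  next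
  fix i assume i: "i : Nd & sg i = i & card {j : Nd. cart T i j = -1} = 1"
  hence "i <= k + 2" using D(3,4) by (cases "i = k + 3 | i = k + 4") (auto simp: N)
  moreover have False if "1 < i" "i <= k + 2"
  proof -
  have "i - 1 : {j : Nd. cart T i j = -1}" "i + 1 : {j : Nd. cart T i j = -1}"
  using that unfolding C N TD_nbr by auto
  hence "card {j : Nd. cart T i j = -1} ~= 1" by (rule two) simp
  thus False using i by blast
  qed
  ultimately show "i = 1" using i by (cases "i = 1") (auto simp: N)
  qed
  thus ?thesis using D(1) M2 by (simp add: aff_nbr_def)
 qed
 have s1: "sg 1 = 1" using D(5)[of 1] by simp
 have n1: "1 : Nd" by (simp add: N)
 have r1: "1 : Rp" using n1 node1_rep by (simp add: reps_iff)
 have e: "d2 T Eps = 2" using D(1) by simp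
 have d: "d2 T (Orb 1) = 4" using csum_diag_fixed[OF n1 s1] M2 by simp
 have t: "aff_t = 4" using e d by (simp add: aff_t_def nbr)
 define f where "f l = (if l <= k + 2 then 2 else 1 :: int)" for l
 have st: "stab l = f l" if "l : {1..k + 4}" for l
 proof -
  have "1 <= l & l <= k + 2 | l = k + 3 | l = k + 4" using that by auto
  thus ?thesis using D(3,4) D(5)[of l] M2 by (auto simp: stab_num_def f_def)
 qed
 have "2 * (SUM l:Nd. cart T b l * (stab l * 1)) = (if rep T b = 1 then 4 else 0)" if b: "b : {1..k + 4}" for b
 proof -
  have "(SUM l:Nd. cart T b l * (stab l * 1)) = (SUM l:{1..k + 4}. cartan (TD (k + 4)) b l * f l)"
  unfolding N C using st by (intro sum.cong) auto
  moreover have "rep T b = 1 \<longleftrightarrow> b = 1" using rep_eq_iff3[of b 1] node1_rep[OF n1] n1 b s1 by (auto simp: N)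
  moreover have "(SUM l:{1..k + 4}. cartan (TD (k + 4)) b l * f l) = (if b = 1 then 2 else 0)"
  unfolding sum_TD[OF b] using b by (auto simp: f_def)
  ultimately show ?thesis by simp
 qed
 hence "aff_labels (%_. 1)" unfolding aff_labels_def nbr t e d using r1 by (auto simp: N)
 thus ?thesis by blast
next
 case (D4 l a b)
 note [simp del] = One_nat_def
 have N: "Nd = insert 2 {1, 3, 4}" using D4(1) by (rule nodes_TD4)
 have l: "l : {1, 3, 4}" "a : {1, 3, 4}" "b : {1, 3, 4}" using D4(2) by blast+
 have C: "cart T = cartan (TD 4)" using D4(1) by simp
 note M2 = D4(11)
 have nbr: "aff_nbr T = l"
 proof -
  have "(THE i. i : Nd & sg i = i & card {j : Nd. cart T i j = -1} = 1) = l"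
  proof (rule the_equality)
  have "{j : Nd. cart T l j = -1} = {2}" using l unfolding C N cartan_TD4_adj by auto
  thus "l : Nd & sg l = l & card {j : Nd. cart T l j = -1} = 1" using D4(7) l by (simp add: N)
  next
  fix i assume i: "i : Nd & sg i = i & card {j : Nd. cart T i j = -1} = 1"
  have "i ~= 2"
  proof
  assume "i = 2"
  hence "{j : Nd. cart T i j = -1} = {1, 3, 4}" unfolding C N cartan_TD4_adj by auto
  thus False using i by simp
  qed
  moreover have "i ~= a" "i ~= b" using i D4(5,8,9) by auto
  moreover have "i = 2 | i = l | i = a | i = b" using i unfolding N D4(2)[symmetric] by blast
  ultimately show "i = l" by blast
  qed
  thus ?thesis using D4(1) M2 by (simp add: aff_nbr_def)
 qed
 have nl: "l : Nd" using l by (simp add: N)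
 have rl: "l : Rp" using nl rep_fixed[OF D4(7)] by (simp add: reps_iff)
 have e: "d2 T Eps = 2" using D4(1) by simp
 have d: "d2 T (Orb l) = 4" using csum_diag_fixed[OF nl D4(7)] M2 by simp
 have t: "aff_t = 4" using e d by (simp add: aff_t_def nbr)
 have st: "stab 2 = 2" "stab l = 2" "stab a = 1" "stab b = 1" using D4(5-9) M2 by (simp_all add: stab_num_def)
 have "2 * (SUM i:Nd. cart T c i * (stab i * 1)) = (if rep T c = l then 4 else 0)" if c: "c : Nd" for c
 proof -
  have "rep T c = l \<longleftrightarrow> c = l" using rep_eq_iff3[OF c nl] rep_fixed[OF D4(7)] D4(7) by auto
  moreover have "c = 2 | c : {l, a, b}" using c unfolding N D4(2) by blast
  hence "(SUM i:Nd. cart T c i * stab i) = (if c = l then 2 else 0)"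
  proof
  assume 2: "c = 2"
  have "(SUM i:{1, 3, 4}. stab i) = 4" unfolding D4(2)[symmetric] using D4(3-5) st by simp
  thus ?thesis unfolding 2 C N sum_cartan_TD4(2) using st l by auto
  next
  assume c: "c : {l, a, b}"
  show ?thesis unfolding C N sum_cartan_TD4(1)[OF c[unfolded D4(2)]] using c st D4(3,4) by auto
  qed
  ultimately show ?thesis by simp
 qed
 hence "aff_labels (%_. 1)" unfolding aff_labels_def nbr t e d using rl by auto
 thus ?thesis by blast
next
 case (D43 a b)
 note [simp del] = One_nat_def
 have N: "Nd = insert 2 {1, 3, 4}" using D43(1) by (rule nodes_TD4)
 have l: "a : {1, 3, 4}" "b : {1, 3, 4}" using D43(2) by blast+
 have C: "cart T = cartan (TD 4)" using D43(1) by simp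
 note M3 = D43(11)
 have nbr: "aff_nbr T = 1" using D43(1) M3 by (simp add: aff_nbr_def)
 have n1: "1 : Nd" by (simp add: N)
 have r1: "1 : Rp" using n1 node1_rep by (simp add: reps_iff)
 have e: "d2 T Eps = 2" using D43(1) by simp
 have d: "d2 T (Orb 1) = 1 | d2 T (Orb 1) = 2" using csum_diag_moved[OF r1] D43(3,7) by auto
 have t: "aff_t = 2" using e d by (auto simp: aff_t_def nbr)
 define mu where "mu i = (if i = 2 then 1 else 2 :: int)" for i :: nat
 have ne: "a ~= 2" "b ~= 2" using l by auto
 have st: "stab 2 * mu 2 = 3" "stab 1 * mu 1 = 2" "stab a * mu a = 2" "stab b * mu b = 2"
  using D43(3-9) ne M3 by (simp_all add: stab_num_def mu_def)
 have "2 * (SUM i:Nd. cart T c i * (stab i * mu i)) = (if rep T c = 1 then 2 else 0)" if c: "c : Nd" for c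
 proof -
  have "rep T c = 1 \<longleftrightarrow> c : {1, a, b}" using rep_eq_iff3[OF c n1] node1_rep[OF n1] D43(7,8) by auto
  moreover have "c = 2 | c : {1, a, b}" using c unfolding N D43(2) by blast
  hence "(SUM i:Nd. cart T c i * (stab i * mu i)) = (if c : {1, a, b} then 1 else 0)"
  proof
  assume 2: "c = 2"
  have "(SUM i:{1, 3, 4}. stab i * mu i) = 6" unfolding D43(2)[symmetric] using D43(3-5) st by simp
  thus ?thesis unfolding 2 C N sum_cartan_TD4(2) using st ne by auto
  next
  assume c: "c : {1, a, b}"
  show ?thesis unfolding C N sum_cartan_TD4(1)[OF c[unfolded D43(2)]] using c st by (auto simp: mult.commute)
  qed
  ultimately show ?thesis by simp
 qed
 moreover have "mu i > 0 & mu (sg i) = mu i" if "i : Nd" for i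
 proof -
  have "i = 2 | i : {1, a, b}" using that unfolding N D43(2) by blast
  thus ?thesis using D43(6-9) ne by (auto simp: mu_def)
 qed
 ultimately have "aff_labels mu" unfolding aff_labels_def nbr t e using r1 d by (auto simp: mu_def)
 thus ?thesis by blast
next
 case E
 note [simp del] = One_nat_def
 have N: "Nd = {1..6}" using E(1) by (auto simp: nodes_def)
 have N': "Nd = {1, 2, 3, 4, 5, 6}" using E(1) by (rule nodes_TE6)
 have C: "cart T = cartan TE6" using E(1) by simp
 note M2 = E(9)
 have nbr: "aff_nbr T = 1" using E(1) by (simp add: aff_nbr_def)
 have n1: "1 : Nd" by (simp add: N)
 have r1: "1 : Rp" using n1 node1_rep by (simp add: reps_iff)
 have e: "d2 T Eps = 2" using E(1) by simp
 have d: "d2 T (Orb 1) = 1 | d2 T (Orb 1) = 2" using csum_diag_moved[OF r1] E(2) by auto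
 have t: "aff_t = 2" using e d by (auto simp: aff_t_def nbr)
 \<comment> \<open>Weighted by the stabilizers this is (2, 2, 3, 4, 3, 2), the solution of the
   Cartan system whose right-hand side is 1 at the two ends 1 and 6 and 0 elsewhere.\<close>
 define mu where "mu i = (if i = 1 | i = 6 | i = 4 then 2 else if i = 2 then 1 else 3 :: int)" for i :: nat
 define f where "f i = stab i * mu i" for i
 have f: "f 1 = 2" "f 2 = 2" "f 3 = 3" "f 4 = 4" "f 5 = 3" "f 6 = 2" using E(2-7) M2 by (simp_all add: f_def stab_num_def mu_def)
 have "2 * (SUM i:Nd. cart T c i * f i) = (if rep T c = 1 then 2 else 0)" if c: "c : Nd" for c
 proof -
  have "rep T c = 1 \<longleftrightarrow> c = 1 | c = 6" using rep_eq_iff3[OF c n1] node1_rep[OF n1] E(2,3) by auto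
  moreover have "c = 1 | c = 2 | c = 3 | c = 4 | c = 5 | c = 6" using c unfolding N' by blast
  hence "(SUM i:Nd. cart T c i * f i) = (if c = 1 | c = 6 then 1 else 0)"
  unfolding C N by (elim disjE) (simp_all only: sum_cartan_TE6 f, simp_all)
  ultimately show ?thesis by simp
 qed
 moreover have "mu i > 0 & mu (sg i) = mu i" if "i : Nd" for i
 proof -
  have "i = 1 | i = 2 | i = 3 | i = 4 | i = 5 | i = 6" using that unfolding N' by blast
  thus ?thesis using E(2-7) by (elim disjE) (simp_all add: mu_def)
 qed
 ultimately have "aff_labels mu" unfolding aff_labels_def nbr t e f_def using r1 d by (auto simp: mu_def)
 thus ?thesis by blast
qed

lemma aff_nbr_reps: "aff_nbr T : Rp"
 and d2_Eps_dvd: "d2 T Eps dvd aff_t"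
 and d2_nbr_dvd: "d2 T (Orb (aff_nbr T)) dvd aff_t" using affine_labels_exist by (auto simp: aff_labels_def)

lemma d2_Eps_pos: "d2 T Eps > 0" by (simp split: dynkin.split)

lemma d2_pos: "a : An ==> d2 T a > 0" using d2_Eps_pos csum_pos by (auto simp: anodes_def)

lemma sym2_sym: "a : An ==> b : An ==> sym2 T a b = sym2 T b a"
 by (auto simp: anodes_def csum_sym reps_no)

lemma sym2_self: "a : An ==> sym2 T a a = 2 * d2 T a" by (auto simp: anodes_def)

lemma sym2_Eps: "j : Rp ==> sym2 T Eps (Orb j) = (if j = aff_nbr T then - aff_t else 0)"
 "j : Rp ==> sym2 T (Orb j) Eps = (if j = aff_nbr T then - aff_t else 0)" by (simp_all add: aff_t_def del: d2.simps)

lemma aff_t_pos: "aff_t > 0" using d2_Eps_pos unfolding aff_t_def by linarith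

lemma sym2_nonpos: "a : An ==> b : An ==> a ~= b ==> sym2 T a b <= 0"
 using aff_t_pos csum_nonpos by (auto simp: anodes_def sym2_Eps simp del: sym2.simps(3,4)) (meson order.trans)+

text \<open>This makes the integer division in \<open>aff_cartan\<close> exact.\<close>

lemma d2_dvd_sym2: "a : An ==> b : An ==> d2 T a dvd sym2 T a b"
 using d2_Eps_dvd d2_nbr_dvd csum_dvd reps_no by (auto simp: anodes_def sym2_Eps simp del: sym2.simps(3,4) d2.simps(2))

lemma d2_aff_cartan: "a : An ==> b : An ==> d2 T a * aff_cartan T a b = sym2 T a b"
 using d2_dvd_sym2 by (simp add: aff_cartan_def)

lemma aff_cartan_nonpos: "a : An ==> b : An ==> a ~= b ==> aff_cartan T a b <= 0"
 using d2_aff_cartan sym2_nonpos d2_pos by (metis mult_pos_pos not_le)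

lemma finite_anodes [simp]: "finite (An)" by (simp add: anodes_def)

lemma sum_anodes: "(SUM a:An. f a) = f Eps + (SUM j:Rp. f (Orb j))"
proof -
 have "(SUM a:An. f a) = f Eps + (SUM a:Orb ` Rp. f a)" unfolding anodes_def by (subst sum.insert) auto
 thus ?thesis by (simp add: sum.reindex inj_on_def)
qed

text \<open>\<open>kac_label\<close> is a definite description, so uniqueness is needed besides
  existence: two solutions agree at \<epsilon>, hence their difference lies in the kernel of the
  nondegenerate matrix \<open>csum\<close>.\<close>

lemma kac_label:
 "(ALL a. a : An \<longleftrightarrow> kac_label T a > 0) & kac_label T Eps = 1 &
  (ALL b:An. (SUM a:An. int (kac_label T a) * d2 T a * aff_cartan T a b) = 0)"
proof -
 define P where "P m \<longleftrightarrow> (ALL a. a : An \<longleftrightarrow> m a > 0) & m Eps = 1 &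
  (ALL b:An. (SUM a:An. int (m a) * d2 T a * aff_cartan T a b) = 0)" for m :: "anode => nat"
 have sym: "(SUM a:An. int (m a) * d2 T a * aff_cartan T a b) = (SUM a:An. int (m a) * sym2 T a b)"
  if "b : An" for m b using that by (intro sum.cong refl) (simp add: d2_aff_cartan mult.assoc)
 obtain m where m: "aff_labels m" using affine_labels_exist by blast
 define k where "k a = (case a of Eps => 1 | Orb j => if j : Rp then nat (m j) else 0)" for a
 have "P k" unfolding P_def
 proof (intro conjI allI ballI)
  fix a show "a : An \<longleftrightarrow> k a > 0"
  using m reps_no by (cases a) (auto simp: k_def anodes_def aff_labels_def)
  show "k Eps = 1" by (simp add: k_def)
 next
  fix b assume b: "b : An"
  have km: "int (k (Orb j)) = m j" if "j : Rp" for j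
  using that m reps_no[OF that] by (auto simp: k_def aff_labels_def order_le_less)
  have "(SUM a:An. int (k a) * sym2 T a b) = sym2 T Eps b + (SUM j:Rp. m j * sym2 T (Orb j) b)"
  unfolding sum_anodes using km by (simp add: k_def)
  also have "... = 0"
  proof (cases b)
  case Eps
  have "(SUM j:Rp. m j * sym2 T (Orb j) Eps) = (SUM j:Rp. if j = aff_nbr T then - (m (aff_nbr T) * aff_t) else 0)"
  by (intro sum.cong refl) (auto simp: sym2_Eps simp del: sym2.simps)
  thus ?thesis using m Eps aff_nbr_reps by (simp add: aff_labels_def del: sym2.simps(4) d2.simps)
  next
  case (Orb i)
  hence i: "i : Rp" using b by (auto simp: anodes_def)
  have "(SUM j:Rp. m j * sym2 T (Orb j) b) = 2 * (SUM j:Rp. csum T i j * m j)"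
  using Orb i csum_sym reps_no by (auto simp: sum_distrib_left mult_ac intro!: sum.cong)
  also have "(SUM j:Rp. csum T i j * m j) = (SUM l:Nd. cart T i l * (stab l * m l))"
  using m by (intro sum_nodes_reps[symmetric]) (auto simp: aff_labels_def)
  finally show ?thesis using m Orb i rep_reps[OF i] reps_no[OF i] by (simp add: aff_labels_def sym2_Eps del: sym2.simps)
  qed
  finally show "(SUM a:An. int (k a) * d2 T a * aff_cartan T a b) = 0" using sym[OF b] by simp
 qed
 moreover have "k' = k" if "P k'" for k'
 proof
  fix a
  define be where "be j = int (k' (Orb j)) - int (k (Orb j))" for j
  have "(SUM j:Rp. be j * csum T j i) = 0" if i: "i : Rp" for i
  proof -
  have b: "Orb i : An" using i by (simp add: anodes_def)
  have "(SUM a:An. int (k' a) * sym2 T a (Orb i)) - (SUM a:An. int (k a) * sym2 T a (Orb i)) = 0"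
  using `P k` `P k'` b unfolding sym[OF b, symmetric] P_def by simp
  hence "(SUM j:Rp. int (k' (Orb j)) * sym2 T (Orb j) (Orb i)) -
  (SUM j:Rp. int (k (Orb j)) * sym2 T (Orb j) (Orb i)) = 0"
  using `P k` `P k'` unfolding sum_anodes P_def by simp
  hence "(SUM j:Rp. be j * sym2 T (Orb j) (Orb i)) = 0"
  unfolding be_def by (simp only: left_diff_distrib sum_subtractf)
  moreover have "(SUM j:Rp. be j * sym2 T (Orb j) (Orb i)) = 2 * (SUM j:Rp. be j * csum T j i)"
  by (simp add: sum_distrib_left mult.left_commute)
  ultimately show ?thesis by simp
  qed
  hence "be j = 0" if "j : Rp" for j by (rule csum_nondeg) (use that in auto)
  hence orb: "k' (Orb j) = k (Orb j)" if "j : Rp" for j using that by (simp add: be_def)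
  have "k' Eps = k Eps" using `P k` `P k'` unfolding P_def by simp
  hence "k' a = k a" if "a : An" using that orb unfolding anodes_def by blast
  moreover have "k' a = k a" if "a ~: An"
  proof -
  have "~ k a > 0" "~ k' a > 0" using `P k` `P k'` that unfolding P_def by blast+
  thus ?thesis by simp
  qed
  ultimately show "k' a = k a" by blast
 qed
 ultimately have "(THE m. P m) = k" by (rule the_equality)
 hence "kac_label T = k" unfolding kac_label_def P_def .
 thus ?thesis using `P k` unfolding P_def by blast
qed

lemma kac_label_Eps [simp]: "kac_label T Eps = 1" using kac_label by blast

lemma sum_kac_sym2:
 assumes "b : An"
 shows "(SUM a:An. int (kac_label T a) * sym2 T a b) = 0"
proof -
 have "(SUM a:An. int (kac_label T a) * sym2 T a b) =
  (SUM a:An. int (kac_label T a) * d2 T a * aff_cartan T a b)"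
  using assms by (intro sum.cong refl) (simp add: d2_aff_cartan mult.assoc)
 thus ?thesis using kac_label assms by simp
qed

subsection \<open>Powers of the square root of \<open>q\<close>\<close>

abbreviation "s == sqrt_q T"

lemma s_nz [simp]: "s ~= 0" using qq_nz by (auto simp: qq_def)

lemma s_root: "n > 0 ==> s ^ n ~= 1"
proof
 assume "n > 0" "s ^ n = 1"
 hence "qq T ^ n = 1" by (simp add: qq_def power2_eq_square power_mult_distrib)
 thus False using qq_root `n > 0` by blast
qed

lemma s_powi_eq_1: "s powi n = 1 \<longleftrightarrow> n = 0"
proof
 assume eq: "s powi n = 1"
 show "n = 0"
 proof (rule ccontr)
  assume "n ~= 0"
  moreover have "s powi (- n) = 1" using eq by (simp add: power_int_minus)
  ultimately have "s ^ nat \<bar>n\<bar> = 1" using eq by (cases "n >= 0") (auto simp: power_int_def)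
  thus False using s_root[of "nat \<bar>n\<bar>"] `n ~= 0` by simp
 qed
qed simp

lemma s_powi_inj: "s powi m = s powi n \<longleftrightarrow> m = n"
proof
 assume "s powi m = s powi n"
 hence "s powi (m - n) = 1" by (simp add: power_int_diff)
 thus "m = n" by (simp add: s_powi_eq_1)
qed simp

lemma qn_inverse: "inverse (qn T a) = s powi (- d2 T a)" by (simp add: qn_def power_int_minus)

definition qd :: "anode => complex" where
 "qd a = qn T a - inverse (qn T a)"

lemma qd_nz: "a : An ==> qd a ~= 0"
 using d2_pos[of a] by (simp add: qd_def qn_inverse) (simp add: qn_def s_powi_inj)

lemma qn_powi_cartan: "a : An ==> b : An ==> qn T a powi aff_cartan T a b = s powi sym2 T a b"
 by (simp add: qn_def d2_aff_cartan flip: power_int_mult)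

lemma qi_diff: "i : Nd ==> qi T i - inverse (qi T i) = qd (Orb (rep T i))" by (simp add: qi_def qd_def)

lemma qq_powi: "qq T powi n = s powi (2 * n)" by (simp add: qq_def power_int_mult flip: power_int_numeral)

text \<open>The exponent of \<open>s\<close> picked up when \<open>k\<^sub>a\<close> passes the
  product of the \<open>e\<^sub>b\<close> over the letters \<open>b\<close> of \<open>u\<close>;
  equivalently, twice the symmetric form between the root of \<open>a\<close> and the weight of
  \<open>u\<close>.\<close>

definition cont :: "anode => anode list => int" where
 "cont a u = (SUM b<-u. sym2 T a b)"

lemma cont_simps [simp]: "cont a [] = 0" "cont a (b # u) = sym2 T a b + cont a u" by (simp_all add: cont_def)

end

section \<open>Quantum Serre elements\<close>

text \<open>The coefficient of \<open>z ^ r\<close> in the product of the factors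
  \<open>1 - x t * z\<close> over \<open>t < n\<close>.\<close>

primrec s_coef :: "(nat => complex) => nat => nat => complex" where
 "s_coef x 0 r = (if r = 0 then 1 else 0)"
| "s_coef x (Suc n) r = s_coef x n r - (if r = 0 then 0 else x n * s_coef x n (r - 1))"

lemma serre_coef_0: "n < r ==> s_coef x n r = 0" by (induction n arbitrary: r) auto

primrec qcomm :: "(nat => complex) => 'g free_alg => 'g free_alg => nat => 'g free_alg" where
 "qcomm x a b 0 = b"
| "qcomm x a b (Suc n) = a * qcomm x a b n - sc (x n) * (qcomm x a b n * a)"

lemma sc_lcomm: "a * (sc c * b) = sc c * (a * (b :: 'g free_alg))" by (metis mult.assoc sc_commute)

text \<open>Left and right multiplication by \<open>a\<close> commute, so the iterated skew
  commutator is a product of commuting operators, left multiplication minus \<open>x t\<close> times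
  right multiplication, and expands with the coefficients \<open>s_coef\<close>.\<close>

lemma qcomm_iter_expand:
 "qcomm x a b n = (SUM r<=n. sc (s_coef x n r) * a ^ (n - r) * b * a ^ r)"
proof (induction n)
 case (Suc n)
 let ?c = "s_coef x n"
 have "a * qcomm x a b n = (SUM r<=n. sc (?c r) * a ^ (Suc n - r) * b * a ^ r)" unfolding Suc sum_distrib_left
 proof (intro sum.cong refl)
  fix r assume "r : {..n}"
  hence "a ^ (Suc n - r) = a * a ^ (n - r)" by (simp add: Suc_diff_le)
  thus "a * (sc (?c r) * a ^ (n - r) * b * a ^ r) = sc (?c r) * a ^ (Suc n - r) * b * a ^ r"
  by (simp add: mult.assoc sc_lcomm)
 qed
 also have "... = (SUM r<=Suc n. sc (?c r) * a ^ (Suc n - r) * b * a ^ r)" by (simp add: serre_coef_0)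
 finally have 1: "a * qcomm x a b n = ..." .
 have "sc (x n) * (qcomm x a b n * a) = (SUM r<=n. sc (x n * ?c r) * a ^ (n - r) * b * a ^ Suc r)"
  unfolding Suc sum_distrib_left sum_distrib_right by (intro sum.cong refl) (simp only: sc_mult mult.assoc power_Suc2)
 also have "... = (SUM r<=Suc n. sc (if r = 0 then 0 else x n * ?c (r - 1)) * a ^ (Suc n - r) * b * a ^ r)"
  by (subst sum.atMost_Suc_shift) simp
 finally show ?case using 1 by (simp add: sc_diff left_diff_distrib sum_subtractf del: sum.atMost_Suc)
qed simp

lemma qbinom_Pascal:
 assumes nz: "!!k. k > 0 ==> qint p k ~= 0" and p: "p ~= 0" "p - inverse p ~= 0" and r: "1 <= r" "r <= n"
 shows "qbinom p (Suc n) r = p ^ r * qbinom p n r + inverse p ^ (Suc n - r) * qbinom p n (r - 1)"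
proof -
 have f: "qfact p k ~= 0" for k unfolding qfact_def using nz by (simp add: prod_zero_iff)
 have fS: "qfact p (Suc k) = qfact p k * qint p (Suc k)" for k by (simp add: qfact_def)
 obtain r' where r': "r = Suc r'" using r by (cases r) auto
 obtain m where m: "n = r' + Suc m" using r r' less_iff_Suc_add[of r' n] by auto
 have key: "qint p (Suc n) = p ^ r * qint p (Suc m) + inverse p ^ (Suc m) * qint p r"
 proof -
  have "p ^ r * (p ^ Suc m - inverse p ^ Suc m) + inverse p ^ Suc m * (p ^ r - inverse p ^ r)
  = p ^ (r + Suc m) - inverse p ^ (Suc m + r)" by (simp add: algebra_simps power_add)
  moreover have "r + Suc m = Suc n" using m r' by simp
  ultimately have "p ^ Suc n - inverse p ^ Suc n =
  p ^ r * (p ^ Suc m - inverse p ^ Suc m) + inverse p ^ Suc m * (p ^ r - inverse p ^ r)" by (simp add: add.commute)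
  thus ?thesis by (simp only: qint_def add_divide_distrib times_divide_eq_right)
 qed
 define X where "X = qfact p n / (qfact p r' * qfact p m)"
 have "qbinom p (Suc n) r = X * qint p (Suc n) / (qint p r * qint p (Suc m))" using m r' by (simp add: qbinom_def fS X_def)
 moreover have "qbinom p n r = X / qint p r" using m r' by (simp add: qbinom_def fS X_def)
 moreover have "qbinom p n (r - 1) = X / qint p (Suc m)" using m r' by (simp add: qbinom_def fS X_def)
 moreover have "Suc n - r = Suc m" using m r' by simp
 moreover have "X * (P * v + Q * u) / (u * v) = P * (X / u) + Q * (X / v)" if "u ~= 0" "v ~= 0" for P Q u v
  using that by (simp add: field_simps)
 ultimately show ?thesis using nz[of "Suc m"] nz[of r] r unfolding key by simp
qed

context twisted
begin

lemma s_powi_pow: "(s powi j) ^ k = s powi (j * int k)" by (simp add: power_int_mult)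

lemma qint_nz: "a : An ==> k > 0 ==> qint (qn T a) k ~= 0"
proof -
 assume a: "a : An" and k: "k > 0"
 have "qn T a ^ k = s powi (d2 T a * int k)" "inverse (qn T a) ^ k = s powi (- (d2 T a * int k))"
  by (simp_all add: qn_inverse s_powi_pow) (simp add: qn_def s_powi_pow)
 moreover have "d2 T a * int k ~= - (d2 T a * int k)" using d2_pos[OF a] k by simp
 ultimately show ?thesis using qd_nz[OF a] unfolding qint_def qd_def by (simp add: s_powi_inj)
qed

definition s_num :: "anode => anode => nat" where
 "s_num a b = nat (1 - aff_cartan T a b)"

definition serre_x :: "anode => anode => nat => complex" where
 "serre_x a b n = s powi (- (sym2 T a b + int n * sym2 T a a))"

text \<open>The quantum binomial theorem, by the quantum Pascal rule. The power of \<open>s\<close>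
  on the right becomes 1 at \<open>n = s_num a b\<close>, where its exponent vanishes by
  \<open>serre_num_rel\<close>.\<close>

lemma serre_coef_eq:
 assumes a: "a : An"
 shows "r <= n ==> s_coef (serre_x a b) n r =
  (-1) ^ r * qbinom (qn T a) n r * s powi (- (int r * (sym2 T a b + (int n - 1) * d2 T a)))"
proof (induction n arbitrary: r)
 case 0
 thus ?case by (simp add: qbinom_def qfact_def)
next
 case (Suc n)
 let ?p = "qn T a" and ?S = "sym2 T a b" and ?d = "d2 T a"
 have fn: "qfact ?p k ~= 0" for k unfolding qfact_def using qint_nz[OF a] by (simp add: prod_zero_iff)
 have p: "?p ~= 0" by (simp add: qn_def)
 have q0: "qbinom ?p k 0 = 1" "qbinom ?p k k = 1" for k using fn by (simp_all add: qbinom_def qfact_def)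
 have pw: "?p ^ k = s powi (?d * int k)" "inverse ?p ^ k = s powi (- (?d * int k))" for k
  by (simp_all add: qn_inverse s_powi_pow) (simp add: qn_def s_powi_pow)
 consider "r = 0" | "1 <= r" "r <= n" | "r = Suc n" using Suc(2) by linarith
 thus ?case
 proof cases
  case 1
  thus ?thesis using Suc.IH[of 0] by (simp add: q0)
 next
  case 2
  then obtain r' where r': "r = Suc r'" by (cases r) auto
  have IH1: "s_coef (serre_x a b) n r = (-1) ^ r * qbinom ?p n r * s powi (- (int r * (?S + (int n - 1) * ?d)))"
  using Suc.IH 2 by simp
  have IH2: "s_coef (serre_x a b) n r' = (-1) ^ r' * qbinom ?p n r' * s powi (- (int r' * (?S + (int n - 1) * ?d)))"
  using Suc.IH[of r'] 2 r' by simp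
  have e1: "s powi (- (int r * (?S + (int n - 1) * ?d))) = s powi (?d * int r) * s powi (- (int r * (?S + int n * ?d)))"
  by (simp add: algebra_simps flip: power_int_add)
  have e2: "s powi (- (?S + int n * (2 * ?d))) * s powi (- (int r' * (?S + (int n - 1) * ?d))) =
  s powi (- (?d * int (Suc n - r))) * s powi (- (int r * (?S + int n * ?d)))"
  using 2 r' by (simp add: algebra_simps of_nat_diff flip: power_int_add)
  have "s_coef (serre_x a b) (Suc n) r =
  (-1) ^ r * s powi (- (int r * (?S + int n * ?d))) * (?p ^ r * qbinom ?p n r + inverse ?p ^ (Suc n - r) * qbinom ?p n (r - 1))"
  unfolding pw using e1 e2 IH1 IH2 r' sym2_self[OF a] by (simp add: serre_x_def algebra_simps)
  thus ?thesis using qbinom_Pascal[of ?p r n] qint_nz[OF a] p qd_nz[OF a] 2 by (simp add: qd_def mult_ac)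
 next
  case 3
  have IH: "s_coef (serre_x a b) n n = (-1) ^ n * s powi (- (int n * (?S + (int n - 1) * ?d)))" using Suc.IH[of n] by (simp add: q0)
  have e: "s powi (- (?S + int n * (2 * ?d))) * s powi (- (int n * (?S + (int n - 1) * ?d))) =
  s powi (- (int (Suc n) * (?S + int n * ?d)))" by (simp add: algebra_simps flip: power_int_add)
  have "s_coef (serre_x a b) (Suc n) (Suc n) = - (serre_x a b n * s_coef (serre_x a b) n n)" by (simp add: serre_coef_0)
  also have "... = (-1) ^ Suc n * (s powi (- (?S + int n * (2 * ?d))) * s powi (- (int n * (?S + (int n - 1) * ?d))))"
  unfolding IH by (simp add: serre_x_def sym2_self[OF a])
  finally show ?thesis unfolding 3 e by (simp add: q0)
 qed
qed

lemma serre_num_rel: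
 assumes "a : An" "b : An" "a ~= b"
 shows "sym2 T a b + (int (s_num a b) - 1) * d2 T a = 0" "s_num a b > 0"
  "2 * sym2 T a b + (int (s_num a b) - 1) * sym2 T a a = 0"
proof -
 have "int (s_num a b) = 1 - aff_cartan T a b" "s_num a b > 0" using aff_cartan_nonpos[OF assms] by (simp_all add: s_num_def)
 moreover have "sym2 T a b = - (- aff_cartan T a b) * d2 T a" using d2_aff_cartan[OF assms(1,2)] by (simp add: mult.commute)
 ultimately show 1: "sym2 T a b + (int (s_num a b) - 1) * d2 T a = 0" "s_num a b > 0" by simp_all
 show "2 * sym2 T a b + (int (s_num a b) - 1) * sym2 T a a = 0" using 1(1) sym2_self[OF assms(1)] by simp
qed

text \<open>Written as an iterated skew commutator, the Serre element can be moved past an opposite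
  generator by induction on the number of steps.\<close>

lemma serre_eq:
 assumes "a : An" "b : An" "a ~= b"
 shows "serre T p a b = qcomm (serre_x a b) (ee p a) (ee p b) (s_num a b)"
 unfolding serre_def qcomm_iter_expand Let_def s_num_def[symmetric]
 using serre_coef_eq[OF assms(1), where n = "s_num a b" and b = b] serre_num_rel(1)[OF assms] by (intro sum.cong refl) auto

end

subsection \<open>Commutation with the opposite generators\<close>

primrec serre_op :: "(complex => 'v => 'v) => (nat => complex) => ('v => 'v) => ('v => 'v) => nat => 'v => 'v::ab_group_add" where
 "serre_op scl x A B 0 v = B v"
| "serre_op scl x A B (Suc n) v = A (serre_op scl x A B n v) - scl (x n) (serre_op scl x A B n (A v))"

lemma (in free_action) act_qcomm_iter:
 "ac (qcomm x a b n) v = serre_op scl x (ac a) (ac b) n v" by (induction n arbitrary: v) (simp_all add: act_mult act_diff)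

text \<open>\<open>A\<close> and \<open>B\<close> belong to two simple roots and have the same sign,
  \<open>F\<close> is a generator of the opposite sign, and \<open>ka\<close>, \<open>ka'\<close>
  are the Cartan operators that commutators with \<open>F\<close> produce. The set \<open>G\<close>
  appears because the relations hold only on a carrier inside a function type. The setting serves
  for Serre elements in the \<open>e\<close>s and in the \<open>f\<close>s alike.\<close>

locale serre_setting = vector_space scl
 for scl :: "complex => 'v::ab_group_add => 'v" +
 fixes A B F ka ka' :: "'v => 'v" and G :: "'v set" and s :: complex and m S :: int and x :: "nat => complex"
 assumes s: "s ~= 0"
  and add: "A (v + w) = A v + A w" "B (v + w) = B v + B w" "F (v + w) = F v + F w"
  and scl: "A (scl c v) = scl c (A v)" "B (scl c v) = scl c (B v)" "F (scl c v) = scl c (F v)"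
  and closed: "v : G ==> A v : G" "v : G ==> B v : G" "v : G ==> F v : G" "v : G ==> ka v : G" "v : G ==> ka' v : G"
  "v : G ==> w : G ==> v + w : G" "v : G ==> scl c v : G"
  and kadd: "ka (v + w) = ka v + ka w" "ka' (v + w) = ka' v + ka' w"
  and kscl: "ka (scl c v) = scl c (ka v)" "ka' (scl c v) = scl c (ka' v)"
  and kA: "v : G ==> ka (A v) = scl (s powi m) (A (ka v))"
  "v : G ==> ka' (A v) = scl (s powi (- m)) (A (ka' v))"
begin

abbreviation "sop == serre_op scl x A B"

lemma diff: "A (v - w) = A v - A w" "B (v - w) = B v - B w" "F (v - w) = F v - F w"
 "ka (v - w) = ka v - ka w" "ka' (v - w) = ka' v - ka' w" "v : G ==> w : G ==> v - w : G"
 using add[of v "scl (-1) w"] scl[of "-1" w] kadd[of v "scl (-1) w"] kscl[of "-1" w]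
  closed(6)[of v "scl (-1) w"] closed(7)[of w "-1"] by simp_all

lemma sop_lin: "sop n (v + w) = sop n v + sop n w" "sop n (scl c v) = scl c (sop n v)"
 by (induction n arbitrary: v w) (simp_all add: add scl algebra_simps scale_right_distrib scale_right_diff_distrib)

lemma sop_diff: "sop n (v - w) = sop n v - sop n w" using sop_lin(1)[of n v "scl (-1) w"] sop_lin(2)[of n "-1" w] by simp

lemma sop_closed: "v : G ==> sop n v : G" by (induction n arbitrary: v) (simp_all add: closed diff(6))

lemma sop_comm:
 assumes "!!v. v : G ==> A (F v) = F (A v)" "!!v. v : G ==> B (F v) = F (B v)"
 shows "v : G ==> sop n (F v) = F (sop n v)"
 using assms by (induction n arbitrary: v) (simp_all add: diff scl closed sop_closed)

text \<open>Moving past \<open>F\<close> leaves only a multiple \<open>rh\<close> of the previous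
  step applied after \<open>ka\<close>: the constants \<open>x n\<close> are such that the terms
  with \<open>ka'\<close> cancel. By the relation on \<open>N\<close>, the summands of
  \<open>rh N\<close> change sign under replacing \<open>t\<close> by \<open>N - 1 - t\<close>, so
  the sum is 0.\<close>

lemma sop_comm_A:
 assumes AF: "!!v. v : G ==> A (F v) = F (A v) + scl de (ka v - ka' v)"
  and BF: "!!v. v : G ==> B (F v) = F (B v)"
  and kB: "!!v. v : G ==> ka (B v) = scl (s powi S) (B (ka v))"
  "!!v. v : G ==> ka' (B v) = scl (s powi (- S)) (B (ka' v))"
  and x: "!!n. x n = s powi (- (S + int n * m))"
  and N: "2 * S + (int N - 1) * m = 0" "N > 0" and v: "v : G"
 shows "sop N (F v) = F (sop N v)"
proof -
 have ks: "ka (sop n v) = scl (s powi (S + int n * m)) (sop n (ka v))"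
  "ka' (sop n v) = scl (s powi (- (S + int n * m))) (sop n (ka' v))" if "v : G" for n v using that
 proof (induction n arbitrary: v)
  case 0
  { case 1 thus ?case by (simp add: kB) }
  { case 2 thus ?case by (simp add: kB) }
 next
  case (Suc n)
  have e: "S + int (Suc n) * m = m + (S + int n * m)" by (simp add: algebra_simps)
  { case 1
  thus ?case using s unfolding e by (simp add: diff kA kscl Suc.IH closed sop_closed scl sop_lin power_int_add
  scale_right_diff_distrib mult_ac) }
  { case 2
  have e': "s powi (- (m + (S + int n * m))) = s powi (- m) * s powi (- (S + int n * m))" using s by (simp flip: power_int_add)
  show ?case using 2 unfolding e e' by (simp add: diff kA kscl Suc.IH closed sop_closed scl sop_lin
  scale_right_diff_distrib mult_ac) }
 qed
 define rh where "rh n = (SUM t<n. s powi (S + int t * m) - s powi (- (S + int t * m)))" for n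
 have main: "sop (Suc n) (F v) = F (sop (Suc n) v) + scl (de * rh (Suc n)) (sop n (ka v))" if "v : G" for n v
  using that
 proof (induction n arbitrary: v)
  case 0
  have "s powi (- S) * s powi S = 1" using s by (simp flip: power_int_add)
  thus ?case using 0 by (simp add: x rh_def AF BF diff scl closed add kB scale_right_distrib scale_right_diff_distrib
  algebra_simps)
 next
  case (Suc n)
  let ?y = "s powi (S + int (Suc n) * m)" and ?x = "s powi (- (S + int (Suc n) * m))"
  have IH: "sop (Suc n) (F w) = F (sop (Suc n) w) + scl (de * rh (Suc n)) (sop n (ka w))" if "w : G" for w
  using Suc.IH that .
  have xS: "x (Suc n) = ?x" by (rule x)
  have xm: "?x * s powi m = x n" unfolding x using s by (simp add: algebra_simps flip: power_int_add)
  have 1: "A (sop (Suc n) (F v)) = F (A (sop (Suc n) v)) + scl de (scl ?y (sop (Suc n) (ka v)) - scl ?x (sop (Suc n) (ka' v)))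
  + scl (de * rh (Suc n)) (A (sop n (ka v)))"
  unfolding IH[OF Suc(2)] add scl using AF[OF sop_closed[OF Suc(2)], of "Suc n"] ks[OF Suc(2), of "Suc n"]
  by (simp del: serre_op.simps of_nat_Suc)
  have 2: "sop (Suc n) (A (F v)) = F (sop (Suc n) (A v)) + scl (de * rh (Suc n)) (scl (s powi m) (sop n (A (ka v))))
  + scl de (sop (Suc n) (ka v) - sop (Suc n) (ka' v))"
  unfolding AF[OF Suc(2)] sop_lin sop_diff IH[OF closed(1)[OF Suc(2)]] kA[OF Suc(2)] ..
  have "sop (Suc (Suc n)) (F v) - F (sop (Suc (Suc n)) v) =
  scl de (scl ?y (sop (Suc n) (ka v)) - scl ?x (sop (Suc n) (ka' v)))
  + scl (de * rh (Suc n)) (A (sop n (ka v)))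
  - scl ?x (scl (de * rh (Suc n)) (scl (s powi m) (sop n (A (ka v))))
  + scl de (sop (Suc n) (ka v) - sop (Suc n) (ka' v)))" unfolding serre_op.simps(2)[of scl x A B "Suc n"] 1 2 xS
  by (simp add: diff scl scale_right_distrib del: serre_op.simps)
  also have "... = scl (de * (?y - ?x)) (sop (Suc n) (ka v)) + scl (de * rh (Suc n)) (A (sop n (ka v)) - scl (?x * s powi m) (sop n (A (ka v))))"
  by (simp add: scale_right_distrib scale_right_diff_distrib scale_left_diff_distrib right_diff_distrib mult_ac del: serre_op.simps)
  also have "A (sop n (ka v)) - scl (?x * s powi m) (sop n (A (ka v))) = sop (Suc n) (ka v)" unfolding xm by simp
  also have "scl (de * (?y - ?x)) (sop (Suc n) (ka v)) + scl (de * rh (Suc n)) (sop (Suc n) (ka v))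
  = scl (de * rh (Suc (Suc n))) (sop (Suc n) (ka v))" by (simp add: rh_def distrib_left flip: scale_left_distrib)
  finally show ?case by (simp add: algebra_simps del: serre_op.simps)
 qed
 obtain n where n: "N = Suc n" using N(2) by (cases N) auto
 have "rh N = 0"
 proof -
  have sw: "(SUM t<N. f (N - Suc t)) = (SUM t<N. f t)" for f :: "nat => complex" by (rule sum.nat_diff_reindex)
  have "(SUM t<N. s powi (- (S + int t * m))) = (SUM t<N. s powi (S + int (N - Suc t) * m))"
  proof (intro sum.cong refl arg_cong[where f = "power_int s"])
  fix t assume "t : {..<N}"
  thus "- (S + int t * m) = S + int (N - Suc t) * m" using N(1) by (simp add: of_nat_diff algebra_simps)
  qed
  thus ?thesis unfolding rh_def sum_subtractf using sw[of "%t. s powi (S + int t * m)"] by simp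
 qed
 thus ?thesis using main[OF v, of n] n by simp
qed

text \<open>Here the commutator leaves pure powers of \<open>A\<close>, with coefficients that are
  products: \<open>al\<close> contains a vanishing factor at \<open>t = 0\<close>, and
  \<open>be\<close> one at \<open>t = N - 1\<close>.\<close>

lemma sop_comm_B:
 assumes BF: "!!v. v : G ==> B (F v) = F (B v) + scl de (ka v - ka' v)"
  and AF: "!!v. v : G ==> A (F v) = F (A v)"
  and m: "m = S" and x: "!!n. x n = s powi (- (S + int n * m'))"
  and N: "2 * S + (int N - 1) * m' = 0" "N > 0" and v: "v : G"
 shows "sop N (F v) = F (sop N v)"
proof -
 define al where "al n = (\<Prod>t<n. 1 - s powi (- (int t * m')))" for n
 define be where "be n = (\<Prod>t<n. 1 - s powi (- (2 * S + int t * m')))" for n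
 have Apow: "(A ^^ n) (v - w) = (A ^^ n) v - (A ^^ n) w" "(A ^^ n) (scl c v) = scl c ((A ^^ n) v)" for n v w c
  by (induction n) (simp_all add: diff scl)
 have main: "sop n (F v) = F (sop n v) + scl de (scl (al n) ((A ^^ n) (ka v)) - scl (be n) ((A ^^ n) (ka' v)))"
  if "v : G" for n v using that
 proof (induction n arbitrary: v)
  case 0
  thus ?case by (simp add: BF al_def be_def)
 next
  case (Suc n)
  have a: "x n * s powi S = s powi (- (int n * m'))" and b: "x n * s powi (- S) = s powi (- (2 * S + int n * m'))"
  unfolding x power_int_add[OF disjI1[OF s], symmetric] by (rule arg_cong[where f = "power_int s"], simp)+
  have sw: "(A ^^ n) (A w) = (A ^^ Suc n) w" for w by (simp add: funpow_swap1)
  have gcl: "w : G ==> sop n w : G" for w by (rule sop_closed)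
  have 1: "A (sop n (F v)) = F (A (sop n v)) + scl de (scl (al n) ((A ^^ Suc n) (ka v)) - scl (be n) ((A ^^ Suc n) (ka' v)))"
  unfolding Suc.IH[OF Suc(2)] add diff scl using AF[OF gcl[OF Suc(2)]] by simp
  have 2: "sop n (A (F v)) = F (sop n (A v)) + scl de (scl (al n * s powi S) ((A ^^ Suc n) (ka v)) - scl (be n * s powi (- S)) ((A ^^ Suc n) (ka' v)))"
  unfolding AF[OF Suc(2)] Suc.IH[OF closed(1)[OF Suc(2)]] kA[OF Suc(2)] Apow sw m by simp
  have "sop (Suc n) (F v) - F (sop (Suc n) v) =
  scl de (scl (al n) ((A ^^ Suc n) (ka v)) - scl (be n) ((A ^^ Suc n) (ka' v)))
  - scl (x n) (scl de (scl (al n * s powi S) ((A ^^ Suc n) (ka v)) - scl (be n * s powi (- S)) ((A ^^ Suc n) (ka' v))))"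
  unfolding serre_op.simps(2) 1 2 by (simp add: diff scl scale_right_distrib del: funpow.simps)
  also have "... = scl de (scl (al n * (1 - x n * s powi S)) ((A ^^ Suc n) (ka v)) - scl (be n * (1 - x n * s powi (- S))) ((A ^^ Suc n) (ka' v)))"
  by (simp add: scale_right_distrib scale_right_diff_distrib scale_left_diff_distrib right_diff_distrib mult_ac del: funpow.simps)
  also have "... = scl de (scl (al (Suc n)) ((A ^^ Suc n) (ka v)) - scl (be (Suc n)) ((A ^^ Suc n) (ka' v)))"
  unfolding a b by (simp add: al_def be_def del: funpow.simps)
  finally show ?case by (simp add: algebra_simps del: serre_op.simps funpow.simps)
 qed
 have "al N = 0" unfolding al_def using N(2) by (intro prod_zero bexI[of _ 0]) auto
 moreover have "be N = 0" unfolding be_def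
 proof (intro prod_zero)
  show "EX t:{..<N}. 1 - s powi (- (2 * S + int t * m')) = 0" using N by (intro bexI[of _ "N - 1"]) (auto simp: of_nat_diff)
 qed simp
 ultimately show ?thesis using main[OF v, of N] by simp
qed

end

section \<open>Congruences in the quantum loop algebra\<close>

lemma subalg_uminus: "a : subalg S ==> - a : subalg S"
 using subalg.mult[OF subalg.scalar[of "-1"]] by (metis mult_minus1 sc_1 sc_uminus)

lemma subalg_diff: "a : subalg S ==> b : subalg S ==> a - b : subalg S"
 using subalg.add[of a S "- b"] subalg_uminus[of b S] by simp

lemma subalg_0: "0 : subalg S" and subalg_1: "1 : subalg S" using subalg.scalar[of 0] subalg.scalar[of 1] by simp_all

lemma subalg_power: "a : subalg S ==> a ^ n : subalg S" by (induction n) (auto intro: subalg.mult subalg_1)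

lemma subalg_sum: "(!!i. i : I ==> f i : subalg S) ==> sum f I : subalg S"
 by (induction I rule: infinite_finite_induct) (auto intro: subalg.add subalg_0)

lemma subalg_prod_list: "(!!a. a : set xs ==> a : subalg S) ==> prod_list xs : subalg S"
 by (induction xs) (auto intro: subalg.mult subalg_1)

lemma subalg_mono: "S <= S' ==> subalg S <= subalg S'"
proof
 fix a assume "S <= S'" "a : subalg S"
 thus "a : subalg S'" by (induction rule: subalg.induct[OF `a : subalg S`]) (auto intro: subalg.intros)
qed

lemma subalg_least: "S <= subalg S' ==> subalg S <= subalg S'"
proof
 fix a assume "S <= subalg S'" "a : subalg S"
 thus "a : subalg S'" by (induction rule: subalg.induct[OF `a : subalg S`]) (auto intro: subalg.intros)
qed

context twisted
begin

abbreviation "chev == chev_alg T"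
abbreviation "relI == rel_ideal T"
abbreviation ueq' (infix "~~" 50) where "a ~~ b == ueq T a b"

lemma chev_gen:
 assumes "a : An"
 shows "ee p a : chev" "kk a : chev" "kinv a : chev" using assms by (cases p; force simp: chev_alg_def intro: subalg.gen)+

lemma chevI:
 "sc c : chev" "0 : chev" "1 : chev"
 "a : chev ==> b : chev ==> a + b : chev" "a : chev ==> b : chev ==> a * b : chev"
 "a : chev ==> b : chev ==> a - b : chev" "a : chev ==> - a : chev" "a : chev ==> a ^ n : chev"
 "(!!i. i : I ==> f i : chev) ==> sum f I : chev" unfolding chev_alg_def
 by (auto intro: subalg.intros subalg_0 subalg_1 subalg_diff subalg_uminus subalg_power subalg_sum)

lemma qcomm_iter_chev: "a : chev ==> b : chev ==> qcomm x a b n : chev"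
 by (induction n) (auto intro!: chevI)

lemma k_delta_chev: "k_delta T : chev" unfolding k_delta_def chev_alg_def
proof (rule subalg_prod_list)
 fix z assume "z : set (map (%a. kk a ^ kac_label T a) (Eps # map Orb (sorted_list_of_set (Rp))))"
 then obtain a where "a : set (Eps # map Orb (sorted_list_of_set (Rp)))" and z: "z = kk a ^ kac_label T a"
  unfolding set_map by blast
 hence "a : An" by (auto simp: anodes_def)
 thus "z : subalg (UN a:An. {ee Pl a, ee Mi a, kk a, kinv a})"
  using chevI(8)[OF chev_gen(2)] z by (simp add: chev_alg_def)
qed

lemma relations_chev: "r : relations T ==> r : chev" unfolding relations_def comm_def
 by (auto intro!: chevI chev_gen k_delta_chev qcomm_iter_chev simp: serre_eq split: if_splits)

lemma relI_chev: "relI <= chev"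
proof
 fix z assume "z : relI"
 thus "z : chev" unfolding rel_ideal_def by induction (simp_all add: chevI relations_chev)
qed

lemma relI_0: "0 : relI" unfolding rel_ideal_def by (rule ideal_gen.zero)

lemma relI_add: "a : relI ==> b : relI ==> a + b : relI"
proof -
 assume a: "a : relI" and b: "b : relI"
 from b show "a + b : relI" unfolding rel_ideal_def
 proof induction
  case zero
  thus ?case using a by (simp add: rel_ideal_def)
 next
  case (step z x r y)
  thus ?case using ideal_gen.step[of "a + z" chev "relations T" x r y] by (simp add: add.assoc)
 qed
qed

lemma relI_left: "a : chev ==> z : relI ==> a * z : relI"
proof -
 assume a: "a : chev" and z: "z : relI"
 from z show "a * z : relI" unfolding rel_ideal_def
 proof induction
  case zero
  thus ?case by (simp add: ideal_gen.zero)
 next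
  case (step z x r y)
  thus ?case using ideal_gen.step[of "a * z" chev "relations T" "a * x" r y] a by (simp add: distrib_left mult.assoc chevI)
 qed
qed

lemma relI_right: "a : chev ==> z : relI ==> z * a : relI"
proof -
 assume a: "a : chev" and z: "z : relI"
 from z show "z * a : relI" unfolding rel_ideal_def
 proof induction
  case zero
  thus ?case by (simp add: ideal_gen.zero)
 next
  case (step z x r y)
  thus ?case using ideal_gen.step[of "z * a" chev "relations T" x r "y * a"] a by (simp add: distrib_right mult.assoc chevI)
 qed
qed

lemma relI_uminus: "a : relI ==> - a : relI" using relI_left[of "- 1" a] by (simp add: chevI)

lemma relI_diff: "a : relI ==> b : relI ==> a - b : relI"
 using relI_add[of a "- b"] relI_uminus by simp

lemma relI_sc: "a : relI ==> sc c * a : relI" by (rule relI_left[OF chevI(1)])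

lemma relI_rel: "r : relations T ==> r : relI" unfolding rel_ideal_def
 using ideal_gen.step[of 0 chev "relations T" 1 r 1] by (simp add: ideal_gen.zero chevI)

lemma ueq_refl [simp]: "a ~~ a" by (simp add: ueq_def relI_0)

lemma ueq_sym: "a ~~ b ==> b ~~ a" unfolding ueq_def using relI_uminus[of "a - b"] by simp

lemma ueq_trans [trans]: "a ~~ b ==> b ~~ c ==> a ~~ c"
 unfolding ueq_def using relI_add[of "a - b" "b - c"] by simp

lemma ueq_add: "a ~~ b ==> c ~~ d ==> a + c ~~ b + d"
 unfolding ueq_def using relI_add[of "a - b" "c - d"] by (simp add: algebra_simps)

lemma ueq_diff: "a ~~ b ==> c ~~ d ==> a - c ~~ b - d"
 unfolding ueq_def using relI_diff[of "a - b" "c - d"] by (simp add: algebra_simps)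

lemma ueq_mult:
 assumes "a ~~ b" "c ~~ d" "a : chev" "d : chev"
 shows "a * c ~~ b * d"
proof -
 have "a * c - b * d = a * (c - d) + (a - b) * d" by (simp add: algebra_simps)
 thus ?thesis using assms relI_add relI_left relI_right unfolding ueq_def by metis
qed

lemma ueq_sc: "a ~~ b ==> sc c * a ~~ sc c * b"
 unfolding ueq_def using relI_sc[of "a - b" c] by (simp add: right_diff_distrib)

lemma ueq_chev: "a ~~ b ==> b : chev ==> a : chev"
 unfolding ueq_def using relI_chev chevI(4)[of "a - b" b] by auto

lemma usub_closed:
 assumes "S <= chev"
 shows "sc c : usub T S" "a : usub T S ==> b : usub T S ==> a + b : usub T S"
  "a : usub T S ==> b : usub T S ==> a * b : usub T S"
  "a : usub T S ==> b : usub T S ==> a - b : usub T S"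
  "a : relI ==> a : usub T S" "a : S ==> a : usub T S" "a : subalg S ==> a : usub T S"
  "a ~~ b ==> b : usub T S ==> a : usub T S"
proof -
 have sub: "subalg S <= chev" using subalg_least[of S] assms unfolding chev_alg_def by blast
 show "sc c : usub T S" unfolding usub_def using chevI(1) subalg.scalar ueq_refl by blast
 show "a : usub T S ==> b : usub T S ==> a + b : usub T S"
  unfolding usub_def using chevI(4) subalg.add ueq_add by blast
 show "a : usub T S ==> b : usub T S ==> a - b : usub T S"
  unfolding usub_def using chevI(6) subalg_diff ueq_diff by blast
 show "a : usub T S ==> b : usub T S ==> a * b : usub T S"
  unfolding usub_def using chevI(5) subalg.mult ueq_mult sub by blast
 show "a : relI ==> a : usub T S"
  unfolding usub_def using relI_chev by (auto simp: ueq_def intro!: bexI[of _ 0] subalg_0)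
 show "a : S ==> a : usub T S" unfolding usub_def using subalg.gen assms ueq_refl by blast
 show "a : subalg S ==> a : usub T S" unfolding usub_def using sub ueq_refl by blast
 show "a ~~ b ==> b : usub T S ==> a : usub T S"
  unfolding usub_def using ueq_trans ueq_chev by blast
qed

abbreviation "bgens == (UN a:An. {ee Pl a, kk a, kinv a})"

lemma borel_gens_chev: "bgens <= chev" using chev_gen by auto

lemma borel_chev: "borel T <= chev" by (auto simp: borel_def usub_def)

lemmas borelI = usub_closed[OF borel_gens_chev, folded borel_def]

lemma borel_ee: "a : An ==> ee Pl a : borel T"
 and borel_kk: "a : An ==> kk a : borel T"
 and borel_kinv: "a : An ==> kinv a : borel T" by (rule borelI(6); force)+

end

section \<open>Representations on subspaces\<close>

text \<open>A representation, on a subset \<open>W\<close> of a type, of a subalgebra given by its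
  full preimage in the free algebra. It covers both the Borel modules, with \<open>W = UNIV\<close>,
  and the induced modules, which are subspaces of a function type.\<close>

locale rep_on = twisted T + vector_space scl
 for T :: datum and scl :: "complex => 'w::ab_group_add => 'w" +
 fixes Alg :: "falg set" and W :: "'w set" and act :: "falg => 'w => 'w"
 assumes alg_rel: "rel_ideal T <= Alg" and alg_chev: "Alg <= chev_alg T"
  and alg_sc: "sc c : Alg"
  and alg_add: "a : Alg ==> b : Alg ==> a + b : Alg"
  and alg_mult: "a : Alg ==> b : Alg ==> a * b : Alg"
  and W_0: "0 : W" and W_add: "v : W ==> w : W ==> v + w : W" and W_scl: "w : W ==> scl c w : W"
  and act_in: "a : Alg ==> w : W ==> act a w : W"
  and act_plus: "a : Alg ==> b : Alg ==> w : W ==> act (a + b) w = act a w + act b w"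
  and act_times: "a : Alg ==> b : Alg ==> w : W ==> act (a * b) w = act a (act b w)"
  and act_sc1: "w : W ==> act (sc c) w = scl c w"
  and act_addr: "a : Alg ==> v : W ==> w : W ==> act a (v + w) = act a v + act a w"
  and act_scl: "a : Alg ==> w : W ==> act a (scl c w) = scl c (act a w)"
  and act_rel: "a : rel_ideal T ==> w : W ==> act a w = 0"
begin

lemma alg_uminus: "a : Alg ==> - a : Alg" using alg_mult[OF alg_sc[of "-1"]] by (metis mult_minus1 sc_1 sc_uminus)

lemma alg_diff: "a : Alg ==> b : Alg ==> a - b : Alg" using alg_add[of a "- b"] alg_uminus by simp

lemma alg_0: "0 : Alg" and alg_1: "1 : Alg" using alg_sc[of 0] alg_sc[of 1] by simp_all

lemma W_uminus: "w : W ==> - w : W" using W_scl[of w "-1"] by simp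

lemma W_sum: "(!!i. i : I ==> f i : W) ==> sum f I : W"
 by (induction I rule: infinite_finite_induct) (auto intro: W_add W_0)

lemma act_zero: "w : W ==> act 0 w = 0" using act_sc1[of w 0] by simp

lemma act_one: "w : W ==> act 1 w = w" using act_sc1[of w 1] by simp

lemma act_neg: "a : Alg ==> w : W ==> act (- a) w = - act a w"
 using act_plus[of a "- a" w] act_zero[of w] alg_uminus by (simp add: eq_neg_iff_add_eq_0 add.commute)

lemma act_minus: "a : Alg ==> b : Alg ==> w : W ==> act (a - b) w = act a w - act b w"
 using act_plus[of a "- b" w] act_neg alg_uminus by simp

lemma act_sc_times: "a : Alg ==> w : W ==> act (sc c * a) w = scl c (act a w)"
 by (simp add: act_times alg_sc act_sc1 act_in)

lemma act_0r: "a : Alg ==> act a 0 = 0" using act_scl[of a 0 0] W_0 by simp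

lemma act_right_neg: "a : Alg ==> w : W ==> act a (- w) = - act a w"
 using act_scl[of a w "-1"] by simp

lemma act_right_sum: "a : Alg ==> (!!i. i : I ==> f i : W) ==> act a (sum f I) = (SUM i:I. act a (f i))"
 by (induction I rule: infinite_finite_induct) (simp_all add: act_0r act_addr W_sum)

lemma alg_sum: "(!!i. i : I ==> f i : Alg) ==> sum f I : Alg"
 by (induction I rule: infinite_finite_induct) (simp_all add: alg_0 alg_add)

lemma act_sum: "w : W ==> (!!i. i : I ==> f i : Alg) ==> act (sum f I) w = (SUM i:I. act (f i) w)"
 by (induction I rule: infinite_finite_induct) (simp_all add: act_zero act_plus alg_sum)

lemma act_ueq: "a ~~ b ==> a : Alg ==> b : Alg ==> w : W ==> act a w = act b w"
 using act_rel[of "a - b" w] act_minus[of a b w] by (simp add: ueq_def)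

end

section \<open>Induced modules\<close>

text \<open>A Borel module given by operators for the generators, subject only to the Chevalley
  relations among these. Whether the whole algebra forces further relations on them is what the
  induced module decides.\<close>

locale bmod = twisted T + vector_space scl
 for T :: datum and scl :: "complex => 'v::ab_group_add => 'v" +
 fixes V :: "'v set" and E K Ki :: "anode => 'v => 'v"
 assumes lin: "E a (v + w) = E a v + E a w" "K a (v + w) = K a v + K a w" "Ki a (v + w) = Ki a v + Ki a w"
  "E a (scl c v) = scl c (E a v)" "K a (scl c v) = scl c (K a v)" "Ki a (scl c v) = scl c (Ki a v)"
  and V: "0 : V" "v : V ==> w : V ==> v + w : V" "v : V ==> scl c v : V"
  "a : An ==> v : V ==> E a v : V" "a : An ==> v : V ==> K a v : V"
  "a : An ==> v : V ==> Ki a v : V"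
  and K_Ki: "a : An ==> v : V ==> K a (Ki a v) = v"
  and Ki_K: "a : An ==> v : V ==> Ki a (K a v) = v"
  and K_K: "a : An ==> b : An ==> v : V ==> K a (K b v) = K b (K a v)"
  and K_E: "a : An ==> b : An ==> v : V ==> K a (E b v) = scl (sqrt_q T powi sym2 T a b) (E b (K a v))"
  and E_serre: "a : An ==> b : An ==> a ~= b ==> v : V ==>
  serre_op scl (twisted.serre_x T a b) (E a) (E b) (twisted.s_num T a b) v = 0"
  and K_delta: "v : V ==>
  foldr (%a. K a ^^ kac_label T a) (Eps # map Orb (sorted_list_of_set (Rp))) v = v"
begin

lemma op_zero [simp]: "E a 0 = 0" "K a 0 = 0" "Ki a 0 = 0" using lin(4)[of a 0 0] lin(5)[of a 0 0] lin(6)[of a 0 0] by simp_all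

lemma op_diff: "K a (v - w) = K a v - K a w" "Ki a (v - w) = Ki a v - Ki a w"
 using lin(2)[of a v "scl (-1) w"] lin(5)[of a "-1" w] lin(3)[of a v "scl (-1) w"] lin(6)[of a "-1" w] by simp_all

lemma V_diff: "v : V ==> w : V ==> v - w : V" using V(2)[of v "scl (-1) w"] V(3)[of w "-1"] by simp

lemma s_inv [simp]: "s powi m * s powi (- m) = 1" "s powi (- m) * s powi m = 1" by (simp_all flip: power_int_add)

lemma scl_s_cancel: "scl (s powi m) (scl (s powi (- m)) v) = v" "scl (s powi (- m)) (scl (s powi m) v) = v" by simp_all

lemma Ki_E: "a : An ==> b : An ==> v : V ==> Ki a (E b v) = scl (s powi (- sym2 T a b)) (E b (Ki a v))"
proof -
 assume *: "a : An" "b : An" "v : V"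
 have "K a (E b (Ki a v)) = scl (s powi sym2 T a b) (E b v)" using K_E[OF *(1,2) V(6)[OF *(1,3)]] K_Ki * by simp
 hence "Ki a (K a (E b (Ki a v))) = scl (s powi sym2 T a b) (Ki a (E b v))" by (simp add: lin)
 thus ?thesis using Ki_K * V by (simp add: scl_s_cancel)
qed

lemma K_Ki_commute: "a : An ==> b : An ==> v : V ==> K a (Ki b v) = Ki b (K a v)"
 by (metis K_K K_Ki Ki_K V(5) V(6))

lemma Ki_Ki: "a : An ==> b : An ==> v : V ==> Ki a (Ki b v) = Ki b (Ki a v)"
 by (metis K_Ki_commute K_Ki Ki_K V(5) V(6))

lemma K_fold: "a : An ==> set u <= An ==> v : V ==>
  K a (fold E u v) = scl (s powi cont a u) (fold E u (K a v))"
 and Ki_fold: "a : An ==> set u <= An ==> v : V ==>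
  Ki a (fold E u v) = scl (s powi (- cont a u)) (fold E u (Ki a v))"
proof -
 have fs: "fold E u (scl c v) = scl c (fold E u v)" for c u v by (induction u arbitrary: v) (simp_all add: lin)
 show "a : An ==> set u <= An ==> v : V ==>
  K a (fold E u v) = scl (s powi cont a u) (fold E u (K a v))"
  by (induction u arbitrary: v) (simp_all add: K_E fs V power_int_add mult.commute)
 show "a : An ==> set u <= An ==> v : V ==>
  Ki a (fold E u v) = scl (s powi (- cont a u)) (fold E u (Ki a v))"
 proof (induction u arbitrary: v)
  case (Cons b u)
  have "s powi (- cont a u) * s powi (- sym2 T a b) = s powi (- cont a (b # u))"
  unfolding cont_simps power_int_add[OF disjI1[OF s_nz], symmetric] by (rule arg_cong[where f = "power_int s"]) simp
  thus ?case using Cons by (simp add: Ki_E fs V mult.commute del: cont_simps)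
 qed simp
qed

text \<open>The module induced from \<open>V\<close> is realized inside functions on words: with \<open>\<pi>\<close> the projection
  onto \<open>V\<close> along \<open>\<Sum> f\<^sub>a\<close>, the element \<open>z\<close> is represented by the function
  \<open>[a\<^sub>1, \<dots>, a\<^sub>n] \<mapsto> \<pi> (e a\<^sub>n \<cdots> e a\<^sub>1 z)\<close>. The Serre relations for the \<open>f\<^sub>a\<close> then hold automatically.\<close>

definition fscl :: "complex => (anode list => 'v) => anode list => 'v" where
 "fscl c F = (%u. scl c (F u))"

definition eh :: "anode => (anode list => 'v) => anode list => 'v" where
 "eh a F = (%u. F (a # u))"

text \<open>The scalar comes from moving \<open>k\<^sub>a\<close> to the left of the
  \<open>e\<close>s given by the word.\<close>

definition kh :: "anode => (anode list => 'v) => anode list => 'v" where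
 "kh a F = (%u. scl (s powi (- cont a u)) (K a (F u)))"

definition khi :: "anode => (anode list => 'v) => anode list => 'v" where
 "khi a F = (%u. scl (s powi cont a u) (Ki a (F u)))"

text \<open>\<open>f\<^sub>a\<close> is moved to the left through the \<open>e\<close>s of the word,
  with one commutator for each letter \<open>a\<close>; once it stands on the far left the
  projection kills it, whence the value 0 at the empty word.\<close>

primrec fh' :: "anode => anode list => (anode list => 'v) => 'v" where
 "fh' a [] F = 0"
| "fh' a (b # u) F = fh' a u (eh b F) + (if a = b then scl (1 / qd a) (kh a F u - khi a F u) else 0)"

definition fh :: "anode => (anode list => 'v) => anode list => 'v" where
 "fh a F = (%u. fh' a u F)"

sublocale fv: vector_space fscl by standard (auto simp: fscl_def scale_right_distrib scale_left_distrib)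

lemma plus_app: "(F + G) u = F u + G u" for F G :: "anode list => 'v" by (simp add: plus_fun_def)

lemma fscl_app: "fscl c F u = scl c (F u)" by (simp add: fscl_def)

lemma h_add: "eh a (F + G) = eh a F + eh a G" "kh a (F + G) = kh a F + kh a G" "khi a (F + G) = khi a F + khi a G"
 by (auto simp: eh_def kh_def khi_def lin scale_right_distrib)

lemma h_scl: "eh a (fscl c F) = fscl c (eh a F)" "kh a (fscl c F) = fscl c (kh a F)" "khi a (fscl c F) = fscl c (khi a F)"
 by (auto simp: eh_def kh_def khi_def fscl_def lin mult.commute)

lemma h_diff: "eh a (F - G) = eh a F - eh a G" "kh a (F - G) = kh a F - kh a G" "khi a (F - G) = khi a F - khi a G"
 using h_add[of a F "fscl (-1) G"] h_scl[of a "-1" G] by simp_all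

lemma h_zero: "eh a 0 = 0" "kh a 0 = 0" "khi a 0 = 0" using h_scl[of a 0 0] by simp_all

lemma fh'_add: "fh' a u (F + G) = fh' a u F + fh' a u G"
 by (induction u arbitrary: F G) (auto simp: h_add plus_app algebra_simps scale_right_distrib scale_right_diff_distrib)

lemma fh'_scl: "fh' a u (fscl c F) = scl c (fh' a u F)"
 by (induction u arbitrary: F) (auto simp: h_scl fscl_app scale_right_distrib scale_right_diff_distrib mult.commute)

lemma fh_add: "fh a (F + G) = fh a F + fh a G" and fh_scl: "fh a (fscl c F) = fscl c (fh a F)"
 by (rule ext, simp only: fh_def fh'_add fh'_scl fscl_app plus_app)+

lemma fh_zero: "fh a 0 = 0" using fh_scl[of a 0 0] by simp

text \<open>The functions vanish on words with letters outside \<open>anodes T\<close>, because the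
  type \<open>anode\<close> has such letters and the relations do not speak about them.\<close>

definition carr :: "(anode list => 'v) set" where
 "carr = {F. ALL u. F u : V & (~ set u <= An --> F u = 0)}"

lemma carrD: "F : carr ==> F u : V" "F : carr ==> ~ set u <= An ==> F u = 0"
 by (auto simp: carr_def)

lemma carr_0: "0 : carr" by (simp add: carr_def V)

lemma carr_add: "F : carr ==> G : carr ==> F + G : carr" by (auto simp: carr_def V)

lemma carr_scl: "F : carr ==> fscl c F : carr" by (auto simp: carr_def V fscl_def)

lemma carr_diff: "F : carr ==> G : carr ==> F - G : carr" by (auto simp: carr_def V_diff)

lemma carr_eh: "F : carr ==> eh a F : carr" by (auto simp: carr_def eh_def)

lemma carr_kh: "a : An ==> F : carr ==> kh a F : carr" "a : An ==> F : carr ==> khi a F : carr"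
 by (auto simp: carr_def kh_def khi_def V)

lemma eh_carr_0: "F : carr ==> b ~: An ==> eh b F = 0" by (auto simp: carr_def eh_def)

lemma carr_fh:
 assumes "a : An" "F : carr"
 shows "fh a F : carr"
proof -
 have "fh' a u F : V & (~ set u <= An --> fh' a u F = 0)" for u using assms(2)
 proof (induction u arbitrary: F)
  case (Cons b u)
  have 1: "kh a F u - khi a F u : V"
  using carrD(1)[OF carr_kh(1)[OF assms(1) Cons(2)]] carrD(1)[OF carr_kh(2)[OF assms(1) Cons(2)]] V_diff by simp
  have 2: "kh a F u - khi a F u = 0" if "~ set u <= An" using carrD(2)[OF Cons(2) that] by (simp add: kh_def khi_def)
  have "fh' a u (eh b F) = 0" if "b ~: An" using eh_carr_0[OF Cons(2) that] fh'_scl[of a u 0 0] by simp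
  thus ?case using Cons.IH[OF carr_eh[OF Cons(2)], of b] 1 2 assms(1)
  by (cases "set u <= An"; cases "b : An") (auto simp: V)
 qed (simp add: V)
 thus ?thesis by (simp add: carr_def fh_def)
qed

lemma eh_fh: "eh b (fh a F) = fh a (eh b F) + (if a = b then fscl (1 / qd a) (kh a F - khi a F) else 0)"
proof
 fix u
 have "eh b (fh a F) u = fh' a (b # u) F" by (simp add: eh_def fh_def)
 thus "eh b (fh a F) u = (fh a (eh b F) + (if a = b then fscl (1 / qd a) (kh a F - khi a F) else 0)) u"
  by (simp add: fh_def fscl_app plus_app)
qed

lemma fh_Nil: "fh a F [] = 0" by (simp add: fh_def)

lemma kh_khi: "a : An ==> F : carr ==> kh a (khi a F) = F" "a : An ==> F : carr ==> khi a (kh a F) = F"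
 by (rule ext, simp add: kh_def khi_def lin K_Ki Ki_K carrD)+

lemma kh_kh: "a : An ==> b : An ==> F : carr ==> kh a (kh b F) = kh b (kh a F)"
 "a : An ==> b : An ==> F : carr ==> kh a (khi b F) = khi b (kh a F)"
 "a : An ==> b : An ==> F : carr ==> khi a (khi b F) = khi b (khi a F)"
 by (auto simp: kh_def khi_def lin K_K K_Ki_commute Ki_Ki carrD mult.commute)

lemma kh_eh: "kh a (eh b F) = fscl (s powi sym2 T a b) (eh b (kh a F))"
 "khi a (eh b F) = fscl (s powi (- sym2 T a b)) (eh b (khi a F))" by (auto simp: kh_def khi_def eh_def fscl_def simp flip: power_int_add)

lemma kh_fh:
 assumes "a : An" "b : An" "F : carr"
 shows "kh a (fh b F) = fscl (s powi (- sym2 T a b)) (fh b (kh a F))"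
  "khi a (fh b F) = fscl (s powi sym2 T a b) (fh b (khi a F))"
proof -
 have "scl (s powi (- cont a u)) (K a (fh' b u F)) = scl (s powi (- sym2 T a b)) (fh' b u (kh a F))" for u using assms(3)
 proof (induction u arbitrary: F)
  case (Cons c u)
  have e: "s powi (- cont a (c # u)) = s powi (- sym2 T a c) * s powi (- cont a u)" by (simp flip: power_int_add)
  have ce: "scl (s powi (- sym2 T a c)) (scl (s powi (- cont a u)) (K a (fh' b u (eh c F)))) =
  scl (s powi (- sym2 T a b)) (fh' b u (eh c (kh a F)))"
  unfolding Cons.IH[OF carr_eh[OF Cons(2)]] kh_eh fh'_scl by (simp add: scale_left_commute scl_s_cancel)
  have kk: "scl (s powi (- cont a u)) (K a (kh b F u - khi b F u)) = kh b (kh a F) u - khi b (kh a F) u"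
  proof -
  have "scl (s powi (- cont a u)) (K a (kh b F u - khi b F u)) = kh a (kh b F) u - kh a (khi b F) u"
  by (simp add: kh_def op_diff scale_right_diff_distrib)
  thus ?thesis using kh_kh assms(1,2) Cons(2) by metis
  qed
  show ?case
  proof (cases "b = c")
  case True
  have "scl (s powi (- sym2 T a c)) (scl (s powi (- cont a u)) (K a (scl (1 / qd b) (kh b F u - khi b F u)))) =
  scl (s powi (- sym2 T a c)) (scl (1 / qd b) (kh b (kh a F) u - khi b (kh a F) u))"
  unfolding lin scale_left_commute[of "s powi (- cont a u)"] kk ..
  thus ?thesis using ce True by (simp add: lin scale_right_distrib del: scale_scale cont_simps minus_add_distrib)
  (simp only: e scale_scale[symmetric])
  next
  case False
  thus ?thesis using ce by (simp only: fh'.simps e scale_scale[symmetric] if_False add_0_right)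
  qed
 qed simp
 hence "kh a (fh b F) u = fscl (s powi (- sym2 T a b)) (fh b (kh a F)) u" for u
  unfolding fscl_app fh_def kh_def[of a "%u. fh' b u F"] .
 thus "kh a (fh b F) = fscl (s powi (- sym2 T a b)) (fh b (kh a F))" by blast
 have "scl (s powi cont a u) (Ki a (fh' b u F)) = scl (s powi sym2 T a b) (fh' b u (khi a F))" for u using assms(3)
 proof (induction u arbitrary: F)
  case (Cons c u)
  have e: "s powi cont a (c # u) = s powi sym2 T a c * s powi cont a u" by (simp flip: power_int_add)
  have ce: "scl (s powi sym2 T a c) (scl (s powi cont a u) (Ki a (fh' b u (eh c F)))) =
  scl (s powi sym2 T a b) (fh' b u (eh c (khi a F)))"
  unfolding Cons.IH[OF carr_eh[OF Cons(2)]] kh_eh fh'_scl by (simp add: scale_left_commute scl_s_cancel)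
  have kk: "scl (s powi cont a u) (Ki a (kh b F u - khi b F u)) = kh b (khi a F) u - khi b (khi a F) u"
  proof -
  have "scl (s powi cont a u) (Ki a (kh b F u - khi b F u)) = khi a (kh b F) u - khi a (khi b F) u"
  by (simp add: khi_def op_diff scale_right_diff_distrib)
  thus ?thesis using kh_kh assms(1,2) Cons(2) by metis
  qed
  show ?case
  proof (cases "b = c")
  case True
  have "scl (s powi sym2 T a c) (scl (s powi cont a u) (Ki a (scl (1 / qd b) (kh b F u - khi b F u)))) =
  scl (s powi sym2 T a c) (scl (1 / qd b) (kh b (khi a F) u - khi b (khi a F) u))"
  unfolding lin scale_left_commute[of "s powi cont a u"] kk ..
  thus ?thesis using ce True by (simp add: lin scale_right_distrib del: scale_scale cont_simps minus_add_distrib)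
  (simp only: e scale_scale[symmetric])
  next
  case False
  thus ?thesis using ce by (simp only: fh'.simps e scale_scale[symmetric] if_False add_0_right)
  qed
 qed simp
 hence "khi a (fh b F) u = fscl (s powi sym2 T a b) (fh b (khi a F)) u" for u
  unfolding fscl_app fh_def khi_def[of a "%u. fh' b u F"] .
 thus "khi a (fh b F) = fscl (s powi sym2 T a b) (fh b (khi a F))" by blast
qed

section \<open>Serre relations on functions of words\<close>

abbreviation "sopE a b n == serre_op fscl (serre_x a b) (eh a) (eh b) n"
abbreviation "sopF a b n == serre_op fscl (serre_x a b) (fh a) (fh b) n"

lemma khi_kh_neg: "fscl de (kh a F - khi a F) = - fscl de (khi a F - kh a F)" by (simp add: fv.scale_right_diff_distrib)

lemma fh_eh: "fh a (eh b F) = eh b (fh a F) + (if a = b then fscl (1 / qd a) (khi a F - kh a F) else 0)" by (simp add: eh_fh khi_kh_neg)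

text \<open>The shifts \<open>eh\<close> are opposite to the \<open>fh\<close> just as the
  \<open>fh\<close> are to the \<open>eh\<close>; \<open>kh\<close> and \<open>khi\<close> exchange
  roles, which matches the inverse scalars in \<open>kh_fh\<close> and the sign in
  \<open>fh_eh\<close>.\<close>

lemma sopF_eh:
 assumes ab: "a : An" "b : An" "a ~= b" and F: "F : carr"
 shows "sopF a b (s_num a b) (eh c F) = eh c (sopF a b (s_num a b) F)"
proof -
 note N = serre_num_rel[OF ab]
 have s0: "s ~= 0" by simp
 have x: "serre_x a b n = s powi (- (sym2 T a b + int n * sym2 T a a))" for n by (simp add: serre_x_def)
 consider "c = a" | "c = b" | "c ~= a" "c ~= b" by blast
 thus ?thesis
 proof cases
  case 1
  interpret serre_setting fscl "fh a" "fh b" "eh a" "khi a" "kh a" carr s "sym2 T a a" "sym2 T a b" "serre_x a b"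
  by unfold_locales (simp_all add: fh_add fh_scl h_add h_scl carr_fh carr_eh carr_kh carr_add carr_scl ab kh_fh)
  show ?thesis unfolding 1 by (rule sop_comm_A[where de = "1 / qd a"]) (use ab F x N in \<open>simp_all add: fh_eh kh_fh\<close>)
 next
  case 2
  interpret serre_setting fscl "fh a" "fh b" "eh b" "khi b" "kh b" carr s "sym2 T b a" "sym2 T a b" "serre_x a b"
  by unfold_locales (simp_all add: fh_add fh_scl h_add h_scl carr_fh carr_eh carr_kh carr_add carr_scl ab kh_fh)
  show ?thesis unfolding 2
  by (rule sop_comm_B[where de = "1 / qd b" and m' = "sym2 T a a"]) (use ab F x N sym2_sym in \<open>simp_all add: fh_eh kh_fh\<close>)
 next
  case 3
  interpret serre_setting fscl "fh a" "fh b" "eh c" "khi a" "kh a" carr s "sym2 T a a" "sym2 T a b" "serre_x a b"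
  by unfold_locales (simp_all add: fh_add fh_scl h_add h_scl carr_fh carr_eh carr_kh carr_add carr_scl ab kh_fh)
  show ?thesis using 3 F by (intro sop_comm) (simp_all add: fh_eh)
 qed
qed

text \<open>At the empty word every \<open>fh\<close> has the value 0, hence so has the Serre
  element. As this element commutes with the shifts, its value at any word is a value at the empty
  word.\<close>

lemma sopF_zero:
 assumes ab: "a : An" "b : An" "a ~= b" and F: "F : carr"
 shows "sopF a b (s_num a b) F = 0"
proof -
 have nil: "serre_op fscl x (fh a) (fh b) n F [] = 0" for n x F by (induction n arbitrary: F) (simp_all add: fh_Nil fscl_app)
 have "sopF a b (s_num a b) F u = 0" for u using F
 proof (induction u arbitrary: F)
  case (Cons c u)
  have "sopF a b (s_num a b) F (c # u) = eh c (sopF a b (s_num a b) F) u" by (simp add: eh_def)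
  also have "... = sopF a b (s_num a b) (eh c F) u" using sopF_eh[OF ab Cons(2)] by simp
  finally show ?case using Cons carr_eh by simp
 qed (rule nil)
 thus ?thesis by auto
qed

lemma sopE_fh:
 assumes ab: "a : An" "b : An" "a ~= b" and c: "c : An" and F: "F : carr"
 shows "sopE a b (s_num a b) (fh c F) = fh c (sopE a b (s_num a b) F)"
proof -
 note N = serre_num_rel[OF ab]
 have x: "serre_x a b n = s powi (- (sym2 T a b + int n * sym2 T a a))" for n by (simp add: serre_x_def)
 consider "c = a" | "c = b" | "c ~= a" "c ~= b" by blast
 thus ?thesis
 proof cases
  case 1
  interpret serre_setting fscl "eh a" "eh b" "fh a" "kh a" "khi a" carr s "sym2 T a a" "sym2 T a b" "serre_x a b"
  by unfold_locales (simp_all add: fh_add fh_scl h_add h_scl carr_fh carr_eh carr_kh carr_add carr_scl ab kh_eh)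
  show ?thesis unfolding 1 by (rule sop_comm_A[where de = "1 / qd a"]) (use ab F x N in \<open>simp_all add: eh_fh kh_eh\<close>)
 next
  case 2
  interpret serre_setting fscl "eh a" "eh b" "fh b" "kh b" "khi b" carr s "sym2 T b a" "sym2 T a b" "serre_x a b"
  by unfold_locales (simp_all add: fh_add fh_scl h_add h_scl carr_fh carr_eh carr_kh carr_add carr_scl ab kh_eh)
  show ?thesis unfolding 2
  by (rule sop_comm_B[where de = "1 / qd b" and m' = "sym2 T a a"]) (use ab F x N sym2_sym in \<open>simp_all add: eh_fh kh_eh\<close>)
 next
  case 3
  interpret serre_setting fscl "eh a" "eh b" "fh c" "kh a" "khi a" carr s "sym2 T a a" "sym2 T a b" "serre_x a b"
  by unfold_locales (simp_all add: fh_add fh_scl h_add h_scl carr_fh carr_eh carr_kh carr_add carr_scl ab kh_eh c)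
  show ?thesis using 3 F by (intro sop_comm) (simp_all add: eh_fh)
 qed
qed

lemma sopE_lin: "sopE a b n (F + G) = sopE a b n F + sopE a b n G" "sopE a b n (fscl c F) = fscl c (sopE a b n F)"
 by (induction n arbitrary: F G) (simp_all add: h_add h_scl fv.scale_right_distrib fv.scale_right_diff_distrib mult.commute)

lemma sopE_diff: "sopE a b n (F - G) = sopE a b n F - sopE a b n G"
 using sopE_lin(1)[of a b n F "fscl (-1) G"] sopE_lin(2)[of a b n "-1" G] by simp

lemma sopE_kh: "EX t. sopE a b n (kh c F) = fscl t (kh c (sopE a b n F))" "EX t. sopE a b n (khi c F) = fscl t (khi c (sopE a b n F))"
proof -
 have gen: "sopE a b n (op F) = fscl (be b * be a ^ n) (op (sopE a b n F))"
  if k: "!!b F. eh b (op F) = fscl (be b) (op (eh b F))"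
  and op: "!!t F. op (fscl t F) = fscl t (op F)" "!!F G. op (F - G) = op F - op G" for op be n F
 proof (induction n arbitrary: F)
  case (Suc n)
  show ?case by (simp only: serre_op.simps Suc.IH k op h_scl sopE_lin fv.scale_right_diff_distrib fv.scale_scale
  power_Suc mult_ac)
 qed (simp add: k)
 show "EX t. sopE a b n (kh c F) = fscl t (kh c (sopE a b n F))"
  by (rule exI, rule gen[where be = "%b. s powi (- sym2 T c b)"]) (simp_all only: h_scl h_diff kh_eh fv.scale_scale s_inv fv.scale_one)
 show "EX t. sopE a b n (khi c F) = fscl t (khi c (sopE a b n F))"
  by (rule exI, rule gen[where be = "%b. s powi (sym2 T c b)"]) (simp_all only: h_scl h_diff kh_eh fv.scale_scale s_inv fv.scale_one)
qed

text \<open>The shifts satisfy no Serre relations on \<open>carr\<close>, so \<open>ind\<close>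
  imposes them after every sequence of shifts. That it remains stable under the \<open>fh\<close>
  rests on \<open>sopE_fh\<close>.\<close>

definition ind :: "(anode list => 'v) set" where
 "ind = {F : carr. ALL a:An. ALL b:An. a ~= b -->
  (ALL u. set u <= An --> sopE a b (s_num a b) (fold eh u F) = 0)}"

lemma fold_eh_lin: "fold eh u (F + G) = fold eh u F + fold eh u G" "fold eh u (fscl c F) = fscl c (fold eh u F)"
 by (induction u arbitrary: F G) (simp_all add: h_add h_scl)

lemma fold_eh_diff: "fold eh u (F - G) = fold eh u F - fold eh u G"
 using fold_eh_lin(1)[of u F "fscl (-1) G"] fold_eh_lin(2)[of u "-1" G] by simp

lemma fold_eh_kh: "EX t. fold eh u (kh c F) = fscl t (kh c (fold eh u F))" "EX t. fold eh u (khi c F) = fscl t (khi c (fold eh u F))"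
proof -
 have "fold eh u (kh c F) = fscl (s powi (- cont c u)) (kh c (fold eh u F))"
 proof (induction u arbitrary: F)
  case (Cons b u)
  have "eh b (kh c F) = fscl (s powi (- sym2 T c b)) (kh c (eh b F))" by (simp add: kh_eh)
  moreover have "s powi (- cont c (b # u)) = s powi (- sym2 T c b) * s powi (- cont c u)"
  unfolding power_int_add[OF disjI1[OF s_nz], symmetric] by (rule arg_cong[where f = "power_int s"]) simp
  ultimately show ?case using Cons by (simp add: fold_eh_lin del: cont_simps)
 qed simp
 thus "EX t. fold eh u (kh c F) = fscl t (kh c (fold eh u F))" by blast
 have "fold eh u (khi c F) = fscl (s powi (cont c u)) (khi c (fold eh u F))"
 proof (induction u arbitrary: F)
  case (Cons b u)
  have "eh b (khi c F) = fscl (s powi (sym2 T c b)) (khi c (eh b F))" by (simp add: kh_eh)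
  moreover have "s powi (cont c (b # u)) = s powi (sym2 T c b) * s powi (cont c u)"
  unfolding power_int_add[OF disjI1[OF s_nz], symmetric] by (rule arg_cong[where f = "power_int s"]) simp
  ultimately show ?case using Cons by (simp add: fold_eh_lin del: cont_simps)
 qed simp
 thus "EX t. fold eh u (khi c F) = fscl t (khi c (fold eh u F))" by blast
qed

lemma ind_carr: "F : ind ==> F : carr" by (simp add: ind_def)

lemma indD: "F : ind ==> a : An ==> b : An ==> a ~= b ==> set u <= An ==>
  sopE a b (s_num a b) (fold eh u F) = 0" by (simp add: ind_def)

lemma ind_0: "0 : ind" using fold_eh_lin(2)[of _ 0 0] sopE_lin(2)[of _ _ _ 0 0] by (simp add: ind_def carr_0)

lemma ind_add: "F : ind ==> G : ind ==> F + G : ind"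
 by (simp add: ind_def carr_add fold_eh_lin sopE_lin)

lemma ind_scl: "F : ind ==> fscl c F : ind" by (simp add: ind_def carr_scl fold_eh_lin sopE_lin)

lemma ind_diff: "F : ind ==> G : ind ==> F - G : ind"
 by (simp add: ind_def carr_diff fold_eh_diff sopE_diff)

lemma ind_eh:
 assumes "c : An" "F : ind"
 shows "eh c F : ind"
proof -
 have "sopE a b (s_num a b) (fold eh u (eh c F)) = 0"
  if "a : An" "b : An" "a ~= b" "set u <= An" for a b u
  using indD[OF assms(2) that(1-3), of "c # u"] assms(1) that by simp
 thus ?thesis using carr_eh[OF ind_carr[OF assms(2)]] by (simp add: ind_def)
qed

lemma ind_kh:
 assumes "c : An" "F : ind"
 shows "kh c F : ind" "khi c F : ind"
proof -
 have "sopE a b (s_num a b) (fold eh u (kh c F)) = 0"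
  if "a : An" "b : An" "a ~= b" "set u <= An" for a b u
 proof -
  obtain t where t: "fold eh u (kh c F) = fscl t (kh c (fold eh u F))" using fold_eh_kh(1) by blast
  obtain t' where "sopE a b (s_num a b) (kh c (fold eh u F)) = fscl t' (kh c (sopE a b (s_num a b) (fold eh u F)))"
  using sopE_kh(1) by blast
  thus ?thesis using indD[OF assms(2) that] t by (simp add: sopE_lin h_zero)
 qed
 thus "kh c F : ind" using carr_kh[OF assms(1) ind_carr[OF assms(2)]] by (simp add: ind_def)
 have "sopE a b (s_num a b) (fold eh u (khi c F)) = 0"
  if "a : An" "b : An" "a ~= b" "set u <= An" for a b u
 proof -
  obtain t where t: "fold eh u (khi c F) = fscl t (khi c (fold eh u F))" using fold_eh_kh(2) by blast
  obtain t' where "sopE a b (s_num a b) (khi c (fold eh u F)) = fscl t' (khi c (sopE a b (s_num a b) (fold eh u F)))"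
  using sopE_kh(2) by blast
  thus ?thesis using indD[OF assms(2) that] t by (simp add: sopE_lin h_zero)
 qed
 thus "khi c F : ind" using carr_kh[OF assms(1) ind_carr[OF assms(2)]] by (simp add: ind_def)
qed

text \<open>\<open>fh c\<close> is moved out through the shifts of the word: for the empty word
  \<open>sopE_fh\<close> applies, and the Cartan terms produced on the way lie in \<open>ind\<close>
  already.\<close>

lemma ind_fh:
 assumes c: "c : An" and F: "F : ind"
 shows "fh c F : ind"
proof -
 have "sopE a b (s_num a b) (fold eh u (fh c F)) = 0"
  if ab: "a : An" "b : An" "a ~= b" and "set u <= An" for a b u using F that(4)
 proof (induction u arbitrary: F)
  case Nil
  thus ?case using sopE_fh[OF ab c ind_carr[OF Nil(1)]] indD[OF Nil(1) ab, of "[]"] by (simp add: fh_zero)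
 next
  case (Cons d u)
  have z: "sopE a b (s_num a b) (fold eh u G) = 0" if "G : ind" for G using indD[OF that ab] Cons(3) by simp
  have 1: "fold eh (d # u) (fh c F) = fold eh u (fh c (eh d F)) +
  fold eh u (if c = d then fscl (1 / qd c) (kh c F - khi c F) else 0)" by (simp add: eh_fh fold_eh_lin)
  have 2: "sopE a b (s_num a b) (fold eh u (fh c (eh d F))) = 0" by (rule Cons.IH) (use Cons(2,3) ind_eh in auto)
  have 3: "(if c = d then fscl (1 / qd c) (kh c F - khi c F) else 0) : ind"
  proof (cases "c = d")
  case True
  thus ?thesis unfolding if_P[OF True] by (intro ind_scl ind_diff ind_kh c Cons(2))
  qed (simp add: ind_0)
  show ?case unfolding 1 sopE_lin 2 z[OF 3] by (rule add_0_right)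
 qed
 thus ?thesis using carr_fh[OF c ind_carr[OF F]] by (simp add: ind_def)
qed

section \<open>The action of the whole algebra on the induced module\<close>

fun fop :: "gen => (anode list => 'v) => anode list => 'v" where
 "fop (Ch Pl a) = eh a"
| "fop (Ch Mi a) = fh a"
| "fop (Kg a) = kh a"
| "fop (Kinvg a) = khi a"

sublocale fa: free_action fscl fop
proof
 fix g F G c
 show "fop g (F + G) = fop g F + fop g G" "fop g (fscl c F) = fscl c (fop g F)"
  by (cases g rule: fop.cases; simp add: h_add h_scl fh_add fh_scl)+
qed

abbreviation "iact == alg_act fscl fop"

lemma fa_right_zero: "iact a 0 = 0" using fa.act_sclr[of a 0 0] by simp

lemma iact_in: "a : chev ==> F : ind ==> iact a F : ind" unfolding chev_alg_def
proof (induction a arbitrary: F rule: subalg.induct)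
 case (gen a)
 thus ?case by (auto simp: ind_eh ind_fh ind_kh)
qed (simp_all add: fa.act_add fa.act_mult ind_add ind_scl)

text \<open>On a word the product of the \<open>k\<close>s picks up the total exponent over the
  labels, and this is 0 letter by letter, because the labels are a null vector of the affine matrix.
  What remains is the relation \<open>K_delta\<close> on the values in \<open>V\<close>.\<close>

lemma iact_k_delta: "F : ind ==> iact (k_delta T) F = F"
proof -
 assume "F : ind"
 hence F: "F : carr" by (rule ind_carr)
 let ?L = "Eps # map Orb (sorted_list_of_set (Rp))"
 have pw: "(kh a ^^ n) F u = scl (s powi (- (int n * cont a u))) ((K a ^^ n) (F u))" for a n F u
 proof (induction n arbitrary: F)
  case (Suc n)
  have "s powi (- (int (Suc n) * cont a u)) = s powi (- (int n * cont a u)) * s powi (- cont a u)"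
  unfolding power_int_add[OF disjI1[OF s_nz], symmetric] by (rule arg_cong[where f = "power_int s"]) (simp add: algebra_simps)
  moreover have "(K a ^^ n) (scl c v) = scl c ((K a ^^ n) v)" for c v by (induction n) (simp_all add: lin)
  moreover have "kh a F u = scl (s powi (- cont a u)) (K a (F u))" by (simp add: kh_def)
  ultimately show ?case using Suc[of "kh a F"] by (simp add: funpow_Suc_right del: funpow.simps)
 qed simp
 have fl: "foldr (%a. kh a ^^ kac_label T a) L F u =
  scl (s powi (- (SUM a<-L. int (kac_label T a) * cont a u))) (foldr (%a. K a ^^ kac_label T a) L (F u))" for L u
 proof (induction L)
  case (Cons a L)
  have "s powi (- (SUM a<-a # L. int (kac_label T a) * cont a u)) =
  s powi (- (int (kac_label T a) * cont a u)) * s powi (- (SUM a<-L. int (kac_label T a) * cont a u))"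
  unfolding power_int_add[OF disjI1[OF s_nz], symmetric] by (rule arg_cong[where f = "power_int s"]) simp
  moreover have "(K a ^^ n) (scl c v) = scl c ((K a ^^ n) v)" for c v n by (induction n) (simp_all add: lin)
  ultimately show ?case using Cons by (simp add: pw)
 qed simp
 have "(SUM a<-?L. int (kac_label T a) * cont a u) = 0" if "set u <= An" for u
 proof -
  have "(SUM a<-?L. int (kac_label T a) * cont a u) = (SUM a:An. int (kac_label T a) * cont a u)"
  unfolding sum_anodes by (simp add: comp_def sum_list_distinct_conv_sum_set)
  also have "... = 0" using that
  proof (induction u)
  case (Cons b u)
  thus ?case using sum_kac_sym2[of b] by (simp add: distrib_left sum.distrib)
  qed simp
  finally show ?thesis .
 qed
 hence "foldr (%a. kh a ^^ kac_label T a) ?L F u = F u" for u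
  unfolding fl K_delta[OF carrD(1)[OF F]] using carrD(2)[OF F, of u] by (cases "set u <= An") simp_all
 hence *: "foldr (%a. kh a ^^ kac_label T a) ?L F = F" by blast
 have "iact (kk a ^ n) G = (kh a ^^ n) G" for a n G by (induction n) (simp_all add: fa.act_mult)
 hence pl: "iact (prod_list (map (%a. kk a ^ kac_label T a) L)) G = foldr (%a. kh a ^^ kac_label T a) L G" for L G
  by (induction L) (simp_all add: fa.act_mult)
 show ?thesis unfolding k_delta_def pl by (rule *)
qed

lemma iact_relations: "r : relations T ==> F : ind ==> iact r F = 0"
proof -
 assume r: "r : relations T" and F: "F : ind"
 note Fc = ind_carr[OF F]
 have k1: "iact (kk a * kinv a - 1) F = 0" "iact (kinv a * kk a - 1) F = 0" if "a : An" for a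
  using that Fc by (simp_all add: fa.act_diff fa.act_mult kh_khi)
 have k2: "iact (comm (kk a) (kk b)) F = 0" if "a : An" "b : An" for a b
  using that Fc by (simp add: comm_def fa.act_diff fa.act_mult kh_kh)
 have k3: "iact (kk a * ee p b - sc (qn T a powi (sgn_int p * aff_cartan T a b)) * ee p b * kk a) F = 0"
  if "a : An" "b : An" for a b p
 proof -
  have "qn T a powi (sgn_int p * aff_cartan T a b) = s powi (sgn_int p * sym2 T a b)"
  using qn_powi_cartan[OF that] by (cases p) (simp_all add: power_int_minus)
  thus ?thesis using that Fc by (cases p) (simp_all add: fa.act_diff fa.act_mult mult.assoc kh_eh kh_fh)
 qed
 have k4: "iact (comm (ee Pl a) (ee Mi b)
  - (if a = b then sc (1 / (qn T a - inverse (qn T a))) * (kk a - kinv a) else 0)) F = 0" for a b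
  by (auto simp: comm_def fa.act_diff fa.act_mult eh_fh qd_def)
 have k5: "iact (serre T p a b) F = 0" if "a : An" "b : An" "a ~= b" for a b p
 proof -
  have "iact (ee Pl a) = eh a" "iact (ee Mi a) = fh a" for a by (simp_all add: fun_eq_iff)
  thus ?thesis unfolding serre_eq[OF that] fa.act_qcomm_iter
  using indD[OF F that, of "[]"] sopF_zero[OF that Fc] by (cases p) simp_all
 qed
 have k6: "iact (k_delta T - 1) F = 0" using iact_k_delta[OF F] by (simp add: fa.act_diff)
 show ?thesis using r k1 k2 k3 k4 k5 k6 unfolding relations_def by blast
qed

lemma iact_relI: "z : relI ==> F : ind ==> iact z F = 0" unfolding rel_ideal_def
 by (induction rule: ideal_gen.induct)
  (simp_all add: fa.act_add fa.act_mult iact_relations iact_in fa_right_zero)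

sublocale ind: rep_on T fscl chev ind iact by unfold_locales
  (simp_all add: relI_chev chevI ind_0 ind_add ind_scl iact_in fa.act_add fa.act_mult
  fa.act_add_right fa.act_sclr iact_relI)

text \<open>For a vector of \<open>V\<close> no projection is involved, since the \<open>e\<close>s
  preserve \<open>V\<close>.\<close>

definition emb :: "'v => anode list => 'v" where
 "emb w = (%u. if set u <= An then fold E u w else 0)"

lemma fold_E_lin: "fold E u (v + w) = fold E u v + fold E u w" "fold E u (scl c v) = scl c (fold E u v)"
 by (induction u arbitrary: v w) (simp_all add: lin)

lemma emb_add: "emb (v + w) = emb v + emb w" and emb_scl: "emb (scl c v) = fscl c (emb v)" by (auto simp: emb_def fold_E_lin fscl_def)

lemma emb_0: "emb 0 = 0" using emb_scl[of 0 0] by simp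

lemma emb_diff: "emb (v - w) = emb v - emb w" using emb_add[of v "scl (-1) w"] emb_scl[of "-1" w] by simp

lemma emb_Nil [simp]: "emb w [] = w" by (simp add: emb_def)

lemma emb_inj: "emb v = emb w \<longleftrightarrow> v = w" using emb_Nil by metis

lemma eh_emb: "a : An ==> eh a (emb w) = emb (E a w)" by (auto simp: eh_def emb_def)

lemma kh_emb: "a : An ==> w : V ==> kh a (emb w) = emb (K a w)"
 "a : An ==> w : V ==> khi a (emb w) = emb (Ki a w)"
 by (auto simp: kh_def khi_def emb_def K_fold Ki_fold scl_s_cancel)

lemma fold_E_V: "set u <= An ==> w : V ==> fold E u w : V"
 by (induction u arbitrary: w) (simp_all add: V)

lemma emb_carr: "w : V ==> emb w : carr" by (auto simp: carr_def emb_def fold_E_V V)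

lemma emb_ind: "w : V ==> emb w : ind"
proof -
 assume w: "w : V"
 have fold: "fold eh u (emb w) = emb (fold E u w)" if "set u <= An" for u w
  using that by (induction u arbitrary: w) (simp_all add: eh_emb)
 have op: "sopE a b n (emb w) = emb (serre_op scl (serre_x a b) (E a) (E b) n w)"
  if "a : An" "b : An" for a b n w using that by (induction n arbitrary: w) (simp_all add: eh_emb emb_diff emb_scl)
 show ?thesis using w emb_carr[OF w] fold_E_V by (simp add: ind_def fold op E_serre emb_0)
qed

text \<open>The letters \<open>f\<close> have no meaning on \<open>V\<close>; their value 0 is a
  placeholder, since \<open>vact\<close> serves for expressions in the Borel generators.\<close>

fun vop :: "gen => 'v => 'v" where
 "vop (Ch Pl a) = E a"
| "vop (Ch Mi a) = (%_. 0)"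
| "vop (Kg a) = K a"
| "vop (Kinvg a) = Ki a"

sublocale va: free_action scl vop
proof
 fix g v w c
 show "vop g (v + w) = vop g v + vop g w" "vop g (scl c v) = scl c (vop g v)" by (cases g rule: vop.cases; simp add: lin)+
qed

abbreviation "vact == alg_act scl vop"

lemma iact_emb: "a : subalg bgens ==> w : V ==> vact a w : V & iact a (emb w) = emb (vact a w)"
proof (induction a arbitrary: w rule: subalg.induct)
 case (gen a)
 thus ?case by (auto simp: V eh_emb kh_emb)
qed (simp_all add: fa.act_add fa.act_mult va.act_add va.act_mult emb_add emb_scl V)

text \<open>The nontrivial half of a triangular decomposition. The module embeds into an induced
  module of the whole algebra, so an expression in the Borel generators that vanishes in the whole
  algebra must act by 0, although only Borel relations were assumed.\<close>

lemma vact_relI: "z : relI ==> z : subalg bgens ==> w : V ==> vact z w = 0"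
 using iact_emb[of z w] iact_relI[OF _ emb_ind, of z w] emb_inj[of "vact z w" 0] by (simp add: emb_0)

end

section \<open>Normal forms in the Borel subalgebra\<close>

context twisted
begin

section \<open>The defining relations as congruences\<close>

lemma rel_kinv: "a : An ==> kk a * kinv a ~~ 1" "a : An ==> kinv a * kk a ~~ 1"
 unfolding ueq_def by (rule relI_rel; unfold relations_def; blast)+

lemma rel_kk_comm: "a : An ==> b : An ==> kk a * kk b ~~ kk b * kk a"
 unfolding ueq_def comm_def[symmetric] by (rule relI_rel; unfold relations_def; blast)

lemma rel_kk_ee:
 assumes "a : An" "b : An"
 shows "kk a * ee p b ~~ sc (s powi (sgn_int p * sym2 T a b)) * (ee p b * kk a)"
proof -
 have "kk a * ee p b - sc (qn T a powi (sgn_int p * aff_cartan T a b)) * ee p b * kk a : relI"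
  by (rule relI_rel) (use assms in \<open>unfold relations_def, blast\<close>)
 moreover have "qn T a powi (sgn_int p * aff_cartan T a b) = s powi (sgn_int p * sym2 T a b)"
  using qn_powi_cartan[OF assms] by (cases p) (simp_all add: power_int_minus)
 ultimately show ?thesis by (simp add: ueq_def mult.assoc)
qed

lemma rel_ee_comm:
 assumes "a : An" "b : An"
 shows "ee Pl a * ee Mi b ~~ ee Mi b * ee Pl a + (if a = b then sc (1 / qd a) * (kk a - kinv a) else 0)"
proof -
 have "comm (ee Pl a) (ee Mi b) - (if a = b then sc (1 / (qn T a - inverse (qn T a))) * (kk a - kinv a) else 0) : relI"
  by (rule relI_rel) (use assms in \<open>unfold relations_def, blast\<close>)
 thus ?thesis unfolding ueq_def comm_def qd_def diff_diff_eq by simp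
qed

lemma rel_k_delta: "k_delta T ~~ 1" unfolding ueq_def by (rule relI_rel) (simp add: relations_def)

lemma ueq_multl: "a : chev ==> b ~~ c ==> a * b ~~ a * c"
 unfolding ueq_def right_diff_distrib[symmetric] by (rule relI_left)

lemma ueq_multr: "c : chev ==> a ~~ b ==> a * c ~~ b * c"
 unfolding ueq_def left_diff_distrib[symmetric] by (rule relI_right)

lemma ueq_cancel_kk:
 assumes "a : An" "x : chev" "y : chev" "kk a * x ~~ kk a * y"
 shows "x ~~ y"
proof -
 have 1: "kinv a * (kk a * x) ~~ kinv a * (kk a * y)" by (rule ueq_multl[OF chev_gen(3)[OF assms(1)] assms(4)])
 have 2: "kinv a * (kk a * z) ~~ z" if "z : chev" for z
  using ueq_multr[OF that rel_kinv(2)[OF assms(1)]] by (simp add: mult.assoc)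
 show ?thesis using ueq_trans[OF ueq_sym[OF 2[OF assms(2)]] ueq_trans[OF 1 2[OF assms(3)]]] .
qed

lemma kinv_swap:
 assumes a: "a : An" and y: "y : chev" and k: "kk a * y ~~ sc (s powi w) * (y * kk a)"
 shows "kinv a * y ~~ sc (s powi (- w)) * (y * kinv a)"
proof -
 have inv: "s powi (- w) * s powi w = 1" by (simp flip: power_int_add)
 have "kinv a * (kk a * y) * kinv a ~~ kinv a * (sc (s powi w) * (y * kk a)) * kinv a"
  using a by (intro ueq_multl ueq_multr k chev_gen)
 moreover have "kinv a * (kk a * y) * kinv a ~~ y * kinv a" using ueq_multr[OF _ rel_kinv(2)[OF a], of "y * kinv a"] a y
  by (simp add: mult.assoc chevI chev_gen)
 moreover have "kinv a * (sc (s powi w) * (y * kk a)) * kinv a ~~ sc (s powi w) * (kinv a * y)"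
  using ueq_multl[OF _ rel_kinv(1)[OF a], of "sc (s powi w) * (kinv a * y)"] a y
  by (simp add: mult.assoc chevI chev_gen sc_lcomm)
 ultimately have "y * kinv a ~~ sc (s powi w) * (kinv a * y)" using ueq_trans ueq_sym by meson
 hence "sc (s powi (- w)) * (y * kinv a) ~~ sc (s powi (- w)) * (sc (s powi w) * (kinv a * y))" by (rule ueq_sc)
 thus ?thesis using inv by (simp add: ueq_sym)
qed

lemma kinv_ee:
 assumes "a : An" "b : An"
 shows "kinv a * ee p b ~~ sc (s powi (- (sgn_int p * sym2 T a b))) * (ee p b * kinv a)"
 using assms by (intro kinv_swap rel_kk_ee chev_gen)

lemma kk_kinv_comm:
 assumes "a : An" "b : An"
 shows "kk a * kinv b ~~ kinv b * kk a"
 using ueq_sym[OF kinv_swap[OF assms(2) chev_gen(2)[OF assms(1)], of 0]] rel_kk_comm[OF assms(2,1)] by simp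

lemma kinv_kinv_comm:
 assumes "a : An" "b : An"
 shows "kinv a * kinv b ~~ kinv b * kinv a"
 using kinv_swap[OF assms(1) chev_gen(3)[OF assms(2)], of 0] kk_kinv_comm[OF assms] by simp

subsection \<open>Monomials\<close>

definition ew :: "anode list => falg" where
 "ew u = prod_list (map (ee Pl) u)"

lemma ew_simps [simp]: "ew [] = 1" "ew (a # u) = ee Pl a * ew u" "ew (u @ w) = ew u * ew w" by (simp_all add: ew_def)

lemma ew_chev: "set u <= An ==> ew u : chev" by (induction u) (simp_all add: chevI chev_gen)

lemma k_ew:
 assumes a: "a : An"
 shows "set u <= An ==> kk a * ew u ~~ sc (s powi cont a u) * (ew u * kk a)"
  "set u <= An ==> kinv a * ew u ~~ sc (s powi (- cont a u)) * (ew u * kinv a)"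
proof -
 have gen: "k * ew u ~~ sc (s powi (e * cont a u)) * (ew u * k)"
  if k: "k : chev" "!!b. b : An ==> k * ee Pl b ~~ sc (s powi (e * sym2 T a b)) * (ee Pl b * k)"
  and u: "set u <= An" for k e using u
 proof (induction u)
  case (Cons b u)
  hence b: "b : An" and u: "set u <= An" by auto
  have "k * ew (b # u) = (k * ee Pl b) * ew u" by (simp add: mult.assoc)
  also have "... ~~ (sc (s powi (e * sym2 T a b)) * (ee Pl b * k)) * ew u" by (intro ueq_multr k b ew_chev u)
  also have "... = sc (s powi (e * sym2 T a b)) * (ee Pl b * (k * ew u))" by (simp add: mult.assoc)
  also have "... ~~ sc (s powi (e * sym2 T a b)) * (ee Pl b * (sc (s powi (e * cont a u)) * (ew u * k)))"
  by (intro ueq_sc ueq_multl Cons.IH u chev_gen b)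
  also have "... = sc (s powi (e * cont a (b # u))) * (ew (b # u) * k)"
  by (simp add: distrib_left power_int_add mult.assoc sc_lcomm[of "ee Pl b"])
  finally show ?case .
 qed simp
 show "set u <= An ==> kk a * ew u ~~ sc (s powi cont a u) * (ew u * kk a)"
  using gen[of "kk a" 1] rel_kk_ee[OF a, of _ Pl] chev_gen[OF a] by simp
 show "set u <= An ==> kinv a * ew u ~~ sc (s powi (- cont a u)) * (ew u * kinv a)"
  using gen[of "kinv a" "-1"] kinv_ee[OF a, of _ Pl] chev_gen[OF a] by simp
qed

definition kz :: "nat => int => falg" where
 "kz j m = (if m >= 0 then kO j ^ nat m else kI j ^ nat (- m))"

definition klist :: "nat list => (nat => int) => falg" where
 "klist L n = prod_list (map (%j. kz j (n j)) L)"

abbreviation "replist == sorted_list_of_set (Rp)"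

definition kmon :: "(nat => int) => falg" where
 "kmon n = klist replist n"

lemma Orb_an: "j : Rp ==> Orb j : An" and Eps_anodes: "Eps : An" by (simp_all add: anodes_def)

lemma kz_chev: "j : Rp ==> kz j m : chev" by (simp add: kz_def chevI chev_gen Orb_an)

lemma klist_chev: "set L <= Rp ==> klist L n : chev"
 by (induction L) (simp_all add: klist_def chevI kz_chev)

lemma kmon_chev: "kmon n : chev" unfolding kmon_def by (rule klist_chev) simp

lemma kz_step:
 assumes "j : Rp"
 shows "kO j * kz j m ~~ kz j (m + 1)" "kI j * kz j m ~~ kz j (m - 1)"
proof -
 note c = chev_gen[OF Orb_an[OF assms]]
 note r = rel_kinv[OF Orb_an[OF assms]]
 show "kO j * kz j m ~~ kz j (m + 1)"
 proof (cases "m >= 0")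
  case True
  hence "nat (m + 1) = Suc (nat m)" by simp
  thus ?thesis using True by (simp add: kz_def)
 next
  case False
  hence e: "nat (- m) = Suc (nat (- m - 1))" by simp
  have "kO j * kz j m = (kO j * kI j) * kI j ^ nat (- m - 1)" using False by (simp add: kz_def e mult.assoc)
  also have "... ~~ 1 * kI j ^ nat (- m - 1)" by (intro ueq_multr r chevI c)
  also have "... = kz j (m + 1)" using False by (cases "m = -1") (auto simp: kz_def)
  finally show ?thesis .
 qed
 show "kI j * kz j m ~~ kz j (m - 1)"
 proof (cases "m >= 1")
  case True
  hence e: "nat m = Suc (nat (m - 1))" by simp
  have "kI j * kz j m = (kI j * kO j) * kO j ^ nat (m - 1)" using True by (simp add: kz_def e mult.assoc)
  also have "... ~~ 1 * kO j ^ nat (m - 1)" by (intro ueq_multr r chevI c)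
  also have "... = kz j (m - 1)" using True by (simp add: kz_def)
  finally show ?thesis .
 next
  case False
  hence "nat (- (m - 1)) = Suc (nat (- m))" by simp
  thus ?thesis using False by (cases "m = 0") (auto simp: kz_def)
 qed
qed

lemma power_comm_ueq:
 assumes "x : chev" "y : chev" "x * y ~~ y * x"
 shows "x * y ^ n ~~ y ^ n * x"
proof (induction n)
 case (Suc n)
 have "x * y ^ Suc n = (x * y) * y ^ n" by (simp add: mult.assoc)
 also have "... ~~ (y * x) * y ^ n" using assms by (intro ueq_multr chevI)
 also have "... = y * (x * y ^ n)" by (simp add: mult.assoc)
 also have "... ~~ y * (y ^ n * x)" using Suc assms by (intro ueq_multl)
 also have "... = y ^ Suc n * x" by (simp add: mult.assoc)
 finally show ?case .
qed simp

lemma klist_step: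
 assumes j: "j : Rp"
 shows "set L <= Rp ==> distinct L ==> j : set L ==> kO j * klist L n ~~ klist L (n(j := n j + 1))"
  "set L <= Rp ==> distinct L ==> j : set L ==> kI j * klist L n ~~ klist L (n(j := n j - 1))"
proof -
 have gen: "k * klist L n ~~ klist L (n(j := n j + e))"
  if k: "k : chev" "!!m. k * kz j m ~~ kz j (m + e)" "!!i m. i : Rp ==> k * kz i m ~~ kz i m * k"
  and L: "set L <= Rp" "distinct L" "j : set L" for k e using L
 proof (induction L)
  case (Cons i L)
  have i: "i : Rp" and L: "set L <= Rp" using Cons(2) by auto
  have Lc: "klist L n : chev" for n using L by (rule klist_chev)
  have 0: "k * klist (i # L) n = (k * kz i (n i)) * klist L n" by (simp add: klist_def mult.assoc)
  show ?case
  proof (cases "i = j")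
  case True
  hence "klist L (n(j := n j + e)) = klist L n"
  using Cons(3) unfolding klist_def by (intro arg_cong[where f = prod_list] map_cong) auto
  moreover have "(k * kz i (n i)) * klist L n ~~ kz i (n i + e) * klist L n" using True k(2) by (intro ueq_multr Lc) simp
  ultimately show ?thesis using 0 True by (simp add: klist_def)
  next
  case False
  have "(k * kz i (n i)) * klist L n ~~ (kz i (n i) * k) * klist L n" using k(3)[OF i] by (intro ueq_multr Lc)
  also have "... = kz i (n i) * (k * klist L n)" by (simp add: mult.assoc)
  also have "... ~~ kz i (n i) * klist L (n(j := n j + e))"
  using Cons False by (intro ueq_multl kz_chev[OF i] Cons.IH) auto
  also have "... = klist (i # L) (n(j := n j + e))" using False by (simp add: klist_def)
  finally show ?thesis unfolding 0 .
  qed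
 qed simp
 note c = chev_gen Orb_an
 have k1: "kO j * kz i m ~~ kz i m * kO j" if "i : Rp" for i m
  using j that by (auto simp: kz_def intro!: power_comm_ueq rel_kk_comm kk_kinv_comm c)
 have k2: "kI j * kz i m ~~ kz i m * kI j" if "i : Rp" for i m
  using j that by (auto simp: kz_def intro!: power_comm_ueq ueq_sym[OF kk_kinv_comm] kinv_kinv_comm c)
 show "set L <= Rp ==> distinct L ==> j : set L ==> kO j * klist L n ~~ klist L (n(j := n j + 1))"
  using kz_step[OF j] k1 j by (intro gen) (auto intro: c)
 show "set L <= Rp ==> distinct L ==> j : set L ==> kI j * klist L n ~~ klist L (n(j := n j - 1))"
  using gen[of "kI j" "-1"] kz_step[OF j] k2 j by (simp add: c)
qed

lemma kmon_step:
 assumes "j : Rp"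
 shows "kO j * kmon n ~~ kmon (n(j := n j + 1))" "kI j * kmon n ~~ kmon (n(j := n j - 1))"
 unfolding kmon_def using assms by (auto intro: klist_step)

lemma kz_kmon:
 assumes j: "j : Rp"
 shows "kz j m * kmon n ~~ kmon (n(j := n j + m))"
proof (cases "m >= 0")
 case True
 have "kO j ^ k * kmon n ~~ kmon (n(j := n j + int k))" for k
 proof (induction k)
  case (Suc k)
  have "kO j ^ Suc k * kmon n = kO j * (kO j ^ k * kmon n)" by (simp add: mult.assoc)
  also have "... ~~ kO j * kmon (n(j := n j + int k))" using Suc j by (intro ueq_multl chev_gen Orb_an)
  also have "... ~~ kmon ((n(j := n j + int k))(j := (n(j := n j + int k)) j + 1))" by (rule kmon_step[OF j])
  also have "(n(j := n j + int k))(j := (n(j := n j + int k)) j + 1) = n(j := n j + int (Suc k))" by (simp add: ac_simps)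
  finally show ?case .
 qed simp
 from this[of "nat m"] show ?thesis using True by (simp add: kz_def)
next
 case False
 have "kI j ^ k * kmon n ~~ kmon (n(j := n j - int k))" for k
 proof (induction k)
  case (Suc k)
  have "kI j ^ Suc k * kmon n = kI j * (kI j ^ k * kmon n)" by (simp add: mult.assoc)
  also have "... ~~ kI j * kmon (n(j := n j - int k))" using Suc j by (intro ueq_multl chev_gen Orb_an)
  also have "... ~~ kmon ((n(j := n j - int k))(j := (n(j := n j - int k)) j - 1))" by (rule kmon_step[OF j])
  also have "(n(j := n j - int k))(j := (n(j := n j - int k)) j - 1) = n(j := n j - int (Suc k))" by (simp add: algebra_simps)
  finally show ?case .
 qed simp
 from this[of "nat (- m)"] show ?thesis using False by (simp add: kz_def)
qed

lemma kmon_mult: "kmon m * kmon n ~~ kmon (%j. n j + (if j : Rp then m j else 0))"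
proof -
 have "klist L m * kmon n ~~ kmon (%j. n j + (if j : set L then m j else 0))"
  if "set L <= Rp" "distinct L" for L using that
 proof (induction L)
  case Nil
  thus ?case by (simp add: klist_def)
 next
  case (Cons i L)
  let ?n = "%j. n j + (if j : set L then m j else 0)"
  have "klist (i # L) m * kmon n = kz i (m i) * (klist L m * kmon n)" by (simp add: klist_def mult.assoc)
  also have "... ~~ kz i (m i) * kmon ?n" using Cons by (intro ueq_multl kz_chev) auto
  also have "... ~~ kmon (?n(i := ?n i + m i))" using Cons by (intro kz_kmon) auto
  also have "?n(i := ?n i + m i) = (%j. n j + (if j : set (i # L) then m j else 0))" using Cons by auto
  finally show ?case .
 qed
 from this[of replist] show ?thesis by (simp add: kmon_def)
qed

lemma kmon_0: "kmon (%_. 0) = 1"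
proof -
 have "klist L (%_. 0) = 1" for L by (induction L) (simp_all add: klist_def kz_def)
 thus ?thesis by (simp add: kmon_def)
qed

lemma kmon_cong: "(!!j. j : Rp ==> n j = m j) ==> kmon n = kmon m"
 unfolding kmon_def klist_def by (intro arg_cong[where f = prod_list] map_cong) auto

lemma kmon_inverse: "kmon n * kmon (%j. - n j) ~~ 1"
proof -
 have "kmon n * kmon (%j. - n j) ~~ kmon (%j. - n j + (if j : Rp then n j else 0))" by (rule kmon_mult)
 also have "... = kmon (%_. 0)" by (rule kmon_cong) simp
 finally show ?thesis by (simp add: kmon_0)
qed

text \<open>The label of \<epsilon> is 1, so \<open>k_delta = 1\<close> can be solved for
  \<open>k\<^sub>\<epsilon>\<close>; hence exponents indexed by the representatives suffice in
  normal forms.\<close>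

lemma k_Eps: "kk Eps ~~ kmon (%j. - int (kac_label T (Orb j)))" "kinv Eps ~~ kmon (%j. int (kac_label T (Orb j)))"
proof -
 let ?l = "%j. int (kac_label T (Orb j))"
 have kd: "k_delta T = kk Eps * kmon ?l" by (simp add: k_delta_def kmon_def klist_def kz_def comp_def)
 note c = chev_gen[OF Eps_anodes] kmon_chev
 have "kk Eps = kk Eps * 1" by simp
 also have "... ~~ kk Eps * (kmon ?l * kmon (%j. - ?l j))" by (intro ueq_multl ueq_sym[OF kmon_inverse] c)
 also have "... = (kk Eps * kmon ?l) * kmon (%j. - ?l j)" by (simp add: mult.assoc)
 also have "... ~~ 1 * kmon (%j. - ?l j)" using rel_k_delta unfolding kd by (intro ueq_multr c)
 finally show "kk Eps ~~ kmon (%j. - int (kac_label T (Orb j)))" by simp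
 have "kinv Eps = kinv Eps * 1" by simp
 also have "... ~~ kinv Eps * (kk Eps * kmon ?l)" using rel_k_delta unfolding kd by (intro ueq_multl ueq_sym[of _ 1] c)
 also have "... = (kinv Eps * kk Eps) * kmon ?l" by (simp add: mult.assoc)
 also have "... ~~ 1 * kmon ?l" by (intro ueq_multr rel_kinv c Eps_anodes)
 finally show "kinv Eps ~~ kmon (%j. int (kac_label T (Orb j)))" by simp
qed

definition nfel :: "(complex \<times> anode list \<times> (nat => int)) list => falg" where
 "nfel L = (\<Sum>(c, u, n)\<leftarrow>L. sc c * (ew u * kmon n))"

definition nfok :: "(complex \<times> anode list \<times> (nat => int)) list => bool" where
 "nfok L \<longleftrightarrow> (ALL (c, u, n):set L. set u <= An & (ALL j. j ~: Rp --> n j = 0))"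

lemma nfel_simps [simp]: "nfel [] = 0" "nfel ((c, u, n) # L) = sc c * (ew u * kmon n) + nfel L"
 "nfel (L @ L') = nfel L + nfel L'" by (simp_all add: nfel_def)

lemma nfok_simps [simp]: "nfok []" "nfok ((c, u, n) # L) \<longleftrightarrow> set u <= An & (ALL j. j ~: Rp --> n j = 0) & nfok L"
 "nfok (L @ L') \<longleftrightarrow> nfok L & nfok L'" by (simp_all add: nfok_def ball_Un)

lemma nfel_chev: "nfok L ==> nfel L : chev" by (induction L) (auto intro!: chevI ew_chev kmon_chev)

definition has_nf :: "falg => bool" where
 "has_nf a \<longleftrightarrow> (EX L. nfok L & a ~~ nfel L)"

lemma has_nf_add: "has_nf a ==> has_nf b ==> has_nf (a + b)"
 unfolding has_nf_def using ueq_add by (metis nfel_simps(3) nfok_simps(3))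

lemma has_nf_ueq: "a ~~ b ==> has_nf b ==> has_nf a" unfolding has_nf_def using ueq_trans by blast

lemma has_nf_scl: "has_nf a ==> has_nf (sc c * a)"
proof -
 assume "has_nf a"
 then obtain L where L: "nfok L" "a ~~ nfel L" by (auto simp: has_nf_def)
 let ?L = "map (%(d, u, n). (c * d, u, n)) L"
 have "nfok ?L & sc c * nfel L = nfel ?L" using L(1) by (induction L) (auto simp: mult.assoc distrib_left)
 thus ?thesis using ueq_sc[OF L(2), of c] unfolding has_nf_def by auto
qed

lemma has_nf_left:
 assumes "g : chev" "!!u n. set u <= An ==> (!!j. j ~: Rp ==> n j = 0) ==> has_nf (g * (ew u * kmon n))"
  and "has_nf b"
 shows "has_nf (g * b)"
proof -
 obtain L where L: "nfok L" "b ~~ nfel L" using assms(3) by (auto simp: has_nf_def)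
 have "has_nf (g * nfel L)" using L(1)
 proof (induction L)
  case Nil
  show ?case unfolding has_nf_def by (rule exI[of _ "[]"]) simp
 next
  case (Cons x L)
  obtain c u n where x: "x = (c, u, n)" by (cases x)
  have "g * nfel (x # L) = sc c * (g * (ew u * kmon n)) + g * nfel L" by (simp add: x distrib_left sc_lcomm)
  thus ?case using Cons assms(2)[of u n] by (auto simp: x intro!: has_nf_add has_nf_scl)
 qed
 thus ?thesis using has_nf_ueq ueq_multl[OF assms(1) L(2)] by blast
qed

lemma has_nf_k:
 assumes j: "j : Rp" and b: "has_nf b"
 shows "has_nf (kO j * b)" "has_nf (kI j * b)"
proof -
 have gen: "has_nf (k * (ew u * kmon n))"
  if k: "k : chev" "k * ew u ~~ sc t * (ew u * k)" "k * kmon n ~~ kmon (n(j := n j + e))"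
  and u: "set u <= An" and n: "!!j. j ~: Rp ==> n j = 0" for k u n t e
 proof -
  have "k * (ew u * kmon n) = (k * ew u) * kmon n" by (simp add: mult.assoc)
  also have "... ~~ (sc t * (ew u * k)) * kmon n" by (intro ueq_multr k kmon_chev)
  also have "... = sc t * (ew u * (k * kmon n))" by (simp add: mult.assoc)
  also have "... ~~ sc t * (ew u * kmon (n(j := n j + e)))" by (intro ueq_sc ueq_multl k ew_chev u)
  also have "... = nfel [(t, u, n(j := n j + e))]" by simp
  finally show ?thesis unfolding has_nf_def using u n j by (intro exI[of _ "[(t, u, n(j := n j + e))]"]) auto
 qed
 note c = chev_gen[OF Orb_an[OF j]]
 show "has_nf (kO j * b)" using k_ew(1)[OF Orb_an[OF j]] kmon_step(1)[OF j] by (intro has_nf_left[OF c(2) gen b] c) auto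
 have "kI j * kmon n ~~ kmon (n(j := n j + (-1)))" for n using kmon_step(2)[OF j, of n] by simp
 thus "has_nf (kI j * b)" using k_ew(2)[OF Orb_an[OF j]] by (intro has_nf_left[OF c(3) gen[where e = "-1"] b] c) auto
qed

lemma has_nf_kmon: "has_nf b ==> has_nf (kmon n * b)"
proof -
 assume b: "has_nf b"
 have kz: "has_nf (kz j m * b)" if "j : Rp" "has_nf b" for j m b
 proof -
  have "has_nf (kO j ^ k * b)" "has_nf (kI j ^ k * b)" for k by (induction k) (simp_all add: that mult.assoc has_nf_k)
  thus ?thesis by (simp add: kz_def)
 qed
 have "set L <= Rp ==> has_nf (klist L n * b)" for L by (induction L) (simp_all add: klist_def b mult.assoc kz)
 thus ?thesis by (simp add: kmon_def)
qed

text \<open>Left multiplication by a generator preserves normal forms. Such forms are not unique,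
  the \<open>e\<close> words being subject to Serre relations; independence is needed only for the
  \<open>k\<close> monomials and is proved in \<open>k_sep\<close>.\<close>

lemma borel_has_nf: "a : borel T ==> has_nf a"
proof -
 have gen: "has_nf (g * b)" if "g : bgens" "has_nf b" for g b
 proof -
  from that(1) obtain a where a: "a : An" and g: "g = ee Pl a | g = kk a | g = kinv a" by auto
  have bc: "b : chev" using that(2) ueq_chev nfel_chev by (auto simp: has_nf_def)
  from g consider "g = ee Pl a" | j where "a = Orb j" "j : Rp" "g = kk a | g = kinv a"
  | "a = Eps" "g = kk Eps" | "a = Eps" "g = kinv Eps" using a by (auto simp: anodes_def)
  thus ?thesis
  proof cases
  case 1
  have "has_nf (g * (ew u * kmon n))" if "set u <= An" "!!j. j ~: Rp ==> n j = 0" for u n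
  unfolding has_nf_def using that a by (intro exI[of _ "[(1, a # u, n)]"]) (auto simp: 1 mult.assoc)
  thus ?thesis using has_nf_left chev_gen(1)[OF a] that(2) 1 by blast
  next
  case 2
  thus ?thesis using has_nf_k that(2) by blast
  next
  case 3
  thus ?thesis using has_nf_ueq[OF ueq_multr[OF bc k_Eps(1)] has_nf_kmon[OF that(2)]] by simp
  next
  case 4
  thus ?thesis using has_nf_ueq[OF ueq_multr[OF bc k_Eps(2)] has_nf_kmon[OF that(2)]] by simp
  qed
 qed
 have mul: "has_nf (a * b)" if "a : subalg bgens" "has_nf b" for a b using that
  by (induction a arbitrary: b rule: subalg.induct) (simp_all add: has_nf_scl gen distrib_right has_nf_add mult.assoc)
 have one: "has_nf 1" unfolding has_nf_def by (rule exI[of _ "[(1, [], %_. 0)]"]) (simp add: kmon_0)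
 assume "a : borel T"
 then obtain b where "b : subalg bgens" "a ~~ b" by (auto simp: borel_def usub_def)
 thus "has_nf a" using has_nf_ueq mul[OF _ one, of b] by simp
qed

end

section \<open>The regular module\<close>

text \<open>A Vandermonde argument: the weights \<open>l m - l a\<close> remove the term at
  \<open>a\<close> and preserve all the power relations.\<close>

lemma (in vector_space) eigen_sep:
 assumes "finite S" "inj_on l S" "!!k. (SUM m:S. scale (l m ^ k) (v m)) = 0"
 shows "ALL m:S. v m = 0" using assms
proof (induction S arbitrary: v rule: finite_induct)
 case (insert a S)
 have "(SUM m:S. scale (l m ^ k) (scale (l m - l a) (v m))) = 0" for k
 proof -
  have "(SUM m:insert a S. scale (l m ^ k) (scale (l m - l a) (v m))) =
  (SUM m:insert a S. scale (l m ^ Suc k) (v m)) - scale (l a) (SUM m:insert a S. scale (l m ^ k) (v m))"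
  unfolding scale_sum_right sum_subtractf[symmetric]
  by (intro sum.cong refl) (simp add: scale_left_diff_distrib scale_right_diff_distrib mult.commute)
  thus ?thesis unfolding insert.prems(2) using insert.hyps by simp
 qed
 hence "ALL m:S. scale (l m - l a) (v m) = 0" using insert.prems(1) by (intro insert.IH) (auto simp: inj_on_insert)
 moreover have "l m ~= l a" if "m : S" for m using that insert.prems(1) insert.hyps by (auto simp: inj_on_def)
 ultimately have 0: "ALL m:S. v m = 0" by simp
 thus ?case using insert.prems(2)[of 0] insert.hyps by simp
qed simp

lemma (in vector_space) eigen_sep_group:
 assumes "finite S" "!!k. (SUM n:S. scale (l n ^ k) (v n)) = 0"
 shows "(SUM n:{n : S. l n = mu}. v n) = 0"
proof -
 let ?w = "%mu. SUM n:{n : S. l n = mu}. v n"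
 have "(\<Sum>mu\<in>l ` S. scale (mu ^ k) (?w mu)) = 0" for k
 proof -
  have "(\<Sum>mu\<in>l ` S. scale (mu ^ k) (?w mu)) = (\<Sum>mu\<in>l ` S. SUM n:{n : S. l n = mu}. scale (l n ^ k) (v n))"
  by (intro sum.cong refl) (simp add: scale_sum_right)
  also have "... = (SUM n:S. scale (l n ^ k) (v n))" by (rule sum.image_gen[OF assms(1), symmetric])
  finally show ?thesis using assms(2) by simp
 qed
 hence w: "ALL mu:l ` S. ?w mu = 0" using assms(1) by (intro eigen_sep[of _ "%mu. mu"]) auto
 show ?thesis
 proof (cases "mu : l ` S")
  case False
  hence e: "{n : S. l n = mu} = {}" by auto
  show ?thesis unfolding e by (rule sum.empty)
 qed (use w in blast)
qed

abbreviation fmul :: "complex => falg => falg" where "fmul c a == sc c * a"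

interpretation fpair: vector_space_pair fmul fmul ..

context twisted
begin

lemma relI_subspace: "free_alg.subspace relI" by (simp add: free_alg.subspace_def relI_0 relI_add relI_sc)

text \<open>A projection along the ideal picks one representative in every class; the quotient
  algebra can then be modelled by the fixed points \<open>Vr\<close> of \<open>pr\<close>, inside
  the free algebra.\<close>

lemma ex_proj: "EX p. Vector_Spaces.linear fmul fmul p & (ALL a:relI. p a = 0) & (ALL a. a - p a : relI)"
proof -
 obtain B where B: "B <= relI" "free_alg.independent B" "free_alg.span B = relI"
  by (rule free_alg.basis_exists[of relI]) (use free_alg.span_minimal[OF _ relI_subspace] in blast)
 let ?B = "free_alg.extend_basis B"
 note ext = free_alg.independent_extend_basis[OF B(2)] free_alg.span_extend_basis[OF B(2)]
  free_alg.extend_basis_superset[OF B(2)]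
 obtain p where p: "Vector_Spaces.linear fmul fmul p" "ALL b:?B. p b = (if b : B then 0 else b)"
  using fpair.linear_independent_extend[OF ext(1), of "%b. if b : B then 0 else b"] by blast
 interpret p: Vector_Spaces.linear fmul fmul p by (rule p(1))
 have "p a = 0" if "a : free_alg.span B" for a using that
 proof (induction rule: free_alg.span_induct_alt)
  case (step c x y)
  thus ?case using p(2) ext(3) by (auto simp: p.add p.scale)
 qed (rule p.zero)
 moreover have "a - p a : relI" if "a : free_alg.span ?B" for a using that
 proof (induction rule: free_alg.span_induct_alt)
  case base
  show ?case by (simp add: p.zero relI_0)
 next
  case (step c x y)
  have "x - p x : relI" using step(1) p(2) B(1) relI_0 by auto
  moreover have "sc c * x + y - p (sc c * x + y) = sc c * (x - p x) + (y - p y)" by (simp add: p.add p.scale right_diff_distrib)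
  ultimately show ?case using relI_add[OF relI_sc step(2), of "x - p x" c] by metis
 qed
 ultimately show ?thesis using p(1) B(3) ext(2) by auto
qed

definition pr :: "falg => falg" where
 "pr = (SOME p. Vector_Spaces.linear fmul fmul p & (ALL a:relI. p a = 0) & (ALL a. a - p a : relI))"

lemma pr: "Vector_Spaces.linear fmul fmul pr" "a : relI ==> pr a = 0" "a - pr a : relI"
 using someI_ex[OF ex_proj] unfolding pr_def[symmetric] by blast+

lemma pr_add: "pr (a + b) = pr a + pr b" and pr_sc: "pr (sc c * a) = sc c * pr a"
 and pr_diff: "pr (a - b) = pr a - pr b" and pr_0: "pr 0 = 0" and pr_sum: "pr (sum f I) = (SUM i:I. pr (f i))"
proof -
 interpret p: Vector_Spaces.linear fmul fmul pr by (rule pr(1))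
 show "pr (a + b) = pr a + pr b" "pr (sc c * a) = sc c * pr a" "pr (a - b) = pr a - pr b" "pr 0 = 0"
  "pr (sum f I) = (SUM i:I. pr (f i))" by (simp_all add: p.add p.scale p.diff p.zero p.sum)
qed

lemma pr_eq_iff: "pr a = pr b \<longleftrightarrow> a ~~ b"
proof
 assume "pr a = pr b"
 hence "a - b = (a - pr a) - (b - pr b)" by simp
 thus "a ~~ b" using pr(3) relI_diff unfolding ueq_def by metis
next
 assume "a ~~ b"
 thus "pr a = pr b" using pr(2)[of "a - b"] by (simp add: ueq_def pr_diff)
qed

lemma pr_0_iff: "pr a = 0 \<longleftrightarrow> a : relI" using pr_eq_iff[of a 0] by (simp add: pr_0 ueq_def)

lemma pr_ueq: "pr a ~~ a" using relI_uminus[OF pr(3)[of a]] by (simp add: ueq_def)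

lemma pr_pr: "pr (pr a) = pr a" using pr_ueq pr_eq_iff by blast

lemma pr_mult: "a : chev ==> pr (a * pr b) = pr (a * b)" unfolding pr_eq_iff by (intro ueq_multl pr_ueq)

definition Vr :: "falg set" where
 "Vr = {a : chev. pr a = a}"

lemma pr_Vr: "a : chev ==> pr a : Vr" using ueq_chev[OF pr_ueq] by (simp add: Vr_def pr_pr)

text \<open>The left regular module twisted by a character of the \<open>k\<close>s; the assumption
  on the product makes the twist compatible with \<open>k_delta = 1\<close>. Varying the character
  is what separates the powers of the \<open>k\<close>s.\<close>

lemma reg_bmod:
 assumes nz: "!!a. ch a ~= 0" and one: "(PROD a:An. ch a ^ kac_label T a) = 1"
 shows "bmod T fmul Vr (%a v. pr (ee Pl a * v)) (%a v. pr (sc (ch a) * (kk a * v)))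
  (%a v. pr (sc (inverse (ch a)) * (kinv a * v)))"
proof
 let ?E = "%a v. pr (ee Pl a * v)"
 let ?K = "%a v. pr (sc (ch a) * (kk a * v))"
 let ?Ki = "%a v. pr (sc (inverse (ch a)) * (kinv a * v))"
 note c = chevI chev_gen
 note vl = sc_lcomm[of "var g" for g]
 have Vc: "v : chev" "pr v = v" if "v : Vr" for v using that by (simp_all add: Vr_def)
 show "?E a (v + w) = ?E a v + ?E a w" "?K a (v + w) = ?K a v + ?K a w" "?Ki a (v + w) = ?Ki a v + ?Ki a w"
  "?E a (fmul c v) = fmul c (?E a v)" "?K a (fmul c v) = fmul c (?K a v)" "?Ki a (fmul c v) = fmul c (?Ki a v)" for a v w c
  by (simp_all add: distrib_left pr_add vl pr_sc mult.commute)
 show "0 : Vr" "!!v w. v : Vr ==> w : Vr ==> v + w : Vr" "!!v c. v : Vr ==> fmul c v : Vr"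
  by (simp_all add: Vr_def pr_0 pr_add pr_sc c)
 show "?E a v : Vr" "?K a v : Vr" "?Ki a v : Vr" if "a : An" "v : Vr" for a v
  using that by (auto intro!: pr_Vr c simp: Vc)
 have mp: "pr (kk a * pr w) = pr (kk a * w)" "pr (kinv a * pr w) = pr (kinv a * w)" "pr (ee p a * pr w) = pr (ee p a * w)"
  if "a : An" for a w p using that by (simp_all add: pr_mult chev_gen)
 have rr: "pr (x * (y * w)) = pr (z * w)" if "x * y ~~ z" "w : chev" for x y z w
  unfolding pr_eq_iff mult.assoc[symmetric] by (rule ueq_multr[OF that(2,1)])
 show "?K a (?Ki a v) = v" "?Ki a (?K a v) = v" if "a : An" "v : Vr" for a v
  using rr[OF rel_kinv(1)[OF that(1)] Vc(1)[OF that(2)]] rr[OF rel_kinv(2)[OF that(1)] Vc(1)[OF that(2)]] that nz[of a]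
  by (simp_all add: pr_sc mp vl Vc)
 show "?K a (?K b v) = ?K b (?K a v)" if "a : An" "b : An" "v : Vr" for a b v
  using rr[OF rel_kk_comm[OF that(1,2)] Vc(1)[OF that(3)]] that by (simp add: pr_sc mp vl mult.assoc mult.commute)
 show "?K a (?E b v) = fmul (s powi sym2 T a b) (?E b (?K a v))" if "a : An" "b : An" "v : Vr" for a b v
  using rr[OF rel_kk_ee[OF that(1,2), of Pl] Vc(1)[OF that(3)]] that by (simp add: pr_sc mp vl mult.assoc mult.commute)
 show "serre_op fmul (serre_x a b) (?E a) (?E b) (s_num a b) v = 0"
  if ab: "a : An" "b : An" "a ~= b" and v: "v : Vr" for a b v
 proof -
  have "serre_op fmul x (?E a) (?E b) n v = pr (qcomm x (ee Pl a) (ee Pl b) n * v)" if "v : Vr" for x n v using that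
  proof (induction n arbitrary: v)
  case (Suc n)
  have q: "qcomm x (ee Pl a) (ee Pl b) n : chev" using ab by (intro qcomm_iter_chev c)
  have "?E a v : Vr" using ab Suc(2) by (auto intro!: pr_Vr c simp: Vc)
  thus ?case using Suc ab q by (simp add: pr_mult c left_diff_distrib pr_diff mult.assoc pr_sc)
  qed simp
  moreover have "serre T Pl a b : relI" by (rule relI_rel) (use ab in \<open>unfold relations_def, blast\<close>)
  ultimately show ?thesis using v Vc(1)[OF v] relI_right unfolding serre_eq[OF ab] by (simp add: pr_0_iff)
 qed
 have pw: "(?K a ^^ n) v = pr (sc (ch a ^ n) * (kk a ^ n * v))" if "a : An" "v : Vr" for a n v
  using that by (induction n) (simp_all add: pr_sc mp vl mult.assoc Vc)
 have fl: "foldr (%a. ?K a ^^ kac_label T a) L v =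
  pr (sc (\<Prod>a\<leftarrow>L. ch a ^ kac_label T a) * (prod_list (map (%a. kk a ^ kac_label T a) L) * v))"
  if "set L <= An" "v : Vr" for L v using that
 proof (induction L)
  case (Cons a L)
  have p: "prod_list (map (%a. kk a ^ kac_label T a) L) * v : chev"
  using Cons(2,3) by (induction L) (auto simp: Vc mult.assoc intro!: c)
  have sp: "((%v. fmul (ch a) (pr (kk a * v))) ^^ n) (fmul c w) = fmul c (((%v. fmul (ch a) (pr (kk a * v))) ^^ n) w)" for n c w
  by (induction n) (simp_all add: vl pr_sc mult.commute)
  have a: "a : An" and L: "set L <= An" using Cons(2) by auto
  show ?case using p pw[OF a pr_Vr[OF p]] a Cons.IH[OF L Cons(3)] by (simp add: pr_sc mp vl mult.assoc Vc c pr_mult sp del: funpow.simps)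
 qed (simp add: Vc)
 have "(\<Prod>a\<leftarrow>Eps # map Orb replist. ch a ^ kac_label T a) = (PROD a:An. ch a ^ kac_label T a)"
  unfolding anodes_def by (subst prod.insert)
  (auto simp: prod.reindex inj_on_def prod.distinct_set_conv_list[of replist, simplified] comp_def)
 thus "foldr (%a. ?K a ^^ kac_label T a) (Eps # map Orb replist) v = v" if "v : Vr" for v
 proof -
  have sub: "set (Eps # map Orb replist) <= An" by (auto simp: Eps_anodes Orb_an)
  have kd: "prod_list (map (%a. kk a ^ kac_label T a) (Eps # map Orb replist)) = k_delta T" unfolding k_delta_def ..
  show ?thesis unfolding fl[OF sub that] kd `(\<Prod>a\<leftarrow>Eps # map Orb replist. ch a ^ kac_label T a) = _` one
  using ueq_multr[OF Vc(1)[OF that] rel_k_delta] Vc[OF that] pr_eq_iff[of "k_delta T * v" "1 * v"] by simp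
 qed
qed

subsection \<open>Separation of powers of the \<open>k\<^sub>i\<close>\<close>

text \<open>Literal expressions in the \<open>e\<close>s. In contrast to \<open>borel T\<close> the
  set is not closed under congruence, so statements about classes speak of some representative in
  it.\<close>

definition Ep :: "falg set" where
 "Ep = subalg (ee Pl ` An)"

lemma Ep_closed:
 "sc c : Ep" "0 : Ep" "1 : Ep" "a : An ==> ee Pl a : Ep"
 "x : Ep ==> y : Ep ==> x + y : Ep" "x : Ep ==> y : Ep ==> x * y : Ep"
 "x : Ep ==> y : Ep ==> x - y : Ep" "x : Ep ==> - x : Ep" "(!!i. i : I ==> f i : Ep) ==> sum f I : Ep"
 unfolding Ep_def by (auto intro: subalg.intros subalg_0 subalg_1 subalg_diff subalg_uminus subalg_sum)

lemma Ep_gens: "Ep <= subalg bgens" unfolding Ep_def by (rule subalg_mono) auto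

lemma subalg_b_chev: "subalg bgens <= chev"
 using subalg_least[of bgens] borel_gens_chev unfolding chev_alg_def by blast

lemma Ep_chev: "x : Ep ==> x : chev" using Ep_gens subalg_b_chev by blast

lemma Ep_borel: "x : Ep ==> x : borel T" using Ep_gens borelI(7) by blast

lemma ew_Ep: "set u <= An ==> ew u : Ep" by (induction u) (simp_all add: Ep_closed)

lemma kz_borel: "j : Rp ==> kz j m : subalg bgens"
proof -
 assume "j : Rp"
 hence "kO j : subalg bgens" "kI j : subalg bgens" by (auto intro!: subalg.gen simp: anodes_def)
 thus ?thesis by (simp add: kz_def subalg_power)
qed

lemma klist_borel: "set L <= Rp ==> klist L n : subalg bgens"
 by (induction L) (auto simp: klist_def subalg_1 intro!: subalg.mult kz_borel)

lemma kmon_borel: "kmon n : subalg bgens" unfolding kmon_def by (rule klist_borel) simp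

definition exps :: "(nat => int) set" where
 "exps = {n. ALL j. j ~: Rp --> n j = 0}"

lemma nfel_sum:
 assumes "nfok L"
 shows "EX S X. finite S & S <= exps & (ALL n. X n : Ep) & nfel L = (SUM n:S. X n * kmon n)"
 using assms
proof (induction L)
 case Nil
 show ?case by (rule exI[of _ "{}"]) (auto intro!: exI[of _ "%_. 0"] simp: Ep_closed)
next
 case (Cons x L)
 obtain c u n where x: "x = (c, u, n)" by (cases x)
 obtain S X where S: "finite S" "S <= exps" "ALL n. X n : Ep" "nfel L = (SUM n:S. X n * kmon n)"
  using Cons by (auto simp: x)
 have u: "set u <= An" and n: "n : exps" using Cons(2) by (auto simp: x exps_def)
 let ?X = "%m. (if m : S then X m else 0) + (if m = n then sc c * ew u else 0)"
 have "(SUM m:insert n S. ?X m * kmon m) =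
  (SUM m:insert n S. if m : S then X m * kmon m else 0) + (SUM m:insert n S. if m = n then sc c * ew u * kmon m else 0)"
  unfolding sum.distrib[symmetric] by (intro sum.cong refl) (auto simp: distrib_right)
 also have "(SUM m:insert n S. if m : S then X m * kmon m else 0) = (SUM n:S. X n * kmon n)"
  by (rule sum.mono_neutral_cong_right) (use S(1) in auto)
 also have "(SUM m:insert n S. if m = n then sc c * ew u * kmon m else 0) = sc c * ew u * kmon n"
  using S(1) by (subst sum.delta) auto
 finally have "nfel (x # L) = (SUM m:insert n S. ?X m * kmon m)" by (simp add: x S(4) mult.assoc add.commute)
 moreover have "?X m : Ep" for m using S(3) u by (auto intro!: Ep_closed ew_Ep)
 ultimately show ?case using S(1,2) n by (intro exI[of _ "insert n S"] exI[of _ ?X]) auto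
qed

lemma borel_nf:
 assumes "a : borel T"
 shows "EX S X. finite S & S <= exps & (ALL n. X n : Ep) & a ~~ (SUM n:S. X n * kmon n)"
 using borel_has_nf[OF assms] nfel_sum unfolding has_nf_def by metis

lemma reg_act_Ep:
 assumes "bmod T fmul Vr (%a v. pr (ee Pl a * v)) K Ki" and "x : Ep" "w : Vr"
 shows "bmod.vact fmul (%a v. pr (ee Pl a * v)) K Ki x w = pr (x * w)"
proof -
 interpret bmod T fmul Vr "%a v. pr (ee Pl a * v)" K Ki by (rule assms(1))
 have Vc: "v : chev" "pr v = v" if "v : Vr" for v using that by (simp_all add: Vr_def)
 show ?thesis using assms(2,3) unfolding Ep_def
 proof (induction x arbitrary: w rule: subalg.induct)
  case (scalar c)
  thus ?case by (simp add: pr_sc Vc)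
 next
  case (mult a b)
  hence "b * w : chev" "a : chev" using Ep_chev Vc by (auto simp: Ep_def intro!: chevI)
  thus ?case using mult by (simp add: va.act_mult pr_Vr pr_mult mult.assoc)
 qed (auto simp: va.act_add distrib_right pr_add)
qed

text \<open>The value at \<open>\<epsilon>\<close> is forced by the relation \<open>k_delta = 1\<close>.\<close>

definition kchar :: "nat => complex => anode => complex" where
 "kchar j t a = (case a of Orb i => if i = j then t else 1 | Eps => t powi (- int (kac_label T (Orb j))))"

lemma kchar:
 assumes "t ~= 0" "j : Rp"
 shows "kchar j t a ~= 0" "(PROD a:An. kchar j t a ^ kac_label T a) = 1"
proof -
 show "kchar j t a ~= 0" using assms by (auto simp: kchar_def split: anode.splits)
 have "(PROD a:An. kchar j t a ^ kac_label T a) =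
  kchar j t Eps * (PROD i:Rp. kchar j t (Orb i) ^ kac_label T (Orb i))"
  unfolding anodes_def by (subst prod.insert) (auto simp: prod.reindex inj_on_def)
 also have "(PROD i:Rp. kchar j t (Orb i) ^ kac_label T (Orb i)) = (PROD i:Rp. if i = j then t ^ kac_label T (Orb i) else 1)"
  by (intro prod.cong) (auto simp: kchar_def)
 also have "... = t ^ kac_label T (Orb j)" using assms(2) by simp
 finally show "(PROD a:An. kchar j t a ^ kac_label T a) = 1" using assms(1) by (simp add: kchar_def power_int_minus)
qed

lemma reg_act_kmon:
 assumes t: "t ~= 0" and j: "j : Rp"
 shows "bmod.vact fmul (%a v. pr (ee Pl a * v)) (%a v. pr (sc (kchar j t a) * (kk a * v)))
  (%a v. pr (sc (inverse (kchar j t a)) * (kinv a * v))) (kmon n) (pr 1) = sc (t powi n j) * pr (kmon n)"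
proof -
 interpret bmod T fmul Vr "%a v. pr (ee Pl a * v)" "%a v. pr (sc (kchar j t a) * (kk a * v))"
  "%a v. pr (sc (inverse (kchar j t a)) * (kinv a * v))" by (rule reg_bmod[OF kchar[OF assms]])
 have Vc: "v : chev" "pr v = v" if "v : Vr" for v using that by (simp_all add: Vr_def)
 define P where "P x c \<longleftrightarrow> x : chev & (ALL w:Vr. vact x w = sc c * pr (x * w))" for x c
 have P1: "P 1 1" by (simp add: P_def chevI Vc)
 have Pm: "P (x * y) (c * d)" if "P x c" "P y d" for x y c d
 proof -
  have "vact (x * y) w = sc (c * d) * pr (x * y * w)" if w: "w : Vr" for w
  proof -
  have yw: "y * w : chev" using `P y d` w by (simp add: P_def chevI Vc)
  hence "vact y w = sc d * pr (y * w)" "pr (y * w) : Vr" using `P y d` w by (auto simp: P_def pr_Vr)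
  thus ?thesis using `P x c` by (simp add: P_def va.act_mult va.act_sclr pr_mult mult.assoc mult.commute)
  qed
  thus ?thesis using that by (simp add: P_def chevI)
 qed
 have Pp: "P (x ^ m) (c ^ m)" if "P x c" for x c m by (induction m) (simp_all add: P1 Pm that)
 have k: "P (kO i) (if i = j then t else 1)" "P (kI i) (if i = j then inverse t else 1)"
  if "i : Rp" for i unfolding P_def va.act_var vop.simps using that by (auto simp: chev_gen Orb_an pr_sc kchar_def)
 have kz: "P (kz i m) (if i = j then t powi m else 1)" if "i : Rp" for i m
  using Pp[OF k(1)[OF that]] Pp[OF k(2)[OF that]] by (auto simp: kz_def power_int_def)
 have "set L <= Rp ==> distinct L ==> P (klist L n) (if j : set L then t powi n j else 1)" for L
 proof (induction L)
  case (Cons i L)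
  have "P (klist (i # L) n) ((if i = j then t powi n i else 1) * (if j : set L then t powi n j else 1))"
  using Cons kz[of i "n i"] Pm[of "kz i (n i)" _ "klist L n"] by (simp add: klist_def)
  moreover have "(if i = j then t powi n i else 1) * (if j : set L then t powi n j else 1) =
  (if j : set (i # L) then t powi n j else 1)" using Cons(3) by auto
  ultimately show ?case by (simp only:)
 qed (simp add: klist_def P1)
 from this[of replist] have "P (kmon n) (t powi n j)" using j by (simp add: kmon_def)
 thus ?thesis using pr_Vr[of 1] by (simp add: P_def chevI pr_mult)
qed

text \<open>In the module twisted by the character with value \<open>2 ^ k\<close> at
  \<open>j\<close>, the term of \<open>n\<close> is multiplied by the \<open>k\<close>-th power of
  \<open>2 powi n j\<close>. The relations for all \<open>k\<close> separate these numbers, and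
  distinct powers of 2 differ.\<close>

lemma k_sep_single:
 assumes S: "finite S" "!!n. n : S ==> X n : Ep" and z: "(SUM n:S. X n * kmon n) : relI" and j: "j : Rp"
 shows "(SUM n:{n : S. n j = m}. X n * kmon n) : relI"
proof -
 have "(SUM n:S. sc (((2::complex) powi n j) ^ k) * pr (X n * kmon n)) = 0" for k
 proof -
  have t: "(2::complex) ^ k ~= 0" by simp
  let ?ch = "kchar j (2 ^ k)"
  interpret bmod T fmul Vr "%a v. pr (ee Pl a * v)" "%a v. pr (sc (?ch a) * (kk a * v))"
  "%a v. pr (sc (inverse (?ch a)) * (kinv a * v))" by (rule reg_bmod[OF kchar[OF t j]])
  have 1: "pr 1 : Vr" by (simp add: pr_Vr chevI)
  have "vact (SUM n:S. X n * kmon n) (pr 1) = 0" using S(2) Ep_gens kmon_borel by (intro vact_relI z 1 subalg_sum subalg.mult) auto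
  also have "vact (SUM n:S. X n * kmon n) (pr 1) = (SUM n:S. vact (X n * kmon n) (pr 1))"
  by (induction S rule: infinite_finite_induct) (simp_all add: va.act_add)
  also have "... = (SUM n:S. sc (((2::complex) powi n j) ^ k) * pr (X n * kmon n))"
  proof (intro sum.cong refl)
  fix n assume n: "n : S"
  have "vact (X n * kmon n) (pr 1) = sc ((2 ^ k) powi n j) * vact (X n) (pr (kmon n))"
  by (simp add: va.act_mult reg_act_kmon[OF t j] va.act_sclr)
  also have "vact (X n) (pr (kmon n)) = pr (X n * kmon n)"
  using S(2)[OF n] by (subst reg_act_Ep) (auto simp: pr_Vr kmon_chev pr_mult Ep_chev intro: bmod_axioms)
  also have "((2::complex) ^ k) powi n j = (2 powi n j) ^ k" by (metis mult.commute power_int_mult power_int_of_nat)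
  finally show "vact (X n * kmon n) (pr 1) = sc (((2::complex) powi n j) ^ k) * pr (X n * kmon n)" .
  qed
  finally show ?thesis .
 qed
 from free_alg.eigen_sep_group[OF S(1) this, of "2 powi m"]
 have "(SUM n:{n : S. (2::complex) powi n j = 2 powi m}. pr (X n * kmon n)) = 0" .
 moreover have "(2::complex) powi a = 2 powi b \<longleftrightarrow> a = b" for a b :: int
 proof
  assume "(2::complex) powi a = 2 powi b"
  hence "norm ((2::complex) powi a) = norm ((2::complex) powi b)" by simp
  hence "(2::real) powi a = 2 powi b" by (simp add: norm_power_int)
  thus "a = b" using power_int_strict_increasing[of a b "2::real"] power_int_strict_increasing[of b a "2::real"]
  by (cases a b rule: linorder_cases) auto
 qed simp
 ultimately show ?thesis by (simp flip: pr_sum add: pr_0_iff)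
qed

lemma kmon_relI_cancel: "x : chev ==> x * kmon n : relI ==> x : relI"
proof -
 assume x: "x : chev" and xk: "x * kmon n : relI"
 have "x * (kmon n * kmon (%j. - n j)) ~~ x * 1" by (intro ueq_multl kmon_inverse x)
 moreover have "x * (kmon n * kmon (%j. - n j)) : relI" using relI_right[OF kmon_chev xk] by (simp add: mult.assoc)
 ultimately show "x : relI" using relI_diff unfolding ueq_def by fastforce
qed

text \<open>The exponent is separated one coordinate at a time; a monomial in the \<open>k\<close>s
  is invertible and can finally be cancelled.\<close>

lemma k_sep:
 assumes S: "finite S" "S <= exps" "!!n. n : S ==> X n : Ep" and z: "(SUM n:S. X n * kmon n) : relI" and m: "m : S"
 shows "X m : relI"
proof -
 have "(SUM n:{n : S. ALL j:R. n j = m j}. X n * kmon n) : relI" if "R <= Rp" for R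
  using finite_subset[OF that finite_reps] that
 proof (induction R rule: finite_induct)
  case (insert j R)
  have "{n : S. ALL j:insert j R. n j = m j} = {n : {n : S. ALL j:R. n j = m j}. n j = m j}" by auto
  thus ?case using insert S by (simp only:) (rule k_sep_single; auto)
 qed (use z in simp)
 from this[of "Rp"] have "(SUM n:{n : S. ALL j:Rp. n j = m j}. X n * kmon n) : relI" by blast
 moreover have "{n : S. ALL j:Rp. n j = m j} = {m}"
 proof -
  have "n j = m j" if "n : S" "ALL j:Rp. n j = m j" for n j
  by (cases "j : Rp") (use that subsetD[OF S(2) that(1)] subsetD[OF S(2) m] in \<open>simp_all add: exps_def\<close>)
  hence "n = m" if "n : S" "ALL j:Rp. n j = m j" for n using that by blast
  thus ?thesis using m by auto
 qed
 ultimately show ?thesis using kmon_relI_cancel S(3)[OF m] Ep_chev by simp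
qed

lemma Ep_k_swap:
 assumes "x : Ep" "a : An"
 shows "EX y:Ep. kk a * x ~~ y * kk a" "EX y:Ep. kinv a * x ~~ y * kinv a"
proof -
 have gen: "EX y:Ep. k * x ~~ y * k"
  if k: "k : chev" "!!b. b : An ==> k * ee Pl b ~~ sc (t b) * (ee Pl b * k)" for k t
  using assms(1) unfolding Ep_def
 proof (induction x rule: subalg.induct)
  case (scalar c)
  thus ?case using subalg.scalar by (intro bexI[of _ "sc c"]) (auto simp: sc_commute)
 next
  case (gen b)
  then obtain a where "a : An" "b = ee Pl a" by auto
  thus ?case using k(2)[of a] by (intro bexI[of _ "sc (t a) * ee Pl a"] subalg.mult subalg.scalar subalg.gen)
  (auto simp: mult.assoc)
 next
  case (add x y)
  then obtain x' y' where *: "x' : Ep" "y' : Ep" "k * x ~~ x' * k" "k * y ~~ y' * k" by (auto simp: Ep_def)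
  hence "k * (x + y) ~~ (x' + y') * k" unfolding distrib_left distrib_right by (intro ueq_add)
  thus ?case using * Ep_closed(5) by (auto simp: Ep_def)
 next
  case (mult x y)
  then obtain x' y' where *: "x' : Ep" "y' : Ep" "k * x ~~ x' * k" "k * y ~~ y' * k" by (auto simp: Ep_def)
  have "k * (x * y) = k * x * y" by (simp add: mult.assoc)
  also have "... ~~ x' * k * y" using mult * Ep_chev by (intro ueq_multr) (auto simp: Ep_def)
  also have "... = x' * (k * y)" by (simp add: mult.assoc)
  also have "... ~~ x' * (y' * k)" using * Ep_chev by (intro ueq_multl) auto
  also have "... = x' * y' * k" by (simp add: mult.assoc)
  finally show ?case using * Ep_closed(6) by (auto simp: Ep_def)
 qed
 show "EX y:Ep. kk a * x ~~ y * kk a" using rel_kk_ee[OF assms(2), of _ Pl] by (intro gen chev_gen assms(2)) auto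
 show "EX y:Ep. kinv a * x ~~ y * kinv a" using kinv_ee[OF assms(2), of _ Pl] by (intro gen chev_gen assms(2)) auto
qed

lemma kk_kmon: "j : Rp ==> kO j ~~ kmon ((%_. 0)(j := 1))" "j : Rp ==> kI j ~~ kmon ((%_. 0)(j := -1))"
 using kmon_step[of j "%_. 0"] by (simp_all add: kmon_0)

text \<open>The inequality between the exponents of \<open>k\<^sub>a\<close> and its inverse is what
  lets \<open>k_sep\<close> tell the two apart; at \<epsilon> it holds because the labels are
  positive.\<close>

lemma k_exp:
 assumes "a : An"
 obtains n where "n : exps" "n ~= (%j. - n j)" "kk a ~~ kmon n" "kinv a ~~ kmon (%j. - n j)"
proof (cases a)
 case Eps
 define n where "n j = (if j : Rp then - int (kac_label T (Orb j)) else 0)" for j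
 have 1: "kmon (%j. - int (kac_label T (Orb j))) = kmon n" "kmon (%j. int (kac_label T (Orb j))) = kmon (%j. - n j)"
  by (auto simp: n_def intro!: kmon_cong)
 obtain j where j: "j : Rp" using aff_nbr_reps by blast
 hence "n j < 0" using kac_label Orb_an[OF j] by (simp add: n_def)
 hence "n ~= (%j. - n j)" by (metis equal_neg_zero less_irrefl)
 moreover have "n : exps" by (simp add: n_def exps_def)
 ultimately show ?thesis using that[of n] k_Eps unfolding Eps 1 by blast
next
 case (Orb j)
 hence j: "j : Rp" using assms by (auto simp: anodes_def)
 have "(%i. - ((%_. 0)(j := 1)) i) = (%_. 0)(j := -1 :: int)" by auto
 moreover have "((%_. 0)(j := 1 :: int)) ~= (%_. 0)(j := -1)" by (auto simp: fun_eq_iff)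
 ultimately show ?thesis using kk_kmon[OF j] that[of "(%_. 0)(j := 1)"] j by (auto simp: Orb exps_def)
qed

text \<open>After the inverse of \<open>k\<^sub>a\<close> has been moved to the right, the two terms
  carry different exponents of the \<open>k\<close>s.\<close>

lemma skew_sep:
 assumes a: "a : An" and xy: "x : Ep" "y : Ep" and z: "x * kk a - kinv a * y : relI"
 shows "x : relI" "y : relI"
proof -
 obtain y' where y': "y' : Ep" "kinv a * y ~~ y' * kinv a" using Ep_k_swap(2)[OF xy(2) a] by blast
 obtain n where n: "n : exps" "n ~= (%j. - n j)" "kk a ~~ kmon n" "kinv a ~~ kmon (%j. - n j)"
  using k_exp[OF a] .
 let ?n = "%j. - n j"
 have n': "?n : exps" using n(1) by (simp add: exps_def)
 have "x * kk a ~~ x * kmon n" "y' * kinv a ~~ y' * kmon ?n" using xy y' n by (auto intro!: ueq_multl Ep_chev)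
 hence "x * kk a - kinv a * y ~~ x * kmon n - y' * kmon ?n" using y'(2) ueq_diff ueq_trans by blast
 hence "x * kmon n - y' * kmon ?n : relI" using z relI_diff unfolding ueq_def by (metis diff_diff_eq2 add_diff_cancel_left')
 moreover define X where "X m = (if m = n then x else - y')" for m
 ultimately have z: "(SUM m:{n, ?n}. X m * kmon m) : relI" using n(2) by (simp add: X_def)
 have "X m : Ep" for m using xy y' by (simp add: X_def Ep_closed)
 hence *: "X m : relI" if "m : {n, ?n}" for m using k_sep[OF _ _ _ z that] n n' by simp
 from *[of n] show "x : relI" by (simp add: X_def)
 have "- y' : relI" using *[of ?n] n(2)[symmetric] by (simp add: X_def)
 hence "y' * kinv a : relI" using relI_uminus[of "- y'"] relI_right chev_gen(3)[OF a] by simp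
 hence "kinv a * y : relI" using y'(2) relI_add[of "kinv a * y - y' * kinv a" "y' * kinv a"] by (simp add: ueq_def)
 hence "kk a * (kinv a * y) : relI" by (rule relI_left[OF chev_gen(2)[OF a]])
 moreover have "kk a * (kinv a * y) ~~ y" using ueq_multr[OF Ep_chev[OF xy(2)] rel_kinv(1)[OF a]] by (simp add: mult.assoc)
 ultimately show "y : relI" unfolding ueq_def using relI_diff[of "kk a * (kinv a * y)" "kk a * (kinv a * y) - y"] by simp
qed

text \<open>Evaluated in the module induced from the regular one, the relation splits: the value at
  the empty word shows that the part \<open>Y\<close> vanishes, and applying
  \<open>e\<^sub>j\<close> to the part with \<open>f\<^sub>j\<close> leaves the difference of
  \<open>k\<^sub>j\<close> and its inverse on \<open>Z\<close>.\<close>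

lemma f_relI:
 assumes j: "j : Rp" and Z: "Z : subalg bgens" and Y: "Y : borel T"
  and z: "ee Mi (Orb j) * Z + Y : relI"
 shows "kO j * (kO j * Z) ~~ Z"
proof -
 obtain Y' where Y': "Y' : subalg bgens" "Y ~~ Y'" using Y by (auto simp: borel_def usub_def)
 have z': "ee Mi (Orb j) * Z + Y' : relI" using relI_diff[OF z Y'(2)[unfolded ueq_def]] by simp
 interpret bmod T fmul Vr "%a v. pr (ee Pl a * v)" "%a v. pr (kk a * v)" "%a v. pr (kinv a * v)"
  using reg_bmod[of "%_. 1"] by simp
 have Vc: "v : chev" "pr v = v" if "v : Vr" for v using that by (simp_all add: Vr_def)
 have 1: "pr 1 : Vr" by (simp add: pr_Vr chevI)
 have reg: "vact a w = pr (a * w)" if "a : subalg bgens" "w : Vr" for a w using that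
 proof (induction a arbitrary: w rule: subalg.induct)
  case (mult a b)
  hence "b * w : chev" "a : chev" using subalg_b_chev Vc by (auto intro!: chevI)
  thus ?case using mult by (simp add: va.act_mult pr_Vr pr_mult mult.assoc)
 qed (auto simp: va.act_add distrib_right pr_add pr_sc Vc)
 define w where "w = vact Z (pr 1)"
 have wV: "w : Vr" and w: "iact Z (emb (pr 1)) = emb w" using iact_emb[OF Z 1] by (auto simp: w_def)
 note a = Orb_an[OF j]
 have "iact (ee Mi (Orb j) * Z + Y') (emb (pr 1)) = 0" using iact_relI[OF z' emb_ind[OF 1]] .
 hence 0: "fh (Orb j) (emb w) + emb (vact Y' (pr 1)) = 0" using iact_emb[OF Y'(1) 1] by (simp add: fa.act_add fa.act_mult w)
 hence "(fh (Orb j) (emb w) + emb (vact Y' (pr 1))) [] = 0" by simp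
 hence "vact Y' (pr 1) = 0" by (simp add: plus_app fh_Nil)
 hence f0: "fh (Orb j) (emb w) = 0" using 0 by (simp only: emb_0 add_0_right)
 have "eh (Orb j) (fh (Orb j) (emb w)) [] = 0" unfolding f0 by (simp add: eh_def)
 hence "sc (1 / qd (Orb j)) * (pr (kO j * w) - pr (kI j * w)) = 0"
  unfolding eh_fh by (simp add: plus_app fh_Nil fscl_app kh_emb a wV)
 hence "pr (kO j * w) = pr (kI j * w)"
  using qd_nz[OF a] free_alg.scale_eq_0_iff[of "1 / qd (Orb j)" "pr (kO j * w) - pr (kI j * w)"] by simp
 moreover have "w = pr Z" unfolding w_def reg[OF Z 1] using subalg_b_chev Z by (simp add: pr_mult subset_iff)
 ultimately have "kO j * Z ~~ kI j * Z" by (simp add: pr_mult chev_gen a flip: pr_eq_iff)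
 hence "kO j * (kO j * Z) ~~ kO j * (kI j * Z)" by (rule ueq_multl[OF chev_gen(2)[OF a]])
 also have "... = (kO j * kI j) * Z" by (simp add: mult.assoc)
 also have "... ~~ 1 * Z" using subalg_b_chev Z by (intro ueq_multr rel_kinv a) auto
 finally show ?thesis by simp
qed

lemma ueq_sum: "(!!i. i : I ==> f i ~~ g i) ==> sum f I ~~ sum g I"
 by (induction I rule: infinite_finite_induct) (auto intro: ueq_add)

lemma ueq_0: "a ~~ 0 \<longleftrightarrow> a : relI" by (simp add: ueq_def)

lemma ueq_relI: "a ~~ b ==> a : relI \<longleftrightarrow> b : relI" using ueq_trans ueq_sym ueq_0 by metis

text \<open>Otherwise the nonzero part \<open>Z\<close> would satisfy
  \<open>k\<^sub>j\<^sup>2 Z = Z\<close> by \<open>f_relI\<close>. But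
  \<open>k\<^sub>j\<^sup>2\<close> raises the \<open>j\<close>-th exponent by 2, which is impossible
  at a term where that exponent is maximal.\<close>

lemma f_sep:
 assumes j: "j : Rp" and S: "finite S" "S <= exps" "!!n. n : S ==> X n : Ep" and Y: "Y : borel T"
  and z: "ee Mi (Orb j) * (SUM n:S. X n * kmon n) + Y : relI" and m: "m : S"
 shows "X m : relI"
proof (rule ccontr)
 assume Xm: "X m ~: relI"
 let ?k = "kO j"
 note a = Orb_an[OF j]
 note kc = chev_gen(2)[OF a]
 define S1 where "S1 = {n : S. X n ~: relI}"
 have S1: "finite S1" "S1 ~= {}" "S1 <= S" using S(1) m Xm by (auto simp: S1_def)
 define Z where "Z = (SUM n:S1. X n * kmon n)"
 have Zg: "Z : subalg bgens" unfolding Z_def using S1 S(3) Ep_gens kmon_borel by (intro subalg_sum subalg.mult) auto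
 have "(SUM n:S. X n * kmon n) ~~ Z"
 proof -
  have "(SUM n:S. X n * kmon n) ~~ (SUM n:S. if n : S1 then X n * kmon n else 0)"
  by (intro ueq_sum) (auto simp: S1_def ueq_0 intro!: relI_right kmon_chev)
  also have "... = Z" unfolding Z_def by (rule sum.mono_neutral_cong_right) (use S(1) S1 in auto)
  finally show ?thesis .
 qed
 hence "ee Mi (Orb j) * (SUM n:S. X n * kmon n) + Y ~~ ee Mi (Orb j) * Z + Y"
  using a by (intro ueq_add ueq_multl chev_gen) auto
 hence "ee Mi (Orb j) * Z + Y : relI" using z ueq_relI by blast
 hence kkZ: "?k * (?k * Z) ~~ Z" by (rule f_relI[OF j Zg Y])
 have "EX X'. X' : Ep & ?k * (?k * X n) ~~ X' * (?k * ?k)" if "n : S1" for n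
 proof -
  have "n : S" using that S1 by blast
  then obtain y where y: "y : Ep" "?k * X n ~~ y * ?k" using Ep_k_swap(1)[OF S(3)[of n] a] by blast
  obtain y' where y': "y' : Ep" "?k * y ~~ y' * ?k" using Ep_k_swap(1)[OF y(1) a] by blast
  have "?k * (?k * X n) ~~ ?k * (y * ?k)" by (rule ueq_multl[OF kc y(2)])
  also have "... = (?k * y) * ?k" by (simp add: mult.assoc)
  also have "... ~~ (y' * ?k) * ?k" by (rule ueq_multr[OF kc y'(2)])
  also have "... = y' * (?k * ?k)" by (simp add: mult.assoc)
  finally show ?thesis using y'(1) by blast
 qed
 then obtain X' where X': "!!n. n : S1 ==> X' n : Ep" "!!n. n : S1 ==> ?k * (?k * X n) ~~ X' n * (?k * ?k)" by metis
 define sh :: "(nat => int) => nat => int" where "sh n = n(j := n j + 2)" for n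
 have inj: "inj_on sh S1"
 proof (rule inj_onI)
  fix n n' assume e: "sh n = sh n'"
  have "n i = n' i" for i using fun_cong[OF e, of i] by (cases "i = j") (auto simp: sh_def)
  thus "n = n'" by blast
 qed
 have k2: "(?k * ?k) * kmon n ~~ kmon (sh n)" for n
 proof -
  have "(?k * ?k) * kmon n = ?k * (?k * kmon n)" by (simp add: mult.assoc)
  also have "... ~~ ?k * kmon (n(j := n j + 1))" by (intro ueq_multl[OF kc] kmon_step j)
  also have "... ~~ kmon ((n(j := n j + 1))(j := (n(j := n j + 1)) j + 1))" by (rule kmon_step[OF j])
  also have "(n(j := n j + 1))(j := (n(j := n j + 1)) j + 1) = sh n" by (simp add: sh_def add.commute)
  finally show ?thesis .
 qed
 have "?k * (?k * Z) = (SUM n:S1. ?k * (?k * X n) * kmon n)" by (simp add: Z_def sum_distrib_left mult.assoc)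
 also have "... ~~ (SUM n:S1. X' n * (?k * ?k) * kmon n)" by (intro ueq_sum ueq_multr kmon_chev X')
 also have "... ~~ (SUM n:S1. X' n * kmon (sh n))"
  unfolding mult.assoc[of "X' _"] using X'(1) by (intro ueq_sum ueq_multl k2 Ep_chev)
 also have "... = (SUM n:sh ` S1. X' (inv_into S1 sh n) * kmon n)" by (simp add: sum.reindex[OF inj] inv_into_f_f[OF inj])
 finally have 1: "(SUM n:sh ` S1. X' (inv_into S1 sh n) * kmon n) ~~ Z" using kkZ ueq_trans ueq_sym by blast
 let ?S = "sh ` S1 Un S1"
 let ?W = "%n. (if n : sh ` S1 then X' (inv_into S1 sh n) else 0) - (if n : S1 then X n else 0)"
 have "(SUM n:?S. ?W n * kmon n) =
  (SUM n:?S. if n : sh ` S1 then X' (inv_into S1 sh n) * kmon n else 0) - (SUM n:?S. if n : S1 then X n * kmon n else 0)"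
  unfolding sum_subtractf[symmetric] by (intro sum.cong refl) (auto simp: left_diff_distrib)
 also have "(SUM n:?S. if n : sh ` S1 then X' (inv_into S1 sh n) * kmon n else 0) = (SUM n:sh ` S1. X' (inv_into S1 sh n) * kmon n)"
  by (rule sum.mono_neutral_cong_right) (use S1 in auto)
 also have "(SUM n:?S. if n : S1 then X n * kmon n else 0) = Z"
  unfolding Z_def by (rule sum.mono_neutral_cong_right) (use S1 in auto)
 finally have WI: "(SUM n:?S. ?W n * kmon n) : relI" using 1 by (simp add: ueq_def)
 have "n : exps" if "n : S1" for n using that S1 S(2) by blast
 hence shE: "sh ` S1 <= exps" using j by (auto simp: sh_def exps_def)
 have WE: "?W n : Ep" for n using X'(1) S(3) S1 by (auto intro!: Ep_closed simp: inv_into_f_f[OF inj])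
 have "Max ((%n. n j) ` S1) : (%n. n j) ` S1" using S1 by (intro Max_in) auto
 then obtain n0 where n0: "n0 : S1" "n0 j = Max ((%n. n j) ` S1)" by fastforce
 have "sh n0 ~: S1"
 proof
  assume "sh n0 : S1"
  hence "sh n0 j <= n0 j" unfolding n0(2) using S1 by (intro Max_ge) auto
  thus False by (simp add: sh_def)
 qed
 moreover have "?W (sh n0) : relI" by (rule k_sep[where X = ?W, OF _ _ WE WI]) (use S1 S(2) shE n0 in auto)
 ultimately have "X' n0 : relI" using n0 by (simp add: inv_into_f_f[OF inj])
 hence "X' n0 * (?k * ?k) : relI" by (intro relI_right chevI kc)
 hence *: "?k * (?k * X n0) : relI" using X'(2)[OF n0(1)] ueq_relI by blast
 have Xc: "X n0 : chev" using n0 S1 S(3) Ep_chev by auto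
 have "?k * X n0 : relI" using ueq_cancel_kk[OF a, of "?k * X n0" 0] * Xc by (simp add: ueq_0 chevI kc)
 hence "X n0 : relI" using ueq_cancel_kk[OF a, of "X n0" 0] Xc by (simp add: ueq_0 chevI)
 thus False using n0 by (simp add: S1_def)
qed

definition kpair :: "(nat => int) => anode => int" where
 "kpair n b = (SUM i:Rp. n i * sym2 T (Orb i) b)"

lemma kmon_swap:
 assumes y: "y : chev" and k: "!!i. i : Rp ==> kO i * y ~~ sc (s powi w i) * (y * kO i)"
 shows "kmon n * y ~~ sc (s powi (SUM i:Rp. n i * w i)) * (y * kmon n)"
proof -
 have mul: "(u * v) * y ~~ sc (c * d) * (y * (u * v))"
  if "u * y ~~ sc c * (y * u)" "v * y ~~ sc d * (y * v)" "u : chev" "v : chev" for u v c d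
 proof -
  have "(u * v) * y = u * (v * y)" by (simp add: mult.assoc)
  also have "... ~~ u * (sc d * (y * v))" by (rule ueq_multl[OF that(3,2)])
  also have "... = sc d * ((u * y) * v)" by (simp add: sc_lcomm mult.assoc)
  also have "... ~~ sc d * ((sc c * (y * u)) * v)" by (intro ueq_sc ueq_multr that)
  also have "... = sc (c * d) * (y * (u * v))" by (simp add: mult.assoc mult.commute)
  finally show ?thesis .
 qed
 have ki: "kI i * y ~~ sc (s powi (- w i)) * (y * kI i)" if i: "i : Rp" for i
  by (rule kinv_swap[OF Orb_an[OF i] y k[OF i]])
 have pw: "u ^ m * y ~~ sc (c ^ m) * (y * u ^ m)" if "u * y ~~ sc c * (y * u)" "u : chev" for u c m
 proof (induction m)
  case (Suc m)
  thus ?case unfolding power_Suc by (intro mul that chevI)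
 qed simp
 have kz: "kz i m * y ~~ sc (s powi (m * w i)) * (y * kz i m)" if i: "i : Rp" for i m
 proof -
  have "(s powi c) ^ nat m = s powi (m * c)" if "m >= 0" for c using that power_int_power'[of s c "nat m"] by (simp add: mult.commute)
  moreover have "(s powi (- c)) ^ nat (- m) = s powi (m * c)" if "~ m >= 0" for c
  using that power_int_power'[of s "- c" "nat (- m)"] by (simp add: mult.commute)
  ultimately show ?thesis using pw[OF k[OF i], of "nat m"] pw[OF ki[OF i], of "nat (- m)"] chev_gen[OF Orb_an[OF i]]
  by (auto simp: kz_def)
 qed
 have kl: "klist L n * y ~~ sc (s powi (SUM i<-L. n i * w i)) * (y * klist L n)" if "set L <= Rp" for L
  using that
 proof (induction L)
  case (Cons i L)
  have e: "klist (i # L) n = kz i (n i) * klist L n" by (simp add: klist_def)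
  have c: "s powi (SUM i<-i # L. n i * w i) = s powi (n i * w i) * s powi (SUM i<-L. n i * w i)"
  by (simp add: power_int_add)
  show ?case unfolding e c using Cons by (intro mul kz kz_chev klist_chev) auto
 qed (simp add: klist_def)
 have "(SUM i<-replist. n i * w i) = (SUM i:Rp. n i * w i)"
  unfolding sum.distinct_set_conv_list[of replist, simplified, symmetric] ..
 thus ?thesis using kl[of replist] by (simp add: kmon_def)
qed

lemma kmon_ee:
 assumes b: "b : An"
 shows "kmon n * ee p b ~~ sc (s powi (sgn_int p * kpair n b)) * (ee p b * kmon n)"
 using kmon_swap[OF chev_gen(1)[OF b] rel_kk_ee[OF Orb_an b], of n] by (simp add: kpair_def sum_distrib_left mult.left_commute)

lemma Ep_f:
 assumes "x : Ep" "a : An"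
 shows "EX y:borel T. x * ee Mi a ~~ ee Mi a * x + y" using assms(1) unfolding Ep_def
proof (induction x rule: subalg.induct)
 case (scalar c)
 show ?case by (rule bexI[of _ 0]) (simp_all add: sc_commute borelI(5) relI_0)
next
 case (gen x)
 then obtain b where b: "b : An" "x = ee Pl b" by auto
 have "(if b = a then sc (1 / qd b) * (kk b - kinv b) else 0) : borel T"
  using b by (auto intro!: borelI(1-4) borel_kk borel_kinv simp: borelI(5) relI_0)
 thus ?case using rel_ee_comm[OF b(1) assms(2)] b(2) by blast
next
 case (add x y)
 then obtain x' y' where *: "x' : borel T" "x * ee Mi a ~~ ee Mi a * x + x'" "y' : borel T" "y * ee Mi a ~~ ee Mi a * y + y'"
  by blast
 have "(x + y) * ee Mi a ~~ (ee Mi a * x + x') + (ee Mi a * y + y')" unfolding distrib_right by (intro ueq_add *)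
 also have "... = ee Mi a * (x + y) + (x' + y')" by (simp add: distrib_left)
 finally show ?case using * by (intro bexI[of _ "x' + y'"] borelI(2))
next
 case (mult x y)
 then obtain x' y' where *: "x' : borel T" "x * ee Mi a ~~ ee Mi a * x + x'" "y' : borel T" "y * ee Mi a ~~ ee Mi a * y + y'"
  by blast
 have xy: "x : Ep" "y : Ep" using mult by (simp_all add: Ep_def)
 have "(x * y) * ee Mi a = x * (y * ee Mi a)" by (simp add: mult.assoc)
 also have "... ~~ x * (ee Mi a * y + y')" using xy * by (intro ueq_multl Ep_chev)
 also have "... = (x * ee Mi a) * y + x * y'" by (simp add: distrib_left mult.assoc)
 also have "... ~~ (ee Mi a * x + x') * y + x * y'" by (rule ueq_add[OF ueq_multr[OF Ep_chev[OF xy(2)] *(2)] ueq_refl])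
 also have "... = ee Mi a * (x * y) + (x' * y + x * y')" by (simp add: distrib_right mult.assoc)
 finally show ?case using borelI(2)[OF borelI(3)[OF *(1) Ep_borel[OF xy(2)]] borelI(3)[OF Ep_borel[OF xy(1)] *(3)]] by blast
qed

text \<open>A term with exponent \<open>n\<close> commutes with \<open>f\<^sub>j\<close> up to a
  scalar given by \<open>kpair n (Orb j)\<close>, and for nonzero \<open>n\<close> this scalar
  differs from 1 for some \<open>j\<close>, as \<open>csum\<close> is nondegenerate. Then
  \<open>f\<^sub>j\<close> would survive in the commutator, which \<open>f_sep\<close> excludes.
  This recognizes Drinfeld generators of mode 1 as elements of the positive part.\<close>

lemma borel_Ep:
 assumes Z: "Z : borel T" and com: "!!j. j : Rp ==> Z * ee Mi (Orb j) - ee Mi (Orb j) * Z : borel T"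
 obtains X where "X : Ep" "Z ~~ X"
proof -
 obtain S X where S: "finite S" "S <= exps" "!!n. X n : Ep" and ZS: "Z ~~ (SUM n:S. X n * kmon n)"
  using borel_nf[OF Z] by blast
 have X0: "X n : relI" if n: "n : S" "n ~= (%_. 0)" for n
 proof -
  have "EX j:Rp. kpair n (Orb j) ~= 0"
  proof (rule ccontr)
  assume "~ (EX j:Rp. kpair n (Orb j) ~= 0)"
  hence z: "kpair n (Orb j) = 0" if "j : Rp" for j using that by blast
  have "(SUM i:Rp. n i * csum T i j) = 0" if "j : Rp" for j
  proof -
  have "kpair n (Orb j) = 2 * (SUM i:Rp. n i * csum T i j)" unfolding kpair_def sum_distrib_left by (intro sum.cong) auto
  thus ?thesis using z[OF that] by simp
  qed
  hence "n i = 0" if "i : Rp" for i using csum_nondeg[OF _ that] by blast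
  hence "n = (%_. 0)" using n(1) S(2) by (auto simp: exps_def fun_eq_iff subset_iff)
  thus False using n(2) by blast
  qed
  then obtain j where j: "j : Rp" "kpair n (Orb j) ~= 0" by blast
  note a = Orb_an[OF j(1)]
  let ?f = "ee Mi (Orb j)"
  note fc = chev_gen(1)[OF a, of Mi]
  let ?t = "%n. s powi (- kpair n (Orb j))"
  obtain B where B: "!!n. B n : borel T" "!!n. X n * ?f ~~ ?f * X n + B n" using Ep_f[OF S(3) a] by metis
  have "Z * ?f ~~ (SUM n:S. X n * kmon n) * ?f" by (rule ueq_multr[OF fc ZS])
  also have "... = (SUM n:S. X n * (kmon n * ?f))" by (simp add: sum_distrib_right mult.assoc)
  also have "... ~~ (SUM n:S. X n * (sc (?t n) * (?f * kmon n)))"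
  using kmon_ee[OF a, of _ Mi] S(3) by (intro ueq_sum ueq_multl Ep_chev) auto
  also have "... = (SUM n:S. sc (?t n) * ((X n * ?f) * kmon n))" by (simp add: sc_lcomm mult.assoc)
  also have "... ~~ (SUM n:S. sc (?t n) * ((?f * X n + B n) * kmon n))"
  by (intro ueq_sum ueq_sc ueq_multr kmon_chev B)
  finally have "Z * ?f - ?f * Z ~~ (SUM n:S. sc (?t n) * ((?f * X n + B n) * kmon n)) - ?f * (SUM n:S. X n * kmon n)"
  by (intro ueq_diff ueq_multl[OF fc] ZS)
  also have "... = ?f * (SUM n:S. (sc (?t n - 1) * X n) * kmon n) + (SUM n:S. sc (?t n) * (B n * kmon n))"
  unfolding sum_distrib_left sum_subtractf[symmetric] sum.distrib[symmetric]
  by (intro sum.cong refl) (simp add: sc_diff sc_lcomm distrib_left distrib_right left_diff_distrib right_diff_distrib mult.assoc)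
  finally have "?f * (SUM n:S. (sc (?t n - 1) * X n) * kmon n) + (SUM n:S. sc (?t n) * (B n * kmon n)) - (Z * ?f - ?f * Z) : relI"
  unfolding ueq_def using relI_uminus by fastforce
  hence I: "?f * (SUM n:S. (sc (?t n - 1) * X n) * kmon n) + ((SUM n:S. sc (?t n) * (B n * kmon n)) - (Z * ?f - ?f * Z)) : relI"
  by (simp add: algebra_simps)
  have sB: "(SUM n:S. sc (?t n) * (B n * kmon n)) : borel T" using S(1) by (induction S rule: finite_induct)
  (auto intro!: borelI(1-3) B borelI(7)[OF kmon_borel] simp: borelI(5) relI_0)
  have "sc (?t n - 1) * X n : Ep" for n by (intro Ep_closed S)
  hence "sc (?t n - 1) * X n : relI" by (rule f_sep[OF j(1) S(1,2) _ borelI(4)[OF sB com[OF j(1)]] I n(1)])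
  hence "sc (inverse (?t n - 1)) * (sc (?t n - 1) * X n) : relI" by (rule relI_sc)
  moreover have "?t n - 1 ~= 0" using j(2) by (simp add: s_powi_eq_1)
  ultimately show ?thesis by simp
 qed
 have "(SUM n:S. X n * kmon n) ~~ (SUM n:S. if n = (%_. 0) then X n * kmon n else 0)"
  by (intro ueq_sum) (auto simp: ueq_0 intro!: relI_right kmon_chev X0)
 also have "... = (if (%_. 0) : S then X (%_. 0) else 0)" using S(1) by (simp add: kmon_0)
 finally have "Z ~~ (if (%_. 0) : S then X (%_. 0) else 0)" using ZS ueq_trans by blast
 moreover have "(if (%_. 0) : S then X (%_. 0) else 0) : Ep" using S(3) by (simp add: Ep_closed)
 ultimately show ?thesis using that by blast
qed

end

section \<open>Skew derivations\<close>

context twisted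
begin

text \<open>The transposes of the two skew derivations \<open>r\<^sub>a\<close>, \<open>r'\<^sub>a\<close> of the free algebra on the \<open>e\<^sub>b\<close>, acting on
  functions of words.\<close>

fun rp :: "anode => (anode list => falg) => anode list => falg" where
 "rp a g [] = 0"
| "rp a g (b # u) = rp a (%w. g (b # w)) u + (if a = b then sc (s powi cont a u) * g u else 0)"

fun rm :: "anode => (anode list => falg) => anode list => falg" where
 "rm a g [] = 0"
| "rm a g (b # u) = (if a = b then g u else 0) + sc (s powi sym2 T b a) * rm a (%w. g (b # w)) u"

text \<open>A derivation by \<open>a\<close> removes one letter \<open>a\<close>, so its values are
  linear combinations of values of \<open>g\<close> at words of the remaining content.\<close>

lemma rp_pred:
 assumes "P 0" "!!x y. P x ==> P y ==> P (x + y)" "!!c x. P x ==> P (sc c * x)"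
  and "!!w. mset u = add_mset a (mset w) ==> P (g w)"
 shows "P (rp a g u)" "P (rm a g u)"
proof -
 show "P (rp a g u)" using assms(4)
 proof (induction u arbitrary: g)
  case (Cons b u)
  have "P (rp a (%w. g (b # w)) u)" using Cons(2) by (intro Cons.IH) auto
  moreover have "P (if a = b then sc (s powi cont a u) * g u else 0)" using Cons(2) assms(1,3) by auto
  ultimately show ?case using assms(2) by simp
 qed (use assms(1) in simp)
 show "P (rm a g u)" using assms(4)
 proof (induction u arbitrary: g)
  case (Cons b u)
  have "P (rm a (%w. g (b # w)) u)" using Cons(2) by (intro Cons.IH) auto
  moreover have "P (if a = b then g u else 0)" using Cons(2) assms(1,3) by auto
  ultimately show ?case using assms(2,3) by simp
 qed (use assms(1) in simp)
qed

definition flin :: "(falg => falg) => bool" where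
 "flin f \<longleftrightarrow> (ALL x y. f (x + y) = f x + f y) & (ALL c x. f (sc c * x) = sc c * f x)"

lemma flin_0: "flin f ==> f 0 = 0" unfolding flin_def by (metis mult_zero_left sc_0)

lemma flin_mult: "flin (%x. x * y)" "flin (%x. y * x)"
 by (simp_all add: flin_def distrib_left distrib_right mult.assoc sc_lcomm[of y])

lemma rp_lin: "flin f ==> rp a (%w. f (g w)) u = f (rp a g u)"
proof (induction u arbitrary: g)
 case (Cons b u)
 show ?case using Cons(1)[OF Cons(2), of "%w. g (b # w)"] Cons(2) flin_0[OF Cons(2)] by (simp add: flin_def)
qed (simp add: flin_0)

lemma rm_lin: "flin f ==> rm a (%w. f (g w)) u = f (rm a g u)"
proof (induction u arbitrary: g)
 case (Cons b u)
 show ?case using Cons(1)[OF Cons(2), of "%w. g (b # w)"] Cons(2) flin_0[OF Cons(2)] by (simp add: flin_def)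
qed (simp add: flin_0)

lemma rp_add: "rp a (%w. g w + g' w) u = rp a g u + rp a g' u" by (induction u arbitrary: g g') (auto simp: distrib_left)

lemma rm_add: "rm a (%w. g w + g' w) u = rm a g u + rm a g' u" by (induction u arbitrary: g g') (auto simp: distrib_left)

lemma rm_cont: "rm c (%w. sc (s powi cont a w) * g w) u = sc (s powi (cont a u - sym2 T a c)) * rm c g u"
proof (induction u arbitrary: g)
 case (Cons b u)
 have "rm c (%w. sc (s powi cont a (b # w)) * g (b # w)) u =
  sc (s powi sym2 T a b) * rm c (%w. sc (s powi cont a w) * g (b # w)) u"
  by (subst rm_lin[OF flin_mult(2), symmetric]) (simp add: power_int_add)
 also have "... = sc (s powi (cont a (b # u) - sym2 T a c)) * rm c (%w. g (b # w)) u"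
  unfolding Cons by (simp flip: power_int_add add: algebra_simps)
 finally show ?case by (simp add: distrib_left mult.commute)
qed simp

text \<open>\<open>rp\<close> weighs the letters after the removed one and \<open>rm\<close> the
  letters before it; \<open>rm_cont\<close> accounts for the mutual pairing of the two removed
  letters.\<close>

lemma rp_rm_comm: "rp a (rm c g) u = rm c (rp a g) u"
proof (induction u arbitrary: g)
 case (Cons b u)
 have "rp a (rm c g) (b # u) =
  rp a (%w. (if c = b then g w else 0) + sc (s powi sym2 T b c) * rm c (%w. g (b # w)) w) u +
  (if a = b then sc (s powi cont a u) * rm c g u else 0)" by simp
 also have "rp a (%w. (if c = b then g w else 0) + sc (s powi sym2 T b c) * rm c (%w. g (b # w)) w) u =
  (if c = b then rp a g u else 0) + sc (s powi sym2 T b c) * rm c (rp a (%w. g (b # w))) u"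
 proof -
  have "rp a (%w. 0) u = 0" using rp_lin[OF flin_mult(2), of a 0 "%_. 0" u] by simp
  thus ?thesis unfolding rp_add rp_lin[OF flin_mult(2)] Cons by simp
 qed
 finally have 1: "rp a (rm c g) (b # u) = (if c = b then rp a g u else 0) +
  sc (s powi sym2 T b c) * rm c (rp a (%w. g (b # w))) u + (if a = b then sc (s powi cont a u) * rm c g u else 0)" .
 have "rm c (rp a g) (b # u) = (if c = b then rp a g u else 0) +
  sc (s powi sym2 T b c) * rm c (%w. rp a (%w. g (b # w)) w + (if a = b then sc (s powi cont a w) * g w else 0)) u" by simp
 also have "rm c (%w. rp a (%w. g (b # w)) w + (if a = b then sc (s powi cont a w) * g w else 0)) u =
  rm c (rp a (%w. g (b # w))) u + (if a = b then sc (s powi (cont a u - sym2 T a c)) * rm c g u else 0)"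
 proof -
  have "rm c (%w. 0) u = 0" using rm_lin[OF flin_mult(2), of c 0 "%_. 0" u] by simp
  thus ?thesis unfolding rm_add by (simp add: rm_cont)
 qed
 finally have 2: "rm c (rp a g) (b # u) = (if c = b then rp a g u else 0) +
  sc (s powi sym2 T b c) * (rm c (rp a (%w. g (b # w))) u + (if a = b then sc (s powi (cont a u - sym2 T a c)) * rm c g u else 0))" .
 have "s powi sym2 T a c * s powi (cont a u - sym2 T a c) = s powi cont a u" unfolding power_int_add[OF disjI1[OF s_nz], symmetric] by simp
 thus ?case unfolding 1 2 by (auto simp: distrib_left add.assoc)
qed simp

fun rr :: "bool \<times> anode => (anode list => falg) => anode list => falg" where
 "rr (True, a) = rp a"
| "rr (False, a) = rm a"

abbreviation "rw == foldr rr"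

lemma rw_pred:
 assumes "P 0" "!!x y. P x ==> P y ==> P (x + y)" "!!c x. P x ==> P (sc c * x)"
  and "!!w. mset u = mset (map snd ws) + mset w ==> P (g w)"
 shows "P (rw ws g u)" using assms(4)
proof (induction ws arbitrary: u)
 case (Cons x ws)
 obtain t a where x: "x = (t, a)" by (cases x)
 have "P (rw ws g w)" if "mset u = add_mset a (mset w)" for w
 proof (rule Cons.IH)
  fix v assume "mset w = mset (map snd ws) + mset v"
  thus "P (g v)" using that x by (intro Cons.prems) simp
 qed
 from rp_pred[where P = P and g = "rw ws g", OF assms(1-3) this]
 show ?case using x by (cases t) auto
qed simp

lemma rw_lin: "flin f ==> rw ws (%w. f (g w)) u = f (rw ws g u)"
proof (induction ws arbitrary: u)
 case (Cons x ws)
 obtain t a where x: "x = (t, a)" by (cases x)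
 have "rw ws (%w. f (g w)) = (%u. f (rw ws g u))" using Cons by auto
 thus ?case using Cons(2) by (cases t) (simp_all add: x rp_lin rm_lin)
qed simp

lemma rw_add: "rw ws (%w. g w + g' w) u = rw ws g u + rw ws g' u"
proof (induction ws arbitrary: u)
 case (Cons x ws)
 obtain t a where x: "x = (t, a)" by (cases x)
 have "rw ws (%w. g w + g' w) = (%u. rw ws g u + rw ws g' u)" using Cons by auto
 thus ?case by (cases t) (simp_all add: x rp_add rm_add)
qed simp

lemma rw_diff: "rw ws (%w. g w - g' w) u = rw ws g u - rw ws g' u"
proof -
 have "rw ws (%w. g w + sc (-1) * g' w) u = rw ws g u + sc (-1) * rw ws g' u" unfolding rw_add rw_lin[OF flin_mult(2)] ..
 thus ?thesis by (simp add: sc_uminus)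
qed

definition e0 :: "anode list => falg" where
 "e0 u = (if u = [] then 1 else 0)"

lemma rp_e0: "rp a e0 = rm a e0"
proof
 fix u
 have z: "rp a (%w. 0) v = 0" "rm a (%w. 0) v = 0" for v
  using rp_lin[OF flin_mult(2), of a 0 "%_. 0" v] rm_lin[OF flin_mult(2), of a 0 "%_. 0" v] by simp_all
 show "rp a e0 u = rm a e0 u" by (cases u) (auto simp: e0_def z)
qed

abbreviation "pure as == map (Pair True) as"

text \<open>On \<open>e0\<close>, the transposed counit, both derivations agree; since they commute,
  an \<open>rm\<close> can be carried inwards to \<open>e0\<close> and turned into an
  \<open>rp\<close>.\<close>

lemma rw_pure: "EX as. rw ws e0 = rw (pure as) e0"
proof (induction ws)
 case Nil
 show ?case by (rule exI[of _ "[]"]) simp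
next
 case (Cons x ws)
 obtain t a where x: "x = (t, a)" by (cases x)
 obtain as where as: "rw ws e0 = rw (pure as) e0" using Cons by blast
 show ?case
 proof (cases t)
  case True
  thus ?thesis using as x by (intro exI[of _ "a # as"]) simp
 next
  case False
  have "rm a (rw (pure as) e0) = rw (pure (as @ [a])) e0"
  proof (induction as)
  case (Cons b as)
  have "rm a (rp b (rw (pure as) e0)) = rp b (rm a (rw (pure as) e0))" using rp_rm_comm by auto
  thus ?case using Cons by simp
  qed (simp add: rp_e0)
  thus ?thesis using as x False by (intro exI[of _ "as @ [a]"]) simp
 qed
qed

lemma rm_rw_pure: "rm a (rw (pure as) g) = rw (pure as) (rm a g)"
proof (induction as)
 case (Cons b as)
 have "rm a (rp b (rw (pure as) g)) = rp b (rm a (rw (pure as) g))" using rp_rm_comm by auto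
 thus ?case using Cons by simp
qed simp

text \<open>Elements of the positive part are given by lists of scalars and words, because the
  derivations are defined on words and are not yet known to respect the relations.
  \<open>ev (rw ws ew) L\<close> is an iterated derivative of the element of \<open>L\<close>; the
  head of \<open>ws\<close> is the derivation taken first.\<close>

definition ev :: "(anode list => falg) => (complex \<times> anode list) list => falg" where
 "ev g L = (\<Sum>(c, u)\<leftarrow>L. sc c * g u)"

lemma ev_simps [simp]: "ev g [] = 0" "ev g ((c, u) # L) = sc c * g u + ev g L" by (simp_all add: ev_def)

lemma ev_lin: "flin f ==> ev (%w. f (g w)) L = f (ev g L)" by (induction L) (auto simp: flin_0, simp add: flin_def)

lemma ev_add: "ev (%w. g w + g' w) L = ev g L + ev g' L" by (induction L) (auto simp: distrib_left)

lemma ev_diff: "ev (%w. g w - g' w) L = ev g L - ev g' L" by (induction L) (auto simp: right_diff_distrib)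

lemma ev_pred:
 assumes "P 0" "!!x y. P x ==> P y ==> P (x + y)" "!!c x. P x ==> P (sc c * x)"
  and "!!c u. (c, u) : set L ==> P (g u)"
 shows "P (ev g L)" using assms(4)
proof (induction L)
 case (Cons x L)
 obtain c u where x: "x = (c, u)" by (cases x)
 have "P (g u)" by (rule Cons(2)[of c]) (simp add: x)
 moreover have "P (ev g L)" by (rule Cons.IH, rule Cons(2)) auto
 ultimately show ?case using assms(2,3) by (simp add: x)
qed (use assms(1) in simp)

text \<open>Each letter \<open>a\<close> of the word contributes \<open>k\<^sub>a\<close> and its
  inverse, which are carried to the right end and to the left end respectively; the scalars
  collected on the way are those of the two derivations.\<close>

lemma ew_f:
 assumes a: "a : An" and "set u <= An"
 shows "ew u * ee Mi a ~~ ee Mi a * ew u + sc (1 / qd a) * (rp a ew u * kk a - kinv a * rm a ew u)" using assms(2)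
proof (induction u)
 case (Cons b u)
 let ?f = "ee Mi a" and ?e = "ee Pl b" and ?d = "sc (1 / qd a)"
 have b: "b : An" and u: "set u <= An" using Cons(2) by auto
 have ec: "?e : chev" and uc: "ew u : chev" using b u by (auto intro: chev_gen ew_chev)
 have rc: "rp a ew u : chev" "rm a ew u : chev"
  by (rule rp_pred[where P = "%x. x : chev"]; (intro chevI; assumption)?;
  use u in \<open>metis ew_chev insert_subset set_mset_add_mset_insert set_mset_mset\<close>)+
 have 1: "ew (b # u) * ?f ~~ ?e * (?f * ew u + ?d * (rp a ew u * kk a - kinv a * rm a ew u))"
  unfolding ew_simps mult.assoc by (intro ueq_multl[OF ec] Cons.IH u)
 have 2: "(?e * ?f) * ew u ~~ (?f * ?e + (if a = b then ?d * (kk a - kinv a) else 0)) * ew u"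
  using rel_ee_comm[OF b a] by (intro ueq_multr[OF uc]) (auto split: if_splits)
 have 3: "(if a = b then ?d * (kk a * ew u) else 0) ~~ (if a = b then ?d * (sc (s powi cont a u) * (ew u * kk a)) else 0)"
  using ueq_sc[OF k_ew(1)[OF a u], of "1 / qd a"] by (cases "a = b") simp_all
 have "(?e * kinv a) * rm a ew u ~~ (sc (s powi sym2 T a b) * (kinv a * ?e)) * rm a ew u"
 proof (rule ueq_multr[OF rc(2)])
  have "sc (s powi sym2 T a b) * (kinv a * ?e) ~~ sc (s powi sym2 T a b) * (sc (s powi (- sym2 T a b)) * (?e * kinv a))"
  using kinv_ee[OF a b, of Pl] by (intro ueq_sc) simp
  also have "... = ?e * kinv a" by (simp flip: power_int_add)
  finally show "?e * kinv a ~~ sc (s powi sym2 T a b) * (kinv a * ?e)" by (rule ueq_sym)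
 qed
 hence 4: "?d * (?e * (kinv a * rm a ew u)) ~~ ?d * (kinv a * (sc (s powi sym2 T a b) * (?e * rm a ew u)))"
  by (intro ueq_sc) (simp add: mult.assoc sc_lcomm[of "kinv a"])
 have R: "rp a ew (b # u) = ?e * rp a ew u + (if a = b then sc (s powi cont a u) * ew u else 0)"
  "rm a ew (b # u) = (if a = b then ew u else 0) + sc (s powi sym2 T a b) * (?e * rm a ew u)"
  by (simp_all add: rp_lin[OF flin_mult(2)] rm_lin[OF flin_mult(2)] sym2_sym[OF a b])
 note 1
 also have "?e * (?f * ew u + ?d * (rp a ew u * kk a - kinv a * rm a ew u)) =
  (?e * ?f) * ew u + (?d * (?e * rp a ew u * kk a) - ?d * (?e * (kinv a * rm a ew u)))"
  by (simp add: distrib_left right_diff_distrib mult.assoc sc_lcomm[of ?e])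
 also have "... ~~ (?f * ?e + (if a = b then ?d * (kk a - kinv a) else 0)) * ew u +
  (?d * (?e * rp a ew u * kk a) - ?d * (kinv a * (sc (s powi sym2 T a b) * (?e * rm a ew u))))" by (intro ueq_add ueq_diff 2 4 ueq_refl)
 also have "... = ?f * ew (b # u) + (if a = b then ?d * (kk a * ew u) else 0) - (if a = b then ?d * (kinv a * ew u) else 0) +
  (?d * (?e * rp a ew u * kk a) - ?d * (kinv a * (sc (s powi sym2 T a b) * (?e * rm a ew u))))"
  by (simp add: distrib_right left_diff_distrib right_diff_distrib mult.assoc)
 also have "... ~~ ?f * ew (b # u) + (if a = b then ?d * (sc (s powi cont a u) * (ew u * kk a)) else 0) - (if a = b then ?d * (kinv a * ew u) else 0) +
  (?d * (?e * rp a ew u * kk a) - ?d * (kinv a * (sc (s powi sym2 T a b) * (?e * rm a ew u))))" by (intro ueq_add ueq_diff 3 ueq_refl)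
 also have "... = ?f * ew (b # u) + ?d * (rp a ew (b # u) * kk a - kinv a * rm a ew (b # u))"
  unfolding R by (simp add: distrib_right distrib_left right_diff_distrib mult.assoc)
 finally show ?case .
qed (simp add: sc_commute)

definition words :: "(complex \<times> anode list) list => bool" where
 "words L \<longleftrightarrow> (ALL (c, u):set L. set u <= An)"

lemma ev_rw_pred:
 assumes "words L" "P 0" "!!x y. P x ==> P y ==> P (x + y)" "!!c x. P x ==> P (sc c * x)"
  and "!!w. set w <= An ==> P (g w)"
 shows "P (ev (rw ws g) L)"
proof (rule ev_pred[where P = P])
 fix c u assume "(c, u) : set L"
 hence "set u <= An" using assms(1) by (auto simp: words_def)
 hence "P (g w)" if "mset u = mset (map snd ws) + mset w" for w using arg_cong[OF that, of set_mset] by (intro assms(5)) auto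
 from rw_pred[where P = P and g = g, OF assms(2-4) this] show "P (rw ws g u)" .
qed (fact assms(2-4))+

lemma ev_Ep: "words L ==> ev (rw ws ew) L : Ep" by (rule ev_rw_pred) (auto intro: Ep_closed ew_Ep)

lemma ev_rp_Ep:
 assumes "words L" "a : An"
 shows "ev (rw ws (rp a ew)) L : Ep" "ev (rw ws (rm a ew)) L : Ep"
 using ev_Ep[OF assms(1), of "ws @ [(True, a)]"] ev_Ep[OF assms(1), of "ws @ [(False, a)]"] by simp_all

text \<open>By \<open>ew_f\<close> the difference of the two sides, as a function of the word, has
  values in the ideal. Derivations of functions only form linear combinations of values, so
  \<open>rw ws\<close> and the evaluation on \<open>L\<close> stay in the ideal.\<close>

lemma ev_f:
 assumes L: "words L" and a: "a : An"
 shows "ev (rw ws ew) L * ee Mi a ~~ ee Mi a * ev (rw ws ew) L +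
  sc (1 / qd a) * (ev (rw ws (rp a ew)) L * kk a - kinv a * ev (rw ws (rm a ew)) L)"
proof -
 let ?D = "%u. ew u * ee Mi a - (ee Mi a * ew u + sc (1 / qd a) * (rp a ew u * kk a - kinv a * rm a ew u))"
 have "ev (rw ws ?D) L : relI"
  using ew_f[OF a] by (intro ev_rw_pred[where P = "%x. x : relI"] L relI_0 relI_add relI_sc) (simp_all add: ueq_def)
 also have "rw ws ?D = (%u. rw ws ew u * ee Mi a - (ee Mi a * rw ws ew u +
  sc (1 / qd a) * (rw ws (rp a ew) u * kk a - kinv a * rw ws (rm a ew) u)))"
  unfolding rw_diff rw_add rw_lin[OF flin_mult(1)] rw_lin[OF flin_mult(2)] by (rule ext) (simp add: rw_diff rw_add rw_lin[OF flin_mult(1)] rw_lin[OF flin_mult(2)])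
 also have "ev ... L = ev (rw ws ew) L * ee Mi a - (ee Mi a * ev (rw ws ew) L +
  sc (1 / qd a) * (ev (rw ws (rp a ew)) L * kk a - kinv a * ev (rw ws (rm a ew)) L))"
  by (simp only: ev_diff ev_add ev_lin[OF flin_mult(1)] ev_lin[OF flin_mult(2)])
 finally show ?thesis by (simp add: ueq_def)
qed

text \<open>The derivations descend to the quotient: an element that is 0 has commutator 0 with
  \<open>f\<^sub>a\<close>, and \<open>skew_sep\<close> splits this into its two
  derivatives.\<close>

lemma ev_relI:
 assumes L: "words L" and a: "a : An" and z: "ev (rw ws ew) L : relI"
 shows "ev (rw ws (rp a ew)) L : relI" "ev (rw ws (rm a ew)) L : relI"
proof -
 let ?A = "ev (rw ws (rp a ew)) L * kk a - kinv a * ev (rw ws (rm a ew)) L"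
 have "ev (rw ws ew) L * ee Mi a - ee Mi a * ev (rw ws ew) L : relI" by (intro relI_diff relI_left relI_right z chev_gen a)
 hence "sc (1 / qd a) * ?A : relI" using ev_f[OF L a, of ws] relI_diff unfolding ueq_def diff_diff_eq[symmetric] by fastforce
 hence "sc (qd a) * (sc (1 / qd a) * ?A) : relI" by (rule relI_sc)
 hence "?A : relI" using qd_nz[OF a] by simp
 thus "ev (rw ws (rp a ew)) L : relI" "ev (rw ws (rm a ew)) L : relI" by (rule skew_sep[OF a ev_rp_Ep[OF L a]])+
qed

lemma ev_relI_rw:
 assumes L: "words L" and z: "ev (rw ws ew) L : relI"
 shows "set (map snd vs) <= An ==> ev (rw (ws @ vs) ew) L : relI"
proof (induction vs rule: rev_induct)
 case (snoc x vs)
 obtain t a where x: "x = (t, a)" by (cases x)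
 have "a : An" "ev (rw (ws @ vs) ew) L : relI" using snoc by (auto simp: x)
 from ev_relI[OF L this] show ?case by (cases t) (simp_all add: x)
qed (use z in simp)

end

subsection \<open>The module induced from a character\<close>

definition cscl :: "complex => complex => complex" where
 "cscl c z = c * z"

definition zop :: "anode => complex => complex" where
 "zop a z = 0"

text \<open>The one-dimensional Borel module on which the \<open>e\<close>s vanish and the
  \<open>k\<close>s act by a character. Induction turns its generator into a vacuum vector, on which
  elements of the whole algebra can be tested.\<close>

lemma (in twisted) vac_bmod:
 assumes nz: "!!a. ch a ~= 0" and one: "(PROD a:An. ch a ^ kac_label T a) = 1"
 shows "bmod T cscl UNIV zop (%a. cscl (ch a)) (%a. cscl (inverse (ch a)))"
proof
 fix v :: complex
 have 0: "serre_op cscl x (zop a) (zop b) n v = 0" for x a b n v by (induction n arbitrary: v) (simp_all add: cscl_def zop_def)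
 show "serre_op cscl (serre_x a b) (zop a) (zop b) (s_num a b) v = 0" for a b by (rule 0)
 have "(cscl (ch a) ^^ n) v = ch a ^ n * v" for a n v by (induction n) (simp_all add: cscl_def)
 hence "foldr (%a. cscl (ch a) ^^ kac_label T a) L v = (\<Prod>a\<leftarrow>L. ch a ^ kac_label T a) * v" for L
  by (induction L) simp_all
 hence A: "foldr (%a. cscl (ch a) ^^ kac_label T a) (Eps # map Orb replist) v =
  (\<Prod>a\<leftarrow>Eps # map Orb replist. ch a ^ kac_label T a) * v" .
 have B: "(\<Prod>a\<leftarrow>Eps # map Orb replist. ch a ^ kac_label T a) = (PROD a:An. ch a ^ kac_label T a)"
  unfolding anodes_def by (subst prod.insert)
  (auto simp: prod.reindex inj_on_def prod.distinct_set_conv_list[of replist, simplified] comp_def)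
 show "foldr (%a. cscl (ch a) ^^ kac_label T a) (Eps # map Orb replist) v = v" unfolding A B one by simp
qed (simp_all add: cscl_def zop_def nz algebra_simps)

locale vacuum = bmod T cscl UNIV zop "%a. cscl (ch a)" "%a. cscl (inverse (ch a))"
 for T ch
begin

definition F0 :: "anode list => complex" where
 "F0 = emb 1"

lemma F0_ind: "F0 : ind" by (simp add: F0_def emb_ind)

lemma eh_F0: "a : An ==> eh a F0 = 0" unfolding F0_def by (simp add: eh_emb emb_0 zop_def)

lemma kh_F0: "a : An ==> kh a F0 = fscl (ch a) F0" "a : An ==> khi a F0 = fscl (inverse (ch a)) F0"
 unfolding F0_def by (simp_all add: kh_emb flip: emb_scl)

lemma ew_F0: "set u <= An ==> iact (ew u) F0 = (if u = [] then F0 else 0)"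
proof (induction u)
 case (Cons a u)
 hence "iact (ew (a # u)) F0 = eh a (if u = [] then F0 else 0)" by (simp only: ew_simps fa.act_mult fa.act_var fop.simps) simp
 also have "... = 0" using Cons(2) eh_F0[of a] h_zero(1) by (cases "u = []") (simp_all only: if_True if_False list.set insert_subset not_Cons_self2 refl)
 finally show ?case by (simp only: list.distinct if_False)
qed simp

text \<open>A nonempty word of \<open>e\<close>s kills the vacuum, so acting on the vacuum computes
  the counit.\<close>

lemma ev_F0:
 assumes "words L"
 shows "sc (iact (ev (rw ws ew) L) F0 v) = sc (F0 v) * ev (rw ws e0) L"
proof -
 let ?f = "%x. sc (iact x F0 v)"
 have f: "flin ?f" by (simp add: flin_def fa.act_add fa.act_mult plus_app fscl_app cscl_def sc_add sc_mult)
 have "ev (rw ws (%u. ?f (ew u) - sc (F0 v) * e0 u)) L = 0"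
  using assms by (rule ev_rw_pred[where P = "%x. x = 0"]) (auto simp: ew_F0 e0_def)
 hence "ev (rw ws (%u. ?f (ew u))) L = ev (rw ws (%u. sc (F0 v) * e0 u)) L" unfolding rw_diff ev_diff by simp
 thus ?thesis unfolding rw_lin[OF f] rw_lin[OF flin_mult(2)] ev_lin[OF f] ev_lin[OF flin_mult(2)] .
qed

lemma counit_relI:
 assumes "words L" "ev (rw ws ew) L : relI"
 shows "ev (rw ws e0) L = 0"
proof -
 have "iact (ev (rw ws ew) L) F0 = 0" using assms(2) F0_ind by (rule iact_relI)
 thus ?thesis using ev_F0[OF assms(1), of ws "[]"] by (simp add: F0_def)
qed

definition fw :: "anode list => anode list => complex" where
 "fw bs = foldr fh bs F0"

lemma fw_ind: "set bs <= An ==> fw bs : ind" by (induction bs) (auto simp: fw_def F0_ind ind_fh)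

lemma kh_fw:
 assumes "a : An" "set bs <= An"
 shows "EX t. kh a (fw bs) = fscl t (fw bs)" "EX t. khi a (fw bs) = fscl t (fw bs)"
proof -
 show "EX t. kh a (fw bs) = fscl t (fw bs)" using assms(2)
 proof (induction bs)
  case (Cons b bs)
  then obtain t where t: "kh a (fw bs) = fscl t (fw bs)" by auto
  have "fw bs : carr" using Cons by (auto intro: ind_carr fw_ind)
  hence "kh a (fw (b # bs)) = fscl (s powi (- sym2 T a b)) (fh b (kh a (fw bs)))"
  using Cons(2) assms(1) kh_fh(1)[of a b "fw bs"] by (simp add: fw_def)
  thus ?case unfolding t fh_scl fv.scale_scale by (auto simp: fw_def)
 qed (use kh_F0 assms in \<open>auto simp: fw_def\<close>)
 show "EX t. khi a (fw bs) = fscl t (fw bs)" using assms(2)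
 proof (induction bs)
  case (Cons b bs)
  then obtain t where t: "khi a (fw bs) = fscl t (fw bs)" by auto
  have "fw bs : carr" using Cons by (auto intro: ind_carr fw_ind)
  hence "khi a (fw (b # bs)) = fscl (s powi (sym2 T a b)) (fh b (khi a (fw bs)))"
  using Cons(2) assms(1) kh_fh(2)[of a b "fw bs"] by (simp add: fw_def)
  thus ?case unfolding t fh_scl fv.scale_scale by (auto simp: fw_def)
 qed (use kh_F0 assms in \<open>auto simp: fw_def\<close>)
qed

text \<open>An element all of whose iterated derivatives have counit 0 is in the radical of the
  pairing with words in the \<open>f\<close>s. Moving it past \<open>f\<^sub>b\<close> produces its
  derivatives, which is why the induction treats all \<open>ws\<close> at once.\<close>

lemma rad_kills:
 assumes L: "words L" and z: "!!ws. ev (rw ws e0) L = 0"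
 shows "set bs <= An ==> iact (ev (rw ws ew) L) (fw bs) = 0"
proof (induction bs arbitrary: ws)
 case Nil
 show ?case
 proof
  fix v
  have "(sc (iact (ev (rw ws ew) L) F0 v) :: falg) = sc (0 v)" unfolding ev_F0[OF L] z by simp
  thus "iact (ev (rw ws ew) L) (fw []) v = 0 v" by (simp only: fw_def foldr.simps id_apply sc_inject)
 qed
next
 case (Cons b bs)
 have b: "b : An" and bs: "set bs <= An" using Cons(2) by auto
 let ?A = "ev (rw ws ew) L" and ?P = "ev (rw ws (rp b ew)) L" and ?M = "ev (rw ws (rm b ew)) L"
 have c: "?A : chev" "?P : chev" "?M : chev" using ev_Ep[OF L] ev_rp_Ep[OF L b] Ep_chev by auto
 have P0: "iact ?P (fw bs) = 0" using Cons.IH[OF bs, of "ws @ [(True, b)]"]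
  by (simp only: foldr_append foldr.simps rr.simps o_apply id_apply)
 have M0: "iact ?M (fw bs) = 0" using Cons.IH[OF bs, of "ws @ [(False, b)]"]
  by (simp only: foldr_append foldr.simps rr.simps o_apply id_apply)
 obtain t where t: "kh b (fw bs) = fscl t (fw bs)" using kh_fw(1)[OF b bs] by blast
 have "iact ?A (fw (b # bs)) = iact (?A * ee Mi b) (fw bs)" by (simp add: fa.act_mult fw_def)
 also have "... = iact (ee Mi b * ?A + sc (1 / qd b) * (?P * kk b - kinv b * ?M)) (fw bs)"
  by (intro ind.act_ueq ev_f L b fw_ind bs chevI chev_gen c)
 also have "... = fh b (iact ?A (fw bs)) + fscl (1 / qd b) (iact ?P (kh b (fw bs)) - khi b (iact ?M (fw bs)))"
  by (simp only: fa.act_add fa.act_mult fa.act_diff fa.act_sc fa.act_var fop.simps)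
 also have "... = 0" unfolding t P0 M0 fa.act_sclr Cons.IH[OF bs] by (simp only: h_zero fh_zero fv.scale_zero_right diff_zero add_0)
 finally show ?case .
qed

definition fspan :: "(anode list => complex) set" where
 "fspan = fv.span (fw ` {bs. set bs <= An})"

lemma eh_fw: "a : An ==> set bs <= An ==> eh a (fw bs) : fspan"
proof (induction bs)
 case Nil
 have "eh a (fw []) = 0" using eh_F0[OF Nil(1)] by (simp only: fw_def foldr.simps id_apply)
 thus ?case by (simp only: fspan_def fv.span_zero)
next
 case (Cons b bs)
 have b: "b : An" and bs: "set bs <= An" using Cons(3) by auto
 have fwin: "fscl t (fw bs) : fspan" for t unfolding fspan_def using bs by (intro fv.span_scale fv.span_base) auto
 have fhs: "fh b F : fspan" if "F : fspan" for F using that unfolding fspan_def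
 proof (induction rule: fv.span_induct_alt)
  case base
  show ?case unfolding fh_zero by (rule fv.span_zero)
 next
  case (step c x y)
  then obtain cs where "x = fw cs" "set cs <= An" by auto
  hence "fh b x : fw ` {bs. set bs <= An}" using b by (intro image_eqI[of _ _ "b # cs"]) (auto simp: fw_def)
  thus ?case unfolding fh_add fh_scl by (intro fv.span_add[OF fv.span_scale[OF fv.span_base] step(2)])
 qed
 obtain t where t: "kh b (fw bs) = fscl t (fw bs)" using kh_fw(1)[OF b bs] by blast
 obtain t' where t': "khi b (fw bs) = fscl t' (fw bs)" using kh_fw(2)[OF b bs] by blast
 have "eh a (fw (b # bs)) = fh b (eh a (fw bs)) + (if b = a then fscl (1 / qd b) (kh b (fw bs) - khi b (fw bs)) else 0)"
  using eh_fh[of a b "fw bs"] by (simp add: fw_def)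
 also have "... : fspan" unfolding fspan_def
 proof (rule fv.span_add)
  show "fh b (eh a (fw bs)) : fv.span (fw ` {bs. set bs <= An})" using fhs Cons bs by (auto simp: fspan_def)
  show "(if b = a then fscl (1 / qd b) (kh b (fw bs) - khi b (fw bs)) else 0) : fv.span (fw ` {bs. set bs <= An})"
  using fwin unfolding t t' fspan_def by (auto intro: fv.span_scale fv.span_diff fv.span_zero)
 qed
 finally show ?case .
qed

lemma fspan_chev: "a : chev ==> F : fspan ==> iact a F : fspan" unfolding chev_alg_def
proof (induction a arbitrary: F rule: subalg.induct)
 case (scalar c)
 thus ?case by (simp add: fspan_def fv.span_scale)
next
 case (gen g)
 then obtain a where a: "a : An" and g: "g = ee Pl a | g = ee Mi a | g = kk a | g = kinv a" by auto
 show ?case using gen(2) unfolding fspan_def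
 proof (induction rule: fv.span_induct_alt)
  case base
  show ?case by (simp only: fa_right_zero fv.span_zero)
 next
  case (step c x y)
  then obtain bs where bs: "x = fw bs" "set bs <= An" by auto
  have "fh a x : fspan" unfolding fspan_def using bs a by (intro fv.span_base image_eqI[of _ _ "a # bs"]) (auto simp: fw_def)
  moreover have "x : fspan" using step by (auto simp: fspan_def intro: fv.span_base)
  hence "kh a x : fspan" "khi a x : fspan" using kh_fw[OF a bs(2)] by (auto simp: bs(1) fspan_def intro: fv.span_scale)
  moreover have "eh a x : fspan" using eh_fw[OF a bs(2)] bs(1) by simp
  ultimately have "iact g x : fspan" using g by auto
  thus ?case using step unfolding fa.act_add_right fa.act_sclr fspan_def by (intro fv.span_add fv.span_scale)
 qed
next
 case (add a b)
 thus ?case unfolding fa.act_add fspan_def by (intro fv.span_add)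
next
 case (mult a b)
 thus ?case by (simp add: fa.act_mult)
qed

lemma radical_kills_span:
 assumes "words L" "!!ws. ev (rw ws e0) L = 0" "F : fspan"
 shows "iact (ev ew L) F = 0" using assms(3) unfolding fspan_def
proof (induction rule: fv.span_induct_alt)
 case (step c x y)
 then obtain bs where "x = fw bs" "set bs <= An" by auto
 hence "iact (ev ew L) x = 0" using rad_kills[OF assms(1,2), of bs "[]"] by simp
 thus ?case using step by (simp only: fa.act_add_right fa.act_sclr fv.scale_zero_right add_0)
qed (rule fa_right_zero)

end

context twisted
begin

lemma vacuum_kchar: "t ~= 0 ==> j : Rp ==> vacuum T (kchar j t)"
 unfolding vacuum_def by (rule vac_bmod[OF kchar])

lemma counit_relI:
 assumes "words L" "ev (rw ws ew) L : relI"
 shows "ev (rw ws e0) L = 0"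
proof -
 obtain j where j: "j : Rp" using aff_nbr_reps by blast
 interpret vacuum T "kchar j 1" by (rule vacuum_kchar[OF one_neq_zero j])
 show ?thesis using counit_relI[OF assms] .
qed

end

section \<open>The Drinfeld generators\<close>

locale drinfeld = twisted T for T +
 fixes x :: "sign => nat => int => falg" and h :: "nat => int => falg"
 assumes dg: "drinfeld_generators T x h"
begin

lemma x_chev: "i : Nd ==> x p i m : chev"
proof -
 assume "i : Nd"
 hence "x p i m : drinfeld_set T x h" unfolding drinfeld_set_def by blast
 thus ?thesis using dg unfolding drinfeld_generators_def by blast
qed

lemma h_chev: "i : Nd ==> r ~= 0 ==> h i r : chev"
 using dg unfolding drinfeld_generators_def drinfeld_set_def by blast

lemma dr_relations: "drinfeld_relations T x h" using dg unfolding drinfeld_generators_def by blast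

lemma dr_x_aut: "i : Nd ==> x p (sg i) m ~~ sc (omega T powi m) * x p i m"
 using dr_relations unfolding drinfeld_relations_def by simp

lemma dr_h_aut: "i : Nd ==> r ~= 0 ==> h (sg i) r ~~ sc (omega T powi r) * h i r"
 using dr_relations unfolding drinfeld_relations_def by simp

lemma dr_hh: "i : Nd ==> j : Nd ==> r ~= 0 ==> m ~= 0 ==> comm (h i r) (h j m) ~~ 0"
 using dr_relations unfolding drinfeld_relations_def by blast

lemma dr_kh: "i : Nd ==> j : Nd ==> r ~= 0 ==> comm (ki T i) (h j r) ~~ 0"
 using dr_relations unfolding drinfeld_relations_def by blast

lemma dr_kx: "i : Nd ==> j : Nd ==>
  ki T i * x p j m ~~ sc (qq T powi (sgn_int p * csum T i j)) * x p j m * ki T i"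
 using dr_relations unfolding drinfeld_relations_def by blast

lemma dr_hx: "i : Nd ==> j : Nd ==> r ~= 0 ==>
  comm (h i r) (x p j l) ~~ sc (of_int (sgn_int p) * hx_coeff T i j r) * x p j (r + l)"
 using dr_relations unfolding drinfeld_relations_def by blast

lemma dr_xx: "i : Nd ==> j : Nd ==> comm (x Pl i m) (x Mi j l) ~~
  sc (xx_coeff T i j l / (qi T i - inverse (qi T i))) * (phi T h Pl i (m + l) - phi T h Mi i (m + l))"
 using dr_relations unfolding drinfeld_relations_def by blast

lemma dr_e: "i : Rp ==> x p i 0 ~~ ee p (Orb i)" using dg unfolding drinfeld_generators_def by blast

lemma x_Pl_borel: "i : Nd ==> r >= 0 ==> x Pl i r : borel T"
 using dg unfolding drinfeld_generators_def by blast

lemma x_Mi_borel: "i : Nd ==> r > 0 ==> x Mi i r : borel T"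
 using dg unfolding drinfeld_generators_def by blast

lemma phi_borel: "i : Nd ==> r >= 0 ==> phi T h Pl i r : borel T"
 using dg unfolding drinfeld_generators_def by blast

lemma dr_grading: "EX G. Z_grading T G & (ALL i:Nd. ALL p m. x p i m : G m) &
  (ALL i:Nd. ki T i : G 0 & ki_inv T i : G 0) & ee Pl Eps : G 1"
 using dg unfolding drinfeld_generators_def by blast

abbreviation "ph i n == phi T h Pl i (int n)"

lemma phi_0: "phi T h Pl i 0 = ki T i" "phi T h Mi i 0 = ki_inv T i" by (simp_all add: phi_def phi_series_def exp_series_def)

lemma phi_neg: "m < 0 ==> phi T h Pl i m = 0" and phi_Mi_pos: "m > 0 ==> phi T h Mi i m = 0"
 by (simp_all add: phi_def)

lemma phi_1: "i : Nd ==> phi T h Pl i 1 = ki T i * (sc (qd (Orb (rep T i))) * h i 1)"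
 by (simp add: phi_def phi_series_def exp_series_def fps_compose_nth h_series_def qi_diff)

lemma omega_M: "omega T ^ M = 1" and omega_nz: "omega T ~= 0" using M_pos by (simp_all add: omega_def DeMoivre)

lemma xx_coeff_reps:
 assumes i: "i : Rp" and j: "j : Rp"
 shows "i ~= j ==> xx_coeff T i j l = 0" "sg i ~= i ==> xx_coeff T i i l = 1"
  "sg i = i ==> xx_coeff T i i l = (SUM r=1..M. omega T powi (int r * l)) / of_nat M"
proof -
 show "xx_coeff T i j l = 0" if "i ~= j"
 proof -
  have "(sg ^^ r) i ~= j" for r using that pow_reps[OF i j] by blast
  thus ?thesis by (simp add: xx_coeff_def)
 qed
 show "xx_coeff T i i l = 1" if "sg i ~= i"
 proof -
  have "(SUM r=1..M. if (sg ^^ r) i = i then omega T powi (int r * l) else 0) = (SUM r=1..M. if r = M then omega T powi (int r * l) else 0)"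
  using pow_eq_self[OF reps_no[OF i] that] by (intro sum.cong) auto
  also have "... = omega T powi (int M * l)" using M_pos by (simp add: Suc_le_eq)
  also have "... = 1" by (simp add: power_int_mult omega_M)
  finally show ?thesis using that by (simp add: xx_coeff_def stab_num_def)
 qed
 show "xx_coeff T i i l = (SUM r=1..M. omega T powi (int r * l)) / of_nat M" if "sg i = i"
  using that by (simp add: xx_coeff_def stab_num_def pow_fixed)
qed

end

subsection \<open>The generator \<open>e\<^sub>\<epsilon>\<close> in terms of the Drinfeld generators\<close>

context twisted
begin

section \<open>Choosing words of a given degree and weight\<close>

lemma ev_append: "ev g (L @ L') = ev g L + ev g L'" by (simp add: ev_def)

lemma words_simps [simp]: "words []" "words ((c, u) # L) \<longleftrightarrow> set u <= An & words L"
 "words (L @ L') \<longleftrightarrow> words L & words L'" by (simp_all add: words_def ball_Un)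

lemma ev_ew_mult: "EX L''. (words L --> words L' --> words L'') & ev ew L'' = ev ew L * ev ew L'"
proof (induction L)
 case Nil
 show ?case by (rule exI[of _ "[]"]) simp
next
 case (Cons y L)
 obtain c u where y: "y = (c, u)" by (cases y)
 obtain L'' where L'': "words L --> words L' --> words L''" "ev ew L'' = ev ew L * ev ew L'" using Cons by blast
 have 1: "ev ew (map (%(d, w). (c * d, u @ w)) L') = sc c * ew u * ev ew L'" for L'
  by (induction L') (auto simp: distrib_left mult.assoc sc_lcomm[of "ew u"])
 have "words L' ==> set u <= An ==> words (map (%(d, w). (c * d, u @ w)) L')"
  by (induction L') auto
 thus ?case using L'' by (intro exI[of _ "map (%(d, w). (c * d, u @ w)) L' @ L''"])
  (auto simp: y ev_append 1 distrib_right)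
qed

lemma Ep_words: "x : Ep ==> EX L. words L & x = ev ew L" unfolding Ep_def
proof (induction x rule: subalg.induct)
 case (scalar c)
 show ?case by (rule exI[of _ "[(c, [])]"]) simp
next
 case (gen y)
 then obtain a where "a : An" "y = ee Pl a" by auto
 thus ?case by (intro exI[of _ "[(1, [a])]"]) simp
next
 case (add y z)
 thus ?case using ev_append words_simps(3) by metis
next
 case (mult y z)
 thus ?case using ev_ew_mult by metis
qed

lemma ev_filter:
 "ev g (filter P L) = (SUM i:{i : {..<length L}. P (L ! i)}. sc (fst (L ! i)) * g (snd (L ! i)))"
proof -
 have "ev g (filter P L) = (SUM p<-L. if P p then sc (fst p) * g (snd p) else 0)"
  by (simp add: ev_def case_prod_unfold sum_list_map_filter')
 also have "... = (SUM i<length L. if P (L ! i) then sc (fst (L ! i)) * g (snd (L ! i)) else 0)"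
  by (simp add: sum_list_sum_nth atLeast0LessThan)
 also have "... = (SUM i:{i : {..<length L}. P (L ! i)}. sc (fst (L ! i)) * g (snd (L ! i)))"
  by (rule sum.inter_filter[symmetric]) simp
 finally show ?thesis .
qed

lemma ev_nth: "ev g L = (SUM i<length L. sc (fst (L ! i)) * g (snd (L ! i)))"
 using ev_filter[of g "%_. True" L] by (simp add: lessThan_def)

lemma words_nth: "words L ==> i < length L ==> set (snd (L ! i)) <= An"
 using nth_mem[of i L] by (auto simp: words_def case_prod_unfold)

lemma words_filter: "words L ==> words (filter P L)" by (auto simp: words_def)

lemma k_pow_swap:
 assumes a: "a : An" and y: "y : chev" and k: "kk a * y ~~ sc c * (y * kk a)"
 shows "kk a ^ t * y ~~ sc (c ^ t) * (y * kk a ^ t)"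
proof (induction t)
 case (Suc t)
 have "kk a ^ Suc t * y = kk a * (kk a ^ t * y)" by (simp add: mult.assoc)
 also have "... ~~ kk a * (sc (c ^ t) * (y * kk a ^ t))" by (rule ueq_multl[OF chev_gen(2)[OF a] Suc])
 also have "... = sc (c ^ t) * ((kk a * y) * kk a ^ t)" by (simp add: mult.assoc sc_lcomm[of "kk a"])
 also have "... ~~ sc (c ^ t) * ((sc c * (y * kk a)) * kk a ^ t)"
  using a by (intro ueq_sc ueq_multr k chevI chev_gen)
 also have "... = sc (c ^ Suc t) * (y * kk a ^ Suc t)" by (simp add: mult.assoc mult.commute)
 finally show ?case .
qed simp

lemma k_pow_cancel:
 assumes a: "a : An" and y: "y : chev"
 shows "y * kk a ^ t : relI ==> y : relI"
proof (induction t)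
 case (Suc t)
 have "y * kk a ^ Suc t * kinv a : relI" by (rule relI_right[OF chev_gen(3)[OF a] Suc(2)])
 moreover have "y * kk a ^ Suc t * kinv a = y * kk a ^ t * (kk a * kinv a)" by (simp add: mult.assoc power_Suc2 del: power_Suc)
 moreover have "y * kk a ^ t * (kk a * kinv a) ~~ y * kk a ^ t * 1"
  using a y by (intro ueq_multl rel_kinv chevI chev_gen)
 ultimately show ?case using Suc(1) ueq_relI by simp
qed simp

text \<open>The commutation with \<open>k\<^sub>a\<close>, used \<open>t\<close> times, gives the
  power relations to which \<open>eigen_sep_group\<close> applies, after passing from congruences to
  equations by \<open>pr\<close>.\<close>

lemma wt_filter:
 assumes L: "words L" and a: "a : An" and k: "kk a * ev ew L ~~ sc (s powi m) * (ev ew L * kk a)"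
 shows "ev ew (filter (%(c, u). cont a u = m) L) ~~ ev ew L"
proof -
 let ?n = "length L" and ?X = "ev ew L"
 define y where "y i = sc (fst (L ! i)) * ew (snd (L ! i))" for i
 define l where "l i = (if i < ?n then s powi cont a (snd (L ! i)) else s powi m)" for i
 \<comment> \<open>The extra index \<open>?n\<close> carries minus the whole element with the
   prescribed eigenvalue, so that it cancels against the sum of the single words.\<close>
 define v where "v i = (if i < ?n then y i else - ?X)" for i
 have yc: "y i : chev" if "i < ?n" for i using words_nth[OF L that] by (auto simp: y_def intro!: chevI ew_chev)
 have X: "?X = (SUM i<?n. y i)" by (simp add: ev_nth y_def)
 have Xc: "?X : chev" unfolding X by (intro chevI yc) simp
 have vc: "v i : chev" for i using yc Xc by (simp add: v_def chevI)
 have yk: "kk a * y i ~~ sc (l i) * (y i * kk a)" if "i < ?n" for i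
 proof -
  have "kk a * y i = sc (fst (L ! i)) * (kk a * ew (snd (L ! i)))" by (simp add: y_def sc_lcomm)
  also have "... ~~ sc (fst (L ! i)) * (sc (l i) * (ew (snd (L ! i)) * kk a))"
  using k_ew(1)[OF a words_nth[OF L that]] that by (intro ueq_sc) (simp add: l_def)
  finally show ?thesis by (simp add: y_def mult.assoc mult.commute)
 qed
 have "(SUM i<=?n. sc (l i ^ t) * v i) : relI" for t
 proof (rule k_pow_cancel[OF a])
  show "(SUM i<=?n. sc (l i ^ t) * v i) : chev" by (intro chevI vc)
  have "(SUM i<=?n. sc (l i ^ t) * v i) * kk a ^ t =
  (SUM i<?n. sc (l i ^ t) * (y i * kk a ^ t)) - sc ((s powi m) ^ t) * (?X * kk a ^ t)"
  by (simp add: lessThan_Suc_atMost[symmetric] v_def l_def sum_distrib_right distrib_right left_diff_distrib mult.assoc)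
  also have "... ~~ (SUM i<?n. kk a ^ t * y i) - kk a ^ t * ?X"
  using k_pow_swap[OF a yc yk] by (intro ueq_diff ueq_sum ueq_sym[OF k_pow_swap[OF a Xc k]]) (auto intro: ueq_sym)
  also have "... = 0" by (simp add: X sum_distrib_left)
  finally show "(SUM i<=?n. sc (l i ^ t) * v i) * kk a ^ t : relI" by (simp add: ueq_0)
 qed
 hence "(SUM i<=?n. sc (l i ^ t) * pr (v i)) = 0" for t by (simp flip: pr_sc pr_sum add: pr_0_iff)
 from free_alg.eigen_sep_group[OF finite_atMost this, of "s powi m"]
 have "(SUM i:{i : {..?n}. l i = s powi m}. v i) : relI" by (simp flip: pr_sum add: pr_0_iff)
 also have "{i : {..?n}. l i = s powi m} = insert ?n {i : {..<?n}. (%(c, u). cont a u = m) (L ! i)}"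
  by (auto simp: l_def s_powi_inj case_prod_unfold)
 also have "(SUM i:.... v i) = ev ew (filter (%(c, u). cont a u = m) L) - ?X"
  by (subst sum.insert) (auto simp: ev_filter v_def y_def intro!: sum.cong)
 finally show ?thesis by (simp add: ueq_def)
qed

lemma cont_count:
 assumes "set u <= An"
 shows "cont a u = int (count (mset u) Eps) * sym2 T a Eps + (SUM i:Rp. int (count (mset u) (Orb i)) * sym2 T a (Orb i))"
 using assms
proof (induction u)
 case (Cons b u)
 have 1: "(SUM i:Rp. int (count (mset (Orb j # u)) (Orb i)) * sym2 T a (Orb i)) =
  sym2 T a (Orb j) + (SUM i:Rp. int (count (mset u) (Orb i)) * sym2 T a (Orb i))" if "j : Rp" for j
 proof -
  have "(SUM i:Rp. int (count (mset (Orb j # u)) (Orb i)) * sym2 T a (Orb i)) =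
  (SUM i:Rp. (if i = j then sym2 T a (Orb i) else 0) + int (count (mset u) (Orb i)) * sym2 T a (Orb i))"
  by (intro sum.cong) (auto simp: distrib_right)
  thus ?thesis using that by (simp add: sum.distrib)
 qed
 show ?case using Cons 1 by (cases b) (auto simp: anodes_def distrib_right)
qed simp

text \<open>The pairings alone would leave multiples of the null root free. Once the number of
  letters \<epsilon> is fixed, the other multiplicities are determined because \<open>csum\<close>
  is nondegenerate.\<close>

lemma same_content:
 assumes u: "set u <= An" "set w <= An" and e: "count (mset u) Eps = count (mset w) Eps"
  and c: "!!j. j : Rp ==> cont (Orb j) u = cont (Orb j) w"
 shows "mset u = mset w"
proof (rule multiset_eqI)
 let ?be = "%i. int (count (mset u) (Orb i)) - int (count (mset w) (Orb i))"
 have z: "(SUM i:Rp. ?be i * csum T i j) = 0" if j: "j : Rp" for j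
 proof -
  have "(SUM i:Rp. int (count (mset u) (Orb i)) * sym2 T (Orb j) (Orb i)) =
  (SUM i:Rp. int (count (mset w) (Orb i)) * sym2 T (Orb j) (Orb i))"
  using c[OF j] e unfolding cont_count[OF u(1)] cont_count[OF u(2)] by simp
  hence "(SUM i:Rp. ?be i * sym2 T (Orb j) (Orb i)) = 0" by (simp add: left_diff_distrib sum_subtractf)
  also have "(SUM i:Rp. ?be i * sym2 T (Orb j) (Orb i)) = 2 * (SUM i:Rp. ?be i * csum T i j)"
  unfolding sum_distrib_left using csum_sym reps_no j by (intro sum.cong) auto
  finally show ?thesis by simp
 qed
 fix b
 show "count (mset u) b = count (mset w) b"
 proof (cases "b : An")
  case True
  thus ?thesis using e csum_nondeg[OF z] by (cases b) (auto simp: anodes_def)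
 next
  case False
  hence "count (mset u) b = 0" "count (mset w) b = 0" using u by (auto simp: count_eq_zero_iff simp del: count_mset)
  thus ?thesis by (simp only:)
 qed
qed

lemma ex_moved_rep: "EX i:Rp. sg i ~= i"
proof (rule ccontr)
 assume neg: "~ ?thesis"
 obtain i where i: "i : Nd" "sg i ~= i" using twisted by (auto simp: twisted_datum_def)
 have r: "rep T i : Rp" using rep_reps'[OF i(1)] .
 have "rep T (rep T i) = rep T i" using rep_rep[OF i(1)] .
 then obtain k where "i = (sg ^^ k) (rep T i)" using rep_eq_iff[OF i(1) reps_no[OF r]] by auto
 moreover have "sg (rep T i) = rep T i" using neg r by blast
 ultimately have "i = rep T i" using pow_fixed by metis
 thus False using neg r i by metis
qed

end

context drinfeld
begin

text \<open>The modes 0 of \<open>x Mi\<close> are the \<open>f\<^sub>j\<close>, which lie outside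
  the Borel subalgebra; they are included because \<open>e\<^sub>\<epsilon>\<close> will be obtained
  by commutators with them.\<close>

definition Pgens :: "falg set" where
 "Pgens = {x p i r |p i r. i : Nd & r >= 0} Un (UN j:Rp. {kO j, kI j})"

lemma Pgens_chev: "Pgens <= chev" unfolding Pgens_def using x_chev chev_gen Orb_an by auto

definition Pa :: "falg set" where
 "Pa = usub T Pgens"

lemmas Pa_closed = usub_closed[OF Pgens_chev, folded Pa_def]

lemma Pa_k: "j : Rp ==> kO j : Pa" "j : Rp ==> kI j : Pa"
 by (rule Pa_closed(6), unfold Pgens_def, blast)+

lemma Pa_x: "i : Nd ==> r >= 0 ==> x p i r : Pa" by (rule Pa_closed(6)) (auto simp: Pgens_def)

lemma Pa_f: "j : Rp ==> ee p (Orb j) : Pa"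
 by (rule Pa_closed(8)[OF ueq_sym[OF dr_e] Pa_x]) (simp_all add: reps_no)

lemma phi1_Ep:
 assumes i: "i : Rp" and H: "H : Ep" "h i 1 ~~ H"
 shows "EX C:Ep. phi T h Pl i 1 ~~ C * kO i"
proof -
 note n = reps_no[OF i] and a = Orb_an[OF i]
 have "sc (qd (Orb i)) * H : Ep" using H by (intro Ep_closed)
 then obtain C where C: "C : Ep" "kO i * (sc (qd (Orb i)) * H) ~~ C * kO i" using Ep_k_swap(1) a by blast
 have "phi T h Pl i 1 ~~ kO i * (sc (qd (Orb i)) * H)"
  unfolding phi_1[OF n] rep_reps[OF i] by (intro ueq_multl ueq_sc H chev_gen a)
 thus ?thesis using C ueq_trans by blast
qed

lemma x_f:
 assumes "i : Nd" "j : Rp"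
 shows "x Pl i m * ee Mi (Orb j) - ee Mi (Orb j) * x Pl i m ~~
  sc (xx_coeff T i j 0 / qd (Orb (rep T i))) * (phi T h Pl i m - phi T h Mi i m)"
proof -
 note c = x_chev[OF assms(1)] x_chev[OF reps_no[OF assms(2)]]
 have "x Pl i m * ee Mi (Orb j) - ee Mi (Orb j) * x Pl i m ~~ x Pl i m * x Mi j 0 - x Mi j 0 * x Pl i m"
  using dr_e[OF assms(2), of Mi] c by (intro ueq_diff ueq_multl ueq_multr) (auto intro: ueq_sym)
 thus ?thesis using dr_xx[OF assms(1) reps_no[OF assms(2)], of m 0] qi_diff[OF assms(1)]
  unfolding comm_def by (simp add: ueq_trans)
qed

lemma h1_borel:
 assumes i: "i : Rp"
 shows "h i 1 : borel T"
proof -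
 note n = reps_no[OF i] and a = Orb_an[OF i]
 let ?d = "qd (Orb i)"
 have "kI i * phi T h Pl i 1 = sc ?d * ((kI i * kO i) * h i 1)"
  by (simp add: phi_1[OF n] rep_reps[OF i] sc_lcomm[of "kk _"] sc_lcomm[of "kinv _"] mult.assoc)
 also have "... ~~ sc ?d * (1 * h i 1)" using a by (intro ueq_sc ueq_multr rel_kinv h_chev n) auto
 finally have "sc (1 / ?d) * (kI i * phi T h Pl i 1) ~~ sc (1 / ?d) * (sc ?d * (1 * h i 1))" by (rule ueq_sc)
 hence "h i 1 ~~ sc (1 / ?d) * (kI i * phi T h Pl i 1)" using qd_nz[OF a] by (simp add: ueq_sym)
 thus ?thesis by (rule borelI(8)) (intro borelI(1,3) borel_kinv a phi_borel n, simp)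
qed

text \<open>The commutator with \<open>f\<^sub>j\<close> is a multiple of \<phi> of mode 1, which is
  in the Borel subalgebra, so \<open>borel_Ep\<close> applies.\<close>

lemma x1_Ep: "i : Rp ==> EX X:Ep. x Pl i 1 ~~ X"
proof -
 assume i: "i : Rp"
 note n = reps_no[OF i]
 have "x Pl i 1 * ee Mi (Orb j) - ee Mi (Orb j) * x Pl i 1 : borel T" if "j : Rp" for j
  by (rule borelI(8)[OF x_f[OF n that]])
  (auto simp: phi_Mi_pos intro!: borelI(1,3) phi_borel n)
 thus ?thesis using borel_Ep[OF x_Pl_borel[OF n, of 1]] by (metis zero_le_one)
qed

text \<open>As for \<open>x1_Ep\<close>; here the commutator with \<open>f\<^sub>j\<close> is a
  multiple of \<open>x\<^sup>-\<close> of mode 1.\<close>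

lemma h1_Ep: "i : Rp ==> EX H:Ep. h i 1 ~~ H"
proof -
 assume i: "i : Rp"
 note n = reps_no[OF i]
 have "h i 1 * ee Mi (Orb j) - ee Mi (Orb j) * h i 1 : borel T" if j: "j : Rp" for j
 proof -
  note nj = reps_no[OF j]
  have "h i 1 * ee Mi (Orb j) - ee Mi (Orb j) * h i 1 ~~ h i 1 * x Mi j 0 - x Mi j 0 * h i 1"
  using dr_e[OF j, of Mi] h_chev[OF n, of 1] by (intro ueq_diff ueq_multl ueq_multr) (auto intro: ueq_sym)
  also have "... ~~ sc (of_int (sgn_int Mi) * hx_coeff T i j 1) * x Mi j (1 + 0)"
  using dr_hx[OF n nj, of 1 Mi 0] unfolding comm_def by simp
  finally show ?thesis by (rule borelI(8)) (intro borelI(1,3) x_Mi_borel nj, simp)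
 qed
 thus ?thesis using borel_Ep[OF h1_borel[OF i]] by metis
qed

text \<open>All \<open>e\<close>s except \<open>e\<^sub>\<epsilon>\<close> have degree 0, so the
  grading leaves words with exactly one letter \<epsilon>; the commutation with the
  \<open>k\<^sub>j\<close> then fixes the pairings, one \<open>j\<close> at a time, by
  \<open>wt_filter\<close>.\<close>

lemma x1_words:
 assumes i: "i : Rp"
 shows "EX L. words L & ev ew L ~~ x Pl i 1 &
  (ALL (c, u):set L. count (mset u) Eps = 1 & (ALL j:Rp. cont (Orb j) u = 2 * csum T j i))"
proof -
 note n = reps_no[OF i]
 obtain X where X: "X : Ep" "x Pl i 1 ~~ X" using x1_Ep[OF i] by blast
 obtain L where L: "words L" "X = ev ew L" using Ep_words[OF X(1)] by blast
 obtain G where G: "Z_grading T G" "!!i p m. i : Nd ==> x p i m : G m"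
  "!!i. i : Nd ==> ki T i : G 0" "!!i. i : Nd ==> ki_inv T i : G 0" "ee Pl Eps : G 1"
  using dr_grading by blast
 have Gr: "relI <= G d" for d using G(1) unfolding Z_grading_def by simp
 have Ga: "a : G d ==> b : G d ==> a + b : G d" for a b d using G(1) unfolding Z_grading_def by simp
 have Gs: "a : G d ==> sc c * a : G d" for a c d using G(1) unfolding Z_grading_def by simp
 have Gm: "a : G d ==> b : G d' ==> a * b : G (d + d')" for a b d d' using G(1) unfolding Z_grading_def by simp
 have Gsep: "finite D ==> ALL d:D. g d : G d ==> (SUM d:D. g d) : relI ==> d : D ==> g d : relI" for d D g
  using G(1) unfolding Z_grading_def by (elim conjE) simp
 have Gu: "a : G d" if "a ~~ b" "b : G d" for a b d using Ga[OF subsetD[OF Gr that(1)[unfolded ueq_def]] that(2)] by simp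
 have G0: "0 : G d" for d using Gr relI_0 by blast
 have Gsum: "(!!i. i : I ==> f i : G d) ==> sum f I : G d" for f and I :: "nat set" and d
  by (induction I rule: infinite_finite_induct) (auto simp: G0 Ga)
 have G1: "1 : G 0" by (rule Gu[OF ueq_sym[OF rel_kinv(1)[OF Orb_an[OF i]]]])
  (use Gm[OF G(3)[OF n] G(4)[OF n]] in \<open>simp add: rep_reps[OF i]\<close>)
 have Gew: "ew u : G (int (count (mset u) Eps))" if "set u <= An" for u using that
 proof (induction u)
  case (Cons a u)
  hence u: "ew u : G (int (count (mset u) Eps))" and a: "a : An" by auto
  have ea: "ee Pl a : G (if a = Eps then 1 else 0)"
  proof (cases a)
  case (Orb j)
  hence j: "j : Rp" using a by (auto simp: anodes_def)
  show ?thesis using Gu[OF ueq_sym[OF dr_e[OF j]] G(2)[OF reps_no[OF j]]] Orb by simp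
  qed (simp add: G(5))
  show ?case using Gm[OF ea u] by (cases "a = Eps") (auto simp: add.commute)
 qed (simp add: G1)
 let ?n = "length L"
 define y where "y k = sc (fst (L ! k)) * ew (snd (L ! k))" for k
 define dg where "dg k = int (count (mset (snd (L ! k))) Eps)" for k
 have yG: "y k : G (dg k)" if "k < ?n" for k unfolding y_def dg_def by (intro Gs Gew words_nth[OF L(1) that])
 let ?D = "insert 1 (dg ` {..<?n})"
 \<comment> \<open>The homogeneous components of the word expression, with the element itself
   subtracted in degree 1. They sum to 0, so each of them lies in the ideal.\<close>
 let ?g = "%d. (SUM k:{k : {..<?n}. dg k = d}. y k) + (if d = 1 then sc (-1) * X else 0)"
 have XG: "X : G 1" by (rule Gu[OF ueq_sym[OF X(2)] G(2)[OF n]])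
 have "sc (-1) * X : G 1" by (rule Gs[OF XG])
 hence "?g d : G d" for d by (intro Ga Gsum) (auto simp: G0 simp del: minus_diff_eq intro: yG split: if_splits)
 moreover have "(SUM d:?D. ?g d) = 0"
 proof -
  have "(SUM d:?D. SUM k:{k : {..<?n}. dg k = d}. y k) = (SUM k<?n. y k)" by (rule sum.group) auto
  also have "... = X" unfolding L(2) ev_nth y_def ..
  finally show ?thesis unfolding sum.distrib by (simp add: sc_uminus)
 qed
 ultimately have "?g 1 : relI" by (intro Gsep[of ?D ?g]) (auto simp: relI_0)
 moreover have "{k : {..<?n}. dg k = 1} = {k : {..<?n}. (%(c, u). count (mset u) Eps = 1) (L ! k)}"
  by (auto simp: dg_def case_prod_unfold)
 ultimately have "ev ew (filter (%(c, u). count (mset u) Eps = 1) L) ~~ X"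
  unfolding ev_filter ueq_def y_def by (simp add: sc_uminus)
 hence L1: "EX L. words L & ev ew L ~~ X & (ALL (c, u):set L. count (mset u) Eps = 1)"
  using words_filter[OF L(1)] by (intro exI[of _ "filter (%(c, u). count (mset u) Eps = 1) L"]) auto
 have "EX L. words L & ev ew L ~~ X & (ALL (c, u):set L. count (mset u) Eps = 1 & (ALL j:R. cont (Orb j) u = 2 * csum T j i))"
  if "R <= Rp" for R using finite_subset[OF that finite_reps] that
 proof (induction R rule: finite_induct)
  case empty
  thus ?case using L1 by simp
 next
  case (insert j R)
  then obtain L where L: "words L" "ev ew L ~~ X"
  "ALL (c, u):set L. count (mset u) Eps = 1 & (ALL j:R. cont (Orb j) u = 2 * csum T j i)" by auto
  have j: "j : Rp" using insert by blast
  note a = Orb_an[OF j] and nj = reps_no[OF j]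
  have eX: "ev ew L ~~ x Pl i 1" using L(2) X(2) ueq_trans ueq_sym by blast
  have "kO j * ev ew L ~~ kO j * x Pl i 1" by (rule ueq_multl[OF chev_gen(2)[OF a] eX])
  also have "... ~~ sc (s powi (2 * csum T j i)) * (x Pl i 1 * kO j)"
  using dr_kx[OF nj n, of Pl 1] by (simp add: rep_reps[OF j] qq_powi mult.assoc)
  also have "... ~~ sc (s powi (2 * csum T j i)) * (ev ew L * kO j)"
  by (intro ueq_sc ueq_multr chev_gen a ueq_sym[OF eX])
  finally have "ev ew (filter (%(c, u). cont (Orb j) u = 2 * csum T j i) L) ~~ ev ew L" by (rule wt_filter[OF L(1) a])
  hence "ev ew (filter (%(c, u). cont (Orb j) u = 2 * csum T j i) L) ~~ X" using L(2) ueq_trans by blast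
  thus ?case using words_filter[OF L(1)] L(3) by (intro exI[of _ "filter (%(c, u). cont (Orb j) u = 2 * csum T j i) L"]) auto
 qed
 from this[OF subset_refl] obtain L where "words L" "ev ew L ~~ X"
  "ALL (c, u):set L. count (mset u) Eps = 1 & (ALL j:Rp. cont (Orb j) u = 2 * csum T j i)" by blast
 thus ?thesis using ueq_trans[OF _ ueq_sym[OF X(2)]] by blast
qed

text \<open>An element of the radical kills the span of the \<open>f\<close> words on the vacuum, so
  its commutator with \<open>x\<^sup>-\<close> of mode -1 would vanish on the vacuum. But this
  commutator is a nonzero multiple of the difference of \<open>k\<^sub>i\<close> and its inverse,
  and the character takes the value 2 on \<open>k\<^sub>i\<close>; \<open>sg i ~= i\<close> makes
  \<open>xx_coeff\<close> equal to 1.\<close>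

lemma x1_not_radical:
 assumes i: "i : Rp" "sg i ~= i" and L: "words L" "ev ew L ~~ x Pl i 1"
 shows "EX ws. ev (rw ws e0) L ~= 0"
proof (rule ccontr)
 assume neg: "~ ?thesis"
 hence z: "ev (rw ws e0) L = 0" for ws by blast
 note n = reps_no[OF i(1)] and a = Orb_an[OF i(1)]
 interpret vacuum T "kchar i 2" by (rule vacuum_kchar) (use i in auto)
 have kill: "iact (x Pl i 1) F = 0" if F: "F : fspan" "F : ind" for F
  using ind.act_ueq[OF L(2) _ x_chev[OF n] F(2)] ev_Ep[OF L(1), of "[]"] Ep_chev
  radical_kills_span[OF L(1) z F(1)] by simp
 have F0: "F0 : fspan" unfolding fspan_def by (intro fv.span_base image_eqI[of _ _ "[]"]) (auto simp: fw_def)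
 note xc = x_chev[OF n]
 have "iact (x Mi i (-1)) F0 : fspan" "iact (x Mi i (-1)) F0 : ind" using fspan_chev[OF xc F0] iact_in[OF xc F0_ind] by auto
 hence "iact (comm (x Pl i 1) (x Mi i (-1))) F0 = 0" unfolding comm_def fa.act_diff fa.act_mult
  by (simp only: kill F0 F0_ind fa_right_zero diff_zero)
 moreover have "iact (comm (x Pl i 1) (x Mi i (-1))) F0 =
  iact (sc (xx_coeff T i i (-1) / (qi T i - inverse (qi T i))) * (phi T h Pl i (1 + -1) - phi T h Mi i (1 + -1))) F0"
  by (rule ind.act_ueq[OF dr_xx[OF n n]]) (use xc a in \<open>auto simp: comm_def phi_0 rep_reps[OF i(1)] intro!: chevI chev_gen F0_ind\<close>)
 moreover have "... = fscl (1 / qd (Orb i)) (fscl 2 F0 - fscl (inverse 2) F0)"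
  by (simp only: xx_coeff_reps(2)[OF i(1) i(1) i(2)] qi_diff[OF n] rep_reps[OF i(1)] phi_0 add.right_inverse
  fa.act_mult fa.act_diff fa.act_sc fa.act_var fop.simps kh_F0[OF a]) (simp add: kchar_def)
 ultimately have Z: "fscl (1 / qd (Orb i)) (fscl 2 F0 - fscl (inverse 2) F0) = 0" by (simp only:)
 have "fscl (1 / qd (Orb i)) (fscl 2 F0 - fscl (inverse 2) F0) [] = 0" unfolding Z by simp
 hence "(1 / qd (Orb i)) * (2 * F0 [] - inverse 2 * F0 []) = 0" by (simp add: fscl_app cscl_def)
 thus False using qd_nz[OF a] by (simp add: F0_def)
qed

text \<open>The commutator with \<open>f\<^sub>j\<close> is a multiple of \<phi> of mode 1, that is,
  of \<open>C * k\<^sub>i\<close> with \<open>C\<close> in the positive part, and it vanishes unless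
  \<open>i = j\<close>. No term with the inverse of \<open>k\<^sub>j\<close> occurs, so
  \<open>skew_sep\<close> kills that derivative.\<close>

lemma x1_rm:
 assumes i: "i : Rp" and L: "words L" "ev ew L ~~ x Pl i 1" and j: "j : Rp"
 shows "ev (rm (Orb j) ew) L : relI"
proof -
 note n = reps_no[OF i] and a = Orb_an[OF j] and nj = reps_no[OF j]
 let ?X = "ev ew L" and ?f = "ee Mi (Orb j)" and ?k = "kO j" and ?d = "qd (Orb j)"
 let ?A = "ev (rp (Orb j) ew) L" and ?B = "ev (rm (Orb j) ew) L"
 note fc = chev_gen(1)[OF a, of Mi]
 have AB: "?A : Ep" "?B : Ep" using ev_rp_Ep[OF L(1) a, of "[]"] by simp_all
 obtain H where H: "H : Ep" "h i 1 ~~ H" using h1_Ep[OF i] by blast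
 obtain C where C: "C : Ep" "phi T h Pl i 1 ~~ C * kO i" using phi1_Ep[OF i H] by blast
 let ?c = "xx_coeff T i j 0 / qd (Orb i)"
 have "?X * ?f - ?f * ?X ~~ x Pl i 1 * ?f - ?f * x Pl i 1" by (intro ueq_diff ueq_multl ueq_multr fc L(2))
 also have "... ~~ sc ?c * phi T h Pl i 1" using x_f[OF n j, of 1] by (simp add: rep_reps[OF i] phi_Mi_pos)
 also have "... ~~ sc ?c * (C * kO i)" by (rule ueq_sc[OF C(2)])
 also have "... = sc ?c * (C * ?k)" using xx_coeff_reps(1)[OF i j, of 0] by (cases "i = j") auto
 finally have 1: "?X * ?f - ?f * ?X ~~ sc ?c * (C * ?k)" .
 have "?X * ?f - ?f * ?X ~~ ?f * ?X + sc (1 / ?d) * (?A * ?k - kI j * ?B) - ?f * ?X"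
  using ev_f[OF L(1) a, of "[]"] by (intro ueq_diff) simp_all
 hence "sc (1 / ?d) * (?A * ?k - kI j * ?B) ~~ sc ?c * (C * ?k)"
  unfolding add_diff_cancel_left' by (rule ueq_trans[OF ueq_sym 1])
 hence "sc ?d * (sc (1 / ?d) * (?A * ?k - kI j * ?B)) ~~ sc ?d * (sc ?c * (C * ?k))" by (rule ueq_sc)
 hence "?A * ?k - kI j * ?B - sc (?d * ?c) * (C * ?k) : relI" using qd_nz[OF a] by (simp add: ueq_def)
 moreover have "(?A - sc (?d * ?c) * C) * ?k - kI j * ?B = ?A * ?k - kI j * ?B - sc (?d * ?c) * (C * ?k)"
  by (simp only: left_diff_distrib mult.assoc diff_diff_eq) (simp only: add.commute)
 ultimately have "(?A - sc (?d * ?c) * C) * ?k - kI j * ?B : relI" by (simp only:)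
 thus ?thesis by (rule skew_sep(2)[OF a Ep_closed(7)[OF AB(1) Ep_closed(6)[OF Ep_closed(1) C(1)]] AB(2)])
qed

text \<open>Since the \<open>rm\<close> derivatives vanish, an \<open>rp\<close> derivative is, up
  to a scalar, the commutator with \<open>f\<^sub>j\<close> times the inverse of
  \<open>k\<^sub>j\<close>, and so it stays in \<open>Pa\<close>.\<close>

lemma x1_rp_Pa:
 assumes i: "i : Rp" and L: "words L" "ev ew L ~~ x Pl i 1"
 shows "set bs <= Orb ` Rp ==> ev (rw (pure bs) ew) L : Pa"
proof (induction bs rule: rev_induct)
 case Nil
 show ?case using Pa_closed(8)[OF L(2) Pa_x[OF reps_no[OF i]]] by simp
next
 case (snoc b bs)
 then obtain j where j: "j : Rp" "b = Orb j" by auto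
 note a = Orb_an[OF j(1)]
 let ?Y = "ev (rw (pure bs) ew) L" and ?f = "ee Mi (Orb j)" and ?k = "kO j" and ?d = "qd (Orb j)"
 let ?A = "ev (rw (pure bs) (rp (Orb j) ew)) L" and ?B = "ev (rw (pure bs) (rm (Orb j) ew)) L"
 have Y: "?Y : Pa" using snoc by simp
 have AB: "?A : chev" "?B : chev" using ev_rp_Ep[OF L(1) a] Ep_chev by blast+
 have "set (map snd (pure bs)) <= An" using snoc by (auto simp: anodes_def)
 hence "ev (rw ([(False, Orb j)] @ pure bs) ew) L : relI" using x1_rm[OF i L j(1)] by (intro ev_relI_rw L) simp_all
 hence "?B : relI" by (simp add: rm_rw_pure)
 hence kB: "sc (1 / ?d) * (kI j * ?B) : relI" by (intro relI_sc relI_left[OF chev_gen(3)[OF a]])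
 have "?Y * ?f - ?f * ?Y ~~ ?f * ?Y + sc (1 / ?d) * (?A * ?k - kI j * ?B) - ?f * ?Y" by (intro ueq_diff ev_f L a ueq_refl)
 also have "... = sc (1 / ?d) * (?A * ?k) - sc (1 / ?d) * (kI j * ?B)" by (simp add: right_diff_distrib)
 also have "... ~~ sc (1 / ?d) * (?A * ?k) - 0" by (intro ueq_diff ueq_refl) (simp add: ueq_0 kB)
 finally have "sc ?d * ((?Y * ?f - ?f * ?Y) * kI j) ~~ sc ?d * ((sc (1 / ?d) * (?A * ?k)) * kI j)"
  by (intro ueq_sc ueq_multr chev_gen a) simp
 also have "... = ?A * (?k * kI j)" using qd_nz[OF a] by (simp add: mult.assoc)
 also have "... ~~ ?A * 1" by (intro ueq_multl rel_kinv AB a)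
 finally have "?A ~~ sc ?d * ((?Y * ?f - ?f * ?Y) * kI j)" by (simp add: ueq_sym)
 moreover have "sc ?d * ((?Y * ?f - ?f * ?Y) * kI j) : Pa" by (intro Pa_closed(1,3,4) Y Pa_f j Pa_k)
 ultimately have "?A : Pa" by (rule Pa_closed(8))
 thus ?case by (simp add: j(2))
qed

text \<open>Some sequence \<open>as\<close> of derivations has nonzero counit on
  \<open>x\<^sup>+\<close> of mode 1; its content is that of the words of this element, with a
  single \<epsilon>. If the last letter were \<open>Orb j\<close>, its derivation could be turned
  into an \<open>rm\<close> and moved to the front, where it annihilates the element. So \<epsilon>
  comes last, and the derivations before it, which stay in \<open>Pa\<close>, leave a nonzero
  multiple of \<open>e\<^sub>\<epsilon>\<close>.\<close>

theorem e_Eps_Pa: "ee Pl Eps : Pa"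
proof -
 obtain i where i: "i : Rp" "sg i ~= i" using ex_moved_rep by blast
 obtain L where L: "words L" "ev ew L ~~ x Pl i 1"
  and Lc: "!!c u. (c, u) : set L ==> count (mset u) Eps = 1"
  "!!c u j. (c, u) : set L ==> j : Rp ==> cont (Orb j) u = 2 * csum T j i"
  using x1_words[OF i(1)] by blast
 obtain as where as: "ev (rw (pure as) e0) L ~= 0" using x1_not_radical[OF i L] rw_pure by metis
 have "EX c u. (c, u) : set L & rw (pure as) e0 u ~= 0"
  using as ev_pred[of "%z. z = 0" L "rw (pure as) e0"] by auto
 then obtain c0 u0 where u0: "(c0, u0) : set L" "rw (pure as) e0 u0 ~= 0" by blast
 have "mset u0 = mset as"
 proof (rule ccontr)
  assume "mset u0 ~= mset as"
  hence "rw (pure as) e0 u0 = 0" by (intro rw_pred[where P = "%z. z = 0"]) (auto simp: e0_def comp_def)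
  thus False using u0 by blast
 qed
 hence mset: "mset u = mset as" if "(c, u) : set L" for c u
  using same_content[of u u0] Lc that u0(1) L(1) by (force simp: words_def)
 have asn: "set as <= An" using `mset u0 = mset as` u0(1) L(1) mset_eq_setD by (force simp: words_def)
 have one: "count (mset as) Eps = 1" using Lc(1)[OF u0(1)] `mset u0 = mset as` by simp
 hence "as ~= []" by auto
 then obtain bs b where bs: "as = bs @ [b]" by (metis rev_exhaust)
 have bsn: "set bs <= An" and b: "b : An" using asn bs by auto
 show ?thesis
 proof (cases "b = Eps")
  case True
  hence "count (mset bs) Eps = 0" using one bs by simp
  hence "Eps ~: set bs" by (metis count_mset_0_iff)
  hence bo: "set bs <= Orb ` Rp" using bsn by (auto simp: anodes_def)
  \<comment> \<open>On a word with the content of \<open>bs\<close> and one \<epsilon>, the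
    derivations \<open>bs\<close> leave the single letter \<epsilon>; \<open>?r\<close> reads off
    its coefficient.\<close>
  let ?r = "rp Eps e0"
  have "ev (rw (pure bs) (%w. ew w - ?r w * ee Pl Eps)) L = 0"
  proof (rule ev_pred[where P = "%z. z = 0"])
  fix c u assume "(c, u) : set L"
  hence "mset u = mset bs + {#Eps#}" using mset bs True by simp
  thus "rw (pure bs) (%w. ew w - ?r w * ee Pl Eps) u = 0"
  by (intro rw_pred[where P = "%z. z = 0"]) (auto simp: comp_def e0_def)
  qed auto
  hence "ev (rw (pure bs) ew) L = ev (rw (pure bs) ?r) L * ee Pl Eps"
  unfolding rw_diff ev_diff rw_lin[OF flin_mult(1)] ev_lin[OF flin_mult(1)] by simp
  moreover have "EX c. ev (rw (pure bs) ?r) L = sc c"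
  proof -
  have cl: "EX c. (0 :: falg) = sc c" "!!x y :: falg. EX c. x = sc c ==> EX c. y = sc c ==> EX c. x + y = sc c"
  "!!c (x :: falg). EX c. x = sc c ==> EX d. sc c * x = sc d"
  by (metis sc_0, metis sc_add, metis sc_mult)
  have "e0 w = sc (if w = [] then 1 else 0)" for w by (simp add: e0_def)
  hence "EX c. e0 w = sc c" for w by blast
  hence "EX c. ?r w = sc c" for w by (intro rp_pred(1)[where P = "%z. EX c. z = sc c"] cl) auto
  thus ?thesis by (intro ev_rw_pred[where P = "%z. EX c. z = sc c"] L(1) cl) auto
  qed
  then obtain c where c: "ev (rw (pure bs) ?r) L = sc c" by blast
  moreover have "c ~= 0" using as c bs True by auto
  ultimately have "ee Pl Eps = sc (1 / c) * ev (rw (pure bs) ew) L" by simp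
  thus ?thesis using x1_rp_Pa[OF i(1) L bo] Pa_closed(1,3) by metis
 next
  case False
  then obtain j where j: "j : Rp" "b = Orb j" using b by (auto simp: anodes_def)
  have e: "rw (pure as) e0 = rw ([(False, b)] @ pure bs) e0" by (simp add: bs rp_e0 rm_rw_pure)
  have "ev (rw ([(False, b)] @ pure bs) ew) L : relI" using x1_rm[OF i(1) L j(1)] bsn j(2) by (intro ev_relI_rw L) auto
  from counit_relI[OF L(1) this] show ?thesis using as unfolding e by blast
 qed
qed

end

section \<open>Linear recurrences\<close>

text \<open>The polynomial \<open>D\<close> in the shift operator, applied to the sequence
  \<open>f\<close> and evaluated at \<open>n\<close>; a product of polynomials acts as a composition
  (\<open>psh_mult\<close>).\<close>

definition psh :: "(complex => 'v => 'v) => complex poly => (nat => 'v) => nat => 'v::ab_group_add" where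
 "psh scl D f n = (SUM t<=degree D. scl (coeff D t) (f (n + t)))"

locale cvector_space = vector_space scale
 for scale :: "complex => 'v::ab_group_add => 'v"
begin

lemma psh_superset: "degree D <= N ==> psh scale D f n = (SUM t<=N. scale (coeff D t) (f (n + t)))"
 unfolding psh_def by (rule sum.mono_neutral_left) (auto simp: coeff_eq_0)

lemma psh_0 [simp]: "psh scale 0 f n = 0" by (simp add: psh_def)

lemma psh_pCons: "psh scale (pCons a p) f n = scale a (f n) + psh scale p f (Suc n)"
proof -
 have "psh scale (pCons a p) f n = (SUM t<=Suc (degree p). scale (coeff (pCons a p) t) (f (n + t)))"
  by (rule psh_superset[OF degree_pCons_le])
 also have "... = scale a (f n) + (SUM t<=degree p. scale (coeff p t) (f (Suc n + t)))" unfolding sum.atMost_Suc_shift by simp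
 finally show ?thesis by (simp only: psh_def)
qed

lemma psh_smult: "psh scale (smult c p) f n = scale c (psh scale p f n)"
 by (subst psh_superset[OF degree_smult_le]) (simp add: psh_def scale_sum_right)

lemma psh_add: "psh scale (p + q) f n = psh scale p f n + psh scale q f n"
proof -
 let ?N = "max (degree p) (degree q)"
 have "psh scale (p + q) f n = (SUM t<=?N. scale (coeff (p + q) t) (f (n + t)))" by (rule psh_superset[OF degree_add_le_max])
 thus ?thesis by (simp add: psh_superset[of p ?N] psh_superset[of q ?N] scale_left_distrib sum.distrib)
qed

lemma psh_mult: "psh scale (p * q) f n = psh scale p (psh scale q f) n"
proof (induction p arbitrary: n)
 case (pCons a p)
 have "psh scale (pCons a p * q) f n = scale a (psh scale q f n) + psh scale (p * q) f (Suc n)"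
  unfolding mult_pCons_left psh_add psh_smult psh_pCons by simp
 thus ?case by (simp add: pCons psh_pCons)
qed simp

lemma psh_in: "subspace W ==> (!!n. f n : W) ==> psh scale D f n : W"
 unfolding psh_def by (intro subspace_sum subspace_scale)

lemma psh_mult_in: "subspace W ==> (!!n. psh scale D f n : W) ==> psh scale (D' * D) f n : W"
 unfolding psh_mult by (rule psh_in)

lemma psh_mult_in': "subspace W ==> (!!n. psh scale D f n : W) ==> psh scale (D * D') f n : W"
 by (subst mult.commute) (rule psh_mult_in)

end

interpretation cpx: cvector_space "(*) :: complex => complex => complex"
 by unfold_locales (simp_all add: algebra_simps)

abbreviation "cpsh == psh ((*) :: complex => complex => complex)"

definition recurrent :: "(nat => complex) => bool" where
 "recurrent f \<longleftrightarrow> (EX D. D ~= 0 & (ALL n. cpsh D f n = 0))"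

lemma common_poly:
 fixes P :: "'i => complex poly => bool"
 assumes "finite I" "!!i. i : I ==> EX D. D ~= 0 & P i D" "!!i D D'. i : I ==> P i D ==> P i (D' * D)"
 shows "EX D. D ~= 0 & (ALL i:I. P i D)" using assms
proof (induction I rule: finite_induct)
 case (insert i I)
 have "EX D. D ~= 0 & (ALL i:I. P i D)" by (rule insert.IH) (use insert.prems in auto)
 then obtain D where D: "D ~= 0" "ALL i:I. P i D" by blast
 obtain D' where D': "D' ~= 0" "P i D'" using insert.prems(1)[of i] by auto
 have "P i (D' * D)" using insert.prems(2)[of i D' D] D' by (simp add: mult.commute)
 moreover have "ALL j:I. P j (D' * D)" using insert.prems(2) D by auto
 ultimately show ?case using D D' by (intro exI[of _ "D' * D"]) auto
qed (auto intro: exI[of _ 1])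

lemma homogeneous_system:
 fixes w :: "'m => 'x => complex"
 assumes "finite I" "finite K" "card I < card K"
 shows "EX c. (EX m:K. c m ~= 0) & (ALL x:I. (SUM m:K. c m * w m x) = 0)" using assms
proof (induction I arbitrary: K w rule: finite_induct)
 case empty
 hence "K ~= {}" by auto
 thus ?case by (intro exI[of _ "%_. 1"]) auto
next
 case (insert x I)
 show ?case
 proof (cases "ALL m:K. w m x = 0")
  case True
  obtain c where "EX m:K. c m ~= 0" "ALL x:I. (SUM m:K. c m * w m x) = 0"
  using insert.IH[of K w] insert.prems insert.hyps by auto
  thus ?thesis using True by (intro exI[of _ c]) (simp add: sum.neutral)
 next
  case False
  then obtain m0 where m0: "m0 : K" "w m0 x ~= 0" by blast
  let ?K = "K - {m0}"
  let ?w = "%m y. w m y - w m x / w m0 x * w m0 y"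
  have "card I < card ?K" using insert m0 by simp
  then obtain c where c: "EX m:?K. c m ~= 0" "ALL y:I. (SUM m:?K. c m * ?w m y) = 0"
  using insert.IH[of ?K ?w] insert.prems by auto
  let ?c = "c(m0 := - (SUM m:?K. c m * w m x) / w m0 x)"
  have split: "(SUM m:K. ?c m * w m y) = - (SUM m:?K. c m * w m x) / w m0 x * w m0 y + (SUM m:?K. c m * w m y)" for y
  proof -
  have "(SUM m:K. ?c m * w m y) = ?c m0 * w m0 y + (SUM m:?K. ?c m * w m y)" using insert.prems m0 by (intro sum.remove)
  moreover have "(SUM m:?K. ?c m * w m y) = (SUM m:?K. c m * w m y)" by (intro sum.cong) auto
  ultimately show ?thesis by simp
  qed
  have "(SUM m:K. ?c m * w m y) = 0" if y: "y : insert x I" for y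
  proof (cases "y = x")
  case True
  thus ?thesis unfolding split using m0(2) by simp
  next
  case False
  hence "(SUM m:?K. c m * ?w m y) = 0" using c(2) y by auto
  moreover have "(SUM m:?K. c m * ?w m y) = (SUM m:?K. c m * w m y) - (SUM m:?K. c m * w m x) / w m0 x * w m0 y"
  unfolding right_diff_distrib sum_subtractf sum_divide_distrib sum_distrib_right by simp
  ultimately show ?thesis unfolding split by simp
  qed
  moreover have "EX m:K. ?c m ~= 0" using c(1) by auto
  ultimately show ?thesis by blast
 qed
qed

section \<open>Rational power series and linear recurrences\<close>

lemma rational_fps_iff: "rational_fps F \<longleftrightarrow> (EX P Q. coeff Q 0 ~= 0 & F * fps_of_poly Q = fps_of_poly P)"
proof
 assume "rational_fps F"
 then obtain P Q where "poly Q 0 ~= 0" "F = fps_of_poly P / fps_of_poly Q" by (auto simp: rational_fps_def)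
 thus "EX P Q. coeff Q 0 ~= 0 & F * fps_of_poly Q = fps_of_poly P"
  by (intro exI[of _ P] exI[of _ Q]) (simp add: poly_0_coeff_0 fps_divide_unit mult.assoc inverse_mult_eq_1)
next
 assume "EX P Q. coeff Q 0 ~= 0 & F * fps_of_poly Q = fps_of_poly P"
 then obtain P Q where "coeff Q 0 ~= 0" "F * fps_of_poly Q = fps_of_poly P" by blast
 thus "rational_fps F" unfolding rational_fps_def
  by (intro exI[of _ P] exI[of _ Q]) (simp add: poly_0_coeff_0 fps_divide_unit mult.assoc inverse_mult_eq_1' flip: `F * _ = _`)
qed

lemma recurrent_if_rational:
 assumes "rational_fps (Abs_fps f)"
 shows "recurrent f"
proof -
 obtain P Q where Q0: "coeff Q 0 ~= 0" and f: "Abs_fps f * fps_of_poly Q = fps_of_poly P"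
  using assms by (auto simp: rational_fps_iff)
 have fQ: "fps_of_poly Q * Abs_fps f = fps_of_poly P" using f by (simp add: mult.commute)
 \<comment> \<open>\<open>D\<close> will be \<open>Q\<close> reversed and padded to length
   \<open>L\<close>. As \<open>L\<close> exceeds the degree of \<open>P\<close>, the recurrence only
   meets coefficients of \<open>P\<close> that vanish.\<close>
 define L where "L = max (degree Q) (Suc (degree P))"
 define D where "D = (SUM t<=L. monom (coeff Q (L - t)) t)"
 have cD: "coeff D t = (if t <= L then coeff Q (L - t) else 0)" for t by (simp add: D_def coeff_sum)
 have "coeff D L ~= 0" using Q0 by (simp add: cD)
 hence D0: "D ~= 0" by auto
 have dL: "degree D <= L" by (rule degree_le) (simp add: cD)
 have "cpsh D f n = 0" for n
 proof -
  have "cpsh D f n = (SUM t<=L. coeff Q (L - t) * f (n + t))"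
  unfolding cpx.psh_superset[OF dL] by (intro sum.cong) (simp_all add: cD)
  also have "... = (SUM j<=L. coeff Q j * f (n + L - j))"
  by (rule sum.reindex_bij_witness[of _ "%j. L - j" "%t. L - t"]) auto
  also have "... = (SUM j=0..n + L. coeff Q j * f (n + L - j))" by (rule sum.mono_neutral_left) (auto simp: L_def coeff_eq_0)
  also have "... = cf (fps_of_poly Q * Abs_fps f) (n + L)" by (simp add: fps_mult_nth)
  also have "... = 0" unfolding fQ by (simp add: L_def coeff_eq_0)
  finally show ?thesis .
 qed
 thus ?thesis using D0 by (auto simp: recurrent_def)
qed

lemma rational_if_recurrent:
 assumes "recurrent f"
 shows "rational_fps (Abs_fps f)"
proof -
 obtain D where D: "D ~= 0" "!!n. cpsh D f n = 0" using assms by (auto simp: recurrent_def)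
 let ?Q = "reflect_poly D" and ?L = "degree D"
 have Q0: "coeff ?Q 0 ~= 0" using D(1) by simp
 let ?G = "fps_of_poly ?Q * Abs_fps f"
 define P where "P = (SUM m<?L. monom (cf ?G m) m)"
 have cP: "coeff P m = (if m < ?L then cf ?G m else 0)" for m by (simp add: P_def coeff_sum)
 have G0: "cf ?G m = 0" if "m >= ?L" for m
 proof -
  have "cf ?G m = (SUM j=0..m. coeff ?Q j * f (m - j))" by (simp add: fps_mult_nth)
  also have "... = (SUM j<=?L. coeff ?Q j * f (m - j))"
  by (rule sum.mono_neutral_right) (use that in \<open>auto simp: coeff_reflect_poly\<close>)
  also have "... = (SUM t<=?L. coeff D t * f (m - ?L + t))"
  by (rule sum.reindex_bij_witness[of _ "%t. ?L - t" "%j. ?L - j"]) (use that in \<open>auto simp: coeff_reflect_poly\<close>)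
  also have "... = 0" using D(2)[of "m - ?L"] by (simp add: psh_def)
  finally show ?thesis .
 qed
 have "?G = fps_of_poly P" by (rule fps_ext) (use G0 in \<open>auto simp: cP\<close>)
 hence "Abs_fps f * fps_of_poly ?Q = fps_of_poly P" by (simp add: mult.commute)
 thus ?thesis using Q0 unfolding rational_fps_iff by blast
qed

lemma recurrent_iff: "recurrent f \<longleftrightarrow> rational_fps (Abs_fps f)" using recurrent_if_rational rational_if_recurrent by blast

text \<open>The solution of the recurrence with characteristic polynomial \<open>D\<close> whose initial values vanish except for
  the one at \<open>i\<close>, which is \<open>1\<close>.\<close>

function cmp :: "complex poly => nat => nat => complex" where
 "cmp D i m = (if m < degree D then (if m = i then 1 else 0)
  else - (SUM t<degree D. coeff D t * cmp D i (m - degree D + t)) / lead_coeff D)" by auto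
termination by (relation "measure (%(D, i, m). m)") auto

declare cmp.simps [simp del]

lemma cmp_init: "m < degree D ==> cmp D i m = (if m = i then 1 else 0)" by (simp add: cmp.simps)

lemma cmp_psh: "D ~= 0 ==> cpsh D (cmp D i) n = 0"
proof -
 assume D: "D ~= 0"
 have "cmp D i (n + degree D) = - (SUM t<degree D. coeff D t * cmp D i (n + t)) / lead_coeff D" by (subst cmp.simps) simp
 thus ?thesis using D by (simp add: psh_def lessThan_Suc_atMost[symmetric])
qed

text \<open>The recurrence rewrites every term through \<open>degree D\<close> consecutive ones
  modulo \<open>W\<close>, with coefficients \<open>cmp D i m\<close> that depend neither on
  \<open>f\<close> nor on the starting point \<open>n\<close>.\<close>

lemma (in cvector_space) cmp_expand:
 assumes W: "subspace W" and D: "D ~= 0" and r: "!!n. psh scale D f n : W"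
 shows "f (n + m) - (SUM i<degree D. scale (cmp D i m) (f (n + i))) : W"
proof (induction m rule: less_induct)
 case (less m)
 let ?p = "degree D"
 show ?case
 proof (cases "m < ?p")
  case True
  have "(SUM i<?p. scale (cmp D i m) (f (n + i))) = (SUM i<?p. if m = i then f (n + i) else 0)"
  by (intro sum.cong) (use True in \<open>auto simp: cmp_init\<close>)
  also have "... = f (n + m)" using True by simp
  finally show ?thesis using W by (simp add: subspace_0)
 next
  case False
  let ?l = "lead_coeff D"
  have l: "?l ~= 0" using D by simp
  let ?m = "%t. m - ?p + t"
  have "(SUM t<?p. scale (coeff D t) (f (n + ?m t) - (SUM i<?p. scale (cmp D i (?m t)) (f (n + i))))) : W" (is "?A : W")
  using False by (intro subspace_sum[OF W] subspace_scale[OF W] less) auto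
  moreover have "psh scale D f (n + m - ?p) : W" by (rule r)
  moreover have "psh scale D f (n + m - ?p) = (SUM t<?p. scale (coeff D t) (f (n + ?m t))) + scale ?l (f (n + m))"
  using False by (simp add: psh_def lessThan_Suc_atMost[symmetric] add.assoc)
  ultimately have "(SUM t<?p. scale (coeff D t) (f (n + ?m t))) + scale ?l (f (n + m)) - ?A : W" using subspace_diff[OF W] by simp
  hence "scale (1 / ?l) ((SUM t<?p. scale (coeff D t) (f (n + ?m t))) + scale ?l (f (n + m)) - ?A) : W"
  by (rule subspace_scale[OF W])
  moreover have "(SUM t<?p. scale (coeff D t) (f (n + ?m t))) - ?A = (SUM i<?p. scale (SUM t<?p. coeff D t * cmp D i (?m t)) (f (n + i)))"
  by (simp add: scale_right_diff_distrib sum_subtractf scale_sum_right scale_sum_left) (rule sum.swap)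
  moreover have "scale (1 / ?l) (SUM i<?p. scale (SUM t<?p. coeff D t * cmp D i (?m t)) (f (n + i))) = - (SUM i<?p. scale (cmp D i m) (f (n + i)))"
  unfolding scale_sum_right sum_negf[symmetric]
  proof (intro sum.cong refl)
  fix i
  have "cmp D i m = - (SUM t<?p. coeff D t * cmp D i (?m t)) / ?l" using False by (subst cmp.simps) simp
  thus "scale (1 / ?l) (scale (SUM t<?p. coeff D t * cmp D i (?m t)) (f (n + i))) = - scale (cmp D i m) (f (n + i))" by simp
  qed
  ultimately show ?thesis using l by (simp add: scale_right_diff_distrib scale_right_distrib algebra_simps)
 qed
qed

text \<open>Every term of the product is a combination of \<open>degree A * degree B\<close>
  products of initial terms, with coefficients \<open>?w\<close> independent of \<open>n\<close>. A
  linear relation between \<open>card ?I + 1\<close> such coefficient vectors is a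
  recurrence.\<close>

lemma recurrent_times:
 assumes "recurrent f" "recurrent g"
 shows "recurrent (%n. f n * g n)"
proof -
 obtain A B where A: "A ~= 0" "!!n. cpsh A f n = 0" and B: "B ~= 0" "!!n. cpsh B g n = 0"
  using assms by (auto simp: recurrent_def)
 let ?I = "{..<degree A} \<times> {..<degree B}"
 let ?w = "%m (i, j). cmp A i m * cmp B j m"
 have f: "f (n + m) = (SUM i<degree A. cmp A i m * f (n + i))" for n m
  using cpx.cmp_expand[of "{0}" A f n m] A by (simp add: cpx.subspace_single_0)
 have g: "g (n + m) = (SUM j<degree B. cmp B j m * g (n + j))" for n m
  using cpx.cmp_expand[of "{0}" B g n m] B by (simp add: cpx.subspace_single_0)
 have "card ?I < card {..card ?I}" by simp
 then obtain c where c: "EX m:{..card ?I}. c m ~= 0" "ALL x:?I. (SUM m<=card ?I. c m * ?w m x) = 0"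
  using homogeneous_system[of ?I "{..card ?I}" ?w] by auto
 define D where "D = (SUM m<=card ?I. monom (c m) m)"
 have cD: "coeff D m = (if m <= card ?I then c m else 0)" for m by (simp add: D_def coeff_sum)
 obtain m where "m <= card ?I" "c m ~= 0" using c(1) by auto
 hence D0: "D ~= 0" using cD[of m] by auto
 have dD: "degree D <= card ?I" by (rule degree_le) (simp add: cD)
 have "cpsh D (%n. f n * g n) n = 0" for n
 proof -
  let ?F = "%(i, j). f (n + i) * g (n + j)"
  have fg: "f (n + m) * g (n + m) = (SUM x:?I. ?w m x * ?F x)" for m
  unfolding f[of n m] g[of n m] sum_product sum.cartesian_product by (intro sum.cong) auto
  have "cpsh D (%n. f n * g n) n = (SUM m<=card ?I. c m * (f (n + m) * g (n + m)))"
  unfolding cpx.psh_superset[OF dD] by (intro sum.cong) (simp_all add: cD)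
  also have "... = (SUM m<=card ?I. SUM x:?I. c m * ?w m x * ?F x)"
  unfolding fg sum_distrib_left by (simp only: mult.assoc)
  also have "... = (SUM x:?I. (SUM m<=card ?I. c m * ?w m x) * ?F x)" unfolding sum_distrib_right by (rule sum.swap)
  also have "... = 0" using c(2) by (intro sum.neutral) auto
  finally show ?thesis .
 qed
 thus ?thesis using D0 by (auto simp: recurrent_def)
qed

lemma rational_fps_mult: "rational_fps F ==> rational_fps G ==> rational_fps (F * G)"
proof -
 assume "rational_fps F" "rational_fps G"
 then obtain P Q P' Q' where *: "coeff Q 0 ~= 0" "F * fps_of_poly Q = fps_of_poly P"
  "coeff Q' 0 ~= 0" "G * fps_of_poly Q' = fps_of_poly P'" by (auto simp: rational_fps_iff)
 have "(F * G) * fps_of_poly (Q * Q') = (F * fps_of_poly Q) * (G * fps_of_poly Q')" by (simp add: fps_of_poly_mult mult_ac)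
 also have "... = fps_of_poly (P * P')" using * by (simp add: fps_of_poly_mult)
 finally show ?thesis unfolding rational_fps_iff using * by (intro exI[of _ "P * P'"] exI[of _ "Q * Q'"]) (simp add: coeff_mult_0)
qed

lemma recurrent_convolution:
 assumes "recurrent f" "recurrent g"
 shows "recurrent (%n. SUM m=0..n. f m * g (n - m))"
proof -
 have "Abs_fps (%n. SUM m=0..n. f m * g (n - m)) = Abs_fps f * Abs_fps g" by (simp add: fps_times_def)
 thus ?thesis using assms rational_fps_mult by (simp add: recurrent_iff)
qed

text \<open>The logarithmic derivative of \<open>C\<close> is that of a product of factors
  \<open>(1 - a t * u) / (1 - b t * u)\<close> in the variable \<open>u\<close>; the induction
  splits off one factor.\<close>

lemma rational_ode:
 fixes C :: "complex fps" and a b :: "'t => complex"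
 assumes "finite I" "fps_deriv C = Abs_fps (%n. SUM t:I. b t ^ Suc n - a t ^ Suc n) * C"
 shows "rational_fps C" using assms
proof (induction I arbitrary: C rule: finite_induct)
 case empty
 have "Abs_fps (%n. 0) = (0 :: complex fps)" by (rule fps_ext) simp
 hence "fps_deriv C = 0" using empty by simp
 hence "C = fps_const (cf C 0)" by (simp add: fps_deriv_eq_0_iff)
 also have "... = fps_of_poly [:cf C 0:]" by (simp add: fps_of_poly_const)
 finally have "C * fps_of_poly 1 = fps_of_poly [:cf C 0:]" by simp
 thus ?case unfolding rational_fps_iff by (intro exI[of _ "[:cf C 0:]"] exI[of _ 1]) simp
next
 case (insert t I)
 define G where "G c = Abs_fps (%n. c ^ n)" for c :: complex
 define l where "l c = 1 - fps_const c * fps_X" for c :: complex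
 have G: "G c * l c = 1" for c
 proof (rule fps_ext)
  fix n show "cf (G c * l c) n = cf 1 n"
  by (cases n) (simp_all add: G_def l_def right_diff_distrib mult.assoc[symmetric] fps_mult_right_const_nth)
 qed
 have l': "fps_deriv (l c) = - fps_const c" for c by (simp add: l_def)
 have G': "fps_deriv (G c) = fps_const c * G c * G c" for c
 proof -
  have "fps_deriv (G c) * l c + G c * fps_deriv (l c) = fps_deriv (G c * l c)" by (simp add: fps_deriv_mult add.commute)
  also have "... = 0" by (simp add: G)
  finally have "fps_deriv (G c) * l c = fps_const c * G c" unfolding l'
  by (metis add_eq_0_iff minus_minus mult.commute mult_minus_left add.commute)
  hence "fps_deriv (G c) * (l c * G c) = fps_const c * G c * G c" by (simp only: mult.assoc[symmetric])
  thus ?thesis using G[of c] by (simp add: mult.commute[of "l c"])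
 qed
 let ?B = "Abs_fps (%n. SUM t:I. b t ^ Suc n - a t ^ Suc n)"
 let ?b = "b t" and ?a = "a t"
 have "Abs_fps (%n. SUM t:insert t I. b t ^ Suc n - a t ^ Suc n) = fps_const ?b * G ?b - fps_const ?a * G ?a + ?B"
  using insert.hyps by (intro fps_ext) (simp add: G_def)
 hence C': "fps_deriv C = (fps_const ?b * G ?b - fps_const ?a * G ?a + ?B) * C" using insert.prems by simp
 define C1 where "C1 = C * l ?b * G ?a"
 have "fps_deriv C1 = fps_deriv C * l ?b * G ?a - C * fps_const ?b * G ?a + C * l ?b * (fps_const ?a * G ?a * G ?a)"
  by (simp add: C1_def fps_deriv_mult l' G' algebra_simps del: fps_const_neg)
 also have "... = ?B * C1 + fps_const ?b * (G ?b * l ?b) * C * G ?a - C * fps_const ?b * G ?a"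
  unfolding C' C1_def by (simp add: algebra_simps)
 also have "... = ?B * C1" by (simp add: G algebra_simps)
 finally have C1: "rational_fps C1" by (rule insert.IH)
 have "C1 * (l ?a * G ?b) = C * (G ?a * l ?a) * (G ?b * l ?b)" unfolding C1_def by (simp only: mult_ac)
 hence "C = C1 * (l ?a * G ?b)" by (simp add: G)
 moreover have "rational_fps (l ?a * G ?b)" unfolding rational_fps_iff by (rule exI[of _ "[:1, - ?a:]"], rule exI[of _ "[:1, - ?b:]"])
  (use G[of ?b] in \<open>simp add: l_def fps_of_poly_pCons mult.assoc mult.commute[of fps_X] flip: fps_const_neg\<close>)
 ultimately show ?case using C1 rational_fps_mult by metis
qed

section \<open>Generating series of the Drinfeld generators\<close>

lemma sc_of_nat: "of_nat n = (sc (of_nat n) :: 'g free_alg)" by (induction n) (simp_all add: sc_add)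

lemma fps_const_sc_commute: "fps_const (sc c) * F = F * (fps_const (sc c) :: 'g free_alg fps)" by (rule fps_ext) (simp add: sc_commute)

lemma sc_collect:
 fixes y z :: "'g free_alg"
 shows "sc a * (sc b * y) * (sc c * z) = sc (a * b * c) * (y * z)"
  "sc c * z * (sc a * (sc b * y)) = sc (a * b * c) * (z * y)"
proof -
 have "sc a * (sc b * y) * (sc c * z) = sc a * (sc b * (y * (sc c * z)))" by (simp only: mult.assoc)
 also have "... = sc (a * b * c) * (y * z)" by (simp only: sc_lcomm[of y] free_alg.scale_scale mult.assoc)
 finally show "sc a * (sc b * y) * (sc c * z) = sc (a * b * c) * (y * z)" .
 have "sc c * z * (sc a * (sc b * y)) = sc c * (z * (sc (a * b) * y))" by (simp only: mult.assoc free_alg.scale_scale)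
 also have "... = sc (c * (a * b)) * (z * y)" by (simp only: sc_lcomm[of z] free_alg.scale_scale)
 finally show "sc c * z * (sc a * (sc b * y)) = sc (a * b * c) * (z * y)" by (simp only: mult.commute[of c])
qed

context twisted
begin

section \<open>Linear differential equations modulo the ideal\<close>

lemma ueq_eqI: "a = b ==> a ~~ b" by simp

definition feq :: "falg fps => falg fps => bool" where
 "feq F G \<longleftrightarrow> (ALL n. cf F n ~~ cf G n)"

definition fchev :: "falg fps => bool" where
 "fchev F \<longleftrightarrow> (ALL n. cf F n : chev)"

lemma feq_refl [simp]: "feq F F" by (simp add: feq_def)

lemma feq_trans [trans]: "feq F G ==> feq G H ==> feq F H" unfolding feq_def using ueq_trans by blast

lemma feq_add: "feq F F' ==> feq G G' ==> feq (F + G) (F' + G')" unfolding feq_def by (simp add: ueq_add)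

lemma feq_mult_left: "fchev H ==> feq F G ==> feq (H * F) (H * G)"
 unfolding feq_def fchev_def fps_mult_nth by (intro allI ueq_sum ueq_multl) auto

lemma feq_mult_right: "fchev H ==> feq F G ==> feq (F * H) (G * H)"
 unfolding feq_def fchev_def fps_mult_nth by (intro allI ueq_sum ueq_multr) auto

lemma fchev_mult: "fchev F ==> fchev G ==> fchev (F * G)"
 unfolding fchev_def fps_mult_nth by (intro allI chevI) auto

lemma fchev_const: "c : chev ==> fchev (fps_const c)" by (auto simp: fchev_def fps_const_def chevI)

lemma fchev_power: "fchev F ==> fchev (F ^ n)"
proof (induction n)
 case 0
 show ?case by (simp add: fchev_def chevI)
qed (auto intro: fchev_mult)

lemma fchev_deriv: "fchev F ==> fchev (fps_deriv F)" by (simp add: fchev_def chevI sc_of_nat del: of_nat_Suc)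

text \<open>The equation expresses \<open>n\<close> times the \<open>n\<close>-th coefficient
  through the earlier ones. Identities between exponentials of the \<open>h\<close>s are proved
  below by this uniqueness.\<close>

lemma feq_ode_unique:
 assumes c: "fchev F" "fchev G" "fchev A" and 0: "cf F 0 ~~ cf G 0"
  and FG: "feq (fps_deriv F) (A * F)" "feq (fps_deriv G) (A * G)"
 shows "feq F G"
proof -
 have "cf F n ~~ cf G n" for n
 proof (induction n rule: less_induct)
  case (less n)
  show ?case
  proof (cases n)
  case (Suc k)
  have "of_nat n * cf F n = cf (fps_deriv F) k" by (simp add: Suc)
  also have "... ~~ cf (A * F) k" using FG(1) by (simp add: feq_def)
  also have "... ~~ cf (A * G) k"
  using less c(3) by (auto simp: fps_mult_nth Suc fchev_def intro!: ueq_sum ueq_multl)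
  also have "... ~~ cf (fps_deriv G) k" using FG(2) by (simp add: feq_def ueq_sym)
  also have "... = of_nat n * cf G n" by (simp add: Suc)
  finally have "sc (1 / of_nat n) * (sc (of_nat n) * cf F n) ~~ sc (1 / of_nat n) * (sc (of_nat n) * cf G n)"
  unfolding sc_of_nat by (rule ueq_sc)
  thus ?thesis using Suc by (simp del: of_nat_Suc)
  qed (simp add: 0)
 qed
 thus ?thesis by (simp add: feq_def)
qed

lemma feq_deriv_power:
 assumes g: "fchev g" and com: "feq (g * fps_deriv g) (fps_deriv g * g)"
 shows "feq (fps_deriv (g ^ Suc n)) (fps_const (sc (of_nat (Suc n))) * (fps_deriv g * g ^ n))"
proof (induction n)
 case (Suc n)
 let ?c = "fps_const (sc (of_nat (Suc n)))"
 have c: "fchev ?c" by (rule fchev_const[OF chevI(1)])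
 have "fps_deriv (g ^ Suc (Suc n)) = g * fps_deriv (g ^ Suc n) + fps_deriv g * g ^ Suc n" by (simp only: power_Suc fps_deriv_mult)
 also have "feq ... (g * (?c * (fps_deriv g * g ^ n)) + fps_deriv g * g ^ Suc n)" by (intro feq_add feq_mult_left g Suc feq_refl)
 also have "g * (?c * (fps_deriv g * g ^ n)) = ?c * ((g * fps_deriv g) * g ^ n)"
  by (simp only: mult.assoc[symmetric] fps_const_sc_commute[symmetric, of g])
 also have "feq (?c * ((g * fps_deriv g) * g ^ n) + fps_deriv g * g ^ Suc n)
  (?c * ((fps_deriv g * g) * g ^ n) + fps_deriv g * g ^ Suc n)"
  by (intro feq_add feq_mult_left[OF c] feq_mult_right fchev_power g com feq_refl)
 also have "?c * ((fps_deriv g * g) * g ^ n) + fps_deriv g * g ^ Suc n =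
  fps_const (sc (of_nat (Suc (Suc n)))) * (fps_deriv g * g ^ Suc n)"
 proof -
  have "of_nat (Suc (Suc n)) = of_nat (Suc n) + (1 :: complex)" by simp
  hence "fps_const (sc (of_nat (Suc (Suc n)))) = ?c + (1 :: falg fps)"
  by (simp only: sc_add sc_1 fps_const_add[symmetric] fps_const_1_eq_1)
  thus ?thesis by (simp only: distrib_right mult.assoc power_Suc mult_1_left)
 qed
 finally show ?case .
qed simp

lemma exp_ode:
 assumes g: "fchev g" "cf g 0 = 0" and com: "feq (g * fps_deriv g) (fps_deriv g * g)"
 shows "fchev (exp_series oo g)" "cf (exp_series oo g) 0 = 1"
  "feq (fps_deriv (exp_series oo g)) (fps_deriv g * (exp_series oo g))"
proof -
 show "fchev (exp_series oo g)" using fchev_power[OF g(1)] by (auto simp: fchev_def fps_compose_nth exp_series_def intro!: chevI)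
 show "cf (exp_series oo g) 0 = 1" by (simp add: exp_series_def)
 show "feq (fps_deriv (exp_series oo g)) (fps_deriv g * (exp_series oo g))" unfolding feq_def
 proof
  fix n
  let ?e = "%k. sc (1 / fact k) :: falg"
  have z: "cf (g ^ i) k = 0" if "k < i" for i k using startsby_zero_power_prefix[OF g(2), of i] that by blast
  have "cf (fps_deriv (exp_series oo g)) n = (SUM k=0..Suc n. ?e k * cf (fps_deriv (g ^ k)) n)"
  unfolding fps_deriv_nth fps_compose_nth sum_distrib_left Suc_eq_plus1
  proof (intro sum.cong refl)
  fix k
  show "of_nat (n + 1) * (cf exp_series k * cf (g ^ k) (n + 1)) = ?e k * (of_nat (n + 1) * cf (g ^ k) (n + 1))"
  unfolding mult.assoc[symmetric] mult_of_nat_commute[of "n + 1" "cf exp_series k"] by (simp only: exp_series_def fps_nth_Abs_fps)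
  qed
  also have "... = (SUM k=0..n. ?e (Suc k) * cf (fps_deriv (g ^ Suc k)) n)"
  unfolding sum.atLeast0_atMost_Suc_shift by (simp del: power_Suc fps_deriv_nth)
  also have "... ~~ (SUM k=0..n. ?e (Suc k) * cf (fps_const (sc (of_nat (Suc k))) * (fps_deriv g * g ^ k)) n)"
  using feq_deriv_power[OF g(1) com] unfolding feq_def by (intro ueq_sum ueq_sc) blast
  also have "... = (SUM k=0..n. ?e k * cf (fps_deriv g * g ^ k) n)" by (intro sum.cong refl) (simp del: of_nat_Suc)
  also have "... = (SUM k=0..n. SUM a=0..n. cf (fps_deriv g) a * (?e k * cf (g ^ k) (n - a)))"
  by (simp only: fps_mult_nth sum_distrib_left sc_lcomm)
  also have "... = (SUM a=0..n. SUM k=0..n. cf (fps_deriv g) a * (?e k * cf (g ^ k) (n - a)))" by (rule sum.swap)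
  also have "... = (SUM a=0..n. cf (fps_deriv g) a * (SUM k=0..n - a. ?e k * cf (g ^ k) (n - a)))"
  unfolding sum_distrib_left by (intro sum.cong refl sum.mono_neutral_right) (auto simp: z)
  also have "... = cf (fps_deriv g * (exp_series oo g)) n" by (simp add: fps_mult_nth fps_compose_nth exp_series_def)
  finally show "cf (fps_deriv (exp_series oo g)) n ~~ cf (fps_deriv g * (exp_series oo g)) n" .
 qed
qed

end

context drinfeld
begin

abbreviation "kap i == qd (Orb (rep T i))"

text \<open>The exponent in the definition of \<phi>. Its exponential \<open>Es\<close> is \<phi>
  without the factor \<open>k\<^sub>i\<close>, and it is \<open>Es\<close> that solves a linear
  differential equation.\<close>

definition gs :: "nat => falg fps" where
 "gs i = fps_const (sc (kap i)) * h_series h Pl i"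

definition Es :: "nat => falg fps" where
 "Es i = exp_series oo gs i"

lemma gs_nth: "cf (gs i) n = (if n = 0 then 0 else sc (kap i) * h i (int n))" by (simp add: gs_def h_series_def)

lemma gs_chev: "i : Nd ==> fchev (gs i)" by (simp add: fchev_def gs_nth chevI h_chev)

lemma phi_Es: "i : Nd ==> ph i n = ki T i * cf (Es i) n"
 by (simp add: phi_def phi_series_def Es_def gs_def qi_diff)

lemma gs_comm:
 assumes i: "i : Nd" "j : Nd"
 shows "cf (gs i) m * cf (gs j) n ~~ cf (gs j) n * cf (gs i) m"
proof (cases "m = 0 | n = 0")
 case False
 have "h i (int m) * h j (int n) ~~ h j (int n) * h i (int m)"
  using dr_hh[OF i, of "int m" "int n"] False by (simp add: comm_def ueq_def)
 from ueq_sc[OF this, of "kap i * kap j"] show ?thesis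
  using False by (simp add: gs_nth mult.assoc sc_lcomm[of "h _ _"] mult.commute)
qed (auto simp: gs_nth)

lemma gs_deriv_comm:
 assumes i: "i : Nd"
 shows "feq (gs i * fps_deriv (gs i)) (fps_deriv (gs i) * gs i)" unfolding feq_def
proof
 fix n
 let ?g = "cf (gs i)"
 have "cf (gs i * fps_deriv (gs i)) n = (SUM k=0..n. sc (of_nat (Suc (n - k))) * (?g k * ?g (Suc (n - k))))"
  unfolding fps_mult_nth fps_deriv_nth sc_of_nat by (intro sum.cong refl) (simp only: sc_lcomm Suc_eq_plus1)
 also have "... ~~ (SUM k=0..n. sc (of_nat (Suc (n - k))) * (?g (Suc (n - k)) * ?g k))" by (intro ueq_sum ueq_sc gs_comm i)
 also have "... ~~ (SUM k=0..n. sc (of_nat (Suc k)) * (?g (Suc k) * ?g (n - k)))"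
  by (rule ueq_eqI, rule sum.reindex_bij_witness[of _ "%k. n - k" "%k. n - k"]) auto
 also have "... ~~ cf (fps_deriv (gs i) * gs i) n"
  unfolding fps_mult_nth fps_deriv_nth sc_of_nat by (intro ueq_eqI sum.cong refl) (simp only: mult.assoc Suc_eq_plus1)
 finally show "cf (gs i * fps_deriv (gs i)) n ~~ cf (fps_deriv (gs i) * gs i) n" .
qed

lemma gs_0: "cf (gs i) 0 = 0" by (simp add: gs_nth)

lemma Es_ode:
 assumes i: "i : Nd"
 shows "fchev (Es i)" "cf (Es i) 0 = 1" "feq (fps_deriv (Es i)) (fps_deriv (gs i) * Es i)"
 unfolding Es_def using exp_ode[OF gs_chev[OF i] gs_0 gs_deriv_comm[OF i]] by blast+

lemma Es_nth:
 assumes i: "i : Nd"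
 shows "sc (of_nat (Suc n)) * cf (Es i) (Suc n) ~~
  (SUM k=0..n. sc (of_nat (Suc k) * kap i) * (h i (int (Suc k)) * cf (Es i) (n - k)))"
proof -
 have "sc (of_nat (Suc n)) * cf (Es i) (Suc n) = cf (fps_deriv (Es i)) n" unfolding fps_deriv_nth sc_of_nat Suc_eq_plus1 ..
 also have "... ~~ cf (fps_deriv (gs i) * Es i) n" using Es_ode(3)[OF i] by (simp only: feq_def)
 also have "... = (SUM k=0..n. sc (of_nat (Suc k) * kap i) * (h i (int (Suc k)) * cf (Es i) (n - k)))"
  unfolding fps_mult_nth fps_deriv_nth sc_of_nat Suc_eq_plus1[symmetric]
  by (intro sum.cong refl) (simp add: gs_nth mult.assoc del: of_nat_Suc)
 finally show ?thesis .
qed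

text \<open>A Newton identity, from the differential equation: it recovers the \<open>h\<close>s
  from the coefficients of \<open>Es\<close> and will show that they act on a highest weight vector
  by scalars.\<close>

lemma h_Es:
 assumes i: "i : Nd"
 shows "h i (int (Suc n)) ~~ sc (1 / kap i) * cf (Es i) (Suc n) -
  (SUM k=0..<n. sc (of_nat (Suc k) / of_nat (Suc n)) * (h i (int (Suc k)) * cf (Es i) (n - k)))"
proof -
 let ?c = "of_nat (Suc n) * kap i"
 have kap: "kap i ~= 0" using qd_nz[OF Orb_an[OF rep_reps'[OF i]]] .
 let ?S = "SUM k=0..<n. sc (of_nat (Suc k) * kap i) * (h i (int (Suc k)) * cf (Es i) (n - k))"
 have "sc (of_nat (Suc n)) * cf (Es i) (Suc n) ~~ ?S + sc ?c * h i (int (Suc n))"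
  using Es_nth[OF i, of n] by (simp add: Es_ode(2)[OF i] atLeastLessThanSuc_atLeastAtMost[symmetric] del: of_nat_Suc)
 hence "sc (of_nat (Suc n)) * cf (Es i) (Suc n) - ?S ~~ ?S + sc ?c * h i (int (Suc n)) - ?S" by (intro ueq_diff ueq_refl)
 hence "sc (1 / ?c) * (sc (of_nat (Suc n)) * cf (Es i) (Suc n) - ?S) ~~ sc (1 / ?c) * (sc ?c * h i (int (Suc n)))"
  by (intro ueq_sc) simp
 moreover have "sc (1 / ?c) * (sc ?c * h i (int (Suc n))) = h i (int (Suc n))" using kap by (simp del: of_nat_Suc)
 moreover have "sc (1 / ?c) * (sc (of_nat (Suc n)) * cf (Es i) (Suc n) - ?S) =
  sc (1 / kap i) * cf (Es i) (Suc n) -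
  (SUM k=0..<n. sc (of_nat (Suc k) / of_nat (Suc n)) * (h i (int (Suc k)) * cf (Es i) (n - k)))"
  using kap unfolding right_diff_distrib sum_distrib_left by (simp del: of_nat_Suc)
 ultimately show ?thesis by (simp only: ueq_sym)
qed

text \<open>The series \<open>Es\<close> at \<open>sg i\<close>, and the one at \<open>i\<close>
  with its variable multiplied by \<omega>, solve the same differential equation with the same
  constant term.\<close>

lemma phi_aut:
 assumes i: "i : Nd" and "m >= 0"
 shows "phi T h Pl (sg i) m ~~ sc (omega T powi m) * phi T h Pl i m"
proof -
 let ?w = "omega T"
 define F where "F = Abs_fps (%n. sc (?w ^ n) * cf (Es i) n)"
 have si: "sg i : Nd" and r: "rep T (sg i) = rep T i" using i by (simp_all add: aut_nodes rep_aut)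
 have Fc: "fchev F" using Es_ode(1)[OF i] by (simp add: F_def fchev_def chevI)
 have gs: "cf (gs (sg i)) n ~~ sc (?w ^ n) * cf (gs i) n" for n
  using ueq_sc[OF dr_h_aut[OF i, of "int n"], of "kap i"] by (simp add: gs_nth r mult.commute)
 have "feq (fps_deriv F) (fps_deriv (gs (sg i)) * F)" unfolding feq_def
 proof
  fix n
  have "cf (fps_deriv F) n = sc (?w ^ Suc n) * cf (fps_deriv (Es i)) n"
  unfolding fps_deriv_nth sc_of_nat F_def Suc_eq_plus1 fps_nth_Abs_fps by (simp only: free_alg.scale_scale mult.commute)
  also have "... ~~ sc (?w ^ Suc n) * cf (fps_deriv (gs i) * Es i) n"
  using Es_ode(3)[OF i] unfolding feq_def by (intro ueq_sc) blast
  also have "... = (SUM k=0..n. (sc (of_nat (Suc k)) * (sc (?w ^ Suc k) * cf (gs i) (Suc k))) * cf F (n - k))"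
  unfolding fps_mult_nth fps_deriv_nth sc_of_nat sum_distrib_left
  proof (intro sum.cong refl)
  fix k assume k: "k : {0..n}"
  have "?w ^ Suc n = ?w ^ Suc k * ?w ^ (n - k)" using k by (simp flip: power_add)
  thus "sc (?w ^ Suc n) * (sc (of_nat (k + 1)) * cf (gs i) (k + 1) * cf (Es i) (n - k)) =
  (sc (of_nat (Suc k)) * (sc (?w ^ Suc k) * cf (gs i) (Suc k))) * cf F (n - k)"
  unfolding F_def fps_nth_Abs_fps mult.assoc sc_lcomm[of "cf (gs i) _"] free_alg.scale_scale
  by (simp only: Suc_eq_plus1 mult_ac)
  qed
  also have "... ~~ (SUM k=0..n. (sc (of_nat (Suc k)) * cf (gs (sg i)) (Suc k)) * cf F (n - k))"
  using Fc by (intro ueq_sum ueq_multr ueq_sc ueq_sym[OF gs]) (simp add: fchev_def)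
  also have "... = cf (fps_deriv (gs (sg i)) * F) n" unfolding fps_mult_nth fps_deriv_nth sc_of_nat by simp
  finally show "cf (fps_deriv F) n ~~ cf (fps_deriv (gs (sg i)) * F) n" .
 qed
 hence "feq (Es (sg i)) F"
  using Es_ode[OF si] Es_ode(2)[OF i] by (intro feq_ode_unique[OF _ Fc fchev_deriv[OF gs_chev[OF si]]]) (simp_all add: F_def)
 hence "cf (Es (sg i)) n ~~ sc (?w ^ n) * cf (Es i) n" for n by (simp add: feq_def F_def)
 hence "ki T i * cf (Es (sg i)) (nat m) ~~ ki T i * (sc (?w ^ nat m) * cf (Es i) (nat m))"
  using Orb_an[OF rep_reps'[OF i]] by (intro ueq_multl chev_gen)
 thus ?thesis using assms(2) phi_Es[OF i, of "nat m"] phi_Es[OF si, of "nat m"] by (simp add: r sc_lcomm power_int_def)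
qed

text \<open>The coefficients of the exponential of the series with term \<open>b k / (k + 1)\<close>
  in degree \<open>k + 1\<close>.\<close>

fun cs :: "(nat => complex) => nat => complex" where
 "cs b 0 = 1"
| "cs b (Suc n) = (SUM k<=n. b k * cs b (n - k)) / of_nat (Suc n)"

declare cs.simps(2) [simp del]

definition bx :: "sign => nat => nat => nat => complex" where
 "bx p i j k = of_nat (Suc k) * kap i * (of_int (sgn_int p) * hx_coeff T i j (int (Suc k)))"

abbreviation "cx p i j == cs (bx p i j)"

text \<open>Both sides, as series in \<open>n\<close>, solve the differential equation with
  coefficient \<open>fps_deriv (gs i)\<close> and agree at 0. For the right-hand side, the bracket
  of \<open>h\<close> with \<open>x\<close> is absorbed by the derivative of
  \<open>Y\<close>.\<close>

lemma Es_x: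
 assumes i: "i : Nd" and j: "j : Nd"
 shows "cf (Es i) n * x p j l ~~ (SUM m=0..n. sc (cx p i j m) * (x p j (l + int m) * cf (Es i) (n - m)))"
proof -
 let ?c = "cx p i j"
 define Y where "Y = Abs_fps (%m. sc (?c m) * x p j (l + int m))"
 let ?X = "fps_const (x p j l)"
 let ?E = "Es i" and ?g = "fps_deriv (gs i)"
 have Yc: "fchev Y" by (simp add: Y_def fchev_def chevI x_chev j)
 have Xc: "fchev ?X" by (intro fchev_const x_chev j)
 note gc = fchev_deriv[OF gs_chev[OF i]]
 have "feq (fps_deriv (?E * ?X)) (?g * (?E * ?X))"
 proof -
  have "fps_deriv (?E * ?X) = fps_deriv ?E * ?X" by simp
  also have "feq ... ((?g * ?E) * ?X)" by (intro feq_mult_right Xc Es_ode i)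
  finally show ?thesis by (simp add: mult.assoc)
 qed
 moreover have "feq (fps_deriv (Y * ?E)) (?g * (Y * ?E))"
 proof -
  have gY: "feq (Y * ?g + fps_deriv Y) (?g * Y)" unfolding feq_def
  proof
  fix n
  let ?t = "%k. of_nat (Suc k) * kap i :: complex"
  have 1: "cf (?g * Y) n = (SUM k=0..n. sc (?t k * ?c (n - k)) * (h i (int (Suc k)) * x p j (l + int (n - k))))"
  unfolding fps_mult_nth fps_deriv_nth sc_of_nat Suc_eq_plus1[symmetric]
  by (intro sum.cong refl) (simp only: gs_nth Y_def fps_nth_Abs_fps nat.simps if_False sc_collect)
  have "cf (Y * ?g) n = (SUM k=0..n. cf Y (n - k) * cf ?g k)"
  unfolding fps_mult_nth by (rule sum.reindex_bij_witness[of _ "%k. n - k" "%k. n - k"]) auto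
  also have "... = (SUM k=0..n. sc (?t k * ?c (n - k)) * (x p j (l + int (n - k)) * h i (int (Suc k))))"
  unfolding fps_deriv_nth sc_of_nat Suc_eq_plus1[symmetric]
  by (intro sum.cong refl) (simp only: gs_nth Y_def fps_nth_Abs_fps nat.simps if_False sc_collect)
  finally have 2: "cf (Y * ?g) n = (SUM k=0..n. sc (?t k * ?c (n - k)) * (x p j (l + int (n - k)) * h i (int (Suc k))))" .
  have sc_sum: "sc (sum f A) = (SUM k:A. sc (f k) :: falg)" for f and A :: "nat set"
  by (induction A rule: infinite_finite_induct) (simp_all add: sc_add)
  have cS: "of_nat (Suc n) * ?c (Suc n) = (SUM k=0..n. bx p i j k * ?c (n - k))"
  by (simp add: cs.simps atLeast0AtMost del: of_nat_Suc)
  have 3: "cf (fps_deriv Y) n = (SUM k=0..n. sc (bx p i j k * ?c (n - k)) * x p j (l + int (Suc n)))"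
  unfolding fps_deriv_nth sc_of_nat Suc_eq_plus1[symmetric] Y_def fps_nth_Abs_fps free_alg.scale_scale cS sc_sum
  by (simp only: sum_distrib_right)
  have 4: "(SUM k=0..n. sc (bx p i j k * ?c (n - k)) * x p j (l + int (Suc n))) ~~
  (SUM k=0..n. sc (?t k * ?c (n - k)) * comm (h i (int (Suc k))) (x p j (l + int (n - k))))"
  proof (rule ueq_sum)
  fix k assume k: "k : {0..n}"
  have "sc (?t k * ?c (n - k)) * comm (h i (int (Suc k))) (x p j (l + int (n - k))) ~~
  sc (?t k * ?c (n - k)) * (sc (of_int (sgn_int p) * hx_coeff T i j (int (Suc k))) * x p j (int (Suc k) + (l + int (n - k))))"
  by (intro ueq_sc dr_hx i j) simp
  also have "... = sc (bx p i j k * ?c (n - k)) * x p j (l + int (Suc n))"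
  proof -
  have e: "int (Suc k) + (l + int (n - k)) = l + int (Suc n)" using k by (simp add: of_nat_diff)
  show ?thesis unfolding e bx_def free_alg.scale_scale by (simp only: mult_ac)
  qed
  finally show "sc (bx p i j k * ?c (n - k)) * x p j (l + int (Suc n)) ~~
  sc (?t k * ?c (n - k)) * comm (h i (int (Suc k))) (x p j (l + int (n - k)))" by (rule ueq_sym)
  qed
  have 5: "(SUM k=0..n. sc (?t k * ?c (n - k)) * comm (h i (int (Suc k))) (x p j (l + int (n - k)))) =
  cf (?g * Y) n - cf (Y * ?g) n" unfolding 1 2 sum_subtractf[symmetric] comm_def right_diff_distrib ..
  have "cf (fps_deriv Y) n ~~ cf (?g * Y) n - cf (Y * ?g) n" using 4 unfolding 3[symmetric] 5 .
  hence "cf (Y * ?g) n + cf (fps_deriv Y) n ~~ cf (Y * ?g) n + (cf (?g * Y) n - cf (Y * ?g) n)"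
  by (intro ueq_add ueq_refl)
  thus "cf (Y * ?g + fps_deriv Y) n ~~ cf (?g * Y) n" by simp
  qed
  have "fps_deriv (Y * ?E) = Y * fps_deriv ?E + fps_deriv Y * ?E" by (rule fps_deriv_mult)
  also have "feq ... (Y * (?g * ?E) + fps_deriv Y * ?E)" by (intro feq_add feq_mult_left Yc Es_ode i feq_refl)
  also have "... = (Y * ?g + fps_deriv Y) * ?E" by (simp add: distrib_right mult.assoc)
  also have "feq ... ((?g * Y) * ?E)" by (intro feq_mult_right Es_ode i gY)
  finally show ?thesis by (simp add: mult.assoc)
 qed
 moreover have "cf (?E * ?X) 0 ~~ cf (Y * ?E) 0" by (rule ueq_eqI) (simp add: Es_ode(2)[OF i] Y_def)
 ultimately have "feq (?E * ?X) (Y * ?E)"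
  by (intro feq_ode_unique[OF fchev_mult[OF Es_ode(1)[OF i] Xc] fchev_mult[OF Yc Es_ode(1)[OF i]] gc])
 hence "cf (?E * ?X) n ~~ cf (Y * ?E) n" unfolding feq_def by blast
 moreover have "cf (?E * ?X) n = cf ?E n * x p j l" by (rule fps_mult_right_const_nth)
 moreover have "cf (Y * ?E) n = (SUM m=0..n. sc (?c m) * (x p j (l + int m) * cf ?E (n - m)))"
  unfolding fps_mult_nth Y_def fps_nth_Abs_fps mult.assoc ..
 ultimately show ?thesis by (simp only:)
qed

lemma kk_x:
 assumes "a : Rp" "j : Nd"
 shows "kO a * x p j l ~~ sc (s powi (sgn_int p * (2 * csum T a j))) * (x p j l * kO a)"
 using dr_kx[OF reps_no[OF assms(1)] assms(2), of p l] by (simp add: rep_reps[OF assms(1)] qq_powi mult.assoc mult.left_commute)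

lemma aut_pow:
 assumes y: "!!i. i : Nd ==> y (sg i) ~~ sc w * y i" and i: "i : Nd"
 shows "y ((sg ^^ r) i) ~~ sc (w ^ r) * y i"
proof (induction r)
 case (Suc r)
 have "y ((sg ^^ Suc r) i) ~~ sc w * y ((sg ^^ r) i)" using y[OF pow_nodes[OF i, of r]] by simp
 also have "... ~~ sc w * (sc (w ^ r) * y i)" by (rule ueq_sc[OF Suc])
 finally show ?case by simp
qed simp

lemma rep_orbit: "i : Nd ==> EX r. i = (sg ^^ r) (rep T i)"
 using rep_eq_iff[of i "rep T i"] rep_rep[of i] reps_no[OF rep_reps'[of i]] by auto

lemma x_rep:
 assumes "i : Nd"
 shows "EX c. x p i m ~~ sc c * x p (rep T i) m"
 using rep_orbit[OF assms] aut_pow[of "%i. x p i m", OF dr_x_aut reps_no[OF rep_reps'[OF assms]]] by metis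

lemma Es_subalg:
 assumes "i : Nd"
 shows "cf (Es i) n : subalg {h i (int r) |r. r > 0}"
proof -
 let ?S = "subalg {h i (int r) |r. r > 0}"
 have g: "cf (gs i) n : ?S" for n by (auto simp: gs_nth subalg_0 intro!: subalg.mult[OF subalg.scalar subalg.gen])
 have "cf (gs i ^ k) n : ?S" for k n
 proof (induction k arbitrary: n)
  case 0
  show ?case by (simp add: subalg_0 subalg_1)
 next
  case (Suc k)
  thus ?case unfolding power_Suc fps_mult_nth by (intro subalg_sum subalg.mult g)
 qed
 thus ?thesis unfolding Es_def fps_compose_nth exp_series_def fps_nth_Abs_fps by (intro subalg_sum subalg.mult subalg.scalar)
qed

lemma subalg_comm:
 assumes "b : subalg S" "S <= chev" "y : chev" "!!a. a : S ==> a * y ~~ y * a"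
 shows "b : chev & b * y ~~ y * b" using assms(1)
proof (induction b rule: subalg.induct)
 case (scalar c)
 thus ?case by (simp add: sc_commute chevI)
next
 case (gen a)
 thus ?case using assms by blast
next
 case (add a b)
 thus ?case by (simp add: distrib_left distrib_right ueq_add chevI)
next
 case (mult a b)
 have "a * b * y = a * (b * y)" by (simp add: mult.assoc)
 also have "... ~~ a * (y * b)" using mult by (intro ueq_multl) auto
 also have "... = a * y * b" by (simp add: mult.assoc)
 also have "... ~~ y * a * b" using mult by (intro ueq_multr) auto
 finally show ?case using mult by (simp add: mult.assoc chevI)
qed

lemma h_set_chev: "i : Nd ==> {h i (int r) |r. r > 0} <= chev" by (auto intro: h_chev)

lemma Es_chev: "i : Nd ==> cf (Es i) n : chev" using Es_ode(1) by (simp add: fchev_def)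

lemma Es_comm:
 assumes "i : Nd" "y : chev" "!!r. r > 0 ==> h i (int r) * y ~~ y * h i (int r)"
 shows "cf (Es i) n * y ~~ y * cf (Es i) n"
 using subalg_comm[OF Es_subalg[OF assms(1)] h_set_chev[OF assms(1)] assms(2)] assms(3) by blast

lemma kk_h: "a : Rp ==> i : Nd ==> r ~= 0 ==> h i r * kO a ~~ kO a * h i r"
 using dr_kh[OF reps_no, of a i r] by (simp add: comm_def ueq_0 ueq_def rep_reps) (metis relI_uminus minus_diff_eq)

lemma kk_Es: "a : Rp ==> i : Nd ==> cf (Es i) n * kO a ~~ kO a * cf (Es i) n"
 by (intro Es_comm kk_h chev_gen Orb_an) simp_all

lemma Es_Es:
 assumes "i : Nd" "j : Nd"
 shows "cf (Es i) m * cf (Es j) n ~~ cf (Es j) n * cf (Es i) m"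
proof (intro Es_comm assms Es_chev)
 fix r :: nat
 assume r: "r > 0"
 have "h j (int t) * h i (int r) ~~ h i (int r) * h j (int t)" if "t > 0" for t
  using dr_hh[OF assms(2,1), of "int t" "int r"] that r by (simp add: comm_def ueq_0 ueq_def)
 from Es_comm[OF assms(2) h_chev[OF assms(1)] this] r
 show "h i (int r) * cf (Es j) n ~~ cf (Es j) n * h i (int r)" by (simp add: ueq_sym)
qed

lemma phi_reps: "i : Rp ==> ph i n = kO i * cf (Es i) n"
 using phi_Es[OF reps_no] by (simp add: rep_reps)

lemma phi_chev: "i : Rp ==> ph i n : chev"
 by (simp add: phi_reps chevI chev_gen Orb_an Es_chev reps_no)

lemma kk_phi:
 assumes "a : Rp" "i : Rp"
 shows "kO a * ph i n ~~ ph i n * kO a"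
proof -
 note c = chev_gen(2)[OF Orb_an[OF assms(1)]] chev_gen(2)[OF Orb_an[OF assms(2)]] Es_chev[OF reps_no[OF assms(2)]]
 have "kO a * ph i n = (kO a * kO i) * cf (Es i) n" by (simp add: phi_reps assms mult.assoc)
 also have "... ~~ (kO i * kO a) * cf (Es i) n" by (intro ueq_multr c rel_kk_comm Orb_an assms)
 also have "... = kO i * (kO a * cf (Es i) n)" by (simp add: mult.assoc)
 also have "... ~~ kO i * (cf (Es i) n * kO a)" by (intro ueq_multl c ueq_sym[OF kk_Es] assms reps_no)
 finally show ?thesis by (simp add: phi_reps assms mult.assoc)
qed

lemma phi_phi:
 assumes "i : Rp" "j : Rp"
 shows "ph i m * ph j n ~~ ph j n * ph i m"
proof -
 let ?E = "cf (Es i) m" and ?F = "cf (Es j) n" and ?k = "kO i" and ?k' = "kO j"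
 note c = chev_gen(2)[OF Orb_an[OF assms(1)]] Es_chev[OF reps_no[OF assms(1)]]
 note pc = phi_chev[OF assms(2)]
 have Ek: "?E * ph j n ~~ ph j n * ?E"
 proof -
  have "?E * ph j n = (?E * ?k') * ?F" by (simp add: phi_reps assms mult.assoc)
  also have "... ~~ (?k' * ?E) * ?F" using assms by (intro ueq_multr kk_Es Es_chev reps_no)
  also have "... = ?k' * (?E * ?F)" by (simp add: mult.assoc)
  also have "... ~~ ?k' * (?F * ?E)" using assms by (intro ueq_multl Es_Es chev_gen Orb_an reps_no)
  finally show ?thesis by (simp add: phi_reps assms mult.assoc)
 qed
 have "ph i m * ph j n = ?k * (?E * ph j n)" by (simp add: phi_reps assms(1) mult.assoc)
 also have "... ~~ ?k * (ph j n * ?E)" by (intro ueq_multl c Ek)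
 also have "... = (?k * ph j n) * ?E" by (simp add: mult.assoc)
 also have "... ~~ (ph j n * ?k) * ?E" by (intro ueq_multr c kk_phi assms)
 finally show ?thesis by (simp add: phi_reps assms(1) mult.assoc)
qed

lemma phi_x:
 assumes i: "i : Rp" and j: "j : Nd"
 shows "ph i n * x p j l ~~
  (SUM m=0..n. sc (s powi (sgn_int p * (2 * csum T i j)) * cx p i j m) * (x p j (l + int m) * phi T h Pl i (int (n - m))))"
proof -
 note n = reps_no[OF i] and kc = chev_gen(2)[OF Orb_an[OF i]]
 let ?t = "s powi (sgn_int p * (2 * csum T i j))"
 have 1: "ph i n * x p j l = kO i * (cf (Es i) n * x p j l)" by (simp only: phi_reps[OF i] mult.assoc)
 have 2: "kO i * (cf (Es i) n * x p j l) ~~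
  kO i * (SUM m=0..n. sc (cx p i j m) * (x p j (l + int m) * cf (Es i) (n - m)))"
  by (rule ueq_multl[OF kc Es_x[OF n j]])
 have 3: "kO i * (SUM m=0..n. sc (cx p i j m) * (x p j (l + int m) * cf (Es i) (n - m))) =
  (SUM m=0..n. sc (cx p i j m) * ((kO i * x p j (l + int m)) * cf (Es i) (n - m)))"
  unfolding sum_distrib_left by (intro sum.cong refl) (simp only: sc_lcomm[of "kO i"] mult.assoc)
 have 4: "(SUM m=0..n. sc (cx p i j m) * ((kO i * x p j (l + int m)) * cf (Es i) (n - m))) ~~
  (SUM m=0..n. sc (cx p i j m) * ((sc ?t * (x p j (l + int m) * kO i)) * cf (Es i) (n - m)))"
  by (intro ueq_sum ueq_sc ueq_multr kk_x i j Es_chev n)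
 have 5: "(SUM m=0..n. sc (cx p i j m) * ((sc ?t * (x p j (l + int m) * kO i)) * cf (Es i) (n - m))) =
  (SUM m=0..n. sc (?t * cx p i j m) * (x p j (l + int m) * phi T h Pl i (int (n - m))))"
  by (intro sum.cong refl) (simp only: phi_reps[OF i] mult.assoc free_alg.scale_scale mult.commute[of ?t])
 show ?thesis using ueq_trans[OF 2[unfolded 3] 4] unfolding 1 3 5 .
qed

text \<open>The numbers \<open>bx Mi i j k\<close> are differences of power sums of the
  \<open>b r\<close> and the \<open>a r\<close>, so the generating series of
  \<open>cx Mi i j\<close> is rational by \<open>rational_ode\<close>.\<close>

lemma cx_recurrent:
 assumes i: "i : Nd"
 shows "recurrent (cx Mi i j)"
proof -
 define a where "a r = qq T powi cart T i ((sg ^^ r) j) * omega T ^ r" for r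
 define b where "b r = qq T powi (- cart T i ((sg ^^ r) j)) * omega T ^ r" for r
 have kap: "kap i ~= 0" using qd_nz[OF Orb_an[OF rep_reps'[OF i]]] .
 have B: "bx Mi i j k = (SUM r=1..M. b r ^ Suc k - a r ^ Suc k)" for k
 proof -
  have w: "omega T powi (int (Suc k) * int r) = (omega T ^ r) ^ Suc k" for r
  by (simp only: of_nat_mult[symmetric] power_int_of_nat power_mult[symmetric] mult.commute)
  let ?q = "qq T" and ?C = "%r. cart T i ((sg ^^ r) j)"
  let ?A = "%r. ?q powi (int (Suc k) * ?C r) - ?q powi (- (int (Suc k) * ?C r))"
  let ?W = "%r. omega T powi (int (Suc k) * int r)"
  have S: "(SUM r=1..M. ?A r / kap i * ?W r) = (SUM r=1..M. ?A r * ?W r) / kap i"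
  unfolding sum_divide_distrib by (intro sum.cong refl) simp
  have N: "(of_int (int (Suc k)) :: complex) = of_nat (Suc k)" "(of_nat (Suc k) :: complex) ~= 0" by (simp_all del: of_nat_Suc)
  have "bx Mi i j k = - (SUM r=1..M. ?A r * ?W r)"
  unfolding bx_def hx_coeff_def qi_diff[OF i] S N(1) using kap N(2) by (simp del: of_nat_Suc)
  also have "... = (SUM r=1..M. b r ^ Suc k - a r ^ Suc k)" unfolding sum_negf[symmetric]
  proof (intro sum.cong refl)
  fix r
  have 1: "a r ^ Suc k = ?q powi (int (Suc k) * ?C r) * omega T powi (int (Suc k) * int r)"
  unfolding a_def power_mult_distrib power_int_power' w by (simp only: mult.commute mult_minus_left mult_minus_right)
  have 2: "b r ^ Suc k = ?q powi (- (int (Suc k) * ?C r)) * omega T powi (int (Suc k) * int r)"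
  unfolding b_def power_mult_distrib power_int_power' w by (simp only: mult.commute mult_minus_left mult_minus_right)
  show "- ((?q powi (int (Suc k) * ?C r) - ?q powi (- (int (Suc k) * ?C r))) * omega T powi (int (Suc k) * int r)) = b r ^ Suc k - a r ^ Suc k"
  unfolding 1 2 by (simp add: algebra_simps)
  qed
  finally show ?thesis .
 qed
 have "fps_deriv (Abs_fps (cx Mi i j)) = Abs_fps (bx Mi i j) * Abs_fps (cx Mi i j)"
 proof (rule fps_ext)
  fix n
  have "of_nat (Suc n) * cx Mi i j (Suc n) = (SUM k=0..n. bx Mi i j k * cx Mi i j (n - k))"
  by (simp add: cs.simps atLeast0AtMost del: of_nat_Suc)
  thus "cf (fps_deriv (Abs_fps (cx Mi i j))) n = cf (Abs_fps (bx Mi i j) * Abs_fps (cx Mi i j)) n"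
  by (simp add: fps_mult_nth del: of_nat_Suc)
 qed
 also have "Abs_fps (bx Mi i j) = Abs_fps (%n. SUM r:{1..M}. b r ^ Suc n - a r ^ Suc n)"
  by (rule fps_ext) (simp only: fps_nth_Abs_fps B)
 finally show ?thesis unfolding recurrent_iff by (rule rational_ode[rotated]) simp
qed

text \<open>At a fixed node the relation for \<sigma> equates the element with
  \<open>omega T powi m\<close> times itself.\<close>

lemma fixed_vanish:
 assumes i: "i : Nd" "sg i = i" and m: "omega T powi m ~= 1"
 shows "x p i m ~~ 0" "m >= 0 ==> phi T h Pl i m ~~ 0"
proof -
 have gen: "y ~~ 0" if "y ~~ sc (omega T powi m) * y" for y
 proof -
  have "y - sc (omega T powi m) * y : relI" using that by (simp add: ueq_def)
  hence "sc (1 - omega T powi m) * y : relI" by (simp add: sc_diff left_diff_distrib)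
  from relI_sc[OF this, of "1 / (1 - omega T powi m)"] show ?thesis using m by (simp add: ueq_0)
 qed
 show "x p i m ~~ 0" using dr_x_aut[OF i(1), of p m] i(2) by (intro gen) simp
 show "phi T h Pl i m ~~ 0" if "m >= 0" using phi_aut[OF i(1) that] i(2) by (intro gen) simp
qed

text \<open>At a node fixed by \<open>\<sigma>\<close> both sides vanish unless the indices are divisible by \<open>M\<close>, so the roots of unity in
  the commutation relation disappear.\<close>

lemma x_x:
 assumes i: "i : Rp" and j: "j : Rp" and sl: "a >= 0" "l >= 0" "a + l > 0"
 shows "x Pl j a ~~ 0 | comm (x Pl j a) (x Mi i l) ~~ sc (if i = j then 1 / kap i else 0) * phi T h Pl i (a + l)"
proof -
 note ni = reps_no[OF i] and nj = reps_no[OF j]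
 have com: "comm (x Pl j a) (x Mi i l) ~~ sc (xx_coeff T j i l / kap j) * phi T h Pl j (a + l)"
  using dr_xx[OF nj ni, of a l] sl by (simp add: phi_Mi_pos qi_diff[OF nj])
 show ?thesis
 proof (cases "i = j")
  case False
  thus ?thesis using com xx_coeff_reps(1)[OF j i] by simp
 next
  case True
  show ?thesis
  proof (cases "sg i = i")
  case False
  thus ?thesis using com xx_coeff_reps(2)[OF i i] True by simp
  next
  case fx: True
  show ?thesis
  proof (cases "omega T powi a = 1")
  case False
  thus ?thesis using fixed_vanish(1)[OF nj] fx True by simp
  next
  case a1: True
  show ?thesis
  proof (cases "omega T powi l = 1")
  case l1: True
  have "xx_coeff T i i l = 1"
  proof -
  have "omega T powi (int r * l) = 1" for r using l1 by (simp add: mult.commute[of "int r"] power_int_mult)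
  thus ?thesis using xx_coeff_reps(3)[OF i i fx] M_pos by simp
  qed
  thus ?thesis using com True by simp
  next
  case False
  have x0: "x Mi i l : relI" using fixed_vanish(1)[OF ni fx False] by (simp add: ueq_0)
  have "comm (x Pl j a) (x Mi i l) : relI" unfolding comm_def by (intro relI_diff relI_left relI_right x0 x_chev nj)
  moreover have "omega T powi (a + l) ~= 1" using a1 False omega_nz by (simp add: power_int_add)
  hence "phi T h Pl i (a + l) : relI" using fixed_vanish(2)[OF ni fx] sl by (simp add: ueq_0)
  hence "sc (if i = j then 1 / kap i else 0) * phi T h Pl i (a + l) : relI" by (rule relI_sc)
  ultimately show ?thesis unfolding ueq_def using relI_diff by blast
  qed
  qed
  qed
 qed
qed

lemma borel_Pa: "borel T <= Pa"
proof
 fix a assume "a : borel T"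
 then obtain b where b: "b : subalg bgens" "a ~~ b" by (auto simp: borel_def usub_def)
 have km: "kmon n : Pa" for n
 proof -
  have p: "y ^ k : Pa" if "y : Pa" for y k by (induction k) (simp_all add: that Pa_closed(3) Pa_closed(1)[of 1, simplified])
  have "set L <= Rp ==> klist L n : Pa" for L
  using Pa_closed(1)[of 1] by (induction L) (auto simp: klist_def kz_def intro!: Pa_closed(3) p Pa_k)
  thus ?thesis by (simp add: kmon_def)
 qed
 have g: "g : Pa" if "g : bgens" for g
 proof -
  from that obtain c where c: "c : An" "g = ee Pl c | g = kk c | g = kinv c" by auto
  show ?thesis
  proof (cases c)
  case Eps
  thus ?thesis using c(2) e_Eps_Pa Pa_closed(8)[OF k_Eps(1) km] Pa_closed(8)[OF k_Eps(2) km] by auto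
  next
  case (Orb j)
  hence "j : Rp" using c(1) by (auto simp: anodes_def)
  thus ?thesis using c(2) Orb Pa_f Pa_k by auto
  qed
 qed
 from b(1) have "b : Pa" by (induction b rule: subalg.induct) (auto intro: Pa_closed(1-3) g)
 thus "a : Pa" using Pa_closed(8)[OF b(2)] by blast
qed

end

section \<open>Highest \<open>l\<close>-weight vectors\<close>

text \<open>The instance used later is the module induced from a simple Borel module, with
  \<open>v0\<close> the image of its highest \<open>l\<close>-weight vector.\<close>

locale hwrep = drinfeld T x h + rep_on T scl "chev_alg T" W act
 for T x h and scl :: "complex => 'w::ab_group_add => 'w" and W act +
 fixes v0 :: 'w and ga :: "nat => nat => complex"
 assumes v0: "v0 : W" "v0 ~= 0"
  and hw_x: "i : Nd ==> r >= 0 ==> act (x Pl i r) v0 = 0"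
  and hw_phi: "i : Nd ==> act (ph i n) v0 = scl (ga i n) v0"
  and hw_rational: "i : Rp ==> recurrent (ga i)"
begin

sublocale cvector_space scl ..

abbreviation "X i r == act (x Mi i (int r))"
abbreviation "Ph i n == act (ph i n)"

text \<open>Only the number of lowering factors is recorded, not the weight; the modes start at 0 so
  that the spans are stable under the generators of \<open>Pa\<close>.\<close>

primrec S :: "nat => 'w set" where
 "S 0 = span {v0}"
| "S (Suc k) = span {X i r z |i r z. i : Rp & z : S k}"

lemma S_sub: "subspace (S k)" by (cases k) simp_all

lemma W_subspace: "subspace W" by (simp add: subspace_def W_0 W_add W_scl)

lemma S_W: "S k <= W"
proof (induction k)
 case 0
 show ?case using v0(1) by (simp add: span_minimal W_subspace)
next
 case (Suc k)
 thus ?case unfolding S.simps by (intro span_minimal W_subspace) (auto intro!: act_in x_chev reps_no)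
qed

lemma S_Suc_induct:
 assumes "z : S (Suc k)" "subspace P" "!!i r z. i : Rp ==> z : S k ==> X i r z : P"
 shows "z : P"
proof -
 have "{X i r z |i r z. i : Rp & z : S k} <= P" using assms(3) by auto
 from span_minimal[OF this assms(2)] show ?thesis using assms(1) by auto
qed

lemma act_vimage:
 assumes "a : chev" "subspace P"
 shows "subspace {z : W. act a z : P}"
 using assms by (auto simp: subspace_def W_0 W_add W_scl act_0r act_addr act_scl)

lemma act_S:
 assumes a: "a : chev" and P: "subspace P" and "!!i r z. i : Rp ==> z : S k ==> act a (X i r z) : P"
  and z: "z : S (Suc k)"
 shows "act a z : P"
proof -
 have "z : {z : W. act a z : P}"
  using assms(3) subsetD[OF S_W] by (intro S_Suc_induct[OF z act_vimage[OF a P]]) (auto intro!: act_in x_chev reps_no)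
 thus ?thesis by simp
qed

lemma act_S0:
 assumes a: "a : chev" and P: "subspace P" and "act a v0 : P" and z: "z : S 0"
 shows "act a z : P"
proof -
 have "span {v0} <= {z : W. act a z : P}" using assms(3) v0 by (intro span_minimal act_vimage a P) auto
 thus ?thesis using z by auto
qed

lemma S_X: "i : Rp ==> z : S k ==> X i r z : S (Suc k)" by (auto intro: span_base)

lemma act_comm:
 assumes "comm a b ~~ sc c * p" "a : chev" "b : chev" "p : chev" "z : W"
 shows "act a (act b z) = act b (act a z) + scl c (act p z)"
proof -
 have "act (comm a b) z = act (sc c * p) z" using assms by (intro act_ueq) (auto simp: comm_def chevI)
 moreover have "act (comm a b) z = act a (act b z) - act b (act a z)" using assms by (simp add: comm_def act_minus act_times chevI)
 moreover have "act (sc c * p) z = scl c (act p z)" using assms by (simp add: act_sc_times)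
 ultimately show ?thesis by (simp add: algebra_simps)
qed

lemma act_rep:
 assumes "i : Nd" "z : W"
 shows "EX c. act (x p i m) z = scl c (act (x p (rep T i) m) z)"
proof -
 obtain c where c: "x p i m ~~ sc c * x p (rep T i) m" using x_rep[OF assms(1)] by blast
 have rc: "x p (rep T i) m : chev" using x_chev rep_reps'[OF assms(1)] reps_no by blast
 have "act (x p i m) z = act (sc c * x p (rep T i) m) z"
  by (rule act_ueq[OF c x_chev[OF assms(1)] chevI(5)[OF chevI(1) rc] assms(2)])
 thus ?thesis using assms rc by (auto simp: act_sc_times)
qed

lemma S_X_nodes: "i : Nd ==> z : S k ==> X i r z : S (Suc k)"
 using act_rep[of i z Mi "int r"] S_X[OF rep_reps', of i z k r] subspace_scale[OF S_sub, of _ "Suc k"] S_W by (metis subsetD)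

definition stable :: "(nat => 'w set) => falg => bool" where
 "stable A a \<longleftrightarrow> a : chev & (ALL k. ALL z:A k. act a z : A k)"

lemma stable_closed:
 assumes A: "!!k. subspace (A k)" and AW: "!!k. A k <= W"
 shows "stable A (sc c)" "stable A a ==> stable A b ==> stable A (a + b)" "stable A a ==> stable A b ==> stable A (a * b)"
  "stable A a ==> stable A b ==> stable A (a - b)"
proof -
 note W = subsetD[OF AW]
 show "stable A (sc c)" by (auto simp: stable_def chevI act_sc1 W intro: subspace_scale[OF A])
 show "stable A a ==> stable A b ==> stable A (a + b)"
  by (auto simp: stable_def chevI act_plus W intro: subspace_add[OF A])
 show "stable A a ==> stable A b ==> stable A (a - b)"
  by (auto simp: stable_def chevI act_minus W intro: subspace_diff[OF A])
 show "stable A a ==> stable A b ==> stable A (a * b)" by (auto simp: stable_def chevI act_times W)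
qed

abbreviation "sstab == stable S"

lemmas sstab_def = stable_def[of S] and sstab_closed = stable_closed[of S, OF S_sub S_W]

lemma sstab_subalg: "b : subalg A ==> (!!a. a : A ==> sstab a) ==> sstab b"
 by (induction b rule: subalg.induct) (auto intro: sstab_closed)

lemma sstab_eigen:
 assumes a: "a : chev" and e: "EX c. act a v0 = scl c v0"
  and X: "!!i r. i : Rp ==> EX c. a * x Mi i (int r) ~~ sc c * (x Mi i (int r) * a)"
 shows "sstab a"
proof -
 have "ALL z:S k. act a z : S k" for k
 proof (induction k)
  case 0
  have "act a v0 : S 0" using e by (auto simp: span_scale span_base)
  thus ?case using act_S0[OF a S_sub] by blast
 next
  case (Suc k)
  have "act a (X i r z) : S (Suc k)" if i: "i : Rp" and z: "z : S k" for i r z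
  proof -
  note xc = x_chev[OF reps_no[OF i]]
  have zW: "z : W" using z S_W by blast
  obtain c where c: "a * x Mi i (int r) ~~ sc c * (x Mi i (int r) * a)" using X[OF i] by blast
  have "act a (X i r z) = act (a * x Mi i (int r)) z" using a xc zW by (simp add: act_times)
  also have "... = act (sc c * (x Mi i (int r) * a)) z" using a xc zW by (intro act_ueq c chevI)
  also have "... = scl c (X i r (act a z))" using a xc zW by (simp add: act_times act_sc1 chevI act_in)
  finally show ?thesis using Suc z i by (auto intro!: subspace_scale[OF S_sub] S_X simp del: S.simps)
  qed
  thus ?case using act_S[OF a S_sub] by blast
 qed
 thus ?thesis using a by (simp add: sstab_def)
qed

lemma kk_v0: "j : Rp ==> act (kO j) v0 = scl (ga j 0) v0"
 using hw_phi[OF reps_no, of j 0] by (simp add: phi_0 rep_reps)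

lemma kinv_v0: "j : Rp ==> ga j 0 ~= 0 & act (kI j) v0 = scl (1 / ga j 0) v0"
proof -
 assume j: "j : Rp"
 note a = Orb_an[OF j]
 note c = chev_gen[OF a] chevI(3)
 have "v0 = act 1 v0" using v0 by (simp add: act_one)
 also have "... = act (kI j * kO j) v0" using v0 c by (intro act_ueq ueq_sym[OF rel_kinv(2)] chevI a) auto
 also have "... = scl (ga j 0) (act (kI j) v0)" using v0 c by (simp add: act_times kk_v0[OF j] act_scl)
 finally have e: "v0 = scl (ga j 0) (act (kI j) v0)" .
 hence "ga j 0 ~= 0" using v0(2) by (metis scale_zero_left)
 moreover from e have "scl (1 / ga j 0) v0 = scl (1 / ga j 0) (scl (ga j 0) (act (kI j) v0))" by simp
 ultimately show ?thesis by simp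
qed

lemma kinv_x:
 assumes "a : Rp" "j : Nd"
 shows "EX c. kI a * x p j l ~~ sc c * (x p j l * kI a)"
 using kinv_swap[OF Orb_an x_chev kk_x] assms by blast

lemma sstab_k: "j : Rp ==> sstab (kO j)" "j : Rp ==> sstab (kI j)"
 using kk_v0 kinv_v0 kk_x kinv_x by (intro sstab_eigen chev_gen Orb_an; blast intro: reps_no)+

text \<open>\<phi> is \<open>k\<^sub>i\<close> times a coefficient of \<open>Es\<close>, the two
  commute, and the eigenvalue of \<open>k\<^sub>i\<close> on \<open>v0\<close> is not 0, so it can
  be divided out.\<close>

lemma Es_v0:
 assumes i: "i : Nd"
 shows "EX c. act (cf (Es i) n) v0 = scl c v0"
proof -
 let ?j = "rep T i"
 have j: "?j : Rp" using rep_reps'[OF i] .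
 note a = Orb_an[OF j] and ec = Es_chev[OF i]
 have "scl (ga ?j 0) (act (cf (Es i) n) v0) = act (cf (Es i) n) (act (kk (Orb ?j)) v0)"
  using v0 ec by (simp add: kk_v0[OF j] act_scl)
 also have "... = act (cf (Es i) n * kk (Orb ?j)) v0" using v0 ec a by (simp add: act_times chev_gen)
 also have "... = act (kk (Orb ?j) * cf (Es i) n) v0" using v0 ec a by (intro act_ueq kk_Es j i chevI chev_gen)
 also have "... = scl (ga i n) v0" using hw_phi[OF i, of n] by (simp add: phi_Es[OF i])
 finally have "scl (1 / ga ?j 0) (scl (ga ?j 0) (act (cf (Es i) n) v0)) = scl (1 / ga ?j 0) (scl (ga i n) v0)" by simp
 thus ?thesis using kinv_v0[OF j] by auto
qed

text \<open>Induction along \<open>h_Es\<close>: the elements acting on \<open>v0\<close> by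
  scalars, collected in \<open>?P\<close>, are closed under all operations that occur there.\<close>

lemma h_v0:
 assumes i: "i : Nd"
 shows "EX c. act (h i (int (Suc n))) v0 = scl c v0"
proof (induction n rule: less_induct)
 case (less n)
 let ?P = "{a : chev. EX c. act a v0 = scl c v0}"
 have cl: "sc c * a : ?P" if "a : ?P" for a c using that v0 by (auto simp: chevI act_sc_times)
 have mu: "a * b : ?P" if "a : ?P" "b : ?P" for a b using that v0 by (auto simp: chevI act_times act_scl)
 have su: "a + b : ?P" "a - b : ?P" if ab: "a : ?P" "b : ?P" for a b
 proof -
  obtain c d where "act a v0 = scl c v0" "act b v0 = scl d v0" using ab by blast
  hence "act (a + b) v0 = scl (c + d) v0" "act (a - b) v0 = scl (c - d) v0"
  using ab v0 by (simp_all add: act_plus act_minus scale_left_distrib scale_left_diff_distrib)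
  thus "a + b : ?P" "a - b : ?P" using ab by (auto simp: chevI)
 qed
 have z: "0 : ?P" using v0 by (auto simp: chevI act_zero intro: exI[of _ 0])
 have su': "sum f A : ?P" if "!!k. k : A ==> f k : ?P" for f and A :: "nat set" using that
 proof (induction A rule: infinite_finite_induct)
  case (insert k A)
  show ?case unfolding sum.insert[OF insert.hyps] by (rule su(1)) (use insert in blast)+
 next
  case (infinite A)
  show ?case unfolding sum.infinite[OF infinite(1)] by (rule z)
 qed (use z in \<open>simp only: sum.empty\<close>)
 have E: "cf (Es i) m : ?P" for m using Es_v0[OF i] Es_chev[OF i] by blast
 have H: "h i (int (Suc k)) : ?P" if "k < n" for k using less[OF that] h_chev[OF i, of "int (Suc k)"] by simp
 let ?R = "sc (1 / kap i) * cf (Es i) (Suc n) -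
  (SUM k=0..<n. sc (of_nat (Suc k) / of_nat (Suc n)) * (h i (int (Suc k)) * cf (Es i) (n - k)))"
 have "?R : ?P" by (intro su cl su' mu E H) simp
 hence R: "?R : chev" "EX c. act ?R v0 = scl c v0" by blast+
 have "act (h i (int (Suc n))) v0 = act ?R v0" by (rule act_ueq[OF h_Es[OF i] _ R(1) v0(1)]) (simp add: h_chev i)
 thus ?case using R(2) by simp
qed

lemma sstab_h:
 assumes i: "i : Nd" and r: "r > 0"
 shows "sstab (h i (int r))"
proof -
 have hc: "h i (int r) : chev" using i r by (simp add: h_chev)
 have "ALL z:S k. act (h i (int r)) z : S k" for k
 proof (induction k)
  case 0
  obtain n where "r = Suc n" using r by (cases r) auto
  then obtain c where "act (h i (int r)) v0 = scl c v0" using h_v0[OF i] by blast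
  hence "act (h i (int r)) v0 : S 0" by (simp add: span_scale span_base)
  thus ?case using act_S0[OF hc S_sub] by blast
 next
  case (Suc k)
  have "act (h i (int r)) (X j l z) : S (Suc k)" if j: "j : Rp" and z: "z : S k" for j l z
  proof -
  note nj = reps_no[OF j]
  note xc = x_chev[OF nj]
  have zW: "z : W" using z S_W by blast
  let ?c = "of_int (sgn_int Mi) * hx_coeff T i j (int r)"
  have e: "act (h i (int r)) (X j l z) = X j l (act (h i (int r)) z) + scl ?c (X j (r + l) z)"
  using dr_hx[OF i nj, of "int r" Mi "int l"] r by (intro act_comm xc zW hc) simp
  have "act (h i (int r)) z : S k" using Suc z by blast
  thus ?thesis unfolding e by (intro subspace_add[OF S_sub] subspace_scale[OF S_sub] S_X j z)
  qed
  thus ?case using act_S[OF hc S_sub] by blast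
 qed
 thus ?thesis using hc by (simp add: sstab_def)
qed

lemma sstab_Es: "i : Nd ==> sstab (cf (Es i) n)" using sstab_subalg[OF Es_subalg, of i n] sstab_h by blast

lemma sstab_phi: "i : Nd ==> sstab (ph i n)"
 unfolding phi_Es by (intro sstab_closed sstab_k sstab_Es rep_reps')

text \<open>The value {0} at height 0 lets \<open>S_xp\<close> and \<open>Z_xp\<close> be stated
  without a case distinction.\<close>

definition below :: "(nat => 'w set) => nat => 'w set" where
 "below A k = (case k of 0 => {0} | Suc l => A l)"

lemma below_simps [simp]: "below A 0 = {0}" "below A (Suc k) = A k" by (simp_all add: below_def)

lemma phi_nodes_chev: "i : Nd ==> ph i n : chev" using sstab_phi by (simp add: sstab_def)

lemma sstab_phi_diff: "i : Nd ==> sstab (ph i m - phi T h Mi i (int m))"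
proof -
 assume i: "i : Nd"
 have "sstab (phi T h Mi i (int m))"
  using sstab_k(2)[OF rep_reps'[OF i]] sstab_closed(1)[of 0] by (cases "m = 0") (simp_all add: phi_0 phi_Mi_pos)
 thus ?thesis using sstab_closed(4)[OF sstab_phi[OF i]] by blast
qed

lemma S_xp:
 assumes i: "i : Nd"
 shows "z : S k ==> act (x Pl i (int r)) z : below S k"
proof (induction k arbitrary: z)
 case 0
 thus ?case using act_S0[OF x_chev[OF i], of "{0}"] hw_x[OF i] by (simp add: subspace_single_0)
next
 case (Suc k)
 have "act (x Pl i (int r)) (X j l z) : S k" if j: "j : Rp" and z: "z : S k" for j l z
 proof -
  note nj = reps_no[OF j]
  note xc = x_chev[OF nj] x_chev[OF i]
  have zW: "z : W" using z S_W by blast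
  let ?P = "phi T h Pl i (int (r + l)) - phi T h Mi i (int (r + l))"
  let ?c = "xx_coeff T i j (int l) / (qi T i - inverse (qi T i))"
  have P: "?P : chev" "act ?P z : S k" using sstab_phi_diff[OF i, of "r + l"] z by (auto simp: sstab_def)
  have "act (x Pl i (int r)) (X j l z) = X j l (act (x Pl i (int r)) z) + scl ?c (act ?P z)"
  using dr_xx[OF i nj, of "int r" "int l"] by (intro act_comm xc zW P(1)) simp
  moreover have "X j l (act (x Pl i (int r)) z) : S k"
  proof (cases k)
  case 0
  thus ?thesis using Suc.IH[OF z] xc S_sub by (simp add: act_0r subspace_0 span_zero)
  next
  case (Suc k')
  thus ?thesis using Suc.IH[OF z] S_X[OF j] by simp
  qed
  ultimately show ?thesis using P by (auto intro!: subspace_add[OF S_sub] subspace_scale[OF S_sub])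
 qed
 thus ?case using act_S[OF x_chev[OF i] S_sub _ Suc(2)] by simp
qed

subsection \<open>Vectors generating submodules without the highest weight vector\<close>

text \<open>One raising operator at a time: this recursive form is what the inductions on the height
  use. The start {0} keeps \<open>v0\<close> out.\<close>

primrec Z :: "nat => 'w set" where
 "Z 0 = {0}"
| "Z (Suc k) = {z : S (Suc k). ALL i:Rp. ALL r. act (x Pl i (int r)) z : Z k}"

lemma Z_S: "Z k <= S k" by (cases k) (auto simp: span_zero)

lemma Z_W: "Z k <= W" using Z_S S_W by blast

lemma Z_sub: "subspace (Z k)"
proof (induction k)
 case 0
 show ?case by (simp add: subspace_single_0)
next
 case (Suc k)
 note S = S_sub[of "Suc k"] and W = subsetD[OF S_W[of "Suc k"]] and c = x_chev[OF reps_no]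
 show ?case unfolding subspace_def
 proof (intro conjI ballI allI)
  show "0 : Z (Suc k)" using subspace_0[OF S] subspace_0[OF Suc] c by (simp add: act_0r del: S.simps)
  show "y + z : Z (Suc k)" if "y : Z (Suc k)" "z : Z (Suc k)" for y z
  using that subspace_add[OF S] subspace_add[OF Suc] c W by (simp add: act_addr del: S.simps)
  show "scl a z : Z (Suc k)" if "z : Z (Suc k)" for a z
  using that subspace_scale[OF S] subspace_scale[OF Suc] c W by (simp add: act_scl del: S.simps)
 qed
qed

lemma Z_xp:
 assumes "i : Nd" "z : Z k"
 shows "act (x Pl i (int r)) z : below Z k"
proof (cases k)
 case 0
 thus ?thesis using assms by (simp add: act_0r x_chev)
next
 case (Suc l)
 have "act (x Pl (rep T i) (int r)) z : Z l" using assms Suc rep_reps' by auto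
 moreover obtain c where "act (x Pl i (int r)) z = scl c (act (x Pl (rep T i) (int r)) z)"
  using act_rep[OF assms(1), of z Pl "int r"] assms(2) Z_W by blast
 ultimately show ?thesis using Suc subspace_scale[OF Z_sub] by simp
qed

abbreviation "zstab == stable Z"

lemmas zstab_def = stable_def[of Z] and zstab_closed = stable_closed[of Z, OF Z_sub Z_W]

lemma zstab_subalg: "b : subalg A ==> (!!a. a : A ==> zstab a) ==> zstab b"
 by (induction b rule: subalg.induct) (auto intro: zstab_closed)

lemma zstab_intro:
 assumes a: "sstab a" and x: "!!k i r z. i : Rp ==> z : Z (Suc k) ==> ALL z:Z k. act a z : Z k ==>
  act (x Pl i (int r)) (act a z) : Z k"
 shows "zstab a"
proof -
 have "ALL z:Z k. act a z : Z k" for k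
 proof (induction k)
  case 0
  thus ?case using a by (simp add: sstab_def act_0r)
 next
  case (Suc k)
  thus ?case using a x Z_S[of "Suc k"] by (auto simp: sstab_def simp del: S.simps)
 qed
 thus ?thesis using a by (simp add: zstab_def sstab_def)
qed

lemma zstab_k:
 assumes j: "j : Rp"
 shows "zstab (kO j)" "zstab (kI j)"
proof -
 have gen: "zstab a" if a: "sstab a" and com: "!!i r. i : Rp ==> EX c. x Pl i (int r) * a ~~ sc c * (a * x Pl i (int r))" for a
 proof (rule zstab_intro[OF a])
  fix k i r z assume i: "i : Rp" and z: "z : Z (Suc k)" and IH: "ALL z:Z k. act a z : Z k"
  note xc = x_chev[OF reps_no[OF i]] and zW = subsetD[OF Z_W z]
  have ac: "a : chev" using a by (simp add: sstab_def)
  obtain c where c: "x Pl i (int r) * a ~~ sc c * (a * x Pl i (int r))" using com[OF i] by blast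
  have "act (x Pl i (int r)) (act a z) = act (x Pl i (int r) * a) z" using ac xc zW by (simp add: act_times)
  also have "... = act (sc c * (a * x Pl i (int r))) z" using ac xc zW by (intro act_ueq c chevI)
  also have "... = scl c (act a (act (x Pl i (int r)) z))" using ac xc zW by (simp add: act_times act_sc1 act_in chevI)
  finally show "act (x Pl i (int r)) (act a z) : Z k" using IH z i by (auto intro!: subspace_scale[OF Z_sub])
 qed
 have sw: "EX c. y * k ~~ sc c * (k * y)" if "k * y ~~ sc t * (y * k)" "t ~= 0" for k y t
  using ueq_sc[OF that(1), of "1 / t"] that(2) by (intro exI[of _ "1 / t"]) (simp add: ueq_sym)
 show "zstab (kO j)" by (intro gen sstab_k j) (use kk_x[OF j reps_no] in \<open>auto intro!: sw\<close>)
 have "EX c. x Pl i (int r) * kI j ~~ sc c * (kI j * x Pl i (int r))" if i: "i : Rp" for i r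
  using sw[OF kinv_swap[OF Orb_an[OF j] x_chev kk_x[OF j]]] reps_no[OF i] by simp
 thus "zstab (kI j)" by (intro gen sstab_k j)
qed

lemma zstab_h:
 assumes i: "i : Nd" and r: "r > 0"
 shows "zstab (h i (int r))"
proof (rule zstab_intro[OF sstab_h[OF assms]])
 fix k j l z assume j: "j : Rp" and z: "z : Z (Suc k)" and IH: "ALL z:Z k. act (h i (int r)) z : Z k"
 note nj = reps_no[OF j]
 note xc = x_chev[OF nj] and zW = subsetD[OF Z_W z]
 have hc: "h i (int r) : chev" using i r by (simp add: h_chev)
 let ?c = "of_int (sgn_int Pl) * hx_coeff T i j (int r)"
 have "act (h i (int r)) (act (x Pl j (int l)) z) = act (x Pl j (int l)) (act (h i (int r)) z) + scl ?c (act (x Pl j (int (r + l))) z)"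
  using dr_hx[OF i nj, of "int r" Pl "int l"] r by (intro act_comm xc zW hc) simp
 hence "act (x Pl j (int l)) (act (h i (int r)) z) = act (h i (int r)) (act (x Pl j (int l)) z) - scl ?c (act (x Pl j (int (r + l))) z)"
  by simp
 thus "act (x Pl j (int l)) (act (h i (int r)) z) : Z k"
  using IH z j by (auto intro!: subspace_diff[OF Z_sub] subspace_scale[OF Z_sub] simp del: of_nat_add)
qed

lemma zstab_phi: "i : Nd ==> zstab (ph i n)"
proof -
 assume i: "i : Nd"
 have "zstab (cf (Es i) n)" using zstab_subalg[OF Es_subalg[OF i]] zstab_h[OF i] by blast
 thus ?thesis unfolding phi_Es[OF i] by (intro zstab_closed zstab_k rep_reps' i)
qed

lemma zstab_phi_diff: "i : Nd ==> zstab (ph i m - phi T h Mi i (int m))"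
proof -
 assume i: "i : Nd"
 have "zstab (phi T h Mi i (int m))"
  using zstab_k(2)[OF rep_reps'[OF i]] zstab_closed(1)[of 0] by (cases "m = 0") (simp_all add: phi_0 phi_Mi_pos)
 thus ?thesis using zstab_closed(4)[OF zstab_phi[OF i]] by blast
qed

text \<open>A raising operator moved past \<open>X j l\<close> gives a term covered by the induction
  hypothesis and a \<phi> term, under which \<open>Z\<close> is already known to be stable.\<close>

lemma Z_X:
 assumes j: "j : Rp"
 shows "z : Z k ==> X j l z : Z (Suc k)"
proof (induction k arbitrary: z)
 case 0
 hence "X j l z = 0" by (simp add: act_0r x_chev reps_no j)
 thus ?case using subspace_0[OF Z_sub] by (simp only:)
next
 case (Suc k)
 note nj = reps_no[OF j] and zW = subsetD[OF Z_W Suc(2)]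
 have "act (x Pl i (int r)) (X j l z) : Z (Suc k)" if i: "i : Rp" for i r
 proof -
  note ni = reps_no[OF i]
  note xc = x_chev[OF nj] x_chev[OF ni]
  let ?P = "phi T h Pl i (int (r + l)) - phi T h Mi i (int (r + l))"
  let ?c = "xx_coeff T i j (int l) / (qi T i - inverse (qi T i))"
  have P: "?P : chev" "act ?P z : Z (Suc k)" using zstab_phi_diff[OF ni, of "r + l"] Suc(2) unfolding zstab_def by blast+
  have e: "act (x Pl i (int r)) (X j l z) = X j l (act (x Pl i (int r)) z) + scl ?c (act ?P z)"
  using dr_xx[OF ni nj, of "int r" "int l"] by (intro act_comm xc zW P(1)) simp
  have "X j l (act (x Pl i (int r)) z) : Z (Suc k)" using Suc i by auto
  thus ?thesis unfolding e by (intro subspace_add[OF Z_sub] subspace_scale[OF Z_sub] P)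
 qed
 moreover have "X j l z : S (Suc (Suc k))" by (rule S_X[OF j subsetD[OF Z_S Suc(2)]])
 ultimately show ?case by (simp only: Z.simps(2)[of "Suc k"]) blast
qed

end

section \<open>Weights\<close>

text \<open>The operators are treated one after the other; each may be applied repeatedly to the
  relation left by the previous ones, which gives all power relations for its eigenvalues.\<close>

lemma (in rep_on) joint_sep:
 assumes J: "finite J" and N: "finite N"
  and z: "!!n j. n : N ==> j : J ==> k j : Alg & act (k j) (z n) = scl (e n j) (z n)"
  and W: "!!n. n : N ==> z n : W" and 0: "(SUM n:N. z n) = 0"
 shows "(SUM n:{n : N. ALL j:J. e n j = ch j}. z n) = 0" using J z
proof (induction J rule: finite_induct)
 case (insert j J)
 let ?N = "{n : N. ALL j:J. e n j = ch j}"
 have IH: "(SUM n:?N. z n) = 0" by (rule insert.IH) (use insert.prems in blast)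
 have "(SUM n:?N. scl (e n j ^ t) (z n)) = 0" for t
 proof (induction t)
  case (Suc t)
  have "(SUM n:?N. scl (e n j ^ Suc t) (z n)) = (SUM n:?N. act (k j) (scl (e n j ^ t) (z n)))"
  proof (rule sum.cong[OF refl])
  fix n assume n: "n : ?N"
  hence "act (k j) (scl (e n j ^ t) (z n)) = scl (e n j ^ t) (act (k j) (z n))"
  using insert.prems(1)[of n j] W by (intro act_scl) auto
  thus "scl (e n j ^ Suc t) (z n) = act (k j) (scl (e n j ^ t) (z n))" using insert.prems(1)[of n j] n by (simp add: mult.commute)
  qed
  also have "... = 0"
  proof (cases "?N = {}")
  case False
  hence k: "k j : Alg" using insert.prems by blast
  have "(SUM n:?N. act (k j) (scl (e n j ^ t) (z n))) = act (k j) (SUM n:?N. scl (e n j ^ t) (z n))"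
  using W by (intro act_right_sum[OF k, symmetric] W_scl) blast
  thus ?thesis unfolding Suc act_0r[OF k] .
  qed (simp only: sum.empty)
  finally show ?case .
 qed (use IH in simp)
 hence "(SUM n:{n : ?N. e n j = ch j}. z n) = 0" using N by (intro eigen_sep_group) simp_all
 moreover have "{n : ?N. e n j = ch j} = {n : N. ALL i:insert j J. e n i = ch i}" by auto
 ultimately show ?case by simp
qed (use 0 in simp)

context hwrep
begin

text \<open>The eigenvalue of \<open>k\<^sub>j\<close> at the highest weight lowered by
  \<open>n i\<close> times the simple root of each \<open>i\<close>.\<close>

definition lw :: "(nat => nat) => nat => complex" where
 "lw n j = ga j 0 * s powi (- 2 * (SUM i:Rp. int (n i) * csum T i j))"

definition wtv :: "(nat => nat) => 'w set" where
 "wtv n = {z : S (sum n (Rp)). ALL j:Rp. act (kO j) z = scl (lw n j) z}"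

lemma lw_inj:
 assumes "!!j. j : Rp ==> lw n j = lw m j"
 shows "sum n (Rp) = sum m (Rp)"
proof (rule sum.cong[OF refl])
 fix i assume i: "i : Rp"
 have "(SUM i:Rp. (int (n i) - int (m i)) * csum T i j) = 0" if j: "j : Rp" for j
  using assms[OF j] kinv_v0[OF j] by (simp add: lw_def s_powi_inj left_diff_distrib sum_subtractf)
 thus "n i = m i" using csum_nondeg[of "%i. int (n i) - int (m i)", OF _ i] by simp
qed

lemma S_weights: "S k <= span (UN n:{n. sum n (Rp) = k}. wtv n)"
proof (induction k)
 case 0
 have "v0 : wtv (%_. 0)" using kk_v0 by (simp add: wtv_def lw_def span_base)
 thus ?case unfolding S.simps(1) by (intro span_mono) auto
next
 case (Suc k)
 let ?P = "span (UN n:{n. sum n (Rp) = Suc k}. wtv n)"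
 have "X i r z : ?P" if i: "i : Rp" and z: "z : S k" for i r z
 proof -
  note ni = reps_no[OF i]
  note xc = x_chev[OF ni, of Mi "int r"]
  have "(UN n:{n. sum n (Rp) = k}. wtv n) <= {z : W. X i r z : ?P}"
  proof
  fix y assume "y : (UN n:{n. sum n (Rp) = k}. wtv n)"
  then obtain n where n: "k = sum n (Rp)" and y: "y : wtv n" by blast
  let ?n = "n(i := Suc (n i))"
  have yS: "y : S k" and yW: "y : W" using y n S_W by (auto simp: wtv_def)
  have sn: "sum ?n (Rp) = Suc k" using i by (simp add: n sum.remove[of _ i])
  have "act (kO j) (X i r y) = scl (lw ?n j) (X i r y)" if j: "j : Rp" for j
  proof -
  note kc = chev_gen(2)[OF Orb_an[OF j]]
  have "act (kO j) (X i r y) = act (kO j * x Mi i (int r)) y" using kc xc yW by (simp add: act_times)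
  also have "... = act (sc (s powi (sgn_int Mi * (2 * csum T j i))) * (x Mi i (int r) * kO j)) y"
  by (rule act_ueq[OF kk_x[OF j ni]]) (use kc xc yW in \<open>simp_all add: chevI\<close>)
  also have "... = scl (s powi (- (2 * csum T j i))) (X i r (act (kO j) y))"
  by (simp only: act_sc_times[OF chevI(5)[OF xc kc] yW] act_times[OF xc kc yW]) simp
  also have "act (kO j) y = scl (lw n j) y" using y j by (simp add: wtv_def)
  also have "X i r (scl (lw n j) y) = scl (lw n j) (X i r y)" by (rule act_scl[OF xc yW])
  also have "scl (s powi (- (2 * csum T j i))) ... = scl (lw ?n j) (X i r y)"
  proof -
  have "(SUM l:Rp. int (?n l) * csum T l j) = csum T i j + (SUM l:Rp. int (n l) * csum T l j)"
  using i by (simp add: sum.remove[of _ i] algebra_simps)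
  hence "lw ?n j = s powi (- (2 * csum T j i)) * lw n j"
  using csum_sym[OF ni reps_no[OF j]] by (simp add: lw_def right_diff_distrib power_int_add[symmetric] algebra_simps)
  thus ?thesis by simp
  qed
  finally show ?thesis .
  qed
  hence wt: "X i r y : wtv ?n" using S_X[OF i yS] unfolding wtv_def sn by blast
  have "X i r y : ?P" by (rule span_base, rule UN_I[of ?n]) (simp only: mem_Collect_eq sn, rule wt)
  thus "y : {z : W. X i r z : ?P}" using yW by simp
  qed
  hence "span (UN n:{n. sum n (Rp) = k}. wtv n) <= {z : W. X i r z : ?P}"
  by (rule span_minimal[OF _ act_vimage[OF xc subspace_span]])
  thus ?thesis using Suc z by blast
 qed
 thus ?case using S_Suc_induct[OF _ subspace_span] by blast
qed

lemma span_weight_vector: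
 assumes w: "w : span (UN n:Q. wtv n)" "w ~= 0" and e: "!!j. j : Rp ==> act (kO j) w = scl (ch j) w"
 shows "EX n:Q. w : S (sum n (Rp)) & (ALL j:Rp. ch j = lw n j)"
proof -
 obtain F r where F: "finite F" "F <= (UN n:Q. wtv n)" "w = (SUM a:F. scl (r a) a)"
  using w(1) unfolding span_explicit by blast
 have "ALL a:F. EX n. n : Q & a : wtv n" using F(2) by blast
 then obtain n where nQ: "!!a. a : F ==> n a : Q" and n: "!!a. a : F ==> a : wtv (n a)" by metis
 have FW: "a : W" if "a : F" for a using n[OF that] S_W by (auto simp: wtv_def)
 have wW: "w : W" unfolding F(3) using FW by (intro W_sum W_scl)
 \<comment> \<open>The vector itself enters with sign -1 as the term \<open>None\<close>; the total
   is then 0, and \<open>joint_sep\<close> extracts the terms that share its eigenvalues.\<close>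
 let ?N = "insert None (Some ` F)"
 let ?z = "%t. case t of None => - w | Some a => scl (r a) a"
 let ?e = "%t. case t of None => ch | Some a => lw (n a)"
 let ?G = "{a : F. ALL j:Rp. lw (n a) j = ch j}"
 have "(SUM t:{t : ?N. ALL j:Rp. ?e t j = ch j}. ?z t) = 0"
 proof (rule joint_sep)
  show "kO j : chev & act (kO j) (?z t) = scl (?e t j) (?z t)" if t: "t : ?N" and j: "j : Rp" for t j
  proof -
  note kc = chev_gen(2)[OF Orb_an[OF j]]
  show ?thesis
  proof (cases t)
  case None
  thus ?thesis using kc e[OF j] wW by (simp add: act_right_neg)
  next
  case (Some a)
  hence a: "a : F" using t by auto
  thus ?thesis using kc n[OF a] FW[OF a] j Some by (simp add: act_scl wtv_def mult.commute)
  qed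
  qed
  show "?z t : W" if "t : ?N" for t using that W_uminus[OF wW] W_scl[OF FW] by (cases t) auto
  show "(SUM t:?N. ?z t) = 0" using F(1) by (subst sum.insert) (auto simp: sum.reindex F(3)[symmetric])
 qed (use F(1) in simp_all)
 moreover have "{t : ?N. ALL j:Rp. ?e t j = ch j} = insert None (Some ` ?G)" by auto
 ultimately have wG: "w = (SUM a:?G. scl (r a) a)" using F(1) by (simp add: sum.reindex)
 have "?G ~= {}" using w(2) unfolding wG by (auto simp del: Collect_empty_eq)
 then obtain a where a: "a : ?G" by blast
 have "scl (r b) b : S (sum (n a) (Rp))" if b: "b : ?G" for b
 proof -
  have "sum (n b) (Rp) = sum (n a) (Rp)" using a b by (intro lw_inj) simp
  thus ?thesis using n[of b] b by (auto simp: wtv_def intro: subspace_scale[OF S_sub])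
 qed
 hence "w : S (sum (n a) (Rp))" using subspace_sum[OF S_sub, of ?G "%b. scl (r b) b"] by (subst wG) blast
 thus ?thesis using a nQ by (intro bexI[of _ "n a"]) auto
qed

lemma S_span_weights: "(UN k. S k) <= span (UN n. wtv n)"
proof
 fix z assume "z : (UN k. S k)"
 then obtain k where "z : S k" by blast
 thus "z : span (UN n. wtv n)" using S_weights[of k] span_mono[of "UN n:{n. sum n (Rp) = k}. wtv n" "UN n. wtv n"] by blast
qed

lemma weight_vector:
 assumes "w : span (UN k. S k)" "w ~= 0" "!!j. j : Rp ==> act (kO j) w = scl (ch j) w"
 shows "EX n. w : S (sum n (Rp)) & (ALL j:Rp. ch j = lw n j)"
proof -
 have "w : span (UN n. wtv n)" using assms(1) span_minimal[OF S_span_weights subspace_span] by blast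
 thus ?thesis using span_weight_vector[OF _ assms(2,3)] by blast
qed

text \<open>Weights in \<open>Z k\<close> have height \<open>k\<close> for positive
  \<open>k\<close>, and \<open>Z 0\<close> is 0. The weight of \<open>v0\<close> has height 0, and
  the eigenvalues determine the height by \<open>lw_inj\<close>.\<close>

lemma v0_notin_Z: "v0 ~: span (UN k. Z k)"
proof
 let ?Q = "{n :: nat => nat. sum n (Rp) ~= 0}"
 assume v: "v0 : span (UN k. Z k)"
 have "Z k <= span (UN n:?Q. wtv n)" for k
 proof (cases k)
  case 0
  thus ?thesis by (simp add: span_zero)
 next
  case (Suc l)
  have "Z k <= span (UN n:{n. sum n (Rp) = k}. wtv n)" using Z_S S_weights by (rule order_trans)
  also have "... <= span (UN n:?Q. wtv n)" unfolding Suc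
  by (rule span_mono, rule UN_mono[OF _ subset_refl], rule Collect_mono) linarith
  finally show ?thesis .
 qed
 hence "(UN k. Z k) <= span (UN n:?Q. wtv n)" by blast
 hence "v0 : span (UN n:?Q. wtv n)" using v span_minimal[OF _ subspace_span] by blast
 moreover have "act (kO j) v0 = scl (lw (%_. 0) j) v0" if "j : Rp" for j using kk_v0[OF that] by (simp add: lw_def)
 ultimately obtain n where "n : ?Q" "!!j. j : Rp ==> lw (%_. 0) j = lw n j"
  using span_weight_vector[OF _ v0(2), of ?Q "lw (%_. 0)"] by blast
 thus False using lw_inj[of "%_. 0" n] by simp
qed

text \<open>Stated for an arbitrary graded family, to serve for both \<open>S\<close> and
  \<open>Z\<close>. Together with \<open>borel_Pa\<close> it gives stability under the Borel
  subalgebra without ever computing \<open>e\<^sub>\<epsilon>\<close>.\<close>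

lemma Pa_stable:
 assumes A: "!!k. A k <= W" "!!k. subspace (A k)"
  and X: "!!i r k z. i : Nd ==> z : A k ==> X i r z : A (Suc k)"
  and xp: "!!i r k z. i : Nd ==> z : A k ==> act (x Pl i (int r)) z : below A k"
  and k: "!!j k z. j : Rp ==> z : A k ==> act (kO j) z : A k"
  "!!j k z. j : Rp ==> z : A k ==> act (kI j) z : A k"
  and a: "a : Pa" and z: "z : span (UN k. A k)"
 shows "act a z : span (UN k. A k)"
proof -
 let ?U = "span (UN k. A k)"
 have UW: "?U <= W" using A(1) by (intro span_minimal W_subspace) auto
 have AU: "A k <= ?U" for k using span_superset by blast
 obtain b where b: "b : subalg Pgens" "a ~~ b" "a : chev" using a by (auto simp: Pa_def usub_def)
 have gen: "g : chev & (ALL z:?U. act g z : ?U)" if "g : Pgens" for g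
 proof -
  have gc: "g : chev" using that Pgens_chev by blast
  have g: "act g z : ?U" if z: "z : A k" for k z
  proof -
  from `g : Pgens` consider p i r where "g = x p i r" "i : Nd" "r >= 0" | j where "j : Rp" "g = kO j | g = kI j"
  by (auto simp: Pgens_def)
  thus ?thesis
  proof cases
  case 1
  hence r: "r = int (nat r)" by simp
  show ?thesis
  proof (cases p)
  case Pl
  hence "act g z : below A k" using xp[OF 1(2) z, of "nat r"] 1 r by simp
  moreover have "below A k <= ?U" using AU by (cases k) (auto simp: span_zero)
  ultimately show ?thesis by blast
  next
  case Mi
  thus ?thesis using X[OF 1(2) z, of "nat r"] 1 AU by auto
  qed
  next
  case 2
  thus ?thesis using k[OF _ z] AU by blast
  qed
  qed
  have "?U <= {z : W. act g z : ?U}" using g A(1) by (intro span_minimal act_vimage gc subspace_span) blast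
  thus ?thesis using gc by blast
 qed
 have "b : chev & (ALL z:?U. act b z : ?U)" using b(1)
 proof (induction b rule: subalg.induct)
  case (scalar c)
  thus ?case using UW by (auto simp: chevI act_sc1 span_scale)
 next
  case (gen g)
  thus ?case by (rule `!!g. g : Pgens ==> _`)
 next
  case (add b c)
  thus ?case using UW by (auto simp: chevI act_plus span_add subset_iff)
 next
  case (mult b c)
  thus ?case using UW by (auto simp: chevI act_times subset_iff)
 qed
 thus ?thesis using act_ueq[OF b(2,3), of z] z UW by auto
qed

lemma borel_S: "a : borel T ==> z : span (UN k. S k) ==> act a z : span (UN k. S k)"
 by (rule Pa_stable[OF S_W S_sub S_X_nodes S_xp])
  (use sstab_k borel_Pa in \<open>auto simp: sstab_def simp del: S.simps\<close>)

lemma Z_X_nodes: "i : Nd ==> z : Z k ==> X i r z : Z (Suc k)"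
proof -
 assume i: "i : Nd" and z: "z : Z k"
 obtain c where "X i r z = scl c (X (rep T i) r z)" using act_rep[OF i subsetD[OF Z_W z]] by blast
 thus ?thesis using Z_X[OF rep_reps'[OF i] z, of r] subspace_scale[OF Z_sub] by metis
qed

lemma borel_Z: "a : borel T ==> z : span (UN k. Z k) ==> act a z : span (UN k. Z k)"
 by (rule Pa_stable[OF Z_W Z_sub Z_X_nodes Z_xp])
  (use zstab_k borel_Pa in \<open>auto simp: zstab_def simp del: Z.simps\<close>)

subsection \<open>Recurrences modulo \<open>Z\<close>\<close>

lemma act_psh:
 assumes "a : chev" "!!m. f m : W"
 shows "act a (psh scl D f n) = psh scl D (%m. act a (f m)) n"
 unfolding psh_def using assms by (simp add: act_right_sum act_scl W_scl)

lemma psh_add_fun: "psh scl D (%m. f m + scl c (g m)) n = psh scl D f n + scl c (psh scl D g n)"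
 by (simp add: psh_def scale_right_distrib sum.distrib scale_sum_right mult.commute)

lemma psh_shift: "psh scl D (%m. f (k + m)) n = psh scl D f (k + n)" by (simp add: psh_def add.assoc)

text \<open>One polynomial for all nodes and all vectors of height \<open>k\<close>; this uniformity
  is needed because the induction applies it to vectors produced by raising modes and by modes of
  \<phi>.\<close>

definition rec2 :: "nat => complex poly => bool" where
 "rec2 k D \<longleftrightarrow> (ALL i:Rp. ALL z:S k. ALL n. psh scl D (%m. X i m z) n : Z (Suc k))"

definition rec3 :: "nat => complex poly => bool" where
 "rec3 k D \<longleftrightarrow> (ALL i:Rp. ALL z:S k. ALL n. psh scl D (%m. Ph i m z) n : Z k)"

lemma rec3_0: "EX D. D ~= 0 & rec3 0 D"
proof -
 have "EX D. D ~= 0 & (ALL i:Rp. ALL n. cpsh D (ga i) n = 0)"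
 proof (rule common_poly)
  show "EX D. D ~= 0 & (ALL n. cpsh D (ga i) n = 0)" if "i : Rp" for i
  using hw_rational[OF that] by (simp add: recurrent_def)
  show "ALL n. cpsh (D' * D) (ga i) n = 0" if "ALL n. cpsh D (ga i) n = 0" for i D D'
  using cpx.psh_mult_in[of "{0}" D "ga i" D'] that by (simp add: cpx.subspace_single_0)
 qed simp
 then obtain D where D: "D ~= 0" "!!i n. i : Rp ==> cpsh D (ga i) n = 0" by blast
 have "psh scl D (%m. Ph i m z) n = 0" if i: "i : Rp" and z: "z : S 0" for i z n
 proof -
  obtain c where z: "z = scl c v0" using z by (auto simp: span_singleton)
  have e: "Ph i m z = scl (ga i m * c) v0" for m using hw_phi[OF reps_no[OF i], of m] phi_nodes_chev[OF reps_no[OF i]] v0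
  by (simp add: z act_scl mult.commute)
  have "psh scl D (%m. Ph i m z) n = scl (cpsh D (ga i) n * c) v0"
  unfolding e by (simp only: psh_def scale_scale sum_distrib_right scale_sum_left mult.assoc)
  thus ?thesis using D(2)[OF i] by simp
 qed
 thus ?thesis using D(1) by (auto simp: rec3_def simp del: S.simps)
qed

text \<open>Membership in \<open>Z (Suc k)\<close> is tested by a raising mode. The commutator term
  is governed by the recurrence for \<phi> at height \<open>k\<close>, the other term by the
  recurrence for lowering modes at height \<open>k - 1\<close>, applied to the raised vector; the
  product of the two polynomials annihilates both.\<close>

lemma rec2_step:
 assumes D1: "D1 ~= 0" "k > 0 ==> rec2 (k - 1) D1" and D2: "D2 ~= 0" "rec3 k D2"
 shows "EX D. D ~= 0 & rec2 k D"
proof -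
 let ?p = "D1 * D2"
 \<comment> \<open>The factor \<open>pCons 0\<close> shifts the lowering modes to at least 1, so the
   commutators have positive total mode, as \<open>x_x\<close> requires, and no
   \<open>phi T h Mi\<close> term appears.\<close>
 have "psh scl (pCons 0 ?p) (%m. X i m z) n : Z (Suc k)" if i: "i : Rp" and z: "z : S k" for i z n
 proof -
  let ?y = "psh scl ?p (%m. X i m z) (Suc n)"
  note ni = reps_no[OF i]
  have zW: "z : W" using z S_W by blast
  have Xc: "x Mi i r : chev" for r by (rule x_chev[OF ni])
  have "act (x Pl j (int r)) ?y : Z k" if j: "j : Rp" for j r
  proof (cases "x Pl j (int r) ~~ 0")
  case True
  have yW: "?y : W" by (intro psh_in W_subspace act_in Xc zW)
  have "act (x Pl j (int r)) ?y = act 0 ?y" by (rule act_ueq[OF True x_chev[OF reps_no[OF j]] chevI(2) yW])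
  thus ?thesis using yW subspace_0[OF Z_sub] by (simp add: act_zero)
  next
  case False
  note nj = reps_no[OF j]
  note xc = x_chev[OF nj]
  let ?c = "if i = j then 1 / kap i else 0"
  let ?w = "act (x Pl j (int r)) z"
  have cc: "comm (x Pl j (int r)) (x Mi i (int (Suc m))) ~~ sc ?c * phi T h Pl i (int (r + Suc m))" for m
  proof -
  have "x Pl j (int r) ~~ 0 | comm (x Pl j (int r)) (x Mi i (int (Suc m))) ~~ sc ?c * phi T h Pl i (int r + int (Suc m))"
  by (rule x_x[OF i j]) simp_all
  thus ?thesis using False by (simp only: of_nat_add simp_thms)
  qed
  have com: "act (x Pl j (int r)) (X i (Suc m) z) = X i (Suc m) ?w + scl ?c (Ph i (r + Suc m) z)" for m
  by (rule act_comm[OF cc xc Xc phi_nodes_chev[OF ni] zW])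
  have "act (x Pl j (int r)) ?y = psh scl ?p (%m. act (x Pl j (int r)) (X i (Suc m) z)) n"
  using act_psh[OF xc, where f = "%m. X i m z" and D = ?p and n = "Suc n"] psh_shift[where D = ?p and f = "%m. act (x Pl j (int r)) (X i m z)" and k = 1 and n = n]
  act_in[OF Xc zW] by simp
  also have "... = psh scl ?p (%m. X i (Suc m) ?w) n + scl ?c (psh scl ?p (%m. Ph i (r + Suc m) z) n)"
  unfolding com by (rule psh_add_fun)
  also have "... = psh scl ?p (%m. X i m ?w) (Suc n) + scl ?c (psh scl ?p (%m. Ph i m z) (r + Suc n))"
  using psh_shift[where D = ?p and f = "%m. X i m ?w" and k = 1 and n = n] psh_shift[where D = ?p and f = "%m. Ph i m z" and k = "Suc r" and n = n] by simp
  also have "... : Z k"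
  proof (intro subspace_add[OF Z_sub] subspace_scale[OF Z_sub])
  show "psh scl ?p (%m. Ph i m z) (r + Suc n) : Z k"
  using D2(2) i z unfolding rec3_def by (intro psh_mult_in Z_sub) blast
  show "psh scl ?p (%m. X i m ?w) (Suc n) : Z k"
  proof (cases k)
  case 0
  hence "?w = 0" using S_xp[OF nj z, of r] by simp
  hence "psh scl ?p (%m. X i m ?w) (Suc n) = 0" by (simp add: psh_def act_0r Xc)
  thus ?thesis using subspace_0[OF Z_sub] by (simp only:)
  next
  case (Suc l)
  hence w: "?w : S l" using S_xp[OF nj z, of r] by simp
  have "rec2 l D1" using D1(2) Suc by simp
  hence "psh scl D1 (%m. X i m ?w) n : Z (Suc l)" for n using i w unfolding rec2_def by blast
  thus ?thesis unfolding Suc by (intro psh_mult_in' Z_sub)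
  qed
  qed
  finally show ?thesis .
  qed
  moreover have "?y : S (Suc k)" by (intro psh_in S_sub S_X i z)
  ultimately have "?y : Z (Suc k)" by (simp only: Z.simps) blast
  thus ?thesis by (simp add: psh_pCons del: Z.simps)
 qed
 hence "rec2 k (pCons 0 ?p)" unfolding rec2_def by blast
 moreover have "pCons 0 ?p ~= 0" using D1(1) D2(1) by simp
 ultimately show ?thesis by blast
qed

text \<open>By \<open>phi_x\<close>, \<phi> on a lowered vector is a convolution of lowering modes
  with modes of \<phi>. Reducing both by \<open>cmp_expand\<close> leaves finitely many vectors
  \<open>a u w\<close> with scalar coefficients \<open>f\<close>, which are convolutions of
  recurrent sequences; \<open>cx_recurrent\<close> enters here.\<close>

lemma rec3_step:
 assumes D1: "D1 ~= 0" "rec2 k D1" and D2: "D2 ~= 0" "rec3 k D2"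
 shows "EX D. D ~= 0 & rec3 (Suc k) D"
proof -
 define f where "f i j u w n = (SUM m=0..n. (s powi (- (2 * csum T i j)) * cx Mi i j m * cmp D1 u m) * cmp D2 w (n - m))" for i j u w n
 have f: "recurrent (f i j u w)" if "i : Rp" for i j u w
 proof -
  have const: "recurrent (%_. c)" for c unfolding recurrent_def by (rule exI[of _ "[:-1, 1:]"]) (simp add: cpx.psh_pCons)
  have "recurrent (cmp D1 u)" "recurrent (cmp D2 w)" using D1(1) D2(1) cmp_psh unfolding recurrent_def by blast+
  thus ?thesis unfolding f_def using that by (intro recurrent_convolution recurrent_times const cx_recurrent reps_no)
 qed
 let ?I = "Rp \<times> Rp \<times> {..<degree D1} \<times> {..<degree D2}"
 have "EX D. D ~= 0 & (ALL x:?I. case x of (i, j, u, w) => ALL n. cpsh D (f i j u w) n = 0)"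
 proof (rule common_poly)
  fix x assume "x : ?I"
  then obtain i j u w where "x = (i, j, u, w)" "i : Rp" by auto
  thus "EX D. D ~= 0 & (case x of (i, j, u, w) => ALL n. cpsh D (f i j u w) n = 0)"
  using f by (simp add: recurrent_def)
 next
  fix x D D' assume "case x of (i, j, u, w) => ALL n. cpsh D (f i j u w) n = 0"
  thus "case x of (i, j, u, w) => ALL n. cpsh (D' * D) (f i j u w) n = 0"
  using cpx.psh_mult_in[of "{0}" D] by (auto simp: cpx.subspace_single_0 split: prod.splits)
 qed simp
 then obtain D where D: "D ~= 0" and
  Df: "!!i j u w n. i : Rp ==> j : Rp ==> u < degree D1 ==> w < degree D2 ==> cpsh D (f i j u w) n = 0"
  by fastforce
 note Zs = Z_sub[of "Suc k"]
 have gen: "psh scl D (%m. Ph i m (X j l z)) n : Z (Suc k)"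
  if i: "i : Rp" and j: "j : Rp" and z: "z : S k" for i j l z n
 proof -
  note ni = reps_no[OF i] and nj = reps_no[OF j]
  note Xc = x_chev[OF nj] and Pc = phi_chev[OF i]
  have zW: "z : W" using z S_W by blast
  let ?p = "degree D1" and ?q = "degree D2"
  let ?e = "s powi (- (2 * csum T i j))"
  define a where "a m p = X j (l + m) (Ph i p z)" for m p
  have Pz: "Ph i p z : S k" for p using sstab_phi[OF ni, of p] z by (auto simp: sstab_def)
  have a1: "a m p - (SUM u<?p. scl (cmp D1 u m) (a u p)) : Z (Suc k)" for m p
  proof -
  have "psh scl D1 (%m. X j m (Ph i p z)) n : Z (Suc k)" for n using D1(2) j Pz unfolding rec2_def by blast
  from cmp_expand[OF Zs D1(1) this, of l m] show ?thesis by (simp only: a_def)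
  qed
  have a2: "a u p - (SUM w<?q. scl (cmp D2 w p) (a u w)) : Z (Suc k)" for u p
  proof -
  have "psh scl D2 (%p. a u p) n : Z (Suc k)" for n
  proof -
  have "psh scl D2 (%p. Ph i p z) n : Z k" using D2(2) i z unfolding rec3_def by blast
  hence "X j (l + u) (psh scl D2 (%p. Ph i p z) n) : Z (Suc k)" by (rule Z_X[OF j])
  moreover have "X j (l + u) (psh scl D2 (%p. Ph i p z) n) = psh scl D2 (%p. X j (l + u) (Ph i p z)) n"
  using act_in[OF Pc zW] by (rule act_psh[OF Xc])
  ultimately show ?thesis by (simp only: a_def)
  qed
  from cmp_expand[OF Zs D2(1) this, of 0 p] show ?thesis by (simp only: add_0)
  qed
  have a12: "a m p - (SUM u<?p. SUM w<?q. scl (cmp D1 u m * cmp D2 w p) (a u w)) : Z (Suc k)" for m p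
  proof -
  have "(a m p - (SUM u<?p. scl (cmp D1 u m) (a u p))) +
  (SUM u<?p. scl (cmp D1 u m) (a u p - (SUM w<?q. scl (cmp D2 w p) (a u w)))) : Z (Suc k)"
  by (intro subspace_add[OF Zs] subspace_sum[OF Zs] subspace_scale[OF Zs] a1 a2)
  thus ?thesis by (simp only: scale_right_diff_distrib sum_subtractf scale_sum_right scale_scale diff_add_cancel add_diff_eq)
  qed
  have Phi: "Ph i n (X j l z) = (SUM m=0..n. scl (?e * cx Mi i j m) (a m (n - m)))" for n
  proof -
  have t: "sc (s powi (sgn_int Mi * (2 * csum T i j)) * cx Mi i j m) * (x Mi j (int l + int m) * phi T h Pl i (int (n - m))) : chev" for m
  by (intro chevI Xc Pc)
  have "Ph i n (X j l z) = act (ph i n * x Mi j (int l)) z" using Xc Pc zW by (simp add: act_times)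
  also have "... = act (SUM m=0..n. sc (s powi (sgn_int Mi * (2 * csum T i j)) * cx Mi i j m) * (x Mi j (int l + int m) * phi T h Pl i (int (n - m)))) z"
  by (rule act_ueq[OF phi_x[OF i nj] chevI(5)[OF Pc Xc] chevI(9)[OF t] zW])
  also have "... = (SUM m=0..n. act (sc (s powi (sgn_int Mi * (2 * csum T i j)) * cx Mi i j m) * (x Mi j (int l + int m) * phi T h Pl i (int (n - m)))) z)"
  by (rule act_sum[OF zW t])
  also have "... = (SUM m=0..n. scl (?e * cx Mi i j m) (a m (n - m)))"
  unfolding a_def by (intro sum.cong refl, subst act_sc_times[OF chevI(5)[OF Xc Pc] zW], subst act_times[OF Xc Pc zW]) simp
  finally show ?thesis .
  qed
  define F where "F n = (SUM u<?p. SUM w<?q. scl (f i j u w n) (a u w))" for n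
  have "Ph i n (X j l z) - F n : Z (Suc k)" for n
  proof -
  have "(SUM m=0..n. scl (?e * cx Mi i j m) (a m (n - m) - (SUM u<?p. SUM w<?q. scl (cmp D1 u m * cmp D2 w (n - m)) (a u w)))) : Z (Suc k)"
  by (intro subspace_sum[OF Zs] subspace_scale[OF Zs] a12)
  moreover have "(SUM m=0..n. scl (?e * cx Mi i j m) (SUM u<?p. SUM w<?q. scl (cmp D1 u m * cmp D2 w (n - m)) (a u w))) = F n"
  proof -
  have "(SUM m=0..n. scl (?e * cx Mi i j m) (SUM u<?p. SUM w<?q. scl (cmp D1 u m * cmp D2 w (n - m)) (a u w))) =
  (SUM m=0..n. SUM u<?p. SUM w<?q. scl (?e * cx Mi i j m * cmp D1 u m * cmp D2 w (n - m)) (a u w))"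
  by (simp only: scale_sum_right scale_scale mult.assoc)
  also have "... = (SUM u<?p. SUM m=0..n. SUM w<?q. scl (?e * cx Mi i j m * cmp D1 u m * cmp D2 w (n - m)) (a u w))"
  by (rule sum.swap)
  also have "... = (SUM u<?p. SUM w<?q. SUM m=0..n. scl (?e * cx Mi i j m * cmp D1 u m * cmp D2 w (n - m)) (a u w))"
  by (rule sum.cong[OF refl], rule sum.swap)
  also have "... = F n" unfolding F_def f_def scale_sum_left ..
  finally show ?thesis .
  qed
  ultimately show ?thesis unfolding Phi by (simp only: scale_right_diff_distrib sum_subtractf)
  qed
  hence "psh scl D (%m. Ph i m (X j l z) - F m) n : Z (Suc k)" by (intro psh_in Zs)
  moreover have "psh scl D F n = 0"
  proof -
  have "psh scl D F n = (SUM u<?p. SUM w<?q. scl (cpsh D (f i j u w) n) (a u w))"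
  unfolding psh_def F_def scale_sum_right scale_scale scale_sum_left by (subst sum.swap, rule sum.cong[OF refl], rule sum.swap)
  also have "... = 0" using Df[OF i j] by (intro sum.neutral ballI) simp
  finally show ?thesis .
  qed
  moreover have "psh scl D (%m. Ph i m (X j l z)) n = psh scl D (%m. Ph i m (X j l z) - F m) n + psh scl D F n"
  by (simp add: psh_def scale_right_diff_distrib sum_subtractf)
  ultimately show ?thesis by simp
 qed
 have "psh scl D (%m. Ph i m z) n : Z (Suc k)" if i: "i : Rp" and z: "z : S (Suc k)" for i z n
 proof -
  note Pc = phi_chev[OF i]
  let ?P = "{z : W. psh scl D (%m. Ph i m z) n : Z (Suc k)}"
  have lin: "psh scl D (%m. Ph i m (y + scl c w)) n = psh scl D (%m. Ph i m y) n + scl c (psh scl D (%m. Ph i m w) n)"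
  if "y : W" "w : W" for y w c unfolding psh_add_fun[symmetric] using Pc that by (simp add: act_addr act_scl W_scl)
  have 0: "psh scl D (%m. Ph i m 0) n = 0" using Pc by (simp add: psh_def act_0r)
  have "subspace ?P" unfolding subspace_def
  proof (intro conjI ballI allI)
  show "0 : ?P" using 0 subspace_0[OF Zs] W_0 by (simp del: Z.simps)
  show "y + w : ?P" if "y : ?P" "w : ?P" for y w
  using that lin[of y w 1] subspace_add[OF Zs] by (simp add: W_add del: Z.simps)
  show "scl c w : ?P" if "w : ?P" for c w using that lin[of 0 w c] 0 subspace_scale[OF Zs] W_0 by (simp add: W_scl del: Z.simps)
  qed
  moreover have "X j l w : ?P" if "j : Rp" "w : S k" for j l w
  using gen[OF i that] act_in[OF x_chev[OF reps_no[OF that(1)]]] S_W that(2) by blast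
  ultimately show ?thesis using S_Suc_induct[OF z, of ?P] by blast
 qed
 thus ?thesis using D unfolding rec3_def by blast
qed

lemma rec_all: "(EX D. D ~= 0 & rec2 k D) & (EX D. D ~= 0 & rec3 k D)"
proof (induction k)
 case 0
 obtain D where D: "D ~= 0" "rec3 0 D" using rec3_0 by blast
 have "EX D. D ~= 0 & rec2 0 D" by (rule rec2_step[of 1, OF _ _ D]) auto
 thus ?case using D by blast
next
 case (Suc k)
 then obtain D1 D2 where D1: "D1 ~= 0" "rec2 k D1" and D2: "D2 ~= 0" "rec3 k D2" by blast
 obtain D3 where D3: "D3 ~= 0" "rec3 (Suc k) D3" using rec3_step[OF D1 D2] by blast
 have "EX D. D ~= 0 & rec2 (Suc k) D" by (rule rec2_step[OF D1(1) _ D3]) (use D1(2) in simp)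
 thus ?case using D3 by blast
qed

text \<open>The recurrence reduces all lowering modes on the finite set \<open>B\<close> to the
  first \<open>degree D\<close> ones, and the error terms from \<open>Z k\<close> are lowered into
  \<open>Z (Suc k)\<close>.\<close>

lemma S_fin: "EX B. finite B & B <= S k & (ALL z:S k. EX b:span B. z - b : Z k)"
proof (induction k)
 case 0
 show ?case by (rule exI[of _ "{v0}"]) (auto simp: span_base intro: bexI)
next
 case (Suc k)
 then obtain B where B: "finite B" "B <= S k" "!!z. z : S k ==> EX b:span B. z - b : Z k" by blast
 obtain D where D: "D ~= 0" "rec2 k D" using rec_all by blast
 let ?B = "(%(i, u, b). X i u b) ` (Rp \<times> {..<degree D} \<times> B)"
 note Zs = Z_sub[of "Suc k"]
 have BS: "?B <= S (Suc k)" using B(2) S_X by (auto simp del: S.simps)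
 define P where "P = {z. EX b:span ?B. z - b : Z (Suc k)}"
 have P: "subspace P" unfolding subspace_def
 proof (intro conjI ballI allI)
  show "0 : P" using subspace_0[OF Zs] by (auto simp: P_def simp del: Z.simps intro: bexI[of _ 0] span_zero)
  show "y + z : P" if yz: "y : P" "z : P" for y z
  proof -
  obtain b c where "b : span ?B" "y - b : Z (Suc k)" "c : span ?B" "z - c : Z (Suc k)" using yz unfolding P_def by blast
  hence "b + c : span ?B" "(y + z) - (b + c) : Z (Suc k)"
  using subspace_add[OF Zs, of "y - b" "z - c"] by (simp_all add: span_add algebra_simps del: Z.simps)
  thus ?thesis unfolding P_def by blast
  qed
  show "scl c z : P" if z: "z : P" for c z
  proof -
  obtain b where "b : span ?B" "z - b : Z (Suc k)" using z unfolding P_def by blast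
  hence "scl c b : span ?B" "scl c z - scl c b : Z (Suc k)"
  using subspace_scale[OF Zs, of "z - b" c] by (simp_all add: span_scale scale_right_diff_distrib del: Z.simps)
  thus ?thesis unfolding P_def by blast
  qed
 qed
 have ZP: "Z (Suc k) <= P"
 proof
  fix z assume z: "z : Z (Suc k)"
  have "z - 0 : Z (Suc k)" using z by (simp only: diff_zero)
  thus "z : P" unfolding P_def using span_zero by blast
 qed
 have Xb: "X i r b : P" if i: "i : Rp" and b: "b : B" for i r b
 proof -
  have "psh scl D (%m. X i m b) n : Z (Suc k)" for n using D(2) i b B(2) unfolding rec2_def by blast
  from cmp_expand[OF Zs D(1) this, of 0 r]
  have "X i r b - (SUM u<degree D. scl (cmp D u r) (X i u b)) : Z (Suc k)" by (simp only: add_0)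
  moreover have "(SUM u<degree D. scl (cmp D u r) (X i u b)) : span ?B" using i b by (intro span_sum span_scale span_base) force
  ultimately show ?thesis unfolding P_def by blast
 qed
 have "X i r z : P" if i: "i : Rp" and z: "z : S k" for i r z
 proof -
  note xc = x_chev[OF reps_no[OF i], of Mi "int r"]
  obtain b where b: "b : span B" "z - b : Z k" using B(3)[OF z] by blast
  have BW: "B <= W" using B(2) S_W by blast
  have "span B <= {z : W. X i r z : P}" using Xb[OF i] BW by (intro span_minimal act_vimage xc P) auto
  hence bP: "X i r b : P" and bW: "b : W" using b(1) by auto
  have "X i r (z - b) : P" using Z_X[OF i b(2)] ZP by blast
  hence "X i r (z - b) + X i r b : P" by (rule subspace_add[OF P _ bP])
  moreover have "X i r (z - b) + X i r b = X i r z" using act_addr[OF xc subsetD[OF Z_W b(2)] bW] by simp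
  ultimately show ?thesis by simp
 qed
 hence "z : P" if "z : S (Suc k)" for z using S_Suc_induct[OF that P] by blast
 thus ?case using B(1) BS by (intro exI[of _ ?B]) (auto simp: P_def simp del: S.simps Z.simps)
qed

end

section \<open>Borel modules\<close>

context twisted
begin

abbreviation "tgens == (UN i:Rp. {kO i, kI i})"

lemma tgens_borel: "tgens <= bgens" using Orb_an by blast

lemmas torusI = usub_closed[OF order_trans[OF tgens_borel borel_gens_chev], folded torus_def]

lemma torus_borel: "torus T <= borel T" unfolding torus_def borel_def usub_def using subalg_mono[OF tgens_borel] by blast

lemma torus_kk: "j : Rp ==> kO j : torus T" and torus_kinv: "j : Rp ==> kI j : torus T"
 by (rule torusI(6); blast)+

lemma torus_subalg: "a : torus T ==> EX b:subalg tgens. a ~~ b" by (simp add: torus_def usub_def)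

lemma tchar_ueq:
 assumes "tchar T ch" "a ~~ b" "b : torus T"
 shows "ch a = ch b"
proof -
 have r: "a - b : rel_ideal T" using assms(2) by (simp add: ueq_def)
 hence "ch (b + (a - b)) = ch b + ch (a - b)" "ch (a - b) = 0"
  using assms(1,3) torusI(5) unfolding tchar_def by blast+
 thus ?thesis by simp
qed

end

locale borel_rep = drinfeld T x h + rep_on T scl "borel T" UNIV act
 for T x h and scl :: "complex => 'v::ab_group_add => 'v" and act
begin

sublocale cvector_space scl ..

lemma eigen_kinv:
 assumes "j : Rp" "act (kO j) w = scl c w" "w ~= 0"
 shows "c ~= 0" "act (kI j) w = scl (1 / c) w"
proof -
 note a = Orb_an[OF assms(1)]
 have "act (kI j * kO j) w = act 1 w"
  using borel_kk[OF a] borel_kinv[OF a] by (intro act_ueq rel_kinv a alg_mult alg_1) auto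
 hence e: "scl c (act (kI j) w) = w"
  using borel_kk[OF a] borel_kinv[OF a] assms(2) by (simp add: act_times act_one act_scl)
 thus "c ~= 0" using assms(3) by auto
 thus "act (kI j) w = scl (1 / c) w" using arg_cong[OF e, of "scl (1 / c)"] by simp
qed

text \<open>The values of a character on the inverses follow from multiplicativity, and congruent
  elements have equal values by \<open>tchar_ueq\<close>; so the \<open>k\<^sub>j\<close>
  decide.\<close>

lemma weight_iff:
 assumes ch: "tchar T ch"
 shows "w : weight_space T scl act ch \<longleftrightarrow> (ALL j:Rp. act (kO j) w = scl (ch (kO j)) w)"
proof
 assume "ALL j:Rp. act (kO j) w = scl (ch (kO j)) w"
 hence k: "act (kO j) w = scl (ch (kO j)) w" if "j : Rp" for j using that by blast
 have hom: "ch (sc c) = c" "a : torus T ==> b : torus T ==> ch (a + b) = ch a + ch b & ch (a * b) = ch a * ch b" for a b c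
  using ch unfolding tchar_def by blast+
 have main: "a : torus T & act a w = scl (ch a) w" if "a : subalg tgens" for a using that
 proof (induction rule: subalg.induct)
  case (gen a)
  then obtain j where j: "j : Rp" and a: "a = kO j | a = kI j" by blast
  have "ch (kI j) = 1 / ch (kO j)" "ch (kO j) ~= 0"
  proof -
  have "ch (kO j) * ch (kI j) = ch (kO j * kI j)"
  using hom(2)[OF torus_kk[OF j] torus_kinv[OF j]] by simp
  also have "... = ch (sc 1)" using rel_kinv(1)[OF Orb_an[OF j]] by (intro tchar_ueq ch torusI(1)) simp
  finally have "ch (kO j) * ch (kI j) = 1" by (simp add: hom(1) del: sc_1)
  thus "ch (kI j) = 1 / ch (kO j)" "ch (kO j) ~= 0" by (metis nonzero_eq_divide_eq mult.commute mult_zero_left zero_neq_one)+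
  qed
  thus ?case using a torus_kk[OF j] torus_kinv[OF j] k[OF j] eigen_kinv[OF j k[OF j]]
  borel_kinv[OF Orb_an[OF j]] by (cases "w = 0") (auto simp: act_0r borel_kk[OF Orb_an[OF j]])
 next
  case (add a b)
  hence "a : borel T" "b : borel T" using torus_borel by auto
  thus ?case using add torusI(2) hom(2)[of a b] by (simp add: act_plus scale_left_distrib)
 next
  case (mult a b)
  hence ab: "a : borel T" "b : borel T" using torus_borel by auto
  hence "act (a * b) w = scl (ch b) (scl (ch a) w)" using mult by (simp add: act_times act_scl)
  thus ?case using mult hom(2)[of a b] torusI(3) by (simp add: mult.commute)
 qed (simp add: torusI act_sc1 hom(1))
 have "act a w = scl (ch a) w" if "a : torus T" for a
 proof -
  obtain b where b: "b : subalg tgens" "a ~~ b" using torus_subalg[OF `a : torus T`] by blast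
  have "act a w = act b w" using b main[OF b(1)] that torus_borel by (intro act_ueq) auto
  moreover have "ch a = ch b" using b main[OF b(1)] by (intro tchar_ueq ch) auto
  ultimately show ?thesis using main[OF b(1)] by simp
 qed
 thus "w : weight_space T scl act ch" by (simp add: weight_space_def)
qed (simp add: weight_space_def torus_kk)

text \<open>The eigenvalues on a nonzero vector are unique, and uniqueness makes them additive and
  multiplicative in the element of the torus.\<close>

lemma eigen_tchar:
 assumes w: "w ~= 0" and k: "!!j. j : Rp ==> EX c. act (kO j) w = scl c w"
 shows "EX ch. tchar T ch & w : weight_space T scl act ch"
proof -
 have main: "a : torus T & (EX c. act a w = scl c w)" if "a : subalg tgens" for a using that
 proof (induction rule: subalg.induct)
  case (gen a)
  then obtain j where j: "j : Rp" and a: "a = kO j | a = kI j" by blast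
  obtain c where "act (kO j) w = scl c w" using k[OF j] by blast
  thus ?case using eigen_kinv(2)[OF j _ w] a torus_kk[OF j] torus_kinv[OF j] by blast
 next
  case (add a b)
  then obtain c d where "act a w = scl c w" "act b w = scl d w" by blast
  hence "act (a + b) w = scl (c + d) w" using add torus_borel by (simp add: act_plus subset_iff scale_left_distrib)
  thus ?case using add torusI(2) by blast
 next
  case (mult a b)
  then obtain c d where "act a w = scl c w" "act b w = scl d w" by blast
  hence "act (a * b) w = scl (d * c) w" using mult torus_borel by (simp add: act_times subset_iff act_scl)
  thus ?case using mult torusI(3) by blast
 qed (auto simp: torusI act_sc1)
 have "EX c. act a w = scl c w" if "a : torus T" for a
 proof -
  obtain b where b: "b : subalg tgens" "a ~~ b" using torus_subalg[OF `a : torus T`] by blast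
  have "act a w = act b w" using b main[OF b(1)] that torus_borel by (intro act_ueq) auto
  thus ?thesis using main[OF b(1)] by simp
 qed
 hence "ALL a. EX c. a : torus T --> act a w = scl c w" by blast
 then obtain ch where ch: "!!a. a : torus T ==> act a w = scl (ch a) w" by metis
 have u: "c = d" if "scl c w = scl d w" for c d using that w by simp
 have "tchar T ch" unfolding tchar_def
 proof (intro conjI allI ballI)
  fix c a b
  show "ch (sc c) = c" using ch[OF torusI(1), of c] by (intro u) (simp only: act_sc1 UNIV_I)
  show "ch a = 0" if "a : rel_ideal T" using ch[OF torusI(5)[OF that]] act_rel[OF that] by (intro u) simp
  assume ab: "a : torus T" "b : torus T"
  hence "a : borel T" "b : borel T" using torus_borel by auto
  thus "ch (a + b) = ch a + ch b" "ch (a * b) = ch a * ch b"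
  using ab ch[OF torusI(2)[OF ab]] ch[OF torusI(3)[OF ab]] ch[OF ab(1)] ch[OF ab(2)]
  by (auto intro!: u simp: act_plus act_times act_scl scale_left_distrib mult.commute)
 qed
 thus ?thesis using ch by (auto simp: weight_space_def)
qed

end

section \<open>Simple modules with a rational highest \<open>l\<close>-weight\<close>

context borel_rep
begin

text \<open>The value 0 outside \<open>anodes T\<close> provides the linearity that
  \<open>bmod\<close> demands at every index.\<close>

definition opE :: "anode => 'v => 'v" where "opE a v = (if a : An then act (ee Pl a) v else 0)"
definition opK :: "anode => 'v => 'v" where "opK a v = (if a : An then act (kk a) v else 0)"
definition opKi :: "anode => 'v => 'v" where "opKi a v = (if a : An then act (kinv a) v else 0)"

lemma borel_gen: "a : An ==> ee Pl a : borel T" "a : An ==> kk a : borel T" "a : An ==> kinv a : borel T"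
 by (simp_all add: borel_ee borel_kk borel_kinv)

lemma op_simps: "a : An ==> opE a v = act (ee Pl a) v" "a : An ==> opK a v = act (kk a) v"
 "a : An ==> opKi a v = act (kinv a) v" by (simp_all add: opE_def opK_def opKi_def)

lemma bmod: "bmod T scl UNIV opE opK opKi"
proof
 note g = borel_gen
 fix a b c v w
 show "opE a (v + w) = opE a v + opE a w" "opK a (v + w) = opK a v + opK a w" "opKi a (v + w) = opKi a v + opKi a w"
  "opE a (scl c v) = scl c (opE a v)" "opK a (scl c v) = scl c (opK a v)" "opKi a (scl c v) = scl c (opKi a v)"
  by (simp_all add: opE_def opK_def opKi_def g act_addr act_scl)
 assume a: "a : An"
 show "opK a (opKi a v) = v" "opKi a (opK a v) = v" using act_ueq[OF rel_kinv(1)[OF a], of v] act_ueq[OF rel_kinv(2)[OF a], of v] a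
  by (simp_all add: opK_def opKi_def g act_times act_one alg_mult alg_1)
 assume b: "b : An"
 show "opK a (opK b v) = opK b (opK a v)" using act_ueq[OF rel_kk_comm[OF a b], of v] a b by (simp add: opK_def g act_times alg_mult)
 show "opK a (opE b v) = scl (s powi sym2 T a b) (opE b (opK a v))" using act_ueq[OF rel_kk_ee[OF a b, of Pl], of v] a b
  by (simp add: opK_def opE_def g act_times act_sc1 alg_mult alg_sc)
 assume ab: "a ~= b"
 have "qcomm x (ee Pl a) (ee Pl b) n : borel T &
  serre_op scl x (opE a) (opE b) n v = act (qcomm x (ee Pl a) (ee Pl b) n) v" for n v x
 proof (induction n arbitrary: v)
  case (Suc n)
  hence "qcomm x (ee Pl a) (ee Pl b) n : borel T" by blast
  thus ?case using Suc g(1)[OF a] a by (simp add: opE_def alg_mult alg_diff alg_sc act_minus act_times act_sc1)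
 qed (simp add: opE_def b g)
 moreover have "serre T Pl a b : relI" by (rule relI_rel) (use a b ab in \<open>unfold relations_def, blast\<close>)
 ultimately show "serre_op scl (serre_x a b) (opE a) (opE b) (s_num a b) v = 0"
  using act_rel[of "serre T Pl a b" v] by (simp add: serre_eq[OF a b ab])
next
 fix v
 have pw: "kk a ^ n : borel T & (opK a ^^ n) w = act (kk a ^ n) w" if "a : An" for a n w
  using that by (induction n arbitrary: w) (simp_all add: alg_1 act_one act_times alg_mult borel_gen opK_def)
 have "prod_list (map (%a. kk a ^ kac_label T a) L) : borel T &
  foldr (%a. opK a ^^ kac_label T a) L v = act (prod_list (map (%a. kk a ^ kac_label T a) L)) v"
  if "set L <= An" for L using that by (induction L) (simp_all add: alg_1 act_one act_times alg_mult pw)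
 from this[of "Eps # map Orb replist"] Eps_anodes Orb_an
 have kd: "k_delta T : borel T & foldr (%a. opK a ^^ kac_label T a) (Eps # map Orb replist) v = act (k_delta T) v"
  unfolding k_delta_def by fastforce
 hence "act (k_delta T) v = act 1 v" by (intro act_ueq rel_k_delta alg_1) auto
 thus "foldr (%a. opK a ^^ kac_label T a) (Eps # map Orb replist) v = v" using kd by (simp add: act_one)
qed simp_all

sublocale bm: bmod T scl UNIV opE opK opKi by (rule bmod)

text \<open>For expressions in the generators this is \<open>bm.iact_emb\<close>; a general element
  is congruent to such an expression, and congruent elements act equally on both sides.\<close>

lemma iact_emb_borel:
 assumes a: "a : borel T"
 shows "bm.iact a (bm.emb w) = bm.emb (act a w)"
proof -
 have v: "b : borel T & bm.vact b w = act b w" if "b : subalg bgens" for b w using that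
 proof (induction b arbitrary: w rule: subalg.induct)
  case (gen a)
  thus ?case by (auto simp: borel_gen op_simps)
 qed (simp_all add: alg_sc alg_add alg_mult act_sc1 act_plus act_times bm.va.act_add bm.va.act_mult)
 obtain b where b: "b : subalg bgens" "a ~~ b" using a by (auto simp: borel_def usub_def)
 have "bm.iact a (bm.emb w) = bm.iact b (bm.emb w)" using a b v[OF b(1)] borel_chev by (intro bm.ind.act_ueq bm.emb_ind) auto
 also have "... = bm.emb (act b w)" using bm.iact_emb[OF b(1), of w] v[OF b(1)] by simp
 also have "act b w = act a w" using a b v[OF b(1)] by (intro act_ueq[OF ueq_sym]) auto
 finally show ?thesis .
qed

lemma s_powi_sum: "finite I ==> (PROD i:I. s powi f i) = s powi (SUM i:I. f i)"
 by (induction rule: finite_induct) (simp_all add: power_int_add)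

lemma wt_prod:
 assumes j: "j : Rp"
 shows "(PROD i:Rp. (qn T (Orb i) powi aff_cartan T (Orb i) (Orb j)) ^ n i) = s powi (2 * (SUM i:Rp. int (n i) * csum T i j))"
 unfolding sum_distrib_left s_powi_sum[OF finite_reps, symmetric]
 using Orb_an j by (intro prod.cong refl) (simp add: qn_powi_cartan s_powi_pow mult_ac)

abbreviation "wts == span (\<Union>ch\<in>{ch. tchar T ch}. weight_space T scl act ch)"

lemma eigen_wts:
 assumes "!!j. j : Rp ==> EX c. act (kO j) w = scl c w"
 shows "w : wts"
proof (cases "w = 0")
 case False
 thus ?thesis using eigen_tchar[OF _ assms] by (intro span_base) blast
qed (simp add: span_zero)

lemma wts_stable:
 assumes "a : borel T" "w : wts"
 shows "act a w : wts"
proof -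
 have "w : wts ==> b : borel T & act b w : wts" if "b : subalg bgens" for b w using that
 proof (induction b arbitrary: w rule: subalg.induct)
  case (gen b)
  then obtain a where a: "a : An" and b: "b = ee Pl a | b = kk a | b = kinv a" by blast
  hence bb: "b : borel T" using borel_gen by blast
  have sw: "EX t. act (kO j) (act b y) = scl t (act b (act (kO j) y))" if j: "j : Rp" for j y
  proof -
  note o = op_simps[OF a] op_simps[OF Orb_an[OF j]]
  have "act (kO j) (act (ee Pl a) y) = scl (s powi sym2 T (Orb j) a) (act (ee Pl a) (act (kO j) y))"
  "act (kO j) (act (kk a) y) = scl 1 (act (kk a) (act (kO j) y))"
  "act (kO j) (act (kinv a) y) = scl 1 (act (kinv a) (act (kO j) y))"
  using bm.K_E[OF Orb_an[OF j] a, of y] bm.K_K[OF Orb_an[OF j] a, of y]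
  bm.K_Ki_commute[OF Orb_an[OF j] a, of y] by (simp_all add: o)
  thus ?thesis using b by blast
  qed
  have "subspace {w. act b w : wts}"
  using bb by (auto simp: subspace_def act_0r act_addr act_scl intro: span_zero span_add span_scale)
  moreover have "act b y : wts" if y: "tchar T ch" "y : weight_space T scl act ch" for y ch
  proof (rule eigen_wts)
  fix j assume j: "j : Rp"
  obtain t where "act (kO j) (act b y) = scl t (act b (act (kO j) y))" using sw[OF j] by blast
  moreover have "act (kO j) y = scl (ch (kO j)) y" using y j by (simp add: weight_iff)
  ultimately show "EX c. act (kO j) (act b y) = scl c (act b y)" using bb by (auto simp: act_scl)
  qed
  ultimately have "wts <= {w. act b w : wts}" by (intro span_minimal) auto
  thus ?case using gen bb by blast
 next
  case (add b c)
  thus ?case using add.IH by (simp add: act_plus alg_add span_add)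
 next
  case (mult b c)
  thus ?case using mult.IH by (simp add: act_times alg_mult)
 qed (simp add: act_sc1 alg_sc span_scale)
 moreover obtain b where b: "b : subalg bgens" "a ~~ b" using assms(1) by (auto simp: borel_def usub_def)
 ultimately have "b : borel T" "act b w : wts" using assms(2) by blast+
 thus ?thesis using act_ueq[OF b(2) assms(1)] by simp
qed

text \<open>Eigenvalues determine the height, so a whole weight space is mapped into a single
  \<open>S k\<close>. A linear relation that holds there modulo \<open>Z k\<close> is a relation in
  the module itself, and \<open>S_fin\<close> bounds the dimension.\<close>

lemma rational_in_cat_O:
 assumes simple: "!!P. borel_submodule T scl act P ==> P = {0} | P = UNIV"
  and gen: "!!P. borel_submodule T scl act P ==> v : P ==> P = UNIV"
  and v: "v ~= 0" and x: "!!i r. i : Nd ==> r >= 0 ==> act (x Pl i r) v = 0"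
  and fi: "!!i m. i : Nd ==> act (ph i m) v = scl (cf (ga i) m) v"
  and rat: "!!i. i : Nd ==> rational_fps (ga i)"
 shows "wts = UNIV"
  and "tchar T ch ==> EX B. finite B & weight_space T scl act ch <= span B"
  and "EX mu. tchar T mu & (ALL ch. tchar T ch & weight_space T scl act ch ~= {0} --> wt_le T ch mu)"
proof -
 have kv: "act (kO j) v = scl (cf (ga j) 0) v" if "j : Rp" for j
  using fi[OF reps_no[OF that], of 0] that by (simp add: phi_0 rep_reps)
 have "borel_submodule T scl act wts" using wts_stable by (simp add: borel_submodule_def)
 thus "wts = UNIV" using kv by (intro gen eigen_wts) blast+
 interpret hw: hwrep T x h bm.fscl bm.ind bm.iact "bm.emb v" "%i. cf (ga i)"
 proof
  show "bm.emb v : bm.ind" by (rule bm.emb_ind) simp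
  show "bm.emb v ~= 0" using v bm.emb_inj[of v 0] unfolding bm.emb_0 by blast
  show "bm.iact (x Pl i r) (bm.emb v) = 0" if "i : Nd" "r >= 0" for i r
  using iact_emb_borel[OF x_Pl_borel[OF that]] x[OF that] by (simp only: bm.emb_0)
  show "bm.iact (ph i n) (bm.emb v) = bm.fscl (cf (ga i) n) (bm.emb v)" if "i : Nd" for i n
  using iact_emb_borel[OF phi_borel[OF that]] fi[OF that] by (simp add: bm.emb_scl)
  show "recurrent (cf (ga i))" if "i : Rp" for i
  using rat[OF reps_no[OF that]] by (simp add: recurrent_iff fps_nth_inverse)
 qed
 have sub: "borel_submodule T scl act {w. bm.emb w : bm.fv.span (UN k. A k)}"
  if "!!a z. a : borel T ==> z : bm.fv.span (UN k. A k) ==> bm.iact a z : bm.fv.span (UN k. A k)" for A :: "nat => _"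
  unfolding borel_submodule_def subspace_def using that
  by (auto simp: bm.emb_0 bm.emb_add bm.emb_scl iact_emb_borel[symmetric] simp del: zero_fun_apply plus_fun_apply
  intro: bm.fv.span_zero bm.fv.span_add bm.fv.span_scale)
 have "{w. bm.emb w : bm.fv.span (UN k. hw.S k)} = UNIV" by (intro gen sub hw.borel_S) (auto intro!: bm.fv.span_base UN_I[of 0])
 hence S: "bm.emb w : bm.fv.span (UN k. hw.S k)" for w by auto
 have "{w. bm.emb w : bm.fv.span (UN k. hw.Z k)} ~= UNIV" using hw.v0_notin_Z by auto
 hence "{w. bm.emb w : bm.fv.span (UN k. hw.Z k)} = {0}" using simple[OF sub[of hw.Z, OF hw.borel_Z]] by blast
 hence Z: "w = 0" if "bm.emb w : hw.Z k" for w k using that bm.fv.span_base[of "bm.emb w" "UN k. hw.Z k"] by blast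
 have wv: "EX n. bm.emb w : hw.S (sum n (Rp)) & (ALL j:Rp. ch (kO j) = hw.lw n j)"
  if "tchar T ch" "w : weight_space T scl act ch" "w ~= 0" for w ch
 proof (rule hw.weight_vector[OF S])
  show "bm.emb w ~= 0" using that(3) bm.emb_inj[of w 0] unfolding bm.emb_0 by blast
  show "bm.iact (kO j) (bm.emb w) = bm.fscl (ch (kO j)) (bm.emb w)" if j: "j : Rp" for j
  using iact_emb_borel[OF borel_kk[OF Orb_an[OF j]]] weight_iff[OF `tchar T ch`] `w : _` j by (simp add: bm.emb_scl)
 qed
 obtain mu where mu: "tchar T mu" "v : weight_space T scl act mu" using eigen_tchar[OF v] kv by blast
 have le: "wt_le T ch mu" if ch: "tchar T ch" "weight_space T scl act ch ~= {0}" for ch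
 proof -
  have "0 : weight_space T scl act ch" using ch(1) borel_gen Orb_an by (simp add: weight_iff act_0r)
  then obtain w where w: "w : weight_space T scl act ch" "w ~= 0" using ch(2) by blast
  obtain n where n: "!!j. j : Rp ==> ch (kO j) = hw.lw n j" using wv[OF ch(1) w] by blast
  have "mu (kO j) = ch (kO j) * (PROD i:Rp. (qn T (Orb i) powi aff_cartan T (Orb i) (Orb j)) ^ n i)"
  if j: "j : Rp" for j
  proof -
  have "ch (kO j) * (PROD i:Rp. (qn T (Orb i) powi aff_cartan T (Orb i) (Orb j)) ^ n i) = cf (ga j) 0"
  by (simp add: wt_prod[OF j] n[OF j] hw.lw_def power_int_minus)
  moreover have "scl (mu (kO j)) v = scl (cf (ga j) 0) v" using mu j kv[OF j] by (simp add: weight_iff)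
  ultimately show ?thesis using v by simp
  qed
  thus ?thesis unfolding wt_le_def by blast
 qed
 thus "EX mu. tchar T mu & (ALL ch. tchar T ch & weight_space T scl act ch ~= {0} --> wt_le T ch mu)" using mu by blast
 show "EX B. finite B & weight_space T scl act ch <= span B" if ch: "tchar T ch"
 proof -
  let ?V = "weight_space T scl act ch"
  have e0: "bm.emb 0 : hw.S k" for k unfolding bm.emb_0 by (rule bm.fv.subspace_0[OF hw.S_sub])
  have "EX k. ALL w:?V. bm.emb w : hw.S k"
  proof (cases "?V <= {0}")
  case True
  hence "ALL w:?V. bm.emb w : hw.S 0" using e0 by (metis singletonD subsetD)
  thus ?thesis ..
  next
  case False
  then obtain y where y: "y : ?V" "y ~= 0" by blast
  obtain n where n: "!!j. j : Rp ==> ch (kO j) = hw.lw n j" using wv[OF ch y] by blast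
  have "bm.emb w : hw.S (sum n (Rp))" if w: "w : ?V" for w
  proof (cases "w = 0")
  case True
  thus ?thesis using e0 by (simp only:)
  next
  case False
  obtain m where m: "bm.emb w : hw.S (sum m (Rp))" "!!j. j : Rp ==> ch (kO j) = hw.lw m j"
  using wv[OF ch w False] by blast
  have "sum m (Rp) = sum n (Rp)" by (rule hw.lw_inj) (simp only: m(2)[symmetric] n[symmetric])
  thus ?thesis using m(1) by simp
  qed
  thus ?thesis by blast
  qed
  then obtain k where k: "!!w. w : ?V ==> bm.emb w : hw.S k" by blast
  obtain B where B: "finite B" "ALL z:hw.S k. EX b:bm.fv.span B. z - b : hw.Z k" using hw.S_fin[of k] by (elim exE conjE)
  have co: "EX f. bm.emb w - (SUM b:B. bm.fscl (f b) b) : hw.Z k" if w: "w : ?V" for w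
  proof -
  obtain b where b: "b : bm.fv.span B" "bm.emb w - b : hw.Z k" using bspec[OF B(2) k[OF w]] by (elim bexE)
  obtain f where "b = (SUM b:B. bm.fscl (f b) b)" using b(1) unfolding bm.fv.span_finite[OF B(1)] by (elim rangeE)
  thus ?thesis using b(2) by (intro exI[of _ f]) (simp only:)
  qed
  define f where "f w = (SOME f. bm.emb w - (SUM b:B. bm.fscl (f b) b) : hw.Z k)" for w
  have f: "bm.emb w - (SUM b:B. bm.fscl (f w b) b) : hw.Z k" if "w : ?V" for w
  unfolding f_def by (rule someI_ex[OF co[OF that]])
  have dep: "EX c. (EX w:D. c w ~= 0) & (SUM w:D. scl (c w) w) = 0" if D: "finite D" "D <= ?V" "card B < card D" for D
  proof -
  \<comment> \<open>There are more vectors than elements of \<open>B\<close>, so their coordinates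
    modulo \<open>Z k\<close> satisfy a linear relation; the corresponding combination of the
    vectors is mapped into \<open>Z k\<close> and hence is 0.\<close>
  obtain c where c: "EX w:D. c w ~= 0" "!!b. b : B ==> (SUM w:D. c w * f w b) = 0"
  using homogeneous_system[OF B(1) D(1,3), of f] by blast
  have "(SUM w:D. bm.fscl (c w) (bm.emb w - (SUM b:B. bm.fscl (f w b) b))) : hw.Z k"
  using f D(2) by (intro bm.fv.subspace_sum bm.fv.subspace_scale hw.Z_sub) blast
  moreover have "(SUM w:D. bm.fscl (c w) (SUM b:B. bm.fscl (f w b) b)) = 0"
  proof -
  have "(SUM w:D. bm.fscl (c w) (SUM b:B. bm.fscl (f w b) b)) = (SUM b:B. bm.fscl (SUM w:D. c w * f w b) b)"
  unfolding bm.fv.scale_sum_right bm.fv.scale_scale bm.fv.scale_sum_left by (rule sum.swap)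
  also have "... = (SUM b:B. 0)" by (rule sum.cong[OF refl]) (simp only: c(2) bm.fv.scale_zero_left)
  finally show ?thesis by (simp only: sum.neutral_const)
  qed
  ultimately have "(SUM w:D. bm.fscl (c w) (bm.emb w)) : hw.Z k"
  by (simp only: bm.fv.scale_right_diff_distrib sum_subtractf diff_zero)
  moreover have "(SUM w:D. bm.fscl (c w) (bm.emb w)) = bm.emb (SUM w:D. scl (c w) w)"
  using D(1) by (induction D rule: finite_induct) (simp_all only: sum.empty sum.insert not_False_eq_True bm.emb_0 bm.emb_add bm.emb_scl)
  ultimately show ?thesis using c(1) Z by metis
  qed
  obtain D where D: "D <= ?V" "independent D" "?V <= span D" using maximal_independent_subset by blast
  have "finite D"
  proof (rule ccontr)
  assume "infinite D"
  then obtain D' where D': "D' <= D" "finite D'" "card D' = Suc (card B)" using infinite_arbitrarily_large by blast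
  then obtain c where "EX w:D'. c w ~= 0" "(SUM w:D'. scl (c w) w) = 0" using dep[of D'] D(1) by auto
  hence "dependent D" using D' unfolding dependent_explicit by blast
  thus False using D(2) by blast
  qed
  thus ?thesis using D(3) by blast
 qed
qed

end

section \<open>Simple modules in the category \<open>O\<close>\<close>

context cvector_space
begin

text \<open>A linear factor of \<open>D\<close> is split off: either it kills \<open>u\<close>
  already, or its value on \<open>u\<close> is annihilated by the quotient polynomial, whose degree
  is smaller.\<close>

lemma eigenvector_from_annihilator:
 assumes U: "subspace U" "!!u. u : U ==> f u : U" and f: "!!u v. f (u + v) = f u + f v" "!!c u. f (scale c u) = scale c (f u)"
 shows "D ~= 0 ==> u : U ==> u ~= 0 ==> psh scale D (%k. (f ^^ k) u) 0 = 0 ==>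
  EX c v. v : U & v ~= 0 & f v = scale c v"
proof (induction "degree D" arbitrary: D u)
 case 0
 then obtain a where "D = [:a:]" "a ~= 0" by (metis degree_eq_zeroE pCons_0_0)
 thus ?case using 0 by (simp add: psh_pCons)
next
 case (Suc n)
 hence "~ constant (poly D)" by (simp add: constant_degree)
 then obtain c where "poly D c = 0" using fundamental_theorem_of_algebra by blast
 then obtain q where q: "D = [:- c, 1:] * q" using poly_eq_0_iff_dvd by (metis dvdE)
 define w where "w = f u - scale c u"
 have "f (a - b) = f a - f b" for a b using f(1)[of "a - b" b] by simp
 hence fk: "(f ^^ k) w = (f ^^ Suc k) u - scale c ((f ^^ k) u)" for k by (induction k) (simp_all add: w_def f)
 show ?case
 proof (cases "w = 0")
  case True
  thus ?thesis using Suc.prems by (auto simp: w_def)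
 next
  case False
  have "psh scale D (%k. (f ^^ k) u) 0 = psh scale q (psh scale [:- c, 1:] (%k. (f ^^ k) u)) 0"
  unfolding q by (subst mult.commute) (rule psh_mult)
  also have "psh scale [:- c, 1:] (%k. (f ^^ k) u) = (%k. (f ^^ k) w)" by (rule ext) (simp only: fk psh_pCons psh_0, simp)
  finally have "psh scale q (%k. (f ^^ k) w) 0 = 0" using Suc.prems by simp
  moreover have q0: "q ~= 0" using Suc.prems(1) q by auto
  hence "degree D = Suc (degree q)" unfolding q by (subst degree_mult_eq) auto
  hence "n = degree q" using Suc.hyps(2) by simp
  moreover have "w : U" unfolding w_def using Suc.prems U by (intro subspace_diff subspace_scale) auto
  ultimately show ?thesis using Suc.hyps(1) q0 False by blast
 qed
qed

lemma linear_relation: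
 assumes B: "finite B" and K: "finite K" "card B < card K" "!!k. k : K ==> u k : span B"
 shows "EX c. (EX k:K. c k ~= 0) & (SUM k:K. scale (c k) (u k)) = 0"
proof -
 have "ALL k:K. EX f. u k = (SUM b:B. scale (f b) b)" using K(3) unfolding span_finite[OF B] by blast
 then obtain f where f: "!!k. k : K ==> u k = (SUM b:B. scale (f k b) b)" by metis
 obtain c where c: "EX k:K. c k ~= 0" "!!b. b : B ==> (SUM k:K. c k * f k b) = 0"
  using homogeneous_system[OF B K(1,2), of f] by blast
 have "(SUM k:K. scale (c k) (u k)) = (SUM k:K. SUM b:B. scale (c k * f k b) b)"
  by (intro sum.cong refl) (simp add: f scale_sum_right)
 also have "... = (SUM b:B. scale (SUM k:K. c k * f k b) b)" unfolding scale_sum_left by (rule sum.swap)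
 also have "... = 0" using c(2) by (intro sum.neutral) simp
 finally show ?thesis using c(1) by blast
qed

lemma eigenvector_exists:
 assumes U: "subspace U" "U <= span B" "finite B" "!!u. u : U ==> f u : U" and u: "u : U" "u ~= 0"
  and f: "!!u v. f (u + v) = f u + f v" "!!c u. f (scale c u) = scale c (f u)"
 shows "EX c v. v : U & v ~= 0 & f v = scale c v"
proof -
 have fk: "(f ^^ k) u : U" for k using u U(4) by (induction k) auto
 obtain a where a: "EX k:{..card B}. a k ~= 0" "(SUM k<=card B. scale (a k) ((f ^^ k) u)) = 0"
  using linear_relation[OF U(3), of "{..card B}" "%k. (f ^^ k) u"] fk U(2) by auto
 define D where "D = (SUM k<=card B. monom (a k) k)"
 have co: "coeff D k = (if k <= card B then a k else 0)" for k by (simp add: D_def coeff_sum)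
 have "degree D <= card B" by (rule degree_le) (simp add: co)
 hence "psh scale D (%k. (f ^^ k) u) 0 = (SUM k<=card B. scale (a k) ((f ^^ k) u))"
  unfolding psh_superset[OF `degree D <= card B`] by (intro sum.cong refl) (simp add: co)
 hence "psh scale D (%k. (f ^^ k) u) 0 = 0" using a(2) by simp
 moreover have "D ~= 0" using a(1) co by (metis atMost_iff coeff_0)
 ultimately show ?thesis using eigenvector_from_annihilator[OF U(1,4) f] u by blast
qed

text \<open>If some operator is not scalar on \<open>u\<close>, it has an eigenspace without
  \<open>u\<close>, which is smaller and stable under the commuting family. The induction is on a
  bound for the dimension, so the family may be infinite.\<close>

lemma common_eigenvector:
 assumes f: "!!i u v. i : I ==> f i (u + v) = f i u + f i v" "!!i c u. i : I ==> f i (scale c u) = scale c (f i u)"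
  and B: "finite B"
 shows "subspace U ==> U <= span B ==> u : U ==> u ~= 0 ==> (!!i u. i : I ==> u : U ==> f i u : U) ==>
  (!!i j u. i : I ==> j : I ==> u : U ==> f i (f j u) = f j (f i u)) ==>
  (!!D. D <= U ==> independent D ==> card D <= n) ==>
  EX v:U. v ~= 0 & (ALL i:I. EX c. f i v = scale c v)"
proof (induction n arbitrary: U u)
 case 0
 have "independent {u}" using 0(4) by simp
 thus ?case using 0(7)[of "{u}"] 0(3) by simp
next
 case (Suc n)
 show ?case
 proof (cases "ALL i:I. EX c. f i u = scale c u")
  case False
  then obtain i where i: "i : I" "!!c. f i u ~= scale c u" by blast
  obtain c v where v: "v : U" "v ~= 0" "f i v = scale c v"
  using eigenvector_exists[OF Suc.prems(1,2) B Suc.prems(5)[OF i(1)] Suc.prems(3,4) f[OF i(1)]] by blast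
  let ?U = "{w : U. f i w = scale c w}"
  have z: "f i 0 = 0" using f(2)[OF i(1), of 0 0] by simp
  have sU: "subspace ?U" using Suc.prems(1) by (auto simp: subspace_def f[OF i(1)] z scale_right_distrib mult.commute)
  have ind: "card D <= n" if D: "D <= ?U" "independent D" for D
  proof -
  have fin: "finite D" using independent_span_bound[OF B D(2)] D(1) Suc.prems(2) by blast
  have "u ~: span D" using span_minimal[OF D(1) sU] i(2) by blast
  hence "independent (insert u D)" "u ~: D" using D(2) span_base by (auto simp: independent_insert)
  thus ?thesis using Suc.prems(7)[of "insert u D"] Suc.prems(3) D(1) fin by auto
  qed
  have "EX v:?U. v ~= 0 & (ALL i:I. EX c. f i v = scale c v)"
  proof (rule Suc.IH[OF sU _ _ v(2) _ _ ind])
  show "?U <= span B" using Suc.prems(2) by blast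
  show "v : ?U" using v by simp
  show "f j w : ?U" if "j : I" "w : ?U" for j w
  using that Suc.prems(5)[OF that(1)] Suc.prems(6)[OF i(1) that(1)] f(2)[OF that(1)] by simp
  show "f j (f l w) = f l (f j w)" if "j : I" "l : I" "w : ?U" for j l w using Suc.prems(6) that by simp
  qed
  thus ?thesis by blast
 qed (use Suc.prems in blast)
qed

end

context borel_rep
begin

text \<open>For a mode divisible by \<open>M\<close> the roots of unity in \<open>xx_coeff\<close>
  are all 1, so fixed and moved nodes behave alike.\<close>

lemma phi_M:
 assumes i: "i : Rp" and a: "a >= 0" and r: "r > 0"
 shows "comm (x Pl i a) (x Mi i (int (M * r))) ~~ sc (1 / kap i) * phi T h Pl i (a + int (M * r))"
proof -
 note n = reps_no[OF i]
 have "omega T powi (int k * int (M * r)) = 1" for k by (metis mult.left_commute of_nat_mult omega_M power_int_of_nat power_mult power_one)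
 hence "xx_coeff T i i (int (M * r)) = 1" using xx_coeff_reps(2,3)[OF i i, of "int (M * r)"] M_pos by (cases "sg i = i") simp_all
 moreover have "a + int (M * r) > 0" using a r M_pos by (intro add_nonneg_pos) simp_all
 ultimately show ?thesis using dr_xx[OF n n, of a "int (M * r)"] qi_diff[OF n] by (simp add: phi_Mi_pos)
qed

text \<open>Weights have values in the nonzero complex numbers, so maximality is measured by the
  multiplicative height \<open>ht\<close>. The height vector makes every simple root contribute the
  same factor \<open>t\<close>, which is not a root of unity.\<close>

lemma highest_weight_space:
 assumes wts: "wts = UNIV" and ne: "(UNIV :: 'v set) ~= {0}"
  and dom: "finite La" "!!ch. tchar T ch ==> weight_space T scl act ch ~= {0} ==> EX mu:La. wt_le T ch mu"
 shows "EX ch w. tchar T ch & w : weight_space T scl act ch & w ~= 0 &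
  (ALL i:Rp. ALL r>=0. ALL u:weight_space T scl act ch. act (x Pl i r) u = 0)"
proof -
 obtain y c where y: "c > 0" "!!i. i : Rp ==> (SUM j:Rp. csum T i j * y j) = c"
  using ex_height_vector by blast
 define t where "t = s powi (2 * c)"
 define ht where "ht ch = (PROD j:Rp. ch (kO j) powi y j)" for ch :: "falg => complex"
 have ht: "ht mu = ht ch * t ^ sum n (Rp)"
  if *: "!!j. j : Rp ==> mu (kO j) = ch (kO j) * s powi (2 * (SUM i:Rp. int (n i) * csum T i j))" for mu ch n
 proof -
  have "(SUM j:Rp. 2 * (SUM i:Rp. int (n i) * csum T i j) * y j) =
  (SUM j:Rp. SUM i:Rp. 2 * (int (n i) * (csum T i j * y j)))"
  by (simp only: sum_distrib_left sum_distrib_right mult_ac)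
  also have "... = (SUM i:Rp. SUM j:Rp. 2 * (int (n i) * (csum T i j * y j)))" by (rule sum.swap)
  also have "... = (SUM i:Rp. 2 * (int (n i) * c))"
  by (rule sum.cong[OF refl]) (simp only: sum_distrib_left[symmetric] y(2))
  also have "... = 2 * c * int (sum n (Rp))" by (simp add: sum_distrib_left mult_ac)
  finally have e: "(SUM j:Rp. 2 * (SUM i:Rp. int (n i) * csum T i j) * y j) = 2 * c * int (sum n (Rp))" .
  have "ht mu = ht ch * (PROD j:Rp. s powi (2 * (SUM i:Rp. int (n i) * csum T i j) * y j))"
  unfolding ht_def prod.distrib[symmetric] using * by (intro prod.cong refl) (simp add: power_int_mult_distrib power_int_mult)
  thus ?thesis unfolding s_powi_sum[OF finite_reps] e t_def s_powi_pow .
 qed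
 let ?V = "weight_space T scl act"
 define P where "P ch \<longleftrightarrow> tchar T ch & (EX w:?V ch. w ~= 0)" for ch
 obtain ch0 where ch0: "P ch0"
 proof (rule ccontr)
  assume a: "~ thesis"
  have "(\<Union>ch\<in>{ch. tchar T ch}. ?V ch) <= {0}" using a `!!ch. P ch ==> thesis` unfolding P_def by blast
  hence "wts <= {0}" by (rule span_minimal) (rule subspace_single_0)
  thus False using wts ne by blast
 qed
 have nz: "ht ch ~= 0" if P: "P ch" for ch
 proof -
  obtain w where w: "w : ?V ch" "w ~= 0" "tchar T ch" using P unfolding P_def by blast
  have "ch (kO j) ~= 0" if j: "j : Rp" for j using eigen_kinv(1)[OF j _ w(2)] w j by (simp add: weight_iff)
  thus ?thesis by (simp add: ht_def)
 qed
 have inj: "m = n" if "t ^ m = t ^ n" for m n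
 proof -
  have "s powi (2 * c * int m) = s powi (2 * c * int n)" using that by (simp add: t_def power_int_mult)
  thus ?thesis using y(1) by (simp add: s_powi_inj)
 qed
 \<comment> \<open>The exponents by which weights lie above \<open>ch0\<close>. Each of the finitely
   many dominating weights bounds them, since \<open>t ^ m\<close> determines
   \<open>m\<close>.\<close>
 let ?M = "{m. EX ch. P ch & ht ch = ht ch0 * t ^ m}"
 have sub: "?M <= (\<Union>mu\<in>La. {m. EX N. ht mu = ht ch0 * t ^ (m + N)})"
 proof
  fix m assume "m : ?M"
  then obtain ch where ch: "P ch" "ht ch = ht ch0 * t ^ m" by blast
  then obtain mu where mu: "mu : La" "wt_le T ch mu" using dom(2)[of ch] unfolding P_def by blast
  obtain n where n: "!!j. j : Rp ==> mu (kO j) =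
  ch (kO j) * (PROD i:Rp. (qn T (Orb i) powi aff_cartan T (Orb i) (Orb j)) ^ n i)"
  using mu(2) unfolding wt_le_def by blast
  have "ht mu = ht ch * t ^ sum n (Rp)" by (rule ht) (simp only: n wt_prod)
  hence "ht mu = ht ch0 * t ^ (m + sum n (Rp))" by (simp add: ch(2) power_add)
  thus "m : (\<Union>mu\<in>La. {m. EX N. ht mu = ht ch0 * t ^ (m + N)})" using mu(1) by blast
 qed
 have finN: "finite {m. EX N. ht mu = ht ch0 * t ^ (m + N)}" for mu
 proof (cases "EX k. ht mu = ht ch0 * t ^ k")
  case True
  then obtain k where k: "ht mu = ht ch0 * t ^ k" by blast
  have le: "m <= k" if "ht mu = ht ch0 * t ^ (m + N)" for m N using that k nz[OF ch0] inj[of "m + N" k] by simp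
  have "{m. EX N. ht mu = ht ch0 * t ^ (m + N)} <= {..k}"
  proof
  fix m assume "m : {m. EX N. ht mu = ht ch0 * t ^ (m + N)}"
  then obtain N where "ht mu = ht ch0 * t ^ (m + N)" by blast
  thus "m : {..k}" unfolding atMost_iff by (rule le)
  qed
  thus ?thesis by (rule finite_subset) simp
 qed simp
 have fin: "finite ?M" by (rule finite_subset[OF sub finite_UN_I[OF dom(1) finN]])
 have "0 : ?M" using ch0 by auto
 hence "Max ?M : ?M" by (intro Max_in[OF fin]) blast
 then obtain ch where ch: "P ch" "ht ch = ht ch0 * t ^ Max ?M" by blast
 have "act (x Pl i r) u = 0" if i: "i : Rp" and r: "r >= 0" and u: "u : ?V ch" for i r u
 proof (rule ccontr)
  let ?u = "act (x Pl i r) u"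
  assume n0: "?u ~= 0"
  note xb = x_Pl_borel[OF reps_no[OF i] r]
  have k: "act (kO j) ?u = scl (ch (kO j) * s powi (2 * csum T i j)) ?u" if j: "j : Rp" for j
  proof -
  note kb = borel_kk[OF Orb_an[OF j]]
  have "act (kO j) ?u = act (kO j * x Pl i r) u" using kb xb by (simp add: act_times)
  also have "... = act (sc (s powi (sgn_int Pl * (2 * csum T j i))) * (x Pl i r * kO j)) u"
  using kb xb by (intro act_ueq kk_x j reps_no i alg_mult alg_sc) simp_all
  also have "... = scl (s powi (2 * csum T j i)) (act (x Pl i r) (act (kO j) u))"
  using kb xb by (simp add: act_times alg_mult alg_sc act_sc1)
  also have "act (kO j) u = scl (ch (kO j)) u" using u ch(1) j unfolding P_def by (simp add: weight_iff)
  finally show ?thesis using xb csum_sym[OF reps_no[OF i] reps_no[OF j]] by (simp add: act_scl mult.commute)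
  qed
  then obtain mu where mu: "tchar T mu" "?u : ?V mu" using eigen_tchar[OF n0] by blast
  have "ht mu = ht ch * t ^ sum (%l. if l = i then 1 else 0) (Rp)"
  proof (rule ht)
  fix j assume j: "j : Rp"
  have "scl (mu (kO j)) ?u = scl (ch (kO j) * s powi (2 * csum T i j)) ?u"
  using mu j k[OF j] by (simp add: weight_iff)
  hence "mu (kO j) = ch (kO j) * s powi (2 * csum T i j)" using n0 by simp
  moreover have "(SUM l:Rp. int (if l = i then 1 else 0) * csum T l j) = csum T i j"
  using i by (subst sum.remove[of _ i]) (auto intro: sum.neutral)
  ultimately show "mu (kO j) = ch (kO j) * s powi (2 * (SUM l:Rp. int (if l = i then 1 else 0) * csum T l j))"
  by simp
  qed
  hence "ht mu = ht ch0 * t ^ Suc (Max ?M)" using i ch(2) by simp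
  moreover have "P mu" using mu n0 unfolding P_def by blast
  ultimately have "Suc (Max ?M) : ?M" by blast
  thus False using Max_ge[OF fin] by fastforce
 qed
 thus ?thesis using ch(1) unfolding P_def by blast
qed

lemma highest_weight_vector:
 assumes "wts = UNIV" "(UNIV :: 'v set) ~= {0}"
  and fd: "!!ch. tchar T ch ==> EX B. finite B & weight_space T scl act ch <= span B"
  and "finite La" "!!ch. tchar T ch ==> weight_space T scl act ch ~= {0} ==> EX mu:La. wt_le T ch mu"
 shows "EX v g. v ~= 0 & (ALL i:Rp. ALL r>=0. act (x Pl i r) v = 0) &
  (ALL i:Rp. ALL n. act (ph i n) v = scl (g i n) v)"
proof -
 obtain ch w where ch: "tchar T ch" and w: "w : weight_space T scl act ch" "w ~= 0"
  and kill: "!!i r u. i : Rp ==> r >= 0 ==> u : weight_space T scl act ch ==> act (x Pl i r) u = 0"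
  using highest_weight_space[OF assms(1,2,4,5)] by blast
 obtain B where B: "finite B" "weight_space T scl act ch <= span B" using fd[OF ch] by blast
 let ?U = "weight_space T scl act ch"
 note pb = phi_borel[OF reps_no] and kb = borel_kk[OF Orb_an]
 have "EX v:?U. v ~= 0 & (ALL p:Rp \<times> (UNIV :: nat set). EX c. act (phi T h Pl (fst p) (int (snd p))) v = scl c v)"
 proof (rule common_eigenvector[OF _ _ B(1) _ B(2) w])
  show "subspace ?U"
  using kb by (auto simp: subspace_def weight_iff[OF ch] act_0r act_addr act_scl scale_right_distrib mult.commute)
  show "card D <= card B" if "D <= ?U" "independent D" for D
  using independent_span_bound[OF B(1) that(2)] that(1) B(2) by blast
 next
  fix p u assume p: "p : Rp \<times> (UNIV :: nat set)" and u: "u : ?U"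
  then obtain i n where i: "i : Rp" "p = (i, n)" by auto
  have "act (kO j) (act (ph i n) u) = scl (ch (kO j)) (act (ph i n) u)" if j: "j : Rp" for j
  using act_ueq[OF kk_phi[OF j i(1), of n], of u] u kb[OF j] pb[OF i(1)] j
  by (simp add: act_times alg_mult weight_iff[OF ch] act_scl)
  thus "act (phi T h Pl (fst p) (int (snd p))) u : ?U" by (simp add: i(2) weight_iff[OF ch])
  fix p' assume "p' : Rp \<times> (UNIV :: nat set)"
  then obtain j m where j: "j : Rp" "p' = (j, m)" by auto
  show "act (phi T h Pl (fst p) (int (snd p))) (act (phi T h Pl (fst p') (int (snd p'))) u) =
  act (phi T h Pl (fst p') (int (snd p'))) (act (phi T h Pl (fst p) (int (snd p))) u)"
  using act_ueq[OF phi_phi[OF i(1) j(1), of n m], of u] pb[OF i(1)] pb[OF j(1)] by (simp add: i(2) j(2) act_times alg_mult)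
 qed (auto simp: act_addr act_scl pb)
 then obtain v where v: "v : ?U" "v ~= 0" "!!i n. i : Rp ==> EX c. act (ph i n) v = scl c v" by fastforce
 hence "ALL i n. EX c. i : Rp --> act (ph i n) v = scl c v" by blast
 then obtain g where "!!i n. i : Rp ==> act (ph i n) v = scl (g i n) v" by metis
 thus ?thesis using v(1,2) kill by blast
qed

text \<open>One linear relation between lowered vectors suffices: the raising modes \<open>a\<close>
  applied to it yield the recurrence at every \<open>a\<close>. The modes of the lowered vectors are
  kept positive, because \<open>x\<^sup>-\<close> of mode 0 is not in the Borel subalgebra.\<close>

lemma highest_weight_recurrent:
 assumes fd: "!!ch. tchar T ch ==> EX B. finite B & weight_space T scl act ch <= span B"
  and v: "v ~= 0" and kill: "!!r. r >= 0 ==> act (x Pl i r) v = 0"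
  and g: "!!j n. j : Rp ==> act (ph j n) v = scl (g j n) v" and i: "i : Rp"
 shows "recurrent (g i)"
proof -
 note ni = reps_no[OF i]
 have kv: "act (kO j) v = scl (g j 0) v" if "j : Rp" for j using g[OF that, of 0] that by (simp add: phi_0 rep_reps)
 define u where "u l = act (x Mi i (int l)) v" for l
 have ku: "act (kO j) (u l) = scl (s powi (- (2 * csum T j i)) * g j 0) (u l)" if l: "l > 0" and j: "j : Rp" for l j
 proof -
  note kb = borel_kk[OF Orb_an[OF j]] and xb = x_Mi_borel[OF ni, of "int l"]
  have "act (kO j) (u l) = act (kO j * x Mi i (int l)) v" using kb xb l by (simp add: u_def act_times)
  also have "... = act (sc (s powi (sgn_int Mi * (2 * csum T j i))) * (x Mi i (int l) * kO j)) v"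
  using kb xb l by (intro act_ueq kk_x j ni alg_mult alg_sc) simp_all
  also have "... = scl (s powi (- (2 * csum T j i))) (act (x Mi i (int l)) (act (kO j) v))"
  using kb xb l by (simp add: act_times alg_mult alg_sc act_sc1)
  finally show ?thesis using xb l by (simp add: kv[OF j] act_scl u_def)
 qed
 \<comment> \<open>The lowered vectors of positive mode share one weight. A nonzero one among them
   supplies the character; if there is none, the empty set serves.\<close>
 have "EX B. finite B & (ALL l>0. u l : span B)"
 proof (cases "ALL l>0. u l = 0")
  case True
  thus ?thesis by (intro exI[of _ "{}"]) simp
 next
  case False
  then obtain l0 where l0: "l0 > 0" "u l0 ~= 0" by blast
  obtain ch where ch: "tchar T ch" "u l0 : weight_space T scl act ch" using eigen_tchar[OF l0(2)] ku[OF l0(1)] by blast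
  have "ch (kO j) = s powi (- (2 * csum T j i)) * g j 0" if j: "j : Rp" for j
  proof -
  have "scl (ch (kO j)) (u l0) = scl (s powi (- (2 * csum T j i)) * g j 0) (u l0)"
  using ch ku[OF l0(1) j] j by (simp add: weight_iff)
  thus ?thesis using l0(2) by simp
  qed
  hence "u l : weight_space T scl act ch" if "l > 0" for l using ku[OF that] by (simp add: weight_iff[OF ch(1)])
  thus ?thesis using fd[OF ch(1)] by blast
 qed
 then obtain B where B: "finite B" "!!l. l > 0 ==> u l : span B" by blast
 let ?K = "(%r. M * r) ` {1..Suc (card B)}"
 have cK: "card ?K = Suc (card B)" using M_pos by (subst card_image) (auto simp: inj_on_def)
 have pos: "l > 0" if "l : ?K" for l using that M_pos by auto
 obtain c where c: "EX l:?K. c l ~= 0" "(SUM l:?K. scl (c l) (u l)) = 0"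
  using linear_relation[OF B(1), of ?K u] cK B(2) pos by auto
 have xu: "act (x Pl i (int a)) (u l) = scl (1 / kap i * g i (a + l)) v" if l: "l : ?K" for a l
 proof -
  obtain r where "r : {1..Suc (card B)}" and r: "l = M * r" using l by (elim imageE)
  hence r0: "r > 0" by simp
  note b = x_Pl_borel[OF ni, of "int a"] x_Mi_borel[OF ni, of "int l"] phi_borel[OF ni, of "int (a + l)"]
  have "comm (x Pl i (int a)) (x Mi i (int l)) ~~ sc (1 / kap i) * phi T h Pl i (int (a + l))"
  using phi_M[OF i _ r0, of "int a"] by (simp add: r)
  hence "act (comm (x Pl i (int a)) (x Mi i (int l))) v = act (sc (1 / kap i) * phi T h Pl i (int (a + l))) v"
  using b pos[OF l] unfolding comm_def by (intro act_ueq alg_diff alg_mult alg_sc) simp_all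
  hence "act (x Pl i (int a)) (u l) - act (x Mi i (int l)) (act (x Pl i (int a)) v) = scl (1 / kap i) (act (phi T h Pl i (int (a + l))) v)"
  using b pos[OF l] unfolding comm_def by (simp add: act_minus act_times alg_mult alg_sc act_sc1 u_def)
  thus ?thesis using kill[of "int a"] b(2) pos[OF l] by (simp add: act_0r g[OF i] del: of_nat_add)
 qed
 have rec: "(SUM l:?K. c l * g i (a + l)) = 0" for a
 proof -
  have xb: "x Pl i (int a) : borel T" by (intro x_Pl_borel ni) simp
  have "scl (1 / kap i * (SUM l:?K. c l * g i (a + l))) v = (SUM l:?K. scl (c l) (act (x Pl i (int a)) (u l)))"
  unfolding sum_distrib_left scale_sum_left by (intro sum.cong refl) (simp add: xu mult_ac)
  also have "... = act (x Pl i (int a)) (SUM l:?K. scl (c l) (u l))" using xb by (simp add: act_right_sum act_scl)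
  also have "... = 0" using xb by (simp only: c(2) act_0r)
  finally show ?thesis using v qd_nz[OF Orb_an[OF rep_reps'[OF ni]]] by simp
 qed
 define D where "D = (SUM l:?K. monom (c l) l)"
 have co: "coeff D k = (if k : ?K then c k else 0)" for k unfolding D_def coeff_sum coeff_monom by (subst sum.delta) simp_all
 have "D ~= 0" using c(1) co by (metis coeff_0)
 moreover have "cpsh D (g i) a = 0" for a
 proof -
  let ?N = "max (degree D) (Max ?K)"
  have "cpsh D (g i) a = (SUM t<=?N. coeff D t * g i (a + t))" by (rule cpx.psh_superset) simp
  also have "... = (SUM t:?K. c t * g i (a + t))"
  using cK by (intro sum.mono_neutral_cong_right) (auto simp: co intro!: max.coboundedI2 Max_ge)
  finally show ?thesis by (simp only: rec)
 qed
 ultimately show ?thesis unfolding recurrent_def by blast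
qed

end

lemma (in borel_rep) simple_in_cat_O:
 assumes wts: "wts = UNIV" and ne: "(UNIV :: 'v set) ~= {0}"
  and fd: "!!ch. tchar T ch ==> EX B. finite B & weight_space T scl act ch <= span B"
  and dom: "finite La" "!!ch. tchar T ch ==> weight_space T scl act ch ~= {0} ==> EX mu:La. wt_le T ch mu"
 shows "EX ga v. l_weight T ga & (ALL i:Nd. rational_fps (ga i)) & v ~= 0 &
  (ALL i:Nd. ALL r>=0. act (x Pl i r) v = 0) &
  (ALL i:Nd. ALL m. act (ph i m) v = scl (cf (ga i) m) v)"
proof -
 obtain v g where v: "v ~= 0" and kill: "!!i r. i : Rp ==> r >= 0 ==> act (x Pl i r) v = 0"
  and g: "!!i n. i : Rp ==> act (ph i n) v = scl (g i n) v"
  using highest_weight_vector[OF wts ne fd dom] by blast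
 let ?w = "omega T"
 have "ALL i. EX r. i : Nd --> i = (sg ^^ r) (rep T i)" using rep_orbit by blast
 then obtain R where R: "!!i. i : Nd ==> i = (sg ^^ R i) (rep T i)" by metis
 \<comment> \<open>The values at the other nodes of an orbit are forced by \<sigma>: each of the
   \<open>R i\<close> steps from the representative multiplies the \<open>n\<close>-th coefficient
   by the \<open>n\<close>-th power of \<omega>. This is multiplication by a geometric sequence,
   which preserves recurrence.\<close>
 define ga where "ga i = Abs_fps (%n. (?w ^ R i) ^ n * g (rep T i) n)" for i
 have kill': "act (x Pl i r) v = 0" if i: "i : Nd" and r: "r >= 0" for i r
 proof -
  note ri = rep_reps'[OF i]
  have "x Pl ((sg ^^ R i) (rep T i)) r ~~ sc ((?w powi r) ^ R i) * x Pl (rep T i) r"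
  by (rule aut_pow) (simp_all add: dr_x_aut reps_no[OF ri])
  hence "act (x Pl i r) v = act (sc ((?w powi r) ^ R i) * x Pl (rep T i) r) v"
  using R[OF i] x_Pl_borel[OF i r] x_Pl_borel[OF reps_no[OF ri] r] by (intro act_ueq alg_mult alg_sc) auto
  thus ?thesis using x_Pl_borel[OF reps_no[OF ri] r] kill[OF ri r] by (simp add: act_times alg_sc act_sc1)
 qed
 have ga: "act (ph i n) v = scl (cf (ga i) n) v" if i: "i : Nd" for i n
 proof -
  note ri = rep_reps'[OF i]
  note pb = phi_borel[OF i, of "int n"] phi_borel[OF reps_no[OF ri], of "int n"]
  have "phi T h Pl ((sg ^^ R i) (rep T i)) (int n) ~~ sc ((?w powi int n) ^ R i) * phi T h Pl (rep T i) (int n)"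
  by (rule aut_pow[where y = "%i. ph i n", OF phi_aut reps_no[OF ri]]) simp_all
  hence "act (ph i n) v = act (sc ((?w powi int n) ^ R i) * phi T h Pl (rep T i) (int n)) v"
  using R[OF i] pb by (intro act_ueq alg_mult alg_sc) auto
  also have "... = scl ((?w ^ R i) ^ n * g (rep T i) n) v"
  using pb by (simp add: act_times alg_sc act_sc1 g[OF ri] power_mult[symmetric] mult.commute)
  finally show ?thesis by (simp add: ga_def)
 qed
 have "l_weight T ga" unfolding l_weight_def
 proof (intro ballI conjI)
  fix i assume i: "i : Nd"
  note ri = rep_reps'[OF i]
  have "act (kk (Orb (rep T i))) v = scl (cf (ga i) 0) v" using ga[OF i, of 0] by (simp add: phi_0)
  thus "cf (ga i) 0 ~= 0" by (rule eigen_kinv(1)[OF ri _ v])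
  have si: "sg i : Nd" using i by (rule aut_nodes)
  have "cf (ga (sg i)) n = ?w ^ n * cf (ga i) n" for n
  proof -
  note pb = phi_borel[OF i, of "int n"] phi_borel[OF si, of "int n"]
  have "scl (cf (ga (sg i)) n) v = act (phi T h Pl (sg i) (int n)) v" using ga[OF si] by simp
  also have "... = act (sc (?w powi int n) * ph i n) v" using pb by (intro act_ueq phi_aut i alg_mult alg_sc) simp_all
  also have "... = scl (?w ^ n * cf (ga i) n) v" using pb by (simp add: act_times alg_sc act_sc1 ga[OF i])
  finally show ?thesis using v by simp
  qed
  thus "ga (sg i) = ga i oo (fps_const ?w * fps_X)" by (simp add: fps_compose_linear fps_eq_iff)
 qed
 moreover have "rational_fps (ga i)" if i: "i : Nd" for i
 proof -
  have "cpsh [:- a, 1:] (%n. a ^ n) n = 0" for a n by (simp add: cpx.psh_pCons)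
  hence "recurrent (%n. a ^ n)" for a unfolding recurrent_def by (metis pCons_eq_0_iff zero_neq_one)
  moreover have "recurrent (g (rep T i))" by (rule highest_weight_recurrent[OF fd v kill g]) (simp_all add: rep_reps'[OF i])
  ultimately show ?thesis unfolding ga_def recurrent_iff[symmetric] by (intro recurrent_times)
 qed
 ultimately show ?thesis using v kill' ga by blast
qed

theorem theorem4p6:
  fixes T :: datum
    and x :: "sign \<Rightarrow> nat \<Rightarrow> int \<Rightarrow> falg"
    and h :: "nat \<Rightarrow> int \<Rightarrow> falg"
    and scl :: "complex \<Rightarrow> 'v::ab_group_add \<Rightarrow> 'v"
    and act :: "falg \<Rightarrow> 'v \<Rightarrow> 'v"
  assumes "twisted_datum T"
    and "drinfeld_generators T x h"
    and "borel_module T scl act"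
  shows "in_cat_O T scl act \<and> simple_module T scl act \<longleftrightarrow>
    (\<exists>\<gamma>. l_weight T \<gamma> \<and> (\<forall>i\<in>nodes T. rational_fps (\<gamma> i)) \<and> is_L T x h scl act \<gamma>)"
proof -
 note bm = assms(3)[unfolded borel_module_def]
 interpret twisted T by (rule twisted.intro[OF assms(1)])
 interpret vector_space scl using bm by blast
 have lin: "act a (v + w) = act a v + act a w" "act a (scl c v) = scl c (act a v)" if "a : borel T" for a v w c
 proof -
  interpret f: Vector_Spaces.linear scl scl "act a" using bm that by blast
  show "act a (v + w) = act a v + act a w" "act a (scl c v) = scl c (act a v)" by (rule f.add f.scale)+
 qed
 interpret borel_rep T x h scl act
 proof
  show "drinfeld_generators T x h" by (rule assms(2))
  show "rel_ideal T <= borel T" using borelI(5) by blast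
  show "borel T <= chev_alg T" by (rule borel_chev)
  show "act (sc c) w = scl c w" "a : borel T ==> b : borel T ==> act (a + b) w = act a w + act b w"
  "a : borel T ==> b : borel T ==> act (a * b) w = act a (act b w)" "a : rel_ideal T ==> act a w = 0" for a b c w
  using bm by simp_all
 qed (simp_all add: lin borelI)
 show ?thesis
 proof
  assume L: "in_cat_O T scl act & simple_module T scl act"
  hence O: "in_cat_O T scl act" and sm: "simple_module T scl act" by blast+
  note o = O[unfolded in_cat_O_def, THEN conjunct2] and s = sm[unfolded simple_module_def, THEN conjunct2]
  obtain La where La: "finite La" "!!ch. tchar T ch ==> weight_space T scl act ch ~= {0} ==> EX mu:La. wt_le T ch mu"
  using o[THEN conjunct2, THEN conjunct2] by blast
  obtain ga v where ga: "l_weight T ga" "ALL i:Nd. rational_fps (ga i)" and v: "v ~= 0"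
  "ALL i:Nd. ALL r>=0. act (x Pl i r) v = 0" "ALL i:Nd. ALL m. act (ph i m) v = scl (cf (ga i) m) v"
  using simple_in_cat_O[OF o[THEN conjunct1] s[THEN conjunct1] o[THEN conjunct2, THEN conjunct1, rule_format] La] by blast
  have "ALL W. borel_submodule T scl act W & v : W --> W = UNIV" using s[THEN conjunct2] v(1) by blast
  hence "is_L T x h scl act ga" using sm v assms(3) unfolding is_L_def highest_l_weight_def by blast
  thus "EX ga. l_weight T ga & (ALL i:Nd. rational_fps (ga i)) & is_L T x h scl act ga" using ga by blast
 next
  assume "EX ga. l_weight T ga & (ALL i:Nd. rational_fps (ga i)) & is_L T x h scl act ga"
  then obtain ga where rat: "!!i. i : Nd ==> rational_fps (ga i)" and L: "is_L T x h scl act ga" by blast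
  have simple: "simple_module T scl act" using L by (simp add: is_L_def)
  note s = simple[unfolded simple_module_def, THEN conjunct2]
  obtain v where gen: "ALL P. borel_submodule T scl act P & v : P --> P = UNIV"
  and hw: "ALL i:Nd. ALL r>=0. act (x Pl i r) v = 0"
  "ALL i:Nd. ALL m. act (ph i m) v = scl (cf (ga i) m) v"
  using L unfolding is_L_def highest_l_weight_def by (elim conjE exE)
  have "borel_submodule T scl act {0}" by (simp add: borel_submodule_def act_0r)
  hence v: "v ~= 0" using spec[OF gen, of "{0}"] s[THEN conjunct1] by blast
  have simp: "P = {0} | P = UNIV" if "borel_submodule T scl act P" for P using s[THEN conjunct2] that by blast
  have gen': "P = UNIV" if "borel_submodule T scl act P" "v : P" for P using spec[OF gen, of P] that by blast
  have cat: "wts = UNIV" "!!ch. tchar T ch ==> EX B. finite B & weight_space T scl act ch <= span B"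
  "EX mu. tchar T mu & (ALL ch. tchar T ch & weight_space T scl act ch ~= {0} --> wt_le T ch mu)"
  by (rule rational_in_cat_O[OF simp gen' v hw[rule_format] rat]; assumption)+
  obtain mu where "tchar T mu" "ALL ch. tchar T ch & weight_space T scl act ch ~= {0} --> wt_le T ch mu"
  using cat(3) by (elim exE conjE)
  hence "EX La. finite La & (ALL mu:La. tchar T mu) &
  (ALL ch. tchar T ch & weight_space T scl act ch ~= {0} --> (EX mu:La. wt_le T ch mu))"
  by (intro exI[of _ "{mu}"]) simp
  hence "in_cat_O T scl act" unfolding in_cat_O_def using cat(1,2) assms(3) by (intro conjI allI impI)
  thus "in_cat_O T scl act & simple_module T scl act" using simple ..
 qed
qed

end
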